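(* Let $n\ge 1$. Let $\Lambda_{R,B_n}^\vee$ be the coroot lattice of type $B_n$, and for $i=1,\dots,n$ let $\mathfrak{Z}_i:=\mathfrak{Z}_{-\alpha_{i\ldots n}/\sqrt2}$ be the short screening operators associated to the short positive roots $\alpha_{i\ldots n}=\alpha_i+\cdots+\alpha_n$ of $B_n$. Put $$\mathcal{W}_{B_n,\ell=4}:=\bigcap_{i=1}^n \ker\left(\mathfrak{Z}_i\big|_{\mathcal{V}_{\sqrt{2}\Lambda_{R,B_n}^\vee}}\right).$$ Then there is an isomorphism of vertex algebras $$\mathcal{V}_{\mathcal{SF}_n^{even}}\;\cong\;\mathcal{W}_{B_n,\ell=4},$$ where $\mathcal{V}_{\mathcal{SF}_n^{even}}$ is the even part of the super vertex algebra of $n$ pairs of symplectic fermions.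
   Context: **Root data.** $B_n$ has simple roots $\alpha_1,\dots,\alpha_n$, with $\alpha_n$ the unique short simple root, and inner product $(\alpha_i,\alpha_i)=4$ for $i<n$, $(\alpha_n,\alpha_n)=2$, $(\alpha_i,\alpha_{i+1})=-2$, and all other products of distinct simple roots $0$. (For $n=1$, $B_1=A_1$ with $(\alpha_1,\alpha_1)=2$.) The coroots are $\alpha_i^\vee=2\alpha_i/(\alpha_i,\alpha_i)$, so $\alpha_i^\vee=\alpha_i/2$ for $i<n$ and $\alpha_n^\vee=\alpha_n$, and $\Lambda_{R,B_n}^\vee$ is the lattice they span. Here $\ell=2p=4$. The lattice $\sqrt2\Lambda_{R,B_n}^\vee$ is even, with basis $\alpha_1/\sqrt2,\dots,\alpha_{n-1}/\sqrt2,\sqrt2\alpha_n$. The vectors $\varepsilon_i:=\alpha_{i\ldots n}/\sqrt2$, where $\alpha_{i\ldots n}=\sum_{k=i}^n\alpha_k$, are orthonormal; thus $\sqrt2\Lambda_{R,B_n}^\vee\subset\bigoplus_i\mathbb{Z}\varepsilon_i\cong\mathbb{Z}^n$. **Lattice vertex (super)algebras.** For an integral lattice $\Lambda$, $\mathcal{V}_\Lambda$ denotes the lattice vertex superalgebra (a vertex algebra if $\Lambda$ is even). It is spanned by elements $u\,e^{\phi_\lambda}$ with $\lambda\in\Lambda$ and $u$ a differential polynomial in $\partial\phi_\alpha$, $\alpha\in\Lambda$. The product of exponentials is twisted by the usual $2$-cocycle so that locality holds. $\mathcal{V}_{\mathbb{Z}^n}$ is the super tensor product of $n$ copies of $\mathcal{V}_{\mathbb{Z}}$,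 and $\mathcal{V}_{\sqrt2\Lambda_{R,B_n}^\vee}$ is its vertex subalgebra spanned by the $u\,e^{\phi_\lambda}$ with $\lambda\in\sqrt2\Lambda_{R,B_n}^\vee$. **Screening operators.** For $\beta\in\mathbb{Z}^n$, $\mathfrak{Z}_\beta$ is the residue, i.e. the coefficient of $z^{-1}$, of the vertex operator $\mathrm{Y}(e^{\phi_\beta},z)$. It is an endomorphism of $\mathcal{V}_{\mathbb{Z}^n}$ and shifts the lattice degree by $\beta$. In the case $B_n,\ell=4$, the short screening operators used to define $\mathcal{W}_{B_n,\ell=4}$ are those attached to the short roots, namely $\mathfrak{Z}_{-\alpha_{i\ldots n}/\sqrt2}$, $i=1,\dots,n$; they are restricted to $\mathcal{V}_{\sqrt2\Lambda_{R,B_n}^\vee}$. **Symplectic fermions.** $\mathcal{V}_{\mathcal{SF}_1}$ is the super vertex algebra generated by two odd fields $\psi(z)=\sum_{k\in\mathbb{Z}}\psi_{-k-1}z^k$ and $\psi^*(z)=\sum_{k\in\mathbb{Z}}\psi^*_{-k-1}z^k$ with anticommutators $[\psi_k,\psi^*_m]_+=k\,\delta_{k+m,0}\,\mathrm{id}$ and $[\psi_k,\psi_m]_+=[\psi^*_k,\psi^*_m]_+=0$. Equivalently, $\psi(z)\psi^*(w)\sim (z-w)^{-2}$ and $\psi^*(z)\psi(w)\sim -(z-w)^{-2}$. Its underlying space is the vacuum module of the affine Lie superalgebra of the purely odd $2$-dimensional symplectic vector space: it is generated from a vacuum vector annihilated by all $\psi_k,\psi^*_k$ with $k\ge0$, with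 only the relations $[\psi_k,\psi^*_m]_+=k\,\delta_{k+m,0}\,\mathrm{id}$ and $[\psi_k,\psi_m]_+=[\psi^*_k,\psi^*_m]_+=0$ for $k,m\in\mathbb{Z}$. $\mathcal{V}_{\mathcal{SF}_n}$ is the super tensor product of $n$ copies of $\mathcal{V}_{\mathcal{SF}_1}$, and $\mathcal{V}_{\mathcal{SF}_n^{even}}$ is its even part. *)

theory Defs
  imports Complex_Main "HOL-Library.Poly_Mapping" "HOL-Library.Multiset" "HOL-Library.FSet"
begin

section \<open>Complex vector spaces with a chosen basis\<close>

text \<open>
  All vector spaces below are subspaces of the free complex vector space
  \<open>'b \<Rightarrow>\<^sub>0 complex\<close> on a type of basis labels.
\<close>

definition vscale :: "complex \<Rightarrow> ('b \<Rightarrow>\<^sub>0 complex) \<Rightarrow> ('b \<Rightarrow>\<^sub>0 complex)" where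
  "vscale c v = Poly_Mapping.map ((*) c) v"

lemma lookup_vscale: "Poly_Mapping.lookup (vscale c v) b = c * Poly_Mapping.lookup v b"
  by (simp add: vscale_def Poly_Mapping.map.rep_eq when_def)

global_interpretation free: vector_space vscale
  by standard (auto intro!: poly_mapping_eqI simp: lookup_vscale lookup_add algebra_simps)

definition basis_vec :: "'b \<Rightarrow> ('b \<Rightarrow>\<^sub>0 complex)" where
  "basis_vec b = Poly_Mapping.single b 1"

definition lin_ext :: "('b \<Rightarrow> ('c \<Rightarrow>\<^sub>0 complex)) \<Rightarrow> ('b \<Rightarrow>\<^sub>0 complex) \<Rightarrow> ('c \<Rightarrow>\<^sub>0 complex)" where
  "lin_ext f v = (\<Sum>b\<in>Poly_Mapping.keys v. vscale (Poly_Mapping.lookup v b) (f b))"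

lemma lin_ext_sum:
  assumes "finite S" "Poly_Mapping.keys v \<subseteq> S"
  shows "lin_ext f v = (\<Sum>b\<in>S. vscale (Poly_Mapping.lookup v b) (f b))"
  unfolding lin_ext_def
  by (rule sum.mono_neutral_left) (use assms in \<open>auto simp: in_keys_iff\<close>)

lemma lin_ext_basis_vec [simp]: "lin_ext f (basis_vec b) = f b"
  by (simp add: lin_ext_def basis_vec_def)

lemma lin_ext_zero [simp]: "lin_ext f 0 = 0"
  by (simp add: lin_ext_def)

lemma lin_ext_add: "lin_ext f (u + v) = lin_ext f u + lin_ext f v"
proof -
  let ?S = "Poly_Mapping.keys u \<union> Poly_Mapping.keys v"
  have "finite ?S" "Poly_Mapping.keys (u + v) \<subseteq> ?S"
    by (auto simp: Poly_Mapping.keys_add)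
  then show ?thesis
    by (simp add: lin_ext_sum[where S = ?S] lookup_add free.scale_left_distrib sum.distrib)
qed

lemma lin_ext_vscale: "lin_ext f (vscale c v) = vscale c (lin_ext f v)"
proof -
  have "Poly_Mapping.keys (vscale c v) \<subseteq> Poly_Mapping.keys v"
    by (auto simp: in_keys_iff lookup_vscale)
  then show ?thesis
    by (simp add: lin_ext_sum[where S = "Poly_Mapping.keys v"] lookup_vscale free.scale_sum_right)
qed

lemma lin_ext_cong: "(\<And>b. f b = g b) \<Longrightarrow> lin_ext f v = lin_ext g v"
  by (simp add: lin_ext_def)

lemma lin_ext_comp: "lin_ext f (lin_ext g v) = lin_ext (\<lambda>b. lin_ext f (g b)) v"
proof -
  have s: "lin_ext f (sum h S) = (\<Sum>b\<in>S. lin_ext f (h b))" if "finite S" for h :: "'c \<Rightarrow> _" and S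
    using that by (induction S) (auto simp: lin_ext_add)
  show ?thesis
    by (simp add: lin_ext_def[of g v] lin_ext_def[of "\<lambda>b. lin_ext f (g b)" v] s lin_ext_vscale)
qed

lemma lin_ext_plus: "lin_ext f v + lin_ext g v = lin_ext (\<lambda>b. f b + g b) v"
  by (simp add: lin_ext_def free.scale_right_distrib sum.distrib)

lemma lin_ext_minus: "lin_ext f v - lin_ext g v = lin_ext (\<lambda>b. f b - g b) v"
  by (simp add: lin_ext_def free.scale_right_diff_distrib sum_subtractf)

lemma lin_ext_id: "lin_ext (\<lambda>b. vscale c (basis_vec b)) v = vscale c v"
proof (rule poly_mapping_eqI)
  fix k
  have "Poly_Mapping.lookup (lin_ext (\<lambda>b. vscale c (basis_vec b)) v) k
    = (\<Sum>b\<in>Poly_Mapping.keys v. if b = k then Poly_Mapping.lookup v b * c else 0)"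
    unfolding lin_ext_def lookup_sum
    by (rule sum.cong) (auto simp: lookup_vscale basis_vec_def lookup_single when_def)
  also have "\<dots> = Poly_Mapping.lookup (vscale c v) k"
    by (subst sum.delta) (auto simp: lookup_vscale in_keys_iff)
  finally show "Poly_Mapping.lookup (lin_ext (\<lambda>b. vscale c (basis_vec b)) v) k = Poly_Mapping.lookup (vscale c v) k" .
qed

primrec pure_tensor :: "('b \<Rightarrow>\<^sub>0 complex) list \<Rightarrow> ('b list \<Rightarrow>\<^sub>0 complex)" where
  "pure_tensor [] = basis_vec []"
| "pure_tensor (v # vs) = lin_ext (\<lambda>b. lin_ext (\<lambda>bs. basis_vec (b # bs)) (pure_tensor vs)) v"


section \<open>Vertex superalgebras\<close>

text \<open>
  \<open>va_prod V a m b\<close> is the mode \<open>a\<^sub>(\<^sub>m\<^sub>) b\<close>, where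
  \<open>Y(a,z) = \<Sum>\<^sub>m a\<^sub>(\<^sub>m\<^sub>) z\<^bsup>-m-1\<^esup>\<close>; \<open>va_part V False\<close> and \<open>va_part V True\<close> are the even and
  the odd subspace.  The translation operator is not a separate datum, since the axioms
  force it to be \<open>a \<mapsto> a\<^sub>(\<^sub>-\<^sub>2\<^sub>) 1\<close>.
\<close>

record 'b vertex_data =
  va_carrier :: "('b \<Rightarrow>\<^sub>0 complex) set"
  va_part :: "bool \<Rightarrow> ('b \<Rightarrow>\<^sub>0 complex) set"
  va_vac :: "'b \<Rightarrow>\<^sub>0 complex"
  va_prod :: "('b \<Rightarrow>\<^sub>0 complex) \<Rightarrow> int \<Rightarrow> ('b \<Rightarrow>\<^sub>0 complex) \<Rightarrow> ('b \<Rightarrow>\<^sub>0 complex)"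

definition va_transl :: "'b vertex_data \<Rightarrow> ('b \<Rightarrow>\<^sub>0 complex) \<Rightarrow> ('b \<Rightarrow>\<^sub>0 complex)" where
  "va_transl V a = va_prod V a (-2) (va_vac V)"

definition super_sign :: "bool \<Rightarrow> bool \<Rightarrow> complex" where
  "super_sign p q = (if p \<and> q then -1 else 1)"

text \<open>
  The conjunct \<open>locality\<close> is the coefficient of \<open>z\<^bsup>-m-1\<^esup> w\<^bsup>-k-1\<^esup>\<close> in
  \<open>(z - w)\<^sup>N (Y(a,z) Y(b,w) - (-1)\<^bsup>pq\<^esup> Y(b,w) Y(a,z)) = 0\<close>, and \<open>translation\<close> that of
  \<open>z\<^bsup>-m-1\<^esup>\<close> in \<open>[T, Y(a,z)] = \<partial>\<^sub>z Y(a,z)\<close>.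
\<close>

locale vertex_superalgebra =
  fixes V :: "'b vertex_data"
  assumes subspaces: "free.subspace (va_carrier V)" "free.subspace (va_part V p)"
    and grading: "va_carrier V = {u + v | u v. u \<in> va_part V False \<and> v \<in> va_part V True}"
      "va_part V False \<inter> va_part V True = {0}"
    and vac_even: "va_vac V \<in> va_part V False"
    and prod_parity: "a \<in> va_part V p \<Longrightarrow> b \<in> va_part V q \<Longrightarrow> va_prod V a m b \<in> va_part V (p \<noteq> q)"
    and prod_add: "a \<in> va_carrier V \<Longrightarrow> a' \<in> va_carrier V \<Longrightarrow> b \<in> va_carrier V \<Longrightarrow>
        va_prod V (a + a') m b = va_prod V a m b + va_prod V a' m b"
      "a \<in> va_carrier V \<Longrightarrow> b \<in> va_carrier V \<Longrightarrow> b' \<in> va_carrier V \<Longrightarrow>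
        va_prod V a m (b + b') = va_prod V a m b + va_prod V a m b'"
    and prod_scale: "a \<in> va_carrier V \<Longrightarrow> b \<in> va_carrier V \<Longrightarrow>
        va_prod V (vscale c a) m b = vscale c (va_prod V a m b)"
      "a \<in> va_carrier V \<Longrightarrow> b \<in> va_carrier V \<Longrightarrow>
        va_prod V a m (vscale c b) = vscale c (va_prod V a m b)"
    and truncation: "a \<in> va_carrier V \<Longrightarrow> b \<in> va_carrier V \<Longrightarrow>
        \<exists>N. \<forall>m\<ge>N. va_prod V a m b = 0"
    and vacuum: "a \<in> va_carrier V \<Longrightarrow> va_prod V (va_vac V) m a = (if m = -1 then a else 0)"
    and creation: "a \<in> va_carrier V \<Longrightarrow> va_prod V a (-1) (va_vac V) = a"
      "a \<in> va_carrier V \<Longrightarrow> m \<ge> 0 \<Longrightarrow> va_prod V a m (va_vac V) = 0"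
    and translation: "a \<in> va_carrier V \<Longrightarrow> b \<in> va_carrier V \<Longrightarrow>
        va_transl V (va_prod V a m b) - va_prod V a m (va_transl V b)
          = vscale (- of_int m) (va_prod V a (m - 1) b)"
    and locality: "a \<in> va_part V p \<Longrightarrow> b \<in> va_part V q \<Longrightarrow>
        \<exists>N::nat. \<forall>m k. \<forall>v\<in>va_carrier V.
          (\<Sum>j\<le>N. vscale ((-1) ^ j * of_nat (N choose j))
            (va_prod V a (m + int (N - j)) (va_prod V b (k + int j) v)
             - vscale (super_sign p q)
                (va_prod V b (k + int j) (va_prod V a (m + int (N - j)) v)))) = 0"

definition vertex_algebra :: "'b vertex_data \<Rightarrow> bool" where
  "vertex_algebra V \<longleftrightarrow> vertex_superalgebra V \<and> va_part V True = {0}"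

definition va_iso :: "'b vertex_data \<Rightarrow> 'c vertex_data
    \<Rightarrow> (('b \<Rightarrow>\<^sub>0 complex) \<Rightarrow> ('c \<Rightarrow>\<^sub>0 complex)) set" where
  "va_iso V W = {f. bij_betw f (va_carrier V) (va_carrier W)
     \<and> (\<forall>u\<in>va_carrier V. \<forall>v\<in>va_carrier V. f (u + v) = f u + f v)
     \<and> (\<forall>c. \<forall>v\<in>va_carrier V. f (vscale c v) = vscale c (f v))
     \<and> f (va_vac V) = va_vac W
     \<and> (\<forall>u\<in>va_carrier V. \<forall>v\<in>va_carrier V. \<forall>m.
          f (va_prod V u m v) = va_prod W (f u) m (f v))}"

definition va_restrict :: "'b vertex_data \<Rightarrow> ('b \<Rightarrow>\<^sub>0 complex) set \<Rightarrow> 'b vertex_data" where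
  "va_restrict V S = V\<lparr>va_carrier := va_carrier V \<inter> S, va_part := (\<lambda>p. va_part V p \<inter> S)\<rparr>"

definition va_even :: "'b vertex_data \<Rightarrow> 'b vertex_data" where
  "va_even V = va_restrict V (va_part V False)"


section \<open>Vertex superalgebras with a homogeneous basis, and super tensor powers\<close>

record 'b based_vertex_data =
  bas_set :: "'b set"
  bas_odd :: "'b \<Rightarrow> bool"
  bas_vac :: 'b
  bas_prod :: "'b \<Rightarrow> int \<Rightarrow> 'b \<Rightarrow> ('b \<Rightarrow>\<^sub>0 complex)"

definition span_va :: "'b based_vertex_data \<Rightarrow> 'b vertex_data" where
  "span_va X = \<lparr>
     va_carrier = {v. Poly_Mapping.keys v \<subseteq> bas_set X},
     va_part = (\<lambda>p. {v. Poly_Mapping.keys v \<subseteq> {b \<in> bas_set X. bas_odd X b = p}}),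
     va_vac = basis_vec (bas_vac X),
     va_prod = (\<lambda>u m v. lin_ext (\<lambda>a. lin_ext (\<lambda>b. bas_prod X a m b) v) u)\<rparr>"

text \<open>Sign of the rearrangement
  \<open>(a\<^sub>1 \<otimes> \<dots> \<otimes> a\<^sub>n) \<otimes> (b\<^sub>1 \<otimes> \<dots> \<otimes> b\<^sub>n) \<mapsto> (a\<^sub>1 \<otimes> b\<^sub>1) \<otimes> \<dots> \<otimes> (a\<^sub>n \<otimes> b\<^sub>n)\<close>.\<close>

definition koszul_sign :: "('b \<Rightarrow> bool) \<Rightarrow> 'b list \<Rightarrow> 'b list \<Rightarrow> complex" where
  "koszul_sign par as bs =
     (\<Prod>i<length as. \<Prod>j<i. super_sign (par (as ! i)) (par (bs ! j)))"

text \<open>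
  The state-field map of the \<open>n\<close>-th super tensor power is
  \<open>Y(a\<^sub>1 \<otimes> \<dots> \<otimes> a\<^sub>n, z)(b\<^sub>1 \<otimes> \<dots> \<otimes> b\<^sub>n) = \<plusminus> Y(a\<^sub>1,z)b\<^sub>1 \<otimes> \<dots> \<otimes> Y(a\<^sub>n,z)b\<^sub>n\<close>, whose coefficient at
  \<open>z\<^bsup>-m-1\<^esup>\<close> collects all \<open>(m\<^sub>1, \<dots>, m\<^sub>n)\<close> with \<open>m\<^sub>1 + \<dots> + m\<^sub>n + n = m + 1\<close>.  Only finitely many
  summands are nonzero, by truncation in each factor.
\<close>

definition tensor_power :: "nat \<Rightarrow> 'b based_vertex_data \<Rightarrow> 'b list based_vertex_data" where
  "tensor_power n X = \<lparr>
     bas_set = {bs. length bs = n \<and> set bs \<subseteq> bas_set X},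
     bas_odd = (\<lambda>bs. odd (length (filter (bas_odd X) bs))),
     bas_vac = replicate n (bas_vac X),
     bas_prod = (\<lambda>as m bs. vscale (koszul_sign (bas_odd X) as bs)
       (Sum_any (\<lambda>ms :: int list.
          pure_tensor (map (\<lambda>i. bas_prod X (as ! i) (ms ! i) (bs ! i)) [0..<n])
            when length ms = n \<and> sum_list ms + int n = m + 1)))\<rparr>"


section \<open>Fields and their normally ordered products\<close>

type_synonym 'b field_modes = "int \<Rightarrow> ('b \<Rightarrow>\<^sub>0 complex) \<Rightarrow> ('b \<Rightarrow>\<^sub>0 complex)"

definition id_field :: "'b field_modes" where
  "id_field m v = (v when m = -1)"

text \<open>
  Modes of the \<open>p\<close>-th product of two fields, which is the field of the state \<open>a\<^sub>(\<^sub>p\<^sub>) b\<close> when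
  \<open>A = Y(a,z)\<close> and \<open>B = Y(b,z)\<close>; \<open>s\<close> is the sign \<open>(-1)\<^bsup>|a||b|\<^esup>\<close>.  For \<open>p = -k-1\<close> it is the
  normally ordered product \<open>:(\<partial>\<^sup>k A / k!) B:\<close>.
\<close>

definition field_prod :: "complex \<Rightarrow> 'b field_modes \<Rightarrow> int \<Rightarrow> 'b field_modes \<Rightarrow> 'b field_modes" where
  "field_prod s A p B m v =
     Sum_any (\<lambda>j :: nat. vscale ((-1) ^ j * (of_int p gchoose j))
       (A (p - int j) (B (m + int j) v)
        - vscale (s * (-1) powi p) (B (p + m - int j) (A (int j) v))))"


section \<open>The lattice vertex superalgebra of the integers\<close>

text \<open>
  The label \<open>(M, l)\<close> stands for \<open>(\<Prod>k\<in>M. a\<^bsub>-k-1\<^esub>) e\<^bsup>\<phi>\<^sub>l\<^esup>\<close>, where \<open>\<partial>\<phi>(z) = \<Sum>\<^sub>k a\<^sub>k z\<^bsup>-k-1\<^esup>\<close> for the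
  generator of norm 1 and \<open>[a\<^sub>j, a\<^sub>k] = j \<delta>\<^bsub>j+k,0\<^esub>\<close>.  So \<open>k \<in> M\<close> corresponds to the factor
  \<open>\<partial>\<^sup>k\<^sup>+\<^sup>1\<phi> / k!\<close>.  In rank one the 2-cocycle is trivial.
\<close>

type_synonym boson_label = "nat multiset \<times> int"

definition heis_basis :: "int \<Rightarrow> boson_label \<Rightarrow> (boson_label \<Rightarrow>\<^sub>0 complex)" where
  "heis_basis j = (\<lambda>(M, l).
     if j < 0 then basis_vec (add_mset (nat (- j - 1)) M, l)
     else if j = 0 then vscale (of_int l) (basis_vec (M, l))
     else vscale (of_int j * of_nat (count M (nat (j - 1))))
       (basis_vec (M - {#nat (j - 1)#}, l)))"

definition heis :: "boson_label field_modes" where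
  "heis j = lin_ext (heis_basis j)"

lemma heis_commutator:
  "heis j (heis k v) - heis k (heis j v) = vscale (if j + k = 0 then of_int j else 0) v"
proof -
  have "lin_ext (heis_basis j) (heis_basis k b) - lin_ext (heis_basis k) (heis_basis j b) 
     = vscale (if j + k = 0 then of_int j else 0) (basis_vec b)" for b
  proof (cases b)
    case (Pair M l)
    note [simp] = Pair heis_basis_def lin_ext_vscale mult_ac
    have sc: "vscale x v - vscale y v = vscale z v" if "x - y = z" for x y z and v :: "boson_label \<Rightarrow>\<^sub>0 complex"
      using that by (simp flip: free.scale_left_diff_distrib)
    have mix: "lin_ext (heis_basis j) (heis_basis k (M, l)) - lin_ext (heis_basis k) (heis_basis j (M, l)) 
     = vscale (if j + k = 0 then of_int j else 0) (basis_vec (M, l))" if "j > 0" "k < 0" for j k :: int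
    proof (cases "j + k = 0")
      case True
      then have k: "k = - j" by simp
      show ?thesis using that unfolding k
        by (cases "nat (j - 1) \<in># M") (simp_all add: not_in_iff sc algebra_simps)
    next
      case False
      then have "nat (j - 1) \<noteq> nat (- k - 1)" using that by auto
      then show ?thesis using that False
        by (cases "nat (j - 1) \<in># M") (auto simp: not_in_iff)
    qed
    consider "j < 0" "k < 0" | "j = 0" | "k = 0" | "j > 0" "k > 0" | "j < 0" "k > 0" | "j > 0" "k < 0" by linarith
    then show ?thesis 
    proof cases
      case 4
      then have "j = k \<or> nat (j - 1) \<noteq> nat (k - 1)" by auto
      with 4 show ?thesis 
        by (auto simp: add_mset_commute)
    next
      case 5
      have "- complex_of_int k = complex_of_int j" if "j + k = 0"
        using that by (simp add: eq_neg_iff_add_eq_0[symmetric])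
      then show ?thesis
        unfolding Pair minus_diff_eq[symmetric, of "lin_ext (heis_basis j) _"] mix[OF 5(2,1)]
        by (auto simp: add.commute simp flip: free.scale_minus_left)
    next
      case 6 then show ?thesis unfolding Pair by (rule mix)
    qed (auto simp: add_mset_commute)
  qed
  then show ?thesis
    by (simp add: heis_def lin_ext_comp lin_ext_minus lin_ext_id)
qed

text \<open>
  Coefficient of \<open>x\<^sup>m\<close> in \<open>exp (\<Sum>k\<ge>1. X\<^sub>k x\<^sup>k / k)\<close> for commuting operators \<open>X\<^sub>k\<close>: the
  \<open>r\<close>-th power in the exponential series contributes the \<open>(k\<^sub>1, \<dots>, k\<^sub>r)\<close> with \<open>k\<^sub>1 + \<dots> + k\<^sub>r = m\<close>.
\<close>

definition exp_coeff ::
    "(nat \<Rightarrow> ('b \<Rightarrow>\<^sub>0 complex) \<Rightarrow> ('b \<Rightarrow>\<^sub>0 complex)) \<Rightarrow> nat \<Rightarrow> ('b \<Rightarrow>\<^sub>0 complex) \<Rightarrow> ('b \<Rightarrow>\<^sub>0 complex)" where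
  "exp_coeff X m v = (\<Sum>ks | 0 \<notin> set ks \<and> sum_list ks = m.
     vscale (1 / fact (length ks)) (foldr (\<lambda>k w. vscale (1 / of_nat k) (X k w)) ks v))"

text \<open>
  Modes of
  \<open>Y(e\<^bsup>\<phi>\<^sub>l\<^esup>, z) = e\<^bsup>\<phi>\<^sub>l\<^esup> z\<^bsup>l a\<^sub>0\<^esup> exp (\<Sum>k\<ge>1. l a\<^bsub>-k\<^esub> z\<^sup>k / k) exp (\<Sum>k\<ge>1. - l a\<^sub>k z\<^bsup>-k\<^esup> / k)\<close>.
\<close>

definition exp_field :: "int \<Rightarrow> boson_label field_modes" where
  "exp_field l m = lin_ext (\<lambda>(M, l').
     Sum_any (\<lambda>(r :: nat, q :: nat).
       exp_coeff (\<lambda>k w. vscale (of_int l) (heis (- int k) w)) r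
         (exp_coeff (\<lambda>k w. vscale (- of_int l) (heis (int k) w)) q
           (basis_vec (M, l + l')))
         when l * l' + int r - int q = - m - 1))"

definition boson_field :: "boson_label \<Rightarrow> boson_label field_modes" where
  "boson_field = (\<lambda>(M, l).
     foldr (\<lambda>k. field_prod 1 heis (- int k - 1)) (sorted_list_of_multiset M) (exp_field l))"

definition VZ :: "boson_label based_vertex_data" where
  "VZ = \<lparr>bas_set = UNIV, bas_odd = (\<lambda>(M, l). odd l), bas_vac = ({#}, 0),
         bas_prod = (\<lambda>a m b. boson_field a m (basis_vec b))\<rparr>"

definition VZn :: "nat \<Rightarrow> boson_label list vertex_data" where
  "VZn n = span_va (tensor_power n VZ)"

definition exp_vec :: "int list \<Rightarrow> (boson_label list \<Rightarrow>\<^sub>0 complex)" where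
  "exp_vec \<beta> = basis_vec (map (\<lambda>l. ({#}, l)) \<beta>)"

definition lattice_deg :: "boson_label list \<Rightarrow> int list" where
  "lattice_deg bs = map snd bs"

definition screening :: "nat \<Rightarrow> int list \<Rightarrow> (boson_label list \<Rightarrow>\<^sub>0 complex) \<Rightarrow> (boson_label list \<Rightarrow>\<^sub>0 complex)" where
  "screening n \<beta> v = va_prod (VZn n) (exp_vec \<beta>) 0 v"


section \<open>Root data of type B\<close>

text \<open>Vectors are coordinate functions with respect to the simple roots \<open>\<alpha>\<^sub>1, \<dots>, \<alpha>\<^sub>n\<close>.\<close>

definition gramB :: "nat \<Rightarrow> nat \<Rightarrow> nat \<Rightarrow> real" where
  "gramB n i j = (if i = j then (if i = n then 2 else 4)
                  else if j = i + 1 \<or> i = j + 1 then -2 else 0)"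

definition formB :: "nat \<Rightarrow> (nat \<Rightarrow> real) \<Rightarrow> (nat \<Rightarrow> real) \<Rightarrow> real" where
  "formB n x y = (\<Sum>i=1..n. \<Sum>j=1..n. x i * y j * gramB n i j)"

definition simple_root :: "nat \<Rightarrow> nat \<Rightarrow> real" where
  "simple_root i = (\<lambda>k. if k = i then 1 else 0)"

definition simple_coroot :: "nat \<Rightarrow> nat \<Rightarrow> nat \<Rightarrow> real" where
  "simple_coroot n i = (\<lambda>k. 2 * simple_root i k / formB n (simple_root i) (simple_root i))"

definition coroot_latticeB :: "nat \<Rightarrow> (nat \<Rightarrow> real) set" where
  "coroot_latticeB n = {x. \<exists>c :: nat \<Rightarrow> int. x = (\<lambda>k. \<Sum>i=1..n. of_int (c i) * simple_coroot n i k)}"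

definition short_root :: "nat \<Rightarrow> nat \<Rightarrow> nat \<Rightarrow> real" where
  "short_root n i = (\<lambda>k. \<Sum>j=i..n. simple_root j k)"

definition eps :: "nat \<Rightarrow> nat \<Rightarrow> nat \<Rightarrow> real" where
  "eps n i = (\<lambda>k. short_root n i k / sqrt 2)"

definition zn_embed :: "nat \<Rightarrow> int list \<Rightarrow> nat \<Rightarrow> real" where
  "zn_embed n \<beta> = (\<lambda>k. \<Sum>i=1..n. of_int (\<beta> ! (i - 1)) * eps n i k)"

definition zn_coords :: "nat \<Rightarrow> (nat \<Rightarrow> real) \<Rightarrow> int list" where
  "zn_coords n x = (THE \<beta>. length \<beta> = n \<and> zn_embed n \<beta> = x)"

definition sqrt2_coroot_lattice :: "nat \<Rightarrow> int list set" where
  "sqrt2_coroot_lattice n =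
     {\<beta>. length \<beta> = n \<and> (\<exists>x\<in>coroot_latticeB n. zn_embed n \<beta> = (\<lambda>k. sqrt 2 * x k))}"

lemma sum_gramB:
  assumes "1 \<le> j" "j \<le> n" "1 \<le> k" "k \<le> n"
  shows "(\<Sum>l=j..n. gramB n k l) = (if k = j then 2 else 0) - (if k + 1 = j then 2 else 0)"
proof -
  have "gramB n k l = (if l = k then (if k = n then 2 else 4) else 0)
      + ((if l = k + 1 then -2 else 0) + (if l = k - 1 then -2 else 0))" if "l \<in> {j..n}" for l
    using that assms by (auto simp: gramB_def)
  then have "(\<Sum>l=j..n. gramB n k l) = (if k \<in> {j..n} then (if k = n then 2 else 4) else 0)
      + ((if k + 1 \<in> {j..n} then -2 else 0) + (if k - 1 \<in> {j..n} then -2 else 0))"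
    by (simp only: sum.distrib sum.delta finite_atLeastAtMost cong: sum.cong)
  then show ?thesis using assms by auto
qed

lemma short_root_eq: "short_root n i = (\<lambda>k. if k \<in> {i..n} then 1 else 0)"
  by (auto simp: short_root_def simple_root_def)

lemma eps_orthonormal:
  assumes "1 \<le> i" "i \<le> n" "1 \<le> j" "j \<le> n"
  shows "formB n (eps n i) (eps n j) = (if i = j then 1 else 0)"
proof -
  have "formB n (eps n i) (eps n j)
      = (\<Sum>k=1..n. \<Sum>l=1..n. (if k \<in> {i..n} then (if l \<in> {j..n} then gramB n k l else 0) else 0) / 2)"
    unfolding formB_def eps_def short_root_eq by (intro sum.cong refl) auto
  also have "\<dots> = (\<Sum>k=1..n. if k \<in> {i..n} then (\<Sum>l=1..n. if l \<in> {j..n} then gramB n k l else 0) / 2 else 0)"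
    by (intro sum.cong refl) (auto simp: sum_divide_distrib)
  also have "\<dots> = (\<Sum>k=i..n. (\<Sum>l=j..n. gramB n k l) / 2)"
  proof -
    have "{1..n} \<inter> {i..n} = {i..n}" "{1..n} \<inter> {j..n} = {j..n}" using assms by auto
    then show ?thesis by (simp only: sum.inter_restrict[symmetric] finite_atLeastAtMost)
  qed
  also have "\<dots> = (\<Sum>k=i..n. (if k = j then 1 else 0) - (if k = j - 1 then (if j = 1 then 0 else 1) else 0))"
    using assms by (intro sum.cong refl) (auto simp: sum_gramB)
  also have "\<dots> = (if i = j then 1 else 0)"
    using assms by (auto simp: sum_subtractf)
  finally show ?thesis .
qed

lemma zn_embed_inj:
  assumes "length \<beta> = n" "length \<gamma> = n" "zn_embed n \<beta> = zn_embed n \<gamma>"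
  shows "\<beta> = \<gamma>"
proof (rule nth_equalityI)
  fix i assume i: "i < length \<beta>"
  have form: "formB n (zn_embed n \<delta>) (eps n j) = of_int (\<delta> ! (j - 1))" if j: "1 \<le> j" "j \<le> n" for \<delta> j
  proof -
    have "formB n (zn_embed n \<delta>) (eps n j)
        = (\<Sum>i=1..n. of_int (\<delta> ! (i - 1)) * formB n (eps n i) (eps n j))"
    proof -
      have "formB n (zn_embed n \<delta>) (eps n j) =
        (\<Sum>k=1..n. \<Sum>l=1..n. \<Sum>i=1..n. of_int (\<delta> ! (i - 1)) * (eps n i k * eps n j l * gramB n k l))"
        unfolding formB_def zn_embed_def by (simp add: sum_distrib_right sum_distrib_left mult_ac)
      also have "\<dots> = (\<Sum>k=1..n. \<Sum>i=1..n. \<Sum>l=1..n. of_int (\<delta> ! (i - 1)) * (eps n i k * eps n j l * gramB n k l))"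
        by (rule sum.cong[OF refl sum.swap])
      also have "\<dots> = (\<Sum>i=1..n. \<Sum>k=1..n. \<Sum>l=1..n. of_int (\<delta> ! (i - 1)) * (eps n i k * eps n j l * gramB n k l))"
        by (rule sum.swap)
      finally show ?thesis unfolding formB_def by (simp add: sum_distrib_left)
    qed
    also have "\<dots> = (\<Sum>i=1..n. if i = j then of_int (\<delta> ! (i - 1)) else 0)"
      using j by (intro sum.cong refl) (auto simp: eps_orthonormal)
    finally show ?thesis using j by simp
  qed
  show "\<beta> ! i = \<gamma> ! i"
    using form[of "i + 1" \<beta>] form[of "i + 1" \<gamma>] assms i by simp
qed (use assms in simp)

lemma zn_coords_zn_embed: "length \<beta> = n \<Longrightarrow> zn_coords n (zn_embed n \<beta>) = \<beta>"
  unfolding zn_coords_def by (rule the_equality) (auto intro: zn_embed_inj)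

lemma zn_coords_short_root:
  assumes "1 \<le> i" "i \<le> n"
  shows "zn_coords n (\<lambda>k. - short_root n i k / sqrt 2) = (replicate n 0)[i - 1 := -1]"
proof -
  have "zn_embed n ((replicate n 0)[i - 1 := -1]) k = - short_root n i k / sqrt 2" for k
  proof -
    have "zn_embed n ((replicate n 0)[i - 1 := -1]) k = (\<Sum>j=1..n. if j = i then - eps n j k else 0)"
      unfolding zn_embed_def using assms by (intro sum.cong refl) (auto simp: nth_list_update)
    then show ?thesis using assms by (simp add: eps_def)
  qed
  then have "zn_embed n ((replicate n 0)[i - 1 := -1]) = (\<lambda>k. - short_root n i k / sqrt 2)" by blast
  then show ?thesis using zn_coords_zn_embed[of "(replicate n 0)[i - 1 := -1]" n] by simp
qed

lemma sqrt2_coroot_lattice_covers: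
  assumes "x \<in> coroot_latticeB n"
  shows "\<exists>\<beta>\<in>sqrt2_coroot_lattice n. zn_embed n \<beta> = (\<lambda>k. sqrt 2 * x k)"
proof -
  obtain c :: "nat \<Rightarrow> int" where c: "x = (\<lambda>k. \<Sum>i=1..n. of_int (c i) * simple_coroot n i k)"
    using assms by (auto simp: coroot_latticeB_def)
  define S where "S k = (if k = 0 then 0 else if k = n then 2 * c n else c k)" for k
  define \<beta> where "\<beta> = map (\<lambda>i. S (i + 1) - S i) [0..<n]"
  have norm: "formB n (simple_root i) (simple_root i) = gramB n i i" if "1 \<le> i" "i \<le> n" for i
  proof -
    have "(\<Sum>l=1..n. simple_root i k * simple_root i l * gramB n k l) = (if k = i then gramB n i i else 0)" for k
    proof -
      have "(\<Sum>l=1..n. simple_root i k * simple_root i l * gramB n k l)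
          = (\<Sum>l=1..n. if l = i then (if k = i then gramB n i i else 0) else 0)"
        by (intro sum.cong refl) (auto simp: simple_root_def)
      then show ?thesis using that by simp
    qed
    then show ?thesis using that by (simp add: formB_def)
  qed
  have cor: "simple_coroot n i k = (if k = i then 2 / gramB n i i else 0)" if "1 \<le> i" "i \<le> n" for i k
    unfolding simple_coroot_def norm[OF that] by (simp add: simple_root_def)
  have x: "x k = (if 1 \<le> k \<and> k \<le> n then of_int (S k) / 2 else 0)" for k
  proof -
    have "x k = (\<Sum>i=1..n. if i = k then of_int (S k) / 2 else 0)"
      unfolding c by (intro sum.cong refl) (auto simp: cor gramB_def S_def)
    then show ?thesis by simp
  qed
  have emb: "zn_embed n \<beta> k = sqrt 2 * x k" for k
  proof -
    have "zn_embed n \<beta> k = (\<Sum>i=1..n. if k \<in> {i..n} then of_int (S i - S (i - 1)) / sqrt 2 else 0)"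
      unfolding zn_embed_def by (intro sum.cong refl) (auto simp: eps_def short_root_eq \<beta>_def)
    also have "\<dots> = (if k \<le> n then (\<Sum>i=1..k. of_int (S i - S (i - 1))) / sqrt 2 else 0)"
    proof (cases "k \<le> n")
      case True
      have "{1..k} = {1..n} \<inter> {i. k \<in> {i..n}}" using True by auto
      with True show ?thesis by (auto simp: sum.inter_restrict sum_divide_distrib intro!: sum.cong)
    qed auto
    also have "(\<Sum>i=1..k. real_of_int (S i - S (i - 1))) = of_int (S k)"
      by (induction k) (auto simp: S_def)
    also have "(if k \<le> n then of_int (S k) / sqrt 2 else 0) = sqrt 2 * x k"
      by (auto simp: x S_def field_simps)
    finally show ?thesis .
  qed
  have "length \<beta> = n" by (simp add: \<beta>_def)
  with emb assms show ?thesis by (auto simp: sqrt2_coroot_lattice_def intro!: bexI[of _ \<beta>] bexI[of _ x])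
qed


section \<open>The kernel of the short screenings\<close>

definition V_sqrt2_coroot :: "nat \<Rightarrow> boson_label list vertex_data" where
  "V_sqrt2_coroot n = va_restrict (VZn n)
     {v. \<forall>bs\<in>Poly_Mapping.keys v. lattice_deg bs \<in> sqrt2_coroot_lattice n}"

definition short_screening :: "nat \<Rightarrow> nat \<Rightarrow> (boson_label list \<Rightarrow>\<^sub>0 complex) \<Rightarrow> (boson_label list \<Rightarrow>\<^sub>0 complex)" where
  "short_screening n i = screening n (zn_coords n (\<lambda>k. - short_root n i k / sqrt 2))"

definition W_B_4 :: "nat \<Rightarrow> boson_label list vertex_data" where
  "W_B_4 n = va_restrict (V_sqrt2_coroot n)
     (\<Inter>i\<in>{1..n}. {v \<in> va_carrier (V_sqrt2_coroot n). short_screening n i v = 0})"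


section \<open>Symplectic fermions\<close>

text \<open>
  The label \<open>(A, B)\<close> stands for the ordered monomial
  \<open>(\<Prod>k\<in>A. \<psi>\<^bsub>-k-1\<^esub>) (\<Prod>k\<in>B. \<psi>\<^sup>*\<^bsub>-k-1\<^esub>) |0>\<close>, both products taken in increasing order of \<open>k\<close>; these are
  the Poincare-Birkhoff-Witt basis of the vacuum module.  In \<open>sf_mode\<close> and \<open>sf_basis\<close> the
  flag is \<open>False\<close> for \<open>\<psi>\<close> and \<open>True\<close> for \<open>\<psi>\<^sup>*\<close>.
\<close>

type_synonym sf_label = "nat fset \<times> nat fset"

definition below :: "nat \<Rightarrow> nat fset \<Rightarrow> nat" where
  "below k A = fcard (ffilter (\<lambda>i. i < k) A)"

definition sf_basis :: "bool \<Rightarrow> int \<Rightarrow> sf_label \<Rightarrow> (sf_label \<Rightarrow>\<^sub>0 complex)" where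
  "sf_basis star m = (\<lambda>(A, B).
     if m < 0 then
       let k = nat (- m - 1) in
       if star then (if k |\<in>| B then 0
                     else vscale ((-1) ^ (fcard A + below k B)) (basis_vec (A, finsert k B)))
       else (if k |\<in>| A then 0 else vscale ((-1) ^ below k A) (basis_vec (finsert k A, B)))
     else if m = 0 then 0
     else
       let k = nat (m - 1) in
       if star then (if k |\<in>| A then vscale (- of_int m * (-1) ^ below k A) (basis_vec (A |-| {|k|}, B))
                     else 0)
       else (if k |\<in>| B then vscale (of_int m * (-1) ^ (fcard A + below k B)) (basis_vec (A, B |-| {|k|}))
             else 0))"

definition sf_mode :: "bool \<Rightarrow> sf_label field_modes" where
  "sf_mode star m = lin_ext (sf_basis star m)"

lemma below_finsert: "k |\<notin>| A \<Longrightarrow> below j (finsert k A) = (if k < j then Suc (below j A) else below j A)"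
  unfolding below_def
  by (subgoal_tac "ffilter (\<lambda>i. i < j) (finsert k A) = (if k < j then finsert k (ffilter (\<lambda>i. i < j) A) else ffilter (\<lambda>i. i < j) A)")
     (auto simp: fcard_finsert_disjoint)

lemma below_remove_sign: "k |\<in>| A \<Longrightarrow>
    (-1 :: complex) ^ below j (A |-| {|k|}) = (if k < j then - ((-1) ^ below j A) else (-1) ^ below j A)"
  using below_finsert[of k "A |-| {|k|}" j] by (simp add: finsert_absorb)

lemma fcard_remove_sign: "k |\<in>| A \<Longrightarrow> (-1 :: complex) ^ fcard (A |-| {|k|}) = - ((-1) ^ fcard A)"
proof -
  assume "k |\<in>| A"
  then have "fcard A = Suc (fcard (A |-| {|k|}))"
    using fcard_finsert_disjoint[of k "A |-| {|k|}"] by (metis fminusE finsertI1 finsert_fminus)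
  then show ?thesis by (simp only: power_Suc) simp
qed

lemma sign_square: "(-1 :: complex) ^ i * (-1) ^ i = 1" "(-1 :: complex) ^ i * ((-1) ^ i * x) = x"
  by (simp_all flip: power_add mult.assoc)

lemma sf_anticommutator:
  "sf_mode s j (sf_mode t k v) + sf_mode t k (sf_mode s j v)
     = vscale (if j + k = 0 \<and> s \<noteq> t then (if s then of_int k else of_int j) else 0) v"
proof -
  have "lin_ext (sf_basis s j) (sf_basis t k b) + lin_ext (sf_basis t k) (sf_basis s j b)
     = vscale (if j + k = 0 \<and> s \<noteq> t then (if s then of_int k else of_int j) else 0) (basis_vec b)" for b
  proof (cases b)
    case (Pair A B)
    note simps = Pair sf_basis_def Let_def lin_ext_vscale below_finsert fcard_finsert_disjoint
      below_remove_sign fcard_remove_sign power_add sign_square mult_ac finsert_absorb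
    have sc: "vscale x v + vscale y w = 0" if "x + y = 0" "v = w" for x y and v w :: "sf_label \<Rightarrow>\<^sub>0 complex"
      using that by (simp flip: free.scale_left_distrib)
    have add_del: "finsert i C |-| {|l|} = (if i = l then C |-| {|l|} else finsert i (C |-| {|l|}))"
      "finsert i (C |-| {|i|}) = finsert i C" "i |\<notin>| C \<Longrightarrow> C |-| {|i|} = C" for i l and C :: "nat fset"
      by auto
    have sgn: "(\<exists>a. i = - int a - 1) \<or> i = 0 \<or> (\<exists>a. i = int a + 1)" for i :: int
      by presburger
    have zero: "lin_ext (\<lambda>(A :: nat fset, B :: nat fset). 0) w = (0 :: sf_label \<Rightarrow>\<^sub>0 complex)" for w
      by (simp add: lin_ext_def split_def)
    consider a c where "j = - int a - 1" "k = - int c - 1" | "j = 0" | "k = 0"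
      | a c where "j = int a + 1" "k = int c + 1" | a c where "j = - int a - 1" "k = int c + 1"
      | a c where "j = int a + 1" "k = - int c - 1"
      by (metis sgn)
    then show ?thesis
    proof cases
      case (1 a c)
      have [simp]: "finsert a (finsert c C) = finsert c (finsert a C)" for C by auto
      consider "a = c" | "a < c" | "c < a" by linarith
      then show ?thesis unfolding 1
        by cases (cases s; cases t; auto simp: simps simp del: fcard_fminus_finsert intro!: sc)+
    next
      case (4 a c)
      have [simp]: "C |-| {|a|} |-| {|c|} = C |-| {|c|} |-| {|a|}" if "a \<noteq> c" for C by auto
      consider "a = c" | "a < c" | "c < a" by linarith
      then show ?thesis unfolding 4
        by cases (cases s; cases t; auto simp: simps simp del: fcard_fminus_finsert intro!: sc)+
    next
      case (5 a c)
      consider "a = c" | "a < c" | "c < a" by linarith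
      then show ?thesis unfolding 5
        by cases (cases s; cases t; auto simp: simps add_del simp del: fcard_fminus_finsert intro!: sc)+
    next
      case (6 a c)
      consider "a = c" | "a < c" | "c < a" by linarith
      then show ?thesis unfolding 6
        by cases (cases s; cases t; auto simp: simps add_del simp del: fcard_fminus_finsert intro!: sc)+
    qed (auto simp: simps zero)
  qed
  then show ?thesis
    by (simp add: sf_mode_def lin_ext_comp lin_ext_plus lin_ext_id)
qed

lemma sf_mode_vac: "k \<ge> 0 \<Longrightarrow> sf_mode s k (basis_vec ({||}, {||})) = 0"
  by (simp add: sf_mode_def sf_basis_def Let_def)

lemma below_least: "(\<And>i. i |\<in>| A \<Longrightarrow> k \<le> i) \<Longrightarrow> below k A = 0"
  unfolding below_def by (subgoal_tac "ffilter (\<lambda>i. i < k) A = {||}") (auto simp: not_less[symmetric])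

lemma sf_basis_vec:
  "basis_vec (A, B) =
    foldr (\<lambda>k. sf_mode False (- int k - 1)) (sorted_list_of_fset A)
      (foldr (\<lambda>k. sf_mode True (- int k - 1)) (sorted_list_of_fset B) (basis_vec ({||}, {||})))"
proof -
  have least: "below k (fset_of_list ks) = 0" if "\<forall>x\<in>set ks. k < x" for k ks
    using that by (intro below_least) (auto simp: fset_of_list_elem)
  have A: "foldr (\<lambda>k. sf_mode False (- int k - 1)) ks (basis_vec ({||}, B)) = basis_vec (fset_of_list ks, B)"
    if "sorted_wrt (<) ks" for ks B
    using that
    by (induction ks) (auto simp: sf_mode_def sf_basis_def Let_def least fset_of_list_elem)
  have B: "foldr (\<lambda>k. sf_mode True (- int k - 1)) ks (basis_vec ({||}, {||})) = basis_vec ({||}, fset_of_list ks)"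
    if "sorted_wrt (<) ks" for ks
    using that
    by (induction ks) (auto simp: sf_mode_def sf_basis_def Let_def least fset_of_list_elem fcard_fempty)
  have s: "sorted_wrt (<) (sorted_list_of_fset S)" "fset_of_list (sorted_list_of_fset S) = S" for S :: "nat fset"
    by (auto simp: sorted_list_of_fset.rep_eq fset_eq_iff fset_of_list_elem)
  show ?thesis by (simp add: A B s)
qed

primrec sf_field_word :: "(bool \<times> nat) list \<Rightarrow> sf_label field_modes" where
  "sf_field_word [] = id_field"
| "sf_field_word (g # gs) =
     field_prod ((-1) ^ length gs) (sf_mode (fst g)) (- int (snd g) - 1) (sf_field_word gs)"

definition sf_field :: "sf_label \<Rightarrow> sf_label field_modes" where
  "sf_field = (\<lambda>(A, B). sf_field_word
     (map (Pair False) (sorted_list_of_fset A) @ map (Pair True) (sorted_list_of_fset B)))"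

definition SF1 :: "sf_label based_vertex_data" where
  "SF1 = \<lparr>bas_set = UNIV, bas_odd = (\<lambda>(A, B). odd (fcard A + fcard B)), bas_vac = ({||}, {||}),
          bas_prod = (\<lambda>a m b. sf_field a m (basis_vec b))\<rparr>"

definition SF :: "nat \<Rightarrow> sf_label list vertex_data" where
  "SF n = span_va (tensor_power n SF1)"

end

theory Submission
  imports Defs
begin

text \<open>
  With \<open>b = e\<^bsup>\<phi>\<^esup>\<close> and \<open>c = e\<^bsup>-\<phi>\<^esup>\<close> the lattice vertex superalgebra of the integers consists of
  charged free fermions: \<open>b\<close> and \<open>c\<close> satisfy canonical anticommutation relations and generate
  everything, since \<open>\<partial>\<phi> = :bc:\<close>.  The screening operator is the mode \<open>c\<^sub>(\<^sub>0\<^sub>)\<close>, which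
  anticommutes with all fermionic modes except \<open>b\<^sub>(\<^sub>-\<^sub>1\<^sub>)\<close>.  The fields \<open>\<psi> = c\<close> and
  \<open>\<psi>\<^sup>* = \<partial>b\<close> use precisely the modes other than \<open>b\<^sub>(\<^sub>-\<^sub>1\<^sub>)\<close> and are symplectic fermions, so
  their vacuum module embeds; the whole space is \<open>U + b\<^sub>(\<^sub>-\<^sub>1\<^sub>) U\<close> for its image \<open>U\<close>, and hence
  \<open>U\<close> is the kernel of \<open>c\<^sub>(\<^sub>0\<^sub>)\<close>.  In the \<open>n\<close>-th super tensor power the joint kernel of the \<open>n\<close>
  screening operators is \<open>U \<otimes> \<dots> \<otimes> U\<close>, and the rescaled coroot lattice is the sublattice of vectors
  with even coordinate sum, which selects the even part.
\<close>

section \<open>Linear maps and locally finite sums\<close>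

text \<open>The fields of composite states are prescribed as iterated normally ordered products
  along sorted words, so neither the axioms nor any compatibility of products comes for free. Both
  follow from a uniqueness principle: Dong's lemma makes products of local fields local, and a
  covariant field that kills the vacuum and is local to every \<open>Y b\<close> is zero. Hence
  \<open>Y\<close> of the state \<open>a_(k) b\<close> is the \<open>k\<close>-th product of
  \<open>Y a\<close> and \<open>Y b\<close> (\<open>Yv_assoc\<close>). This gives the fermionic
  anticommutators, the formula for the Heisenberg field, and the multiplicativity of
  \<open>emb\<close>, because words in \<open>psi\<close> obey the same recursion on both sides.
  Identities for exponentials are reduced in a similar spirit: a family of operators stable under
  commutation with Heisenberg modes vanishes once its vacuum matrix elements do, and those are
  expansions of \<open>z^A w^B (z - w)^K\<close>. Injectivity of \<open>emb\<close> lets the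
  symplectic fermions inherit their axioms. For \<open>n\<close> factors the screening operators
  carry Koszul signs, but a sign does not change a kernel, so tensor factors can be peeled off one
  at a time.\<close>

abbreviation keys :: "('b \<Rightarrow>\<^sub>0 complex) \<Rightarrow> 'b set" where "keys \<equiv> Poly_Mapping.keys"
abbreviation lookup :: "('b \<Rightarrow>\<^sub>0 complex) \<Rightarrow> 'b \<Rightarrow> complex" where "lookup \<equiv> Poly_Mapping.lookup"

type_synonym 'b vec = "'b \<Rightarrow>\<^sub>0 complex"

definition lin :: "('b vec \<Rightarrow> 'c vec) \<Rightarrow> bool" where
  "lin f \<longleftrightarrow> (\<forall>u v. f (u + v) = f u + f v) \<and> (\<forall>c v. f (vscale c v) = vscale c (f v))"

lemma linI:
  "(\<And>u v. f (u + v) = f u + f v) \<Longrightarrow> (\<And>c v. f (vscale c v) = vscale c (f v)) \<Longrightarrow> lin f"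
  by (simp add: lin_def)

lemma lin_add: "lin f \<Longrightarrow> f (u + v) = f u + f v"
  by (simp add: lin_def)

lemma lin_scale: "lin f \<Longrightarrow> f (vscale c v) = vscale c (f v)"
  by (simp add: lin_def)

lemma lin_zero: "lin f \<Longrightarrow> f 0 = 0"
  using lin_scale[of f 0 0] by simp

lemma lin_uminus: "lin f \<Longrightarrow> f (- v) = - f v"
  using lin_scale[of f "-1" v] by (simp add: free.scale_minus_left)

lemma lin_diff: "lin f \<Longrightarrow> f (u - v) = f u - f v"
  using lin_add[of f u "- v"] lin_uminus[of f v] by simp

lemma lin_sum: "lin f \<Longrightarrow> f (sum g S) = (\<Sum>i\<in>S. f (g i))"
  by (induction S rule: infinite_finite_induct) (simp_all add: lin_zero lin_add)

lemma lin_lin_ext [simp]: "lin (lin_ext f)"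
  by (rule linI) (simp_all add: lin_ext_add lin_ext_vscale)

lemma lin_id: "lin (\<lambda>v. v)"
  by (simp add: lin_def)

lemma lin_const_zero: "lin (\<lambda>v. 0)"
  by (simp add: lin_def)

lemma lin_comp: "lin f \<Longrightarrow> lin g \<Longrightarrow> lin (\<lambda>v. f (g v))"
  by (simp add: lin_def)

lemma lin_plus: "lin f \<Longrightarrow> lin g \<Longrightarrow> lin (\<lambda>v. f v + g v)"
  by (simp add: lin_def free.scale_right_distrib)

lemma lin_minus: "lin f \<Longrightarrow> lin g \<Longrightarrow> lin (\<lambda>v. f v - g v)"
  by (simp add: lin_def free.scale_right_diff_distrib)

lemma lin_vscale: "lin f \<Longrightarrow> lin (\<lambda>v. vscale c (f v))"
  by (simp add: lin_def free.scale_right_distrib free.scale_left_commute)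

lemma lin_sum_op: "(\<And>i. i \<in> S \<Longrightarrow> lin (f i)) \<Longrightarrow> lin (\<lambda>v. \<Sum>i\<in>S. f i v)"
  by (induction S rule: infinite_finite_induct) (auto intro!: lin_const_zero lin_plus)

lemma lin_eq_lin_ext:
  assumes "lin f"
  shows "f v = lin_ext (\<lambda>b. f (basis_vec b)) v"
proof -
  have "v = lin_ext (\<lambda>b. basis_vec b) v"
    using lin_ext_id[of 1 v] by simp
  then have "f v = f (lin_ext (\<lambda>b. basis_vec b) v)" by simp
  also have "\<dots> = lin_ext (\<lambda>b. f (basis_vec b)) v"
    by (simp add: lin_ext_def lin_sum[OF assms] lin_scale[OF assms])
  finally show ?thesis .
qed

lemma lin_eqI:
  assumes "lin f" "lin g" "\<And>b. b \<in> keys v \<Longrightarrow> f (basis_vec b) = g (basis_vec b)"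
  shows "f v = g v"
proof -
  have "lin_ext (\<lambda>b. f (basis_vec b)) v = lin_ext (\<lambda>b. g (basis_vec b)) v"
    unfolding lin_ext_def using assms(3) by (intro sum.cong) auto
  then show ?thesis using lin_eq_lin_ext[OF assms(1)] lin_eq_lin_ext[OF assms(2)] by metis
qed

lemma lookup_lin_ext:
  "lookup (lin_ext f v) k =
    (\<Sum>b\<in>keys v. lookup v b * lookup (f b) k)"
  by (simp add: lin_ext_def lookup_sum lookup_vscale)

lemma lookup_basis_vec: "lookup (basis_vec b) k = (if b = k then 1 else 0)"
  by (simp add: basis_vec_def lookup_single when_def)

lemma keys_basis_vec [simp]: "keys (basis_vec b) = {b}"
  by (auto simp: basis_vec_def)

lemma basis_vec_neq_zero [simp]: "basis_vec b \<noteq> 0"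
  by (metis keys_basis_vec insert_not_empty keys_zero)

lemma keys_vscale: "keys (vscale c v) \<subseteq> keys v"
  by (auto simp: in_keys_iff lookup_vscale)

lemma keys_sum_subset:
  "(\<And>i. i \<in> I \<Longrightarrow> keys (f i) \<subseteq> S) \<Longrightarrow> keys (sum f I) \<subseteq> S"
proof (induction I rule: infinite_finite_induct)
  case (insert x F)
  then show ?case using Poly_Mapping.keys_add[of "f x" "sum f F"] by auto
qed auto

lemma keys_lin_ext_subset:
  assumes "\<And>b. b \<in> keys v \<Longrightarrow> keys (f b) \<subseteq> S"
  shows "keys (lin_ext f v) \<subseteq> S"
  unfolding lin_ext_def by (intro keys_sum_subset order_trans[OF keys_vscale] assms)

lemma keys_Sum_any_subset:
  "(\<And>i. keys (f i) \<subseteq> S) \<Longrightarrow> keys (Sum_any f) \<subseteq> S"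
  unfolding Sum_any.expand_set by (rule keys_sum_subset)

text \<open>The vector is built up one label at a time, and the bound on \<open>keys\<close> is
  carried along because \<open>scale_add\<close> demands it of both summands. With \<open>S\<close>
  the set of labels of one parity this is induction on homogeneous vectors.\<close>

lemma vec_induct [consumes 1, case_names zero basis scale_add]:
  assumes "keys v \<subseteq> S" "P 0" "\<And>b. b \<in> S \<Longrightarrow> P (basis_vec b)"
    "\<And>c u w. keys u \<subseteq> S \<Longrightarrow> keys w \<subseteq> S \<Longrightarrow> P u \<Longrightarrow> P w \<Longrightarrow> P (vscale c u + w)"
  shows "P v"
proof -
  have "P (\<Sum>b\<in>B. vscale (lookup v b) (basis_vec b)) \<and>
      keys (\<Sum>b\<in>B. vscale (lookup v b) (basis_vec b)) \<subseteq> S"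
    if "finite B" "B \<subseteq> S" for B
    using that
  proof (induction B)
    case empty
    then show ?case using assms(2) by simp
  next
    case (insert x F)
    have "keys (\<Sum>b\<in>insert x F. vscale (lookup v b) (basis_vec b)) \<subseteq> S"
      using insert.prems by (intro keys_sum_subset order_trans[OF keys_vscale]) auto
    then show ?case using insert assms(3) assms(4)[of "basis_vec x"] by auto
  qed
  from this[OF finite_keys assms(1)] lin_ext_id[of 1 v] show ?thesis
    by (simp add: lin_ext_def)
qed

lemma Sum_any_lin:
  assumes "lin f" "finite {j. g j \<noteq> 0}"
  shows "f (Sum_any g) = Sum_any (\<lambda>j. f (g j))"
proof -
  have "Sum_any (\<lambda>j. f (g j)) = (\<Sum>j\<in>{j. g j \<noteq> 0}. f (g j))"
    using assms by (intro Sum_any.expand_superset) (auto simp: lin_zero)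
  then show ?thesis using assms by (simp add: Sum_any.expand_set lin_sum)
qed

text \<open>A map with trivial kernel preserves the support of the family, so the equation persists
  for infinite support, where both sides are 0 by convention. This lets \<open>emb\<close> and
  \<open>embn\<close> pass through mode sums before finiteness is known on the symplectic
  side.\<close>

lemma Sum_any_inj_lin:
  assumes "lin f" "\<And>x. f x = 0 \<Longrightarrow> x = 0"
  shows "f (Sum_any g) = Sum_any (\<lambda>j. f (g j))"
proof -
  have "{j. f (g j) \<noteq> 0} = {j. g j \<noteq> 0}"
    using assms lin_zero[OF assms(1)] by (metis (full_types))
  then show ?thesis using assms by (simp add: Sum_any.expand_set lin_sum)
qed

lemma Sum_any_minus:
  fixes f g :: "'i \<Rightarrow> 'b vec"
  assumes "finite {i. f i \<noteq> 0}" "finite {i. g i \<noteq> 0}"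
  shows "Sum_any (\<lambda>i. f i - g i) = Sum_any f - Sum_any g"
proof -
  let ?S = "{i. f i \<noteq> 0} \<union> {i. g i \<noteq> 0}"
  have "Sum_any (\<lambda>i. f i - g i) = (\<Sum>i\<in>?S. f i - g i)" "Sum_any f = sum f ?S" "Sum_any g = sum g ?S"
    using assms by (auto intro!: Sum_any.expand_superset)
  then show ?thesis by (simp add: sum_subtractf)
qed

definition fsupp :: "(nat \<Rightarrow> 'b vec) \<Rightarrow> bool" where
  "fsupp x \<longleftrightarrow> (\<exists>J. \<forall>j\<ge>J. x j = 0)"

lemma fsupp_finite: "fsupp x \<Longrightarrow> finite {j. x j \<noteq> 0}"
  unfolding fsupp_def by (metis (mono_tags, lifting) finite_nat_set_iff_bounded_le mem_Collect_eq nat_le_linear)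

lemma fsupp_Sum_any:
  fixes x :: "nat \<Rightarrow> 'b vec"
  shows "\<forall>j\<ge>J. x j = 0 \<Longrightarrow> Sum_any x = (\<Sum>j<J. x j)"
  by (rule Sum_any.expand_superset) (auto simp: not_le[symmetric])

lemma fsupp_diff: "fsupp x \<Longrightarrow> fsupp y \<Longrightarrow> fsupp (\<lambda>j. x j - y j)"
  unfolding fsupp_def by (metis diff_0_right le_trans nat_le_linear)

lemma fsupp_vscale: "fsupp x \<Longrightarrow> fsupp (\<lambda>j. vscale (c j) (x j))"
  unfolding fsupp_def by (metis free.scale_zero_right)

lemma fsupp_Suc: "fsupp x \<Longrightarrow> fsupp (\<lambda>j. x (Suc j))"
  unfolding fsupp_def by (metis le_SucI)

section \<open>Sums weighted by the expansion coefficients of a power of z - w\<close>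

definition bco :: "int \<Rightarrow> nat \<Rightarrow> complex" where
  "bco p j = (-1) ^ j * (of_int p gchoose j)"

text \<open>The weight \<open>bco p j\<close> is the coefficient of \<open>x^j\<close> in
  \<open>(1 - x)^p\<close>, equivalently of \<open>z^(p-j) w^j\<close> in the expansion of
  \<open>(z - w)^p\<close> for |z| > |w|.\<close>

definition csum :: "int \<Rightarrow> (nat \<Rightarrow> 'b vec) \<Rightarrow> 'b vec" where
  "csum p x = Sum_any (\<lambda>j. vscale (bco p j) (x j))"

lemma csum_eq: "\<forall>j\<ge>J. x j = 0 \<Longrightarrow> csum p x = (\<Sum>j<J. vscale (bco p j) (x j))"
  unfolding csum_def by (rule fsupp_Sum_any) auto

lemma csum_add: "fsupp x \<Longrightarrow> fsupp y \<Longrightarrow> csum p (\<lambda>j. x j + y j) = csum p x + csum p y"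
  unfolding csum_def free.scale_right_distrib
  by (rule Sum_any.distrib) (auto intro!: fsupp_finite fsupp_vscale)

lemma csum_diff: "fsupp x \<Longrightarrow> fsupp y \<Longrightarrow> csum p (\<lambda>j. x j - y j) = csum p x - csum p y"
  unfolding csum_def free.scale_right_diff_distrib
  by (rule Sum_any_minus) (auto intro!: fsupp_finite fsupp_vscale)

lemma csum_lin: "lin f \<Longrightarrow> fsupp x \<Longrightarrow> csum p (\<lambda>j. f (x j)) = f (csum p x)"
  unfolding csum_def
  by (subst Sum_any_lin) (auto intro!: fsupp_finite fsupp_vscale simp: lin_scale)

lemma lin_vscale_self: "lin (vscale c)"
  using lin_vscale[OF lin_id] .

lemma csum_vscale: "fsupp x \<Longrightarrow> csum p (\<lambda>j. vscale c (x j)) = vscale c (csum p x)"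
  by (rule csum_lin[OF lin_vscale_self])

lemma bco_0 [simp]: "bco p 0 = 1"
  by (simp add: bco_def)

lemma bco_Suc: "bco (p + 1) (Suc j) = bco p (Suc j) - bco p j"
  unfolding bco_def using gbinomial_Suc_Suc[of "of_int p :: complex" j] by (simp add: algebra_simps)

lemma bco_zero_exp: "bco 0 j = (if j = 0 then 1 else 0)"
  by (cases j) (auto simp: bco_def)

text \<open>Coefficient form of the differential equation (1 - x) f' = -p f satisfied by f = (1 -
  x)^p.\<close>

lemma bco_absorb: "of_nat (Suc j) * bco p (Suc j) = (of_nat j - of_int p) * bco p j"
proof -
  have "of_nat (Suc j) * (of_int p gchoose Suc j) = (of_int p - of_nat j) * (of_int p gchoose j :: complex)"
    using gbinomial_absorb_comp[of "of_int p :: complex" j] gbinomial_absorption[of j "of_int p :: complex"]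
    by (simp add: algebra_simps)
  then have "(-1) ^ Suc j * (of_nat (Suc j) * (of_int p gchoose Suc j)) =
      (-1) ^ Suc j * ((of_int p - of_nat j) * (of_int p gchoose j :: complex))"
    by (rule arg_cong)
  then show ?thesis unfolding bco_def by (simp add: algebra_simps)
qed

text \<open>Summation by parts: moving the shift from \<open>x\<close> to the weights produces
  \<open>bco p j - bco p (j - 1)\<close>, the weight for \<open>p + 1\<close>. It encodes (z - w) (z
  - w)^p = (z - w)^(p+1).\<close>

lemma csum_pascal:
  assumes "fsupp x"
  shows "csum p (\<lambda>j. x j - x (Suc j)) = csum (p + 1) x"
proof -
  from assms obtain J where J: "\<forall>j\<ge>J. x j = 0" by (auto simp: fsupp_def)
  \<comment> \<open>The partial sums differ only by a boundary term at \<open>K\<close>, which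
    vanishes beyond the support.\<close>
  have *: "(\<Sum>j<Suc K. vscale (bco p j) (x j - x (Suc j))) =
     (\<Sum>j<Suc K. vscale (bco (p + 1) j) (x j)) - vscale (bco p K) (x (Suc K))" for K
    by (induction K) (simp_all add: bco_Suc free.scale_right_diff_distrib free.scale_left_diff_distrib)
  have "csum p (\<lambda>j. x j - x (Suc j)) = (\<Sum>j<Suc J. vscale (bco p j) (x j - x (Suc j)))"
    using J by (intro csum_eq) auto
  also have "\<dots> = (\<Sum>j<Suc J. vscale (bco (p + 1) j) (x j))"
    using J unfolding * by simp
  also have "\<dots> = csum (p + 1) x"
    using J by (intro csum_eq[symmetric]) auto
  finally show ?thesis .
qed

lemma csum_zero_exp: "fsupp x \<Longrightarrow> csum 0 x = x 0"
proof -
  assume "fsupp x"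
  then obtain J where J: "\<forall>j\<ge>J. x j = 0" by (auto simp: fsupp_def)
  have "csum 0 x = (\<Sum>j<Suc J. vscale (bco 0 j) (x j))" using J by (intro csum_eq) auto
  also have "\<dots> = (\<Sum>j<Suc J. if j = 0 then x 0 else 0)"
    by (intro sum.cong) (auto simp: bco_zero_exp)
  finally show ?thesis by simp
qed

lemma csum_head: "\<forall>j\<ge>1. x j = 0 \<Longrightarrow> csum p x = x 0"
  by (subst csum_eq[of 1]) auto

lemma csum_zero: "(\<And>j. x j = 0) \<Longrightarrow> csum p x = 0"
  by (simp add: csum_def)

text \<open>By \<open>bco_absorb\<close> the term with \<open>x (Suc j)\<close> has weight
  \<open>j + 1\<close> times \<open>bco p (j + 1)\<close>, so it cancels the part
  \<open>of_nat j\<close> of the next summand and only the constant \<open>- of_int m\<close>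
  survives. The summand is what a translation operator leaves over in the first half of a field
  product.\<close>

lemma csum_derivation:
  assumes "fsupp x"
  shows "csum p (\<lambda>j. vscale (of_nat j - of_int p) (x (Suc j)) - vscale (of_int m + of_nat j) (x j))
    = vscale (- of_int m) (csum p x)"
proof -
  from assms obtain J where J: "\<forall>j\<ge>J. x j = 0" by (auto simp: fsupp_def)
  have *: "(\<Sum>j<K. vscale (bco p j) (vscale (of_nat j - of_int p) (x (Suc j)) - vscale (of_int m + of_nat j) (x j))) =
     (\<Sum>j<K. vscale (- of_int m) (vscale (bco p j) (x j))) + vscale (of_nat K * bco p K) (x K)" for K
  proof (induction K)
    case (Suc K)
    have "vscale (bco p K) (vscale (of_nat K - of_int p) (x (Suc K)) - vscale (of_int m + of_nat K) (x K))
       = vscale (of_nat (Suc K) * bco p (Suc K)) (x (Suc K)) - vscale ((of_int m + of_nat K) * bco p K) (x K)"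
      unfolding bco_absorb by (simp add: free.scale_right_diff_distrib mult.commute)
    moreover have "- vscale ((of_int m + of_nat K) * bco p K) (x K) = vscale (- of_int m) (vscale (bco p K) (x K)) 
       - vscale (of_nat K * bco p K) (x K)"
      by (simp add: algebra_simps)
    ultimately show ?case using Suc by simp
  qed simp
  have "csum p (\<lambda>j. vscale (of_nat j - of_int p) (x (Suc j)) - vscale (of_int m + of_nat j) (x j))
     = (\<Sum>j<J. vscale (bco p j) (vscale (of_nat j - of_int p) (x (Suc j)) - vscale (of_int m + of_nat j) (x j)))"
    using J by (intro csum_eq) auto
  then show ?thesis
    using J unfolding * by (simp add: csum_eq[OF J] free.scale_sum_right)
qed

text \<open>Companion for the second half of a field product, where the shift goes the other way;
  the value 0 at index 0 stands for the absent predecessor of \<open>y 0\<close>. The cancellation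
  is again \<open>bco_absorb\<close>, between neighbouring indices in the opposite
  direction.\<close>

lemma csum_derivation':
  assumes "fsupp y"
  shows "csum p (\<lambda>j. vscale (of_nat j - of_int p - of_int m) (y j) - (case j of 0 \<Rightarrow> 0 | Suc i \<Rightarrow> vscale (of_nat j) (y i)))
    = vscale (- of_int m) (csum p y)"
proof -
  from assms obtain J where J: "\<forall>j\<ge>J. y j = 0" by (auto simp: fsupp_def)
  let ?t = "\<lambda>j. vscale (of_nat j - of_int p - of_int m) (y j) - (case j of 0 \<Rightarrow> 0 | Suc i \<Rightarrow> vscale (of_nat j) (y i))"
  have *: "(\<Sum>j<Suc K. vscale (bco p j) (?t j)) =
     (\<Sum>j<Suc K. vscale (- of_int m) (vscale (bco p j) (y j))) + vscale ((of_nat K - of_int p) * bco p K) (y K)" for K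
  proof (induction K)
    case 0
    then show ?case by (simp add: algebra_simps)
  next
    case (Suc K)
    have h1: "vscale (bco p (Suc K)) (?t (Suc K)) =
      vscale (bco p (Suc K) * (of_nat (Suc K) - of_int p - of_int m)) (y (Suc K)) - vscale (of_nat (Suc K) * bco p (Suc K)) (y K)"
      by (simp add: free.scale_right_diff_distrib mult.commute)
    have h2: "vscale (of_nat (Suc K) * bco p (Suc K)) (y K) = vscale ((of_nat K - of_int p) * bco p K) (y K)"
      unfolding bco_absorb by (simp add: algebra_simps)
    have h3: "vscale (bco p (Suc K) * (of_nat (Suc K) - of_int p - of_int m)) (y (Suc K)) =
       vscale (- of_int m) (vscale (bco p (Suc K)) (y (Suc K))) + vscale ((of_nat (Suc K) - of_int p) * bco p (Suc K)) (y (Suc K))"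
      by (simp add: algebra_simps)
    have abel: "a + z + ((u + w) - z) = a + u + w" for a z u w :: "'a vec" by simp
    show ?case
      by (simp only: sum.lessThan_Suc[of _ "Suc K"] Suc.IH h1 h2 h3 abel)
  qed
  have "?t j = 0" if "j \<ge> Suc J" for j using that J by (cases j) auto
  then have "csum p ?t = (\<Sum>j<Suc J. vscale (bco p j) (?t j))"
    by (intro csum_eq) auto
  moreover have "csum p y = (\<Sum>j<Suc J. vscale (bco p j) (y j))"
    using J by (intro csum_eq) auto
  ultimately show ?thesis
    using J unfolding * by (simp add: free.scale_sum_right)
qed

section \<open>Fields, locality and Dong's lemma\<close>

definition is_field :: "'b field_modes \<Rightarrow> bool" where
  "is_field A \<longleftrightarrow> (\<forall>m. lin (A m)) \<and> (\<forall>v. \<exists>N. \<forall>m\<ge>N. A m v = 0)"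

lemma is_field_lin: "is_field A \<Longrightarrow> lin (A m)"
  by (simp add: is_field_def)

lemma is_fieldE:
  assumes "is_field A"
  obtains N where "\<And>m. m \<ge> N \<Longrightarrow> A m v = 0"
  using assms unfolding is_field_def by meson

text \<open>Multiplication by \<open>z - w\<close> on the coefficients of \<open>z\<^bsup>-m-1\<^esup> w\<^bsup>-k-1\<^esup>\<close>.\<close>

definition dl :: "(int \<Rightarrow> int \<Rightarrow> 'a :: ab_group_add) \<Rightarrow> int \<Rightarrow> int \<Rightarrow> 'a" where
  "dl F = (\<lambda>m k. F (m + 1) k - F m (k + 1))"

lemma dl_pow_diff:
  "(dl ^^ N) (\<lambda>m k. F m k - G m k) = (\<lambda>m k. (dl ^^ N) F m k - (dl ^^ N) G m k)"
  by (induction N) (auto simp: dl_def fun_eq_iff)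

lemma dl_pow_add:
  "(dl ^^ N) (\<lambda>m k. F m k + G m k) = (\<lambda>m k. (dl ^^ N) F m k + (dl ^^ N) G m k)"
  by (induction N) (auto simp: dl_def fun_eq_iff)

lemma dl_pow_lin: "lin f \<Longrightarrow> (dl ^^ N) (\<lambda>m k. f (F m k)) = (\<lambda>m k. f ((dl ^^ N) F m k))"
  by (induction N) (auto simp: dl_def fun_eq_iff lin_diff)

lemma dl_pow_zero: "(dl ^^ N) (\<lambda>m k. 0) = (\<lambda>m k. 0)"
  by (induction N) (auto simp: dl_def fun_eq_iff)

lemma funpow_vanish: "(d ^^ N) F = Z \<Longrightarrow> (\<And>n. (d ^^ n) Z = Z) \<Longrightarrow> N \<le> M \<Longrightarrow> (d ^^ M) F = Z"
  by (metis le_add_diff_inverse2 funpow_add comp_apply)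

lemma dl_pow_mono: "(dl ^^ N) F = (\<lambda>m k. 0) \<Longrightarrow> N \<le> M \<Longrightarrow> (dl ^^ M) F = (\<lambda>m k. 0)"
  by (rule funpow_vanish) (simp_all add: dl_pow_zero)

text \<open>Exchanging the two variables turns z - w into its negative, once for each power.\<close>

lemma dl_pow_flip: "(dl ^^ N) (\<lambda>m k. F k m) = (\<lambda>m k. vscale ((-1) ^ N) ((dl ^^ N) F k m))"
  by (induction N) (auto simp: dl_def fun_eq_iff free.scale_right_diff_distrib)

text \<open>The right-hand side is the shape of the \<open>locality\<close> axiom of
  \<open>vertex_superalgebra\<close>; the arguments about locality work with iterates of
  \<open>dl\<close>, and this is the bridge.\<close>

lemma dl_pow_expand:
  "(dl ^^ N) F m k =
    (\<Sum>j\<le>N. vscale ((-1) ^ j * of_nat (N choose j)) (F (m + int (N - j)) (k + int j)))"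
proof (induction N arbitrary: m k)
  case (Suc N)
  let ?c = "\<lambda>N j. (-1) ^ j * of_nat (N choose j) :: complex"
  let ?F = "\<lambda>j. F (m + int (Suc N - j)) (k + int j)"
  have 1: "(dl ^^ N) F (m + 1) k = (\<Sum>j\<le>Suc N. vscale (?c N j) (?F j))"
  proof -
    have "(dl ^^ N) F (m + 1) k = (\<Sum>j\<le>N. vscale (?c N j) (?F j))"
      unfolding Suc by (intro sum.cong refl) (simp add: of_nat_diff algebra_simps)
    then show ?thesis by (simp add: binomial_eq_0)
  qed
  have 2: "(dl ^^ N) F m (k + 1) = (\<Sum>j\<le>N. vscale (?c N j) (?F (Suc j)))"
    unfolding Suc by (auto simp: algebra_simps intro!: sum.cong)
  have c: "?c (Suc N) (Suc j) = ?c N (Suc j) - ?c N j" for j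
    by (simp add: algebra_simps)
  have "(dl ^^ Suc N) F m k = (\<Sum>j\<le>Suc N. vscale (?c N j) (?F j)) - (\<Sum>j\<le>N. vscale (?c N j) (?F (Suc j)))"
    using 1 2 by (simp add: dl_def)
  also have "\<dots> = (\<Sum>j\<le>Suc N. vscale (?c (Suc N) j) (?F j))"
    unfolding sum.atMost_Suc_shift c by (simp add: free.scale_left_diff_distrib sum_subtractf)
  finally show ?case .
qed simp

text \<open>Order and sign are explicit parameters so that Dong's lemma can multiply signs and
  different orders can be raised to a common value.\<close>

definition mlocal :: "nat \<Rightarrow> complex \<Rightarrow> 'b field_modes \<Rightarrow> 'b field_modes \<Rightarrow> bool" where
  "mlocal N s A B \<longleftrightarrow> (\<forall>v. (dl ^^ N) (\<lambda>m k. A m (B k v) - vscale s (B k (A m v))) = (\<lambda>m k. 0))"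

lemma mlocal_mono: "mlocal N s A B \<Longrightarrow> N \<le> M \<Longrightarrow> mlocal M s A B"
  unfolding mlocal_def using dl_pow_mono by blast

lemma mlocal_sym:
  assumes "mlocal N s A B" "s * s = 1"
  shows "mlocal N s B A"
  unfolding mlocal_def
proof
  fix v
  let ?F = "\<lambda>m k. A m (B k v) - vscale s (B k (A m v))"
  \<comment> \<open>Since \<open>s * s = 1\<close>, the supercommutator with the roles exchanged is
    \<open>- s\<close> times the original one with swapped indices.\<close>
  have "(\<lambda>m k. B m (A k v) - vscale s (A k (B m v))) = (\<lambda>m k. vscale (- s) (?F k m))"
    using assms(2) by (simp add: fun_eq_iff free.scale_right_diff_distrib)
  then have "(dl ^^ N) (\<lambda>m k. B m (A k v) - vscale s (A k (B m v))) = (dl ^^ N) (\<lambda>m k. vscale (- s) (?F k m))"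
    by (rule arg_cong)
  also have "\<dots> = (\<lambda>m k. vscale (- s) ((dl ^^ N) (\<lambda>m k. ?F k m) m k))"
    by (rule dl_pow_lin[OF lin_vscale_self])
  also have "\<dots> = (\<lambda>m k. 0)"
  proof -
    have "(dl ^^ N) ?F = (\<lambda>m k. 0)" using assms(1) unfolding mlocal_def by blast
    then show ?thesis using dl_pow_flip[of N ?F] by (simp only: free.scale_zero_right)
  qed
  finally show "(dl ^^ N) (\<lambda>m k. B m (A k v) - vscale s (A k (B m v))) = (\<lambda>m k. 0)" .
qed

lemma mlocal_lin_comb:
  assumes "mlocal N s A C" "mlocal N s B C" "is_field C"
  shows "mlocal N s (\<lambda>m v. vscale c (A m v) + B m v) C"
  unfolding mlocal_def
proof
  fix v
  have l: "lin (C k)" for k using assms(3) by (rule is_field_lin)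
  have "(\<lambda>m k. vscale c (A m (C k v)) + B m (C k v) - vscale s (C k (vscale c (A m v) + B m v)))
    = (\<lambda>m k. vscale c (A m (C k v) - vscale s (C k (A m v))) + (B m (C k v) - vscale s (C k (B m v))))"
    by (simp add: fun_eq_iff lin_add[OF l] lin_scale[OF l] algebra_simps)
  then show "(dl ^^ N) (\<lambda>m k. vscale c (A m (C k v)) + B m (C k v) - vscale s (C k (vscale c (A m v) + B m v)))
     = (\<lambda>m k. 0)"
    using assms(1,2) unfolding mlocal_def by (simp add: dl_pow_add dl_pow_lin[OF lin_vscale_self])
qed

lemma field_prod_eq:
  assumes "is_field A" "is_field B"
  shows "fsupp (\<lambda>j. A (p - int j) (B (m + int j) v))"
    and "fsupp (\<lambda>j. B (p + m - int j) (A (int j) v))"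
    and "field_prod s A p B m v = csum p (\<lambda>j. A (p - int j) (B (m + int j) v))
      - vscale (s * (-1) powi p) (csum p (\<lambda>j. B (p + m - int j) (A (int j) v)))"
proof -
  obtain NA where NA: "\<And>m. m \<ge> NA \<Longrightarrow> A m v = 0" by (rule is_fieldE[OF assms(1), of v]) blast
  obtain NB where NB: "\<And>m. m \<ge> NB \<Longrightarrow> B m v = 0" by (rule is_fieldE[OF assms(2), of v]) blast
  have z: "A k 0 = 0" "B k 0 = 0" for k using assms by (simp_all add: is_field_lin lin_zero)
  have "A (p - int j) (B (m + int j) v) = 0" if "j \<ge> nat (NB - m)" for j
    using NB[of "m + int j"] that z by auto
  then show 1: "fsupp (\<lambda>j. A (p - int j) (B (m + int j) v))" unfolding fsupp_def by blast
  have "B (p + m - int j) (A (int j) v) = 0" if "j \<ge> nat NA" for j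
    using NA[of "int j"] that z by auto
  then show 2: "fsupp (\<lambda>j. B (p + m - int j) (A (int j) v))" unfolding fsupp_def by blast
  show "field_prod s A p B m v = csum p (\<lambda>j. A (p - int j) (B (m + int j) v))
      - vscale (s * (-1) powi p) (csum p (\<lambda>j. B (p + m - int j) (A (int j) v)))"
    unfolding csum_vscale[OF 2, symmetric]
    using csum_diff[OF 1 fsupp_vscale[OF 2, of "\<lambda>_. s * (-1) powi p"], of p]
    by (simp add: field_prod_def csum_def bco_def)
qed

lemma is_field_field_prod:
  assumes A: "is_field A" and B: "is_field B"
  shows "is_field (field_prod s A p B)"
  unfolding is_field_def
proof (intro conjI allI)
  fix m
  note l = is_field_lin[OF A] is_field_lin[OF B]
  note eq = field_prod_eq[OF A B]
  show "lin (field_prod s A p B m)"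
    by (rule linI)
      (simp_all add: eq(3) lin_add[OF l(1)] lin_add[OF l(2)] csum_add[OF eq(1) eq(1)] csum_add[OF eq(2) eq(2)]
        lin_scale[OF l(1)] lin_scale[OF l(2)] csum_vscale[OF eq(1)] csum_vscale[OF eq(2)] algebra_simps)
next
  fix v
  obtain NA where NA: "\<And>m. m \<ge> NA \<Longrightarrow> A m v = 0" by (rule is_fieldE[OF assms(1), of v]) blast
  obtain NB where NB: "\<And>m. m \<ge> NB \<Longrightarrow> B m v = 0" by (rule is_fieldE[OF assms(2), of v]) blast
  have z: "A k 0 = 0" "B k 0 = 0" for k using assms by (simp_all add: is_field_lin lin_zero)
  \<comment> \<open>Only the finitely many vectors \<open>A (int j) v\<close> with
    \<open>j < nat NA\<close> can be nonzero, so the truncation bounds of \<open>B\<close> on them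
    have a common maximum.\<close>
  have "\<exists>M. \<forall>j<J. \<forall>k\<ge>M. B k (A (int j) v) = 0" for J
  proof (induction J)
    case (Suc J)
    then obtain M where M: "\<forall>j<J. \<forall>k\<ge>M. B k (A (int j) v) = 0" by blast
    obtain M' where "\<forall>k\<ge>M'. B k (A (int J) v) = 0" by (rule is_fieldE[OF B, of "A (int J) v"]) blast
    with M have "\<forall>j<Suc J. \<forall>k\<ge>max M M'. B k (A (int j) v) = 0" by (auto simp: less_Suc_eq)
    then show ?case by blast
  qed auto
  then obtain M where M: "\<And>j k. j < nat NA \<Longrightarrow> k \<ge> M \<Longrightarrow> B k (A (int j) v) = 0" by blast
  have "field_prod s A p B m v = 0" if m: "m \<ge> max NB (M - p + int (nat NA))" for m
  proof -
    have "B (p + m - int j) (A (int j) v) = 0" for j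
    proof (cases "j < nat NA")
      case True
      then have "M \<le> p + m - int j" using m by linarith
      with True show ?thesis by (rule M)
    next
      case False
      then show ?thesis using NA[of "int j"] z by auto
    qed
    moreover have "A (p - int j) (B (m + int j) v) = 0" for j
      using NB[of "m + int j"] m z by auto
    ultimately show ?thesis by (simp add: field_prod_eq(3)[OF A B] csum_zero)
  qed
  then show "\<exists>N. \<forall>m\<ge>N. field_prod s A p B m v = 0" by blast
qed

text \<open>
  In the proof of Dong's lemma the three indices belong to the variables of \<open>A\<close>, \<open>B\<close> and \<open>C\<close>.
  The operators below are multiplication by \<open>x - w\<close>, \<open>x - z\<close> and \<open>w - z\<close>, and \<open>prodR p\<close> takes the
  residue in \<open>x\<close> against the two expansions of \<open>(x - w)\<^sup>p\<close>.
\<close>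

type_synonym 'b tri = "int \<Rightarrow> int \<Rightarrow> int \<Rightarrow> 'b vec"

definition dab :: "'b tri \<Rightarrow> 'b tri" where "dab F = (\<lambda>a b c. F (a + 1) b c - F a (b + 1) c)"
definition dac :: "'b tri \<Rightarrow> 'b tri" where "dac F = (\<lambda>a b c. F (a + 1) b c - F a b (c + 1))"
definition dbc :: "'b tri \<Rightarrow> 'b tri" where "dbc F = (\<lambda>a b c. F a (b + 1) c - F a b (c + 1))"

lemmas dtri_defs = dab_def dac_def dbc_def

definition prodR :: "int \<Rightarrow> 'b tri \<Rightarrow> 'b tri \<Rightarrow> int \<Rightarrow> int \<Rightarrow> 'b vec" where
  "prodR p F G m c = csum p (\<lambda>j. F (p - int j) (m + int j) c)
     - vscale ((-1) powi p) (csum p (\<lambda>j. G (int j) (p + m - int j) c))"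

text \<open>Vanishing uniform in the remaining index: in \<open>A a (B b (C c v))\<close> a large
  \<open>b\<close> kills the vector whatever \<open>a\<close> is, and in
  \<open>B b (A a (C c v))\<close> a large \<open>a\<close> does. This makes the two sums in
  \<open>prodR\<close> finite.\<close>

definition admB :: "'b tri \<Rightarrow> bool" where "admB F \<longleftrightarrow> (\<forall>c. \<exists>N. \<forall>b\<ge>N. \<forall>a. F a b c = 0)"
definition admA :: "'b tri \<Rightarrow> bool" where "admA F \<longleftrightarrow> (\<forall>c. \<exists>N. \<forall>a\<ge>N. \<forall>b. F a b c = 0)"

lemma admB_shift: "admB F \<Longrightarrow> admB (dab F)" "admB F \<Longrightarrow> admB (dac F)" "admB F \<Longrightarrow> admB (dbc F)"
proof -
  assume F: "admB F"
  have *: "\<exists>N. \<forall>b\<ge>N. \<forall>a. F a b c = 0 \<and> F a b (c + 1) = 0" for c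
  proof -
    obtain N M where "\<forall>b\<ge>N. \<forall>a. F a b c = 0" "\<forall>b\<ge>M. \<forall>a. F a b (c + 1) = 0"
      using F unfolding admB_def by metis
    then show ?thesis by (intro exI[of _ "max N M"]) auto
  qed
  have gen: "admB G" if "\<And>a b c N. \<forall>b\<ge>N. \<forall>a. F a b c = 0 \<and> F a b (c + 1) = 0 \<Longrightarrow> b \<ge> N \<Longrightarrow> G a b c = 0" for G
    unfolding admB_def using * that by meson
  show "admB (dab F)" "admB (dac F)" "admB (dbc F)"
    by (rule gen; auto simp: dtri_defs)+
qed

lemma admA_shift: "admA F \<Longrightarrow> admA (dab F)" "admA F \<Longrightarrow> admA (dac F)" "admA F \<Longrightarrow> admA (dbc F)"
proof -
  assume F: "admA F"
  have *: "\<exists>N. \<forall>a\<ge>N. \<forall>b. F a b c = 0 \<and> F a b (c + 1) = 0" for c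
  proof -
    obtain N M where "\<forall>a\<ge>N. \<forall>b. F a b c = 0" "\<forall>a\<ge>M. \<forall>b. F a b (c + 1) = 0"
      using F unfolding admA_def by metis
    then show ?thesis by (intro exI[of _ "max N M"]) auto
  qed
  have gen: "admA G" if "\<And>a b c N. \<forall>a\<ge>N. \<forall>b. F a b c = 0 \<and> F a b (c + 1) = 0 \<Longrightarrow> a \<ge> N \<Longrightarrow> G a b c = 0" for G
    unfolding admA_def using * that by meson
  show "admA (dab F)" "admA (dac F)" "admA (dbc F)"
    by (rule gen; auto simp: dtri_defs)+
qed

lemma adm_pow:
  "admB F \<Longrightarrow> admB ((dab ^^ n) F)" "admB F \<Longrightarrow> admB ((dac ^^ n) F)" "admB F \<Longrightarrow> admB ((dbc ^^ n) F)"
  "admA F \<Longrightarrow> admA ((dab ^^ n) F)" "admA F \<Longrightarrow> admA ((dac ^^ n) F)" "admA F \<Longrightarrow> admA ((dbc ^^ n) F)"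
  by (induction n) (simp_all add: admB_shift admA_shift)

lemma dtri_commute:
  "dac (dab F) = dab (dac F)" "dbc (dab F) = dab (dbc F)" "dac (dbc F) = dbc (dac F)"
  by (simp_all add: dtri_defs fun_eq_iff)

lemma dtri_pow_commute1:
  "dac ((dab ^^ n) F) = (dab ^^ n) (dac F)" "dbc ((dab ^^ n) F) = (dab ^^ n) (dbc F)"
  "dac ((dbc ^^ n) F) = (dbc ^^ n) (dac F)" "dab ((dac ^^ n) F) = (dac ^^ n) (dab F)"
  by (induction n) (simp_all add: dtri_commute, simp add: dtri_commute(1)[symmetric])

lemma dtri_pow_commute:
  "(dac ^^ k) ((dab ^^ n) F) = (dab ^^ n) ((dac ^^ k) F)" "(dbc ^^ k) ((dab ^^ n) F) = (dab ^^ n) ((dbc ^^ k) F)"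
  "(dac ^^ k) ((dbc ^^ n) F) = (dbc ^^ n) ((dac ^^ k) F)"
  by (induction k) (simp_all add: dtri_pow_commute1)

lemma dtri_pow_diff:
  "(dab ^^ n) (\<lambda>a b c. F a b c - G a b c) = (\<lambda>a b c. (dab ^^ n) F a b c - (dab ^^ n) G a b c)"
  "(dac ^^ n) (\<lambda>a b c. F a b c - G a b c) = (\<lambda>a b c. (dac ^^ n) F a b c - (dac ^^ n) G a b c)"
  "(dbc ^^ n) (\<lambda>a b c. F a b c - G a b c) = (\<lambda>a b c. (dbc ^^ n) F a b c - (dbc ^^ n) G a b c)"
  by (induction n) (simp_all add: dtri_defs fun_eq_iff)

lemma dtri_pow_add:
  "(dac ^^ n) (\<lambda>a b c. F a b c + G a b c) = (\<lambda>a b c. (dac ^^ n) F a b c + (dac ^^ n) G a b c)"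
  "(dbc ^^ n) (\<lambda>a b c. F a b c + G a b c) = (\<lambda>a b c. (dbc ^^ n) F a b c + (dbc ^^ n) G a b c)"
  by (induction n) (simp_all add: dtri_defs fun_eq_iff)

lemma dtri_pow_zero:
  "(dab ^^ n) (\<lambda>a b c. 0) = (\<lambda>a b c. 0)" "(dac ^^ n) (\<lambda>a b c. 0) = (\<lambda>a b c. 0)"
  "(dbc ^^ n) (\<lambda>a b c. 0) = (\<lambda>a b c. 0)"
  by (induction n) (simp_all add: dtri_defs fun_eq_iff)

lemma dtri_pow_mono:
  "(dab ^^ N) F = (\<lambda>a b c. 0) \<Longrightarrow> N \<le> M \<Longrightarrow> (dab ^^ M) F = (\<lambda>a b c. 0)"
  "(dac ^^ N) F = (\<lambda>a b c. 0) \<Longrightarrow> N \<le> M \<Longrightarrow> (dac ^^ M) F = (\<lambda>a b c. 0)"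
  by (rule funpow_vanish; simp add: dtri_pow_zero)+

lemma dtri_pow_dl:
  "(dab ^^ n) F a b c = (dl ^^ n) (\<lambda>a b. F a b c) a b"
  "(dac ^^ n) F a b c = (dl ^^ n) (\<lambda>a c. F a b c) a c"
  "(dbc ^^ n) F a b c = (dl ^^ n) (\<lambda>b c. F a b c) b c"
  by (induction n arbitrary: a b c) (simp_all add: dtri_defs dl_def)

lemma prodR_fsupp:
  assumes "admB F" "admA G"
  shows "fsupp (\<lambda>j. F (p - int j) (m + int j) c)" "fsupp (\<lambda>j. G (int j) (p + m - int j) c)"
proof -
  obtain N where "\<And>a b. b \<ge> N \<Longrightarrow> F a b c = 0" using assms unfolding admB_def by metis
  then have "\<forall>j\<ge>nat (N - m). F (p - int j) (m + int j) c = 0" by auto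
  then show "fsupp (\<lambda>j. F (p - int j) (m + int j) c)" unfolding fsupp_def by blast
  obtain M where "\<And>a b. a \<ge> M \<Longrightarrow> G a b c = 0" using assms unfolding admA_def by metis
  then have "\<forall>j\<ge>nat M. G (int j) (p + m - int j) c = 0" by auto
  then show "fsupp (\<lambda>j. G (int j) (p + m - int j) c)" unfolding fsupp_def by blast
qed

lemma prodR_diff:
  assumes "admB F" "admB F'" "admA G" "admA G'"
  shows "prodR p (\<lambda>a b c. F a b c - F' a b c) (\<lambda>a b c. G a b c - G' a b c)
    = (\<lambda>m c. prodR p F G m c - prodR p F' G' m c)"
  unfolding prodR_def
  by (simp add: fun_eq_iff csum_diff prodR_fsupp[OF assms(1,3)] prodR_fsupp[OF assms(2,4)] algebra_simps)

text \<open>The residue is taken in \<open>x\<close> alone, so multiplication by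
  \<open>w - z\<close> passes through it.\<close>

lemma prodR_dbc: 
  assumes "admB F" "admA G"
  shows "prodR p (dbc F) (dbc G) = dl (prodR p F G)"
proof -
  note s = prodR_fsupp[OF assms]
  have "prodR p (dbc F) (dbc G) m c = dl (prodR p F G) m c" for m c
  proof -
    have 1: "(\<lambda>j. dbc F (p - int j) (m + int j) c) = 
      (\<lambda>j. F (p - int j) ((m + 1) + int j) c - F (p - int j) (m + int j) (c + 1))"
      by (simp add: dbc_def fun_eq_iff algebra_simps)
    have 2: "(\<lambda>j. dbc G (int j) (p + m - int j) c) = 
      (\<lambda>j. G (int j) (p + (m + 1) - int j) c - G (int j) (p + m - int j) (c + 1))"
      by (simp add: dbc_def fun_eq_iff algebra_simps)
    show ?thesis
      unfolding prodR_def dl_def 1 2 csum_diff[OF s(1) s(1)] csum_diff[OF s(2) s(2)]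
      by (simp add: free.scale_right_diff_distrib)
  qed
  then show ?thesis by blast
qed

text \<open>A factor \<open>x - w\<close> is absorbed into \<open>(x - w)^p\<close>. In the second
  sum the two indices run in the opposite direction, and the resulting -1 is the change of sign of
  \<open>(-1) powi p\<close>.\<close>

lemma prodR_dab:
  assumes "admB F" "admA G"
  shows "prodR p (dab F) (dab G) = prodR (p + 1) F G"
proof -
  note s = prodR_fsupp[OF assms]
  have "prodR p (dab F) (dab G) m c = prodR (p + 1) F G m c" for m c
  proof -
    let ?x = "\<lambda>j. F (p + 1 - int j) (m + int j) c" and ?y = "\<lambda>j. G (int j) (p + 1 + m - int j) c"
    have 1: "(\<lambda>j. dab F (p - int j) (m + int j) c) = (\<lambda>j. ?x j - ?x (Suc j))"
      by (simp add: dab_def fun_eq_iff algebra_simps)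
    have 2: "(\<lambda>j. dab G (int j) (p + m - int j) c) = (\<lambda>j. vscale (-1) (?y j - ?y (Suc j)))"
      by (simp add: dab_def fun_eq_iff algebra_simps)
    have f: "fsupp (\<lambda>j. ?y j - ?y (Suc j))" using s(2) by (intro fsupp_diff fsupp_Suc)
    have "(-1 :: complex) powi (p + 1) = - ((-1) powi p)" by (simp add: power_int_add)
    then show ?thesis
      unfolding prodR_def 1 2 csum_pascal[OF s(1)] csum_vscale[OF f] csum_pascal[OF s(2)] by simp
  qed
  then show ?thesis by blast
qed

lemma prodR_dab_pow:
  assumes "admB F" "admA G"
  shows "prodR p ((dab ^^ n) F) ((dab ^^ n) G) = prodR (p + int n) F G"
proof (induction n arbitrary: p)
  case (Suc n)
  then show ?case
    by (simp add: prodR_dab adm_pow assms add.assoc)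
qed simp

lemma prodR_dbc_pow:
  assumes "admB F" "admA G"
  shows "prodR p ((dbc ^^ n) F) ((dbc ^^ n) G) = (dl ^^ n) (prodR p F G)"
  by (induction n) (simp_all add: prodR_dbc adm_pow assms)

text \<open>For nonnegative \<open>p\<close> both expansions of \<open>(x - w)^p\<close> are the
  same polynomial, so the residue depends only on (x - w)^p (F - G). Formally all \<open>p\<close>
  factors are moved into the arguments, leaving exponent 0, where \<open>prodR\<close> is a plain
  difference.\<close>

lemma prodR_vanish:
  assumes "admB F" "admA G" "(dab ^^ N) (\<lambda>a b c. F a b c - G a b c) = (\<lambda>a b c. 0)" "p \<ge> int N"
  shows "prodR p F G = (\<lambda>m c. 0)"
proof -
  define n where "n = nat p"
  have n: "p = 0 + int n" "N \<le> n" using assms(4) by (auto simp: n_def)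
  have 0: "prodR 0 ((dab ^^ n) F) ((dab ^^ n) G) m c = (dab ^^ n) F 0 m c - (dab ^^ n) G 0 m c" for m c
    using prodR_fsupp[OF adm_pow(1)[OF assms(1), of n] adm_pow(4)[OF assms(2), of n], of 0 m c]
    by (simp add: prodR_def csum_zero_exp)
  have "(dab ^^ n) F 0 m c - (dab ^^ n) G 0 m c = 0" for m c
    using dtri_pow_mono(1)[OF assms(3) n(2)] unfolding dtri_pow_diff by metis
  then show ?thesis
    unfolding n prodR_dab_pow[OF assms(1,2), symmetric] by (simp add: fun_eq_iff 0)
qed

text \<open>Uses \<open>w - z = (x - z) - (x - w)\<close> instead of a binomial expansion.\<close>

lemma prodR_dbc_vanish:
  assumes "admB F" "admA G"
    and "\<And>i j. i + j = M \<Longrightarrow>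
      prodR p ((dac ^^ i) ((dab ^^ j) F)) ((dac ^^ i) ((dab ^^ j) G)) = (\<lambda>m c. 0)"
  shows "prodR p ((dbc ^^ M) F) ((dbc ^^ M) G) = (\<lambda>m c. 0)"
proof -
  have "prodR p ((dac ^^ i) ((dab ^^ j) ((dbc ^^ k) F))) ((dac ^^ i) ((dab ^^ j) ((dbc ^^ k) G))) = (\<lambda>m c. 0)"
    if "i + j + k = M" for i j k
    using that
  proof (induction k arbitrary: i j)
    case 0
    then show ?case using assms(3) by simp
  next
    case (Suc k)
    have e: "(dac ^^ i) ((dab ^^ j) ((dbc ^^ Suc k) H)) = 
      (\<lambda>a b c. (dac ^^ Suc i) ((dab ^^ j) ((dbc ^^ k) H)) a b c - (dac ^^ i) ((dab ^^ Suc j) ((dbc ^^ k) H)) a b c)"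
      for H :: "'a tri"
    proof -
      have "dbc K = (\<lambda>a b c. dac K a b c - dab K a b c)" for K :: "'a tri"
        by (simp add: dtri_defs fun_eq_iff)
      then have "(dac ^^ i) ((dab ^^ j) ((dbc ^^ Suc k) H)) = 
        (dac ^^ i) ((dab ^^ j) (\<lambda>a b c. dac ((dbc ^^ k) H) a b c - dab ((dbc ^^ k) H) a b c))"
        by simp
      also have "\<dots> = (\<lambda>a b c. (dac ^^ i) ((dab ^^ j) (dac ((dbc ^^ k) H))) a b c - 
          (dac ^^ i) ((dab ^^ j) (dab ((dbc ^^ k) H))) a b c)"
        by (simp add: dtri_pow_diff)
      also have "(dac ^^ i) ((dab ^^ j) (dac ((dbc ^^ k) H))) = (dac ^^ Suc i) ((dab ^^ j) ((dbc ^^ k) H))"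
        by (simp only: dtri_pow_commute1[symmetric] funpow_Suc_right comp_apply)
      also have "(dab ^^ j) (dab ((dbc ^^ k) H)) = (dab ^^ Suc j) ((dbc ^^ k) H)"
        by (simp only: funpow_Suc_right comp_apply)
      finally show ?thesis .
    qed
    show ?case
      unfolding e using Suc.IH[of "Suc i" j] Suc.IH[of i "Suc j"] Suc.prems
      by (subst prodR_diff) (auto intro!: adm_pow assms simp del: funpow.simps)
  qed
  from this[of 0 0 M] show ?thesis by simp
qed

theorem dong:
  assumes A: "is_field A" and B: "is_field B" and C: "is_field C"
    and AB: "mlocal N1 s A B" and AC: "mlocal N2 s2 A C" and BC: "mlocal N3 s3 B C"
  shows "\<exists>N. mlocal N (s2 * s3) (field_prod s A p B) C"
proof -
  \<comment> \<open>If \<open>i + j = M\<close>, then either \<open>i \<ge> N2\<close>, which is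
    enough factors \<open>x - z\<close> for locality of \<open>A\<close> and \<open>C\<close>, or
    \<open>p + int j \<ge> int N1\<close>, so that locality of \<open>A\<close> and \<open>B\<close>
    applies. The \<open>N3\<close> further factors \<open>w - z\<close> take care of
    \<open>B\<close> and \<open>C\<close>.\<close>
  define M where "M = N2 + nat (int N1 - p)"
  note lA = is_field_lin[OF A] and lB = is_field_lin[OF B] and lC = is_field_lin[OF C]
  have "(dl ^^ (N3 + M)) (\<lambda>m k. field_prod s A p B m (C k v) - vscale (s2 * s3) (C k (field_prod s A p B m v)))
      = (\<lambda>m k. 0)" for v
  proof -
    \<comment> \<open>\<open>F\<close> has \<open>A\<close> to the left of \<open>B\<close>,
      \<open>G\<close> the reversed order with the sign \<open>s\<close>; \<open>L\<close> and
      \<open>R\<close> record whether \<open>C\<close> acts first or last.\<close>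
    define FL where "FL = (\<lambda>a b c. A a (B b (C c v)))"
    define GL where "GL = (\<lambda>a b c. vscale s (B b (A a (C c v))))"
    define FR where "FR = (\<lambda>a b c. vscale (s2 * s3) (C c (A a (B b v))))"
    define GR where "GR = (\<lambda>a b c. vscale (s2 * s3 * s) (C c (B b (A a v))))"
    have trA: "\<exists>N. \<forall>m\<ge>N. A m u = 0" and trB: "\<exists>N. \<forall>m\<ge>N. B m u = 0" for u
      using A B by (auto simp: is_field_def)
    have adm: "admB FL" "admA GL" "admB FR" "admA GR"
      unfolding admB_def admA_def FL_def GL_def FR_def GR_def
      by (intro allI, use trA trB in \<open>metis lin_zero[OF lA] lin_zero[OF lB] lin_zero[OF lC] free.scale_zero_right\<close>)+
    have L: "field_prod s A p B m (C k v) = prodR p FL GL m k" for m k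
      unfolding field_prod_eq(3)[OF A B] prodR_def FL_def GL_def
      by (simp add: csum_vscale[OF field_prod_eq(2)[OF A B]] mult.commute)
    have R: "vscale (s2 * s3) (C k (field_prod s A p B m v)) = prodR p FR GR m k" for m k
      unfolding field_prod_eq(3)[OF A B] prodR_def FR_def GR_def
      using csum_lin[OF lin_vscale[OF lC, of "s2 * s3" k] field_prod_eq(1)[OF A B], of p p m v]
        csum_lin[OF lin_vscale[OF lC, of "s2 * s3 * s" k] field_prod_eq(2)[OF A B], of p p m v]
      by (simp add: lin_diff[OF lC] lin_scale[OF lC] free.scale_right_diff_distrib mult_ac)
    define H where "H = (\<lambda>a b c. FL a b c - FR a b c)"
    define G where "G = (\<lambda>a b c. GL a b c - GR a b c)"
    have admH: "admB H" "admA G"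
    proof -
      show "admB H" unfolding admB_def
      proof
        fix c
        obtain N N' where "\<forall>b\<ge>N. \<forall>a. FL a b c = 0" "\<forall>b\<ge>N'. \<forall>a. FR a b c = 0"
          using adm unfolding admB_def by metis
        then show "\<exists>N. \<forall>b\<ge>N. \<forall>a. H a b c = 0" by (intro exI[of _ "max N N'"]) (auto simp: H_def)
      qed
      show "admA G" unfolding admA_def
      proof
        fix c
        obtain N N' where "\<forall>a\<ge>N. \<forall>b. GL a b c = 0" "\<forall>a\<ge>N'. \<forall>b. GR a b c = 0"
          using adm unfolding admA_def by metis
        then show "\<exists>N. \<forall>a\<ge>N. \<forall>b. G a b c = 0" by (intro exI[of _ "max N N'"]) (auto simp: G_def)
      qed
    qed
    have eq: "(\<lambda>m k. field_prod s A p B m (C k v) - vscale (s2 * s3) (C k (field_prod s A p B m v))) = prodR p H G"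
      unfolding L R H_def G_def prodR_diff[OF adm(1,3,2,4)] ..
    have ab: "(dab ^^ N1) (\<lambda>a b c. H a b c - G a b c) = (\<lambda>a b c. 0)"
    proof -
      have "(\<lambda>a b c. H a b c - G a b c) = (\<lambda>a b c. (FL a b c - GL a b c) - (FR a b c - GR a b c))"
        by (simp add: H_def G_def fun_eq_iff)
      moreover have "(dab ^^ N1) (\<lambda>a b c. FL a b c - GL a b c) = (\<lambda>a b c. 0)"
        using AB unfolding mlocal_def FL_def GL_def by (simp add: fun_eq_iff dtri_pow_dl)
      moreover have "(dab ^^ N1) (\<lambda>a b c. FR a b c - GR a b c) = (\<lambda>a b c. 0)"
      proof -
        have "FR a b c - GR a b c = vscale (s2 * s3) (C c (A a (B b v) - vscale s (B b (A a v))))" for a b c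
          by (simp add: FR_def GR_def lin_diff[OF lC] lin_scale[OF lC] free.scale_right_diff_distrib)
        then show ?thesis
          using AB unfolding mlocal_def
          by (simp add: fun_eq_iff dtri_pow_dl dl_pow_lin[OF lin_vscale[OF lC]] lin_zero[OF lC])
      qed
      ultimately show ?thesis by (simp only: dtri_pow_diff) simp
    qed
    have split: "(dac ^^ N2) ((dbc ^^ N3) (\<lambda>a b c. K1 a b c + K2 a b c)) = (\<lambda>a b c. 0)"
      if "(dbc ^^ N3) K1 = (\<lambda>a b c. 0)" "(dac ^^ N2) K2 = (\<lambda>a b c. 0)" for K1 K2 :: "'a tri"
      using that by (simp add: dtri_pow_add dtri_pow_commute(3) dtri_pow_zero)
    have acH: "(dac ^^ N2) ((dbc ^^ N3) H) = (\<lambda>a b c. 0)"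
    proof -
      \<comment> \<open>\<open>C\<close> is moved to the left past \<open>B\<close> and then past
        \<open>A\<close>; each move costs one supercommutator, killed by powers of
        \<open>w - z\<close> and of \<open>x - z\<close> respectively.\<close>
      have "H = (\<lambda>a b c. A a (B b (C c v) - vscale s3 (C c (B b v)))
          + vscale s3 (A a (C c (B b v)) - vscale s2 (C c (A a (B b v)))))"
        by (simp add: H_def FL_def FR_def fun_eq_iff lin_diff[OF lA] lin_scale[OF lA] free.scale_right_diff_distrib mult.commute)
      moreover have "(dbc ^^ N3) (\<lambda>a b c. A a (B b (C c v) - vscale s3 (C c (B b v)))) = (\<lambda>a b c. 0)"
        using BC unfolding mlocal_def by (simp add: fun_eq_iff dtri_pow_dl dl_pow_lin[OF lA] lin_zero[OF lA])
      moreover have "(dac ^^ N2) (\<lambda>a b c. vscale s3 (A a (C c (B b v)) - vscale s2 (C c (A a (B b v))))) = (\<lambda>a b c. 0)"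
        using AC unfolding mlocal_def by (simp add: fun_eq_iff dtri_pow_dl dl_pow_lin[OF lin_vscale_self])
      ultimately show ?thesis by (simp only: split)
    qed
    have acG: "(dac ^^ N2) ((dbc ^^ N3) G) = (\<lambda>a b c. 0)"
    proof -
      have "G = (\<lambda>a b c. vscale (s * s2) (B b (C c (A a v)) - vscale s3 (C c (B b (A a v))))
          + vscale s (B b (A a (C c v) - vscale s2 (C c (A a v)))))"
        by (simp add: G_def GL_def GR_def fun_eq_iff lin_diff[OF lB] lin_scale[OF lB] free.scale_right_diff_distrib mult_ac)
      moreover have "(dbc ^^ N3) (\<lambda>a b c. vscale (s * s2) (B b (C c (A a v)) - vscale s3 (C c (B b (A a v))))) = (\<lambda>a b c. 0)"
        using BC unfolding mlocal_def by (simp add: fun_eq_iff dtri_pow_dl dl_pow_lin[OF lin_vscale_self])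
      moreover have "(dac ^^ N2) (\<lambda>a b c. vscale s (B b (A a (C c v) - vscale s2 (C c (A a v))))) = (\<lambda>a b c. 0)"
        using AC unfolding mlocal_def by (simp add: fun_eq_iff dtri_pow_dl dl_pow_lin[OF lin_vscale[OF lB]] lin_zero[OF lB])
      ultimately show ?thesis by (simp only: split)
    qed
    define H' where "H' = (dbc ^^ N3) H"
    define G' where "G' = (dbc ^^ N3) G"
    have adm': "admB H'" "admA G'" unfolding H'_def G'_def by (intro adm_pow admH)+
    have ab': "(dab ^^ N1) (\<lambda>a b c. (dac ^^ i) H' a b c - (dac ^^ i) G' a b c) = (\<lambda>a b c. 0)" for i
      unfolding H'_def G'_def dtri_pow_diff[symmetric] dtri_pow_commute[symmetric] ab
      by (simp add: dtri_pow_zero)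
    have "prodR p ((dac ^^ i) ((dab ^^ j) H')) ((dac ^^ i) ((dab ^^ j) G')) = (\<lambda>m c. 0)" if ij: "i + j = M" for i j
    proof (cases "N2 \<le> i")
      case True
      have z: "(dac ^^ i) H' = (\<lambda>a b c. 0)" "(dac ^^ i) G' = (\<lambda>a b c. 0)"
        unfolding H'_def G'_def by (rule dtri_pow_mono(2)[OF acH True] dtri_pow_mono(2)[OF acG True])+
      show ?thesis
        unfolding dtri_pow_commute z dtri_pow_zero by (simp add: fun_eq_iff prodR_def csum_zero)
    next
      case False
      then have "p + int j \<ge> int N1" using ij by (simp add: M_def)
      then show ?thesis
        unfolding dtri_pow_commute prodR_dab_pow[OF adm_pow(2)[OF adm'(1)] adm_pow(5)[OF adm'(2)]]
        by (rule prodR_vanish[OF adm_pow(2)[OF adm'(1)] adm_pow(5)[OF adm'(2)] ab'])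
    qed
    then have "prodR p ((dbc ^^ M) H') ((dbc ^^ M) G') = (\<lambda>m c. 0)"
      by (intro prodR_dbc_vanish adm')
    then have "(dl ^^ M) ((dl ^^ N3) (prodR p H G)) = (\<lambda>m c. 0)"
      unfolding H'_def G'_def by (simp add: prodR_dbc_pow adm_pow admH)
    then show ?thesis unfolding eq by (simp add: funpow_add add.commute[of N3])
  qed
  then show ?thesis unfolding mlocal_def by blast
qed

section \<open>Translation covariance, creation and uniqueness\<close>

definition covariant :: "('b vec \<Rightarrow> 'b vec) \<Rightarrow> 'b field_modes \<Rightarrow> bool" where
  "covariant T A \<longleftrightarrow> (\<forall>m v. T (A m v) = A m (T v) - vscale (of_int m) (A (m - 1) v))"

definition creates :: "'b vec \<Rightarrow> 'b field_modes \<Rightarrow> 'b vec \<Rightarrow> bool" where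
  "creates \<Omega> A v \<longleftrightarrow> A (-1) \<Omega> = v \<and> (\<forall>m\<ge>0. A m \<Omega> = 0)"

text \<open>\<open>T\<close> passes both mode operators at the cost of one lowered mode each.
  Collected with their binomial weights, the terms left over in the two halves are evaluated by
  \<open>csum_derivation\<close> and \<open>csum_derivation'\<close>, and both halves yield the same
  factor \<open>- of_int m\<close>.\<close>

lemma covariant_field_prod:
  assumes A: "is_field A" and B: "is_field B" and T: "lin T"
    and cA: "covariant T A" and cB: "covariant T B"
  shows "covariant T (field_prod s A p B)"
  unfolding covariant_def
proof (intro allI)
  fix m v
  note lA = is_field_lin[OF A] and lB = is_field_lin[OF B]
  note f1 = field_prod_eq(1)[OF A B] and f2 = field_prod_eq(2)[OF A B]
  let ?x = "\<lambda>j. A (p - int j) (B (m - 1 + int j) v)" and ?y = "\<lambda>j. B (p + (m - 1) - int j) (A (int j) v)"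
  have 1: "T (A (p - int j) (B (m + int j) v)) = A (p - int j) (B (m + int j) (T v)) +
      (vscale (of_nat j - of_int p) (?x (Suc j)) - vscale (of_int m + of_nat j) (?x j))" for j
  proof -
    have a1: "T (A (p - int j) (B (m + int j) v)) =
        A (p - int j) (T (B (m + int j) v)) - vscale (of_int p - of_nat j) (?x (Suc j))"
      using cA[unfolded covariant_def, rule_format, of "p - int j" "B (m + int j) v"] by (simp add: diff_diff_eq add.commute)
    have a2: "T (B (m + int j) v) = B (m + int j) (T v) - vscale (of_int m + of_nat j) (B (m - 1 + int j) v)"
      using cB[unfolded covariant_def, rule_format, of "m + int j" v] by (simp add: algebra_simps)
    have a3: "- vscale (of_int p - of_nat j) w = vscale (of_nat j - of_int p) w" for w :: "'a vec"
      by (simp flip: free.scale_minus_left)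
    show ?thesis
      unfolding a1 a2 lin_diff[OF lA] lin_scale[OF lA] a3[symmetric] by simp
  qed
  have 2: "T (B (p + m - int j) (A (int j) v)) = B (p + m - int j) (A (int j) (T v)) +
      (vscale (of_nat j - of_int p - of_int m) (?y j) - (case j of 0 \<Rightarrow> 0 | Suc i \<Rightarrow> vscale (of_nat j) (?y i)))" for j
  proof -
    have a1: "T (B (p + m - int j) (A (int j) v)) =
        B (p + m - int j) (T (A (int j) v)) - vscale (of_int p + of_int m - of_nat j) (?y j)"
      using cB[unfolded covariant_def, rule_format, of "p + m - int j" "A (int j) v"] by (simp add: algebra_simps)
    have a2: "T (A (int j) v) = A (int j) (T v) - vscale (of_nat j) (A (int j - 1) v)"
      using cA[unfolded covariant_def, rule_format, of "int j" v] by simp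
    have a3: "vscale (of_nat j - of_int p - of_int m) w = - vscale (of_int p + of_int m - of_nat j) w" for w :: "'a vec"
      by (simp flip: free.scale_minus_left)
    have a4: "vscale (of_nat j) (B (p + m - int j) (A (int j - 1) v)) = (case j of 0 \<Rightarrow> 0 | Suc i \<Rightarrow> vscale (of_nat j) (?y i))"
      by (cases j) (simp_all add: algebra_simps)
    show ?thesis
      unfolding a1 a2 lin_diff[OF lB] lin_scale[OF lB] a3 a4 by simp
  qed
  have "T (field_prod s A p B m v) = csum p (\<lambda>j. T (A (p - int j) (B (m + int j) v)))
      - vscale (s * (-1) powi p) (csum p (\<lambda>j. T (B (p + m - int j) (A (int j) v))))"
    unfolding field_prod_eq(3)[OF A B] by (simp add: lin_diff[OF T] lin_scale[OF T] csum_lin[OF T] f1 f2)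
  also have "csum p (\<lambda>j. T (A (p - int j) (B (m + int j) v))) = csum p (\<lambda>j. A (p - int j) (B (m + int j) (T v)))
      + vscale (- of_int m) (csum p ?x)"
    unfolding 1 csum_derivation[OF f1, symmetric]
    by (intro csum_add f1 fsupp_diff fsupp_vscale fsupp_Suc[of ?x])
  also have "csum p (\<lambda>j. T (B (p + m - int j) (A (int j) v))) = csum p (\<lambda>j. B (p + m - int j) (A (int j) (T v)))
      + vscale (- of_int m) (csum p ?y)"
  proof -
    have "fsupp (\<lambda>j. case j of 0 \<Rightarrow> 0 | Suc i \<Rightarrow> vscale (of_nat j) (?y i))"
    proof -
      obtain J where "\<forall>j\<ge>J. ?y j = 0" using f2[where m = "m - 1"] unfolding fsupp_def by blast
      then have "\<forall>j\<ge>Suc J. (case j of 0 \<Rightarrow> 0 | Suc i \<Rightarrow> vscale (of_nat j) (?y i)) = 0"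
        by (auto split: nat.split)
      then show ?thesis unfolding fsupp_def by blast
    qed
    then show ?thesis
      unfolding 2 csum_derivation'[OF f2, symmetric]
      by (intro csum_add f2 fsupp_diff fsupp_vscale)
  qed
  finally show "T (field_prod s A p B m v) = field_prod s A p B m (T v) - vscale (of_int m) (field_prod s A p B (m - 1) v)"
    unfolding field_prod_eq(3)[OF A B] by (simp add: algebra_simps)
qed

text \<open>The half in which \<open>A\<close> acts first vanishes on \<open>\<Omega>\<close>, and
  in the other half only the summand with index 0 survives, because \<open>B (m + int j)\<close>
  kills \<open>\<Omega>\<close> once \<open>m \<ge> -1\<close> and \<open>j \<ge> 1\<close>.\<close>

lemma creates_field_prod:
  assumes A: "is_field A" and B: "is_field B" and "creates \<Omega> A a" "creates \<Omega> B b"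
  shows "creates \<Omega> (field_prod s A p B) (A p b)"
proof -
  note lA = is_field_lin[OF A] and lB = is_field_lin[OF B]
  have 1: "csum p (\<lambda>j. B (p + m - int j) (A (int j) \<Omega>)) = 0" for m
    using assms(3) by (intro csum_zero) (auto simp: creates_def lin_zero[OF lB])
  have 2: "field_prod s A p B m \<Omega> = A p (B m \<Omega>)" if "m \<ge> -1" for m
    unfolding field_prod_eq(3)[OF A B] 1 using assms(4) that
    by (subst csum_head) (auto simp: creates_def lin_zero[OF lA])
  show ?thesis
    unfolding creates_def using 2 assms(4) by (auto simp: creates_def lin_zero[OF lA])
qed

lemma covariant_lin_comb:
  "lin T \<Longrightarrow> covariant T A \<Longrightarrow> covariant T B \<Longrightarrow> covariant T (\<lambda>m v. vscale c (A m v) + B m v)"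
  by (simp add: covariant_def lin_add lin_scale free.scale_right_diff_distrib free.scale_right_distrib mult.commute)

lemma creates_lin_comb:
  "creates \<Omega> A a \<Longrightarrow> creates \<Omega> B b \<Longrightarrow> creates \<Omega> (\<lambda>m v. vscale c (A m v) + B m v) (vscale c a + b)"
  by (simp add: creates_def)

lemma is_field_lin_comb:
  assumes "is_field A" "is_field B"
  shows "is_field (\<lambda>m v. vscale c (A m v) + B m v)"
  unfolding is_field_def
proof (intro conjI allI)
  show "lin (\<lambda>v. vscale c (A m v) + B m v)" for m
    using assms by (intro lin_plus lin_vscale) (simp_all add: is_field_def)
  show "\<exists>N. \<forall>m\<ge>N. vscale c (A m v) + B m v = 0" for v
  proof -
    obtain N where N: "\<And>m. m \<ge> N \<Longrightarrow> A m v = 0" by (rule is_fieldE[OF assms(1), of v]) blast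
    obtain M where M: "\<And>m. m \<ge> M \<Longrightarrow> B m v = 0" by (rule is_fieldE[OF assms(2), of v]) blast
    from N M show ?thesis by (intro exI[of _ "max N M"]) auto
  qed
qed

text \<open>Covariance and \<open>T \<Omega> = 0\<close> give
  \<open>T (D (-1 - n) \<Omega>) = (n + 1) D (-2 - n) \<Omega>\<close>, so vanishing of the constant
  term propagates to all higher coefficients.\<close>

lemma creates_zero_vanish:
  assumes "is_field D" "covariant T D" "lin T" "T \<Omega> = 0" "creates \<Omega> D 0"
  shows "D m \<Omega> = 0"
proof -
  have "D (- 1 - int n) \<Omega> = 0" for n
  proof (induction n)
    case 0
    then show ?case using assms(5) by (simp add: creates_def)
  next
    case (Suc n)
    have TD: "T (D (- 1 - int n) \<Omega>) = D (- 1 - int n) (T \<Omega>) - vscale (of_int (- 1 - int n)) (D (- 1 - int n - 1) \<Omega>)"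
      using assms(2) unfolding covariant_def by blast
    have "vscale (of_int (- 1 - int n)) (D (- 1 - int n - 1) \<Omega>) = 0"
      using TD by (simp only: Suc.IH assms(4) lin_zero[OF assms(3)] lin_zero[OF is_field_lin[OF assms(1)]] diff_0 neg_equal_0_iff_equal neg_0_equal_iff_equal)
    moreover have "of_int (- 1 - int n) \<noteq> (0 :: complex)"
      by (simp only: of_int_eq_0_iff)
    ultimately have "D (- 1 - int n - 1) \<Omega> = 0" unfolding free.scale_eq_0_iff by blast
    moreover have "- 1 - int (Suc n) = - 1 - int n - 1" by simp
    ultimately show ?case by metis
  qed
  from this[of "nat (- m - 1)"] show ?thesis
    using assms(5) by (cases "m \<ge> 0") (auto simp: creates_def)
qed

text \<open>Goddard's argument: \<open>(z - w)\<^sup>N D(z) B(w) \<Omega> = \<plusminus> (z - w)\<^sup>N B(w) D(z) \<Omega> = 0\<close>, and the lowest power of \<open>w\<close> shows \<open>D(z) b = 0\<close>.\<close>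

lemma goddard:
  assumes D: "is_field D" and B: "is_field B" and "\<And>m. D m \<Omega> = 0" "mlocal N s D B" "creates \<Omega> B b"
  shows "D m b = 0"
proof -
  note lD = is_field_lin[OF D] and lB = is_field_lin[OF B]
  let ?F = "\<lambda>m k. D m (B k \<Omega>)"
  have "(dl ^^ N) ?F = (\<lambda>m k. 0)"
  proof -
    have "?F = (\<lambda>m k. D m (B k \<Omega>) - vscale s (B k (D m \<Omega>)))"
      by (simp add: fun_eq_iff assms(3) lin_zero[OF lB])
    then show ?thesis using assms(4) unfolding mlocal_def by presburger
  qed
  \<comment> \<open>The indices -1 for \<open>B\<close> and \<open>m - int N\<close> for
    \<open>D\<close> isolate one term: summand \<open>j\<close> contains
    \<open>B (int j - 1) \<Omega>\<close>, which vanishes for \<open>j > 0\<close>, and summand 0 is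
    \<open>D m b\<close>.\<close>
  then have "0 = (dl ^^ N) ?F (m - int N) (-1)" by simp
  also have "\<dots> = (\<Sum>j\<le>N. if j = 0 then D m b else 0)"
    unfolding dl_pow_expand using assms(5)
    by (intro sum.cong) (auto simp: creates_def lin_zero[OF lD])
  finally show ?thesis by simp
qed

section \<open>Vertex superalgebras from a state-field correspondence\<close>

text \<open>Everything is required on basis labels and for an abstract translation operator
  \<open>T\<close>; linear extension and associativity are derived from this in
  \<open>Yv_properties\<close>, \<open>Yv_local\<close> and \<open>Yv_assoc\<close>.\<close>

locale state_field =
  fixes Y :: "'b \<Rightarrow> 'b field_modes" and par :: "'b \<Rightarrow> bool" and vac :: 'b and T :: "'b vec \<Rightarrow> 'b vec"
  assumes field: "is_field (Y a)"
    and cov: "covariant T (Y a)"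
    and creation: "creates (basis_vec vac) (Y a) (basis_vec a)"
    and loc: "\<exists>N. mlocal N (super_sign (par a) (par b)) (Y a) (Y b)"
    and vac_field: "Y vac = id_field"
    and parity: "keys (Y a m (basis_vec b)) \<subseteq> {c. par c = (par a \<noteq> par b)}"
    and T_lin: "lin T" and T_vac: "T (basis_vec vac) = 0"
begin

definition Yv :: "'b vec \<Rightarrow> 'b field_modes" where
  "Yv u m v = lin_ext (\<lambda>a. Y a m v) u"

lemma Yv_basis [simp]: "Yv (basis_vec a) = Y a"
  by (simp add: Yv_def fun_eq_iff)

lemma Yv_zero: "Yv 0 = (\<lambda>m v. 0)"
  by (simp add: Yv_def fun_eq_iff)

lemma Yv_comb: "Yv (vscale c u + w) = (\<lambda>m v. vscale c (Yv u m v) + Yv w m v)"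
  by (simp add: Yv_def fun_eq_iff lin_ext_add lin_ext_vscale)

lemma Yv_lin1: "lin (\<lambda>u. Yv u m v)"
  unfolding Yv_def by simp

lemma Yv_properties:
  shows Yv_field: "is_field (Yv u)" and Yv_cov: "covariant T (Yv u)"
    and Yv_creates: "creates (basis_vec vac) (Yv u) u"
proof -
  have "keys u \<subseteq> UNIV" by simp
  then have "is_field (Yv u) \<and> covariant T (Yv u) \<and> creates (basis_vec vac) (Yv u) u"
  proof (induction u rule: vec_induct)
    case zero
    then show ?case
      by (simp add: Yv_zero is_field_def covariant_def creates_def lin_const_zero lin_zero[OF T_lin])
  next
    case (basis b)
    then show ?case by (simp add: field cov creation)
  next
    case (scale_add c u w)
    then show ?case
      by (simp add: Yv_comb is_field_lin_comb covariant_lin_comb T_lin creates_lin_comb)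
  qed
  then show "is_field (Yv u)" "covariant T (Yv u)" "creates (basis_vec vac) (Yv u) u" by auto
qed

lemma Yv_local_basis:
  assumes "keys u \<subseteq> {a. par a = p}"
  shows "\<exists>N. mlocal N (super_sign p (par b)) (Yv u) (Y b)"
  using assms
proof (induction u rule: vec_induct)
  case zero
  have "mlocal 0 (super_sign p (par b)) (Yv 0) (Y b)"
    unfolding mlocal_def by (simp add: Yv_zero fun_eq_iff lin_zero[OF is_field_lin[OF field]])
  then show ?case by blast
next
  case (basis a)
  then show ?case using loc[of a b] by simp
next
  case (scale_add c u w)
  then obtain N M where "mlocal N (super_sign p (par b)) (Yv u) (Y b)" "mlocal M (super_sign p (par b)) (Yv w) (Y b)"
    by blast
  then have "mlocal (max N M) (super_sign p (par b)) (Yv (vscale c u + w)) (Y b)"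
    unfolding Yv_comb by (intro mlocal_lin_comb field) (auto elim: mlocal_mono)
  then show ?case by blast
qed

lemma super_sign_sq: "super_sign p q * super_sign p q = 1"
  by (simp add: super_sign_def)

lemma super_sign_sym: "super_sign p q = super_sign q p"
  by (auto simp: super_sign_def)

lemma Yv_local:
  assumes u: "keys u \<subseteq> {a. par a = p}" and w: "keys w \<subseteq> {a. par a = q}"
  shows "\<exists>N. mlocal N (super_sign p q) (Yv u) (Yv w)"
proof -
  have "\<exists>N. mlocal N (super_sign q p) (Yv w) (Yv u)"
    using w
  proof (induction w rule: vec_induct)
    case zero
    have "mlocal 0 (super_sign q p) (Yv 0) (Yv u)"
      unfolding mlocal_def by (simp add: Yv_zero fun_eq_iff lin_zero[OF is_field_lin[OF Yv_field]])
    then show ?case by blast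
  next
    case (basis a)
    then have "par a = q" by simp
    then obtain N where "mlocal N (super_sign p q) (Yv u) (Y a)" using Yv_local_basis[OF u, of a] by blast
    from mlocal_sym[OF this super_sign_sq] show ?case unfolding super_sign_sym[of q p] by auto
  next
    case (scale_add c w w')
    then obtain N M where "mlocal N (super_sign q p) (Yv w) (Yv u)" "mlocal M (super_sign q p) (Yv w') (Yv u)"
      by blast
    then have "mlocal (max N M) (super_sign q p) (Yv (vscale c w + w')) (Yv u)"
      unfolding Yv_comb by (intro mlocal_lin_comb Yv_field) (auto elim: mlocal_mono)
    then show ?case by blast
  qed
  then obtain N where "mlocal N (super_sign q p) (Yv w) (Yv u)" by blast
  from mlocal_sym[OF this super_sign_sq] show ?thesis unfolding super_sign_sym[of q p] by blast
qed

lemma Yv_parity: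
  assumes "keys u \<subseteq> {a. par a = p}" "keys v \<subseteq> {a. par a = q}"
  shows "keys (Yv u m v) \<subseteq> {a. par a = (p \<noteq> q)}"
proof -
  have "keys (Y a m v) \<subseteq> {c. par c = (p \<noteq> q)}" if "par a = p" for a
  proof -
    have "Y a m v = lin_ext (\<lambda>b. Y a m (basis_vec b)) v"
      by (rule lin_eq_lin_ext[OF is_field_lin[OF field]])
    moreover have "keys (Y a m (basis_vec b)) \<subseteq> {c. par c = (p \<noteq> q)}" if "b \<in> keys v" for b
    proof -
      have "par b = q" using that assms(2) by auto
      then show ?thesis using parity[of a m b] \<open>par a = p\<close> by simp
    qed
    ultimately show ?thesis by (metis keys_lin_ext_subset)
  qed
  then show ?thesis unfolding Yv_def using assms(1) by (intro keys_lin_ext_subset) auto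
qed

text \<open>Both fields create the same state, so they agree by uniqueness.\<close>

theorem Yv_assoc:
  assumes u: "keys u \<subseteq> {a. par a = p}" and v: "keys v \<subseteq> {a. par a = q}"
  shows "Yv (Yv u k v) = field_prod (super_sign p q) (Yv u) k (Yv v)"
proof -
  let ?P = "field_prod (super_sign p q) (Yv u) k (Yv v)"
  \<comment> \<open>The difference of the two sides. It creates the zero state and is covariant,
    hence kills the vacuum, and it is local to every \<open>Y b\<close>, so Goddard's argument
    applies.\<close>
  let ?D = "\<lambda>m w. vscale (-1) (Yv (Yv u k v) m w) + ?P m w"
  have P: "is_field ?P" by (intro is_field_field_prod Yv_field)
  have D: "is_field ?D" by (intro is_field_lin_comb Yv_field P)
  have "creates (basis_vec vac) ?P (Yv u k v)"
    by (rule creates_field_prod[OF Yv_field Yv_field Yv_creates Yv_creates])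
  then have "creates (basis_vec vac) ?D (vscale (-1) (Yv u k v) + Yv u k v)"
    by (intro creates_lin_comb Yv_creates)
  then have cr: "creates (basis_vec vac) ?D 0" by (simp add: free.scale_minus_left)
  have cD: "covariant T ?D"
    by (intro covariant_lin_comb T_lin Yv_cov covariant_field_prod Yv_field)
  have Dvac: "?D m (basis_vec vac) = 0" for m
    using creates_zero_vanish[OF D cD T_lin T_vac cr] .
  have "?D m w = 0" for m w
  proof -
    have "?D m (basis_vec b) = 0" for b
    proof -
      obtain N1 where 1: "mlocal N1 (super_sign (p \<noteq> q) (par b)) (Yv (Yv u k v)) (Y b)"
        using Yv_local_basis[OF Yv_parity[OF u v]] by blast
      obtain n where "mlocal n (super_sign p q) (Yv u) (Yv v)" using Yv_local[OF u v] by blast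
      moreover obtain n' where "mlocal n' (super_sign p (par b)) (Yv u) (Y b)" using Yv_local_basis[OF u] by blast
      moreover obtain n'' where "mlocal n'' (super_sign q (par b)) (Yv v) (Y b)" using Yv_local_basis[OF v] by blast
      ultimately obtain N2 where "mlocal N2 (super_sign p (par b) * super_sign q (par b)) ?P (Y b)"
        using dong[OF Yv_field Yv_field field] by blast
      \<comment> \<open>The sign produced by Dong's lemma has to agree with the one for a state of
        parity \<open>p \<noteq> q\<close>, so that both parts of \<open>?D\<close> are local with
        the same sign.\<close>
      moreover have "super_sign p (par b) * super_sign q (par b) = super_sign (p \<noteq> q) (par b)"
        by (auto simp: super_sign_def)
      ultimately have 2: "mlocal N2 (super_sign (p \<noteq> q) (par b)) ?P (Y b)" by simp
      have "mlocal (max N1 N2) (super_sign (p \<noteq> q) (par b)) ?D (Y b)"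
        by (rule mlocal_lin_comb[OF mlocal_mono[OF 1] mlocal_mono[OF 2] field]) auto
      from goddard[OF D field Dvac this creation] show ?thesis .
    qed
    then show ?thesis
      using lin_eqI[OF is_field_lin[OF D] lin_const_zero] by blast
  qed
  then have "?P m w = Yv (Yv u k v) m w" for m w
    using free.scale_minus_left[of 1] by (simp add: add_eq_0_iff2)
  then show ?thesis by (simp add: fun_eq_iff)
qed

end

section \<open>Exponentials of commuting operators\<close>

text \<open>With L the series of the \<open>X k x^k / k\<close>, this is the coefficient of
  \<open>x^m\<close> in \<open>L^r\<close>. Separating the powers replaces the sum over all
  compositions by a recursion on \<open>r\<close>.\<close>

definition exp_word :: "(nat \<Rightarrow> 'b vec \<Rightarrow> 'b vec) \<Rightarrow> nat \<Rightarrow> nat \<Rightarrow> 'b vec \<Rightarrow> 'b vec" where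
  "exp_word X r m v = (\<Sum>ks | length ks = r \<and> 0 \<notin> set ks \<and> sum_list ks = m.
     foldr (\<lambda>k w. vscale (1 / of_nat k) (X k w)) ks v)"

lemma length_le_sum_list: "0 \<notin> set ks \<Longrightarrow> length ks \<le> sum_list (ks :: nat list)"
  by (induction ks) auto

lemma finite_compositions: "finite {ks :: nat list. length ks = r \<and> 0 \<notin> set ks \<and> sum_list ks = m}"
proof (rule finite_subset)
  show "{ks. length ks = r \<and> 0 \<notin> set ks \<and> sum_list ks = m} \<subseteq> {ks. set ks \<subseteq> {..m} \<and> length ks = r}"
    using member_le_sum_list by fastforce
  show "finite {ks. set ks \<subseteq> {..m} \<and> length ks = r}"
    by (rule finite_lists_length_eq) simp
qed

lemma exp_word_0: "exp_word X 0 m v = (if m = 0 then v else 0)"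
proof -
  have "{ks :: nat list. length ks = 0 \<and> 0 \<notin> set ks \<and> sum_list ks = m} = (if m = 0 then {[]} else {})" by auto
  then show ?thesis by (simp add: exp_word_def)
qed

lemma exp_word_Suc:
  assumes "\<And>k. lin (X k)"
  shows "exp_word X (Suc r) m v = (\<Sum>k=1..m. vscale (1 / of_nat k) (X k (exp_word X r (m - k) v)))"
proof -
  let ?C = "\<lambda>r m. {ks :: nat list. length ks = r \<and> 0 \<notin> set ks \<and> sum_list ks = m}"
  let ?f = "\<lambda>ks. foldr (\<lambda>k w. vscale (1 / of_nat k) (X k w)) ks v"
  have C: "?C (Suc r) m = (\<lambda>(k, ks). k # ks) ` (SIGMA k:{1..m}. ?C r (m - k))"
  proof (intro equalityI subsetI)
    fix ks assume "ks \<in> ?C (Suc r) m"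
    then show "ks \<in> (\<lambda>(k, ks). k # ks) ` (SIGMA k:{1..m}. ?C r (m - k))"
      by (cases ks) (auto simp: image_iff)
  qed auto
  have "exp_word X (Suc r) m v = (\<Sum>(k, ks)\<in>(SIGMA k:{1..m}. ?C r (m - k)). ?f (k # ks))"
    unfolding exp_word_def C by (subst sum.reindex) (auto simp: inj_on_def split_def)
  also have "\<dots> = (\<Sum>k=1..m. \<Sum>ks\<in>?C r (m - k). ?f (k # ks))"
    by (rule sum.Sigma[symmetric]) (auto intro: finite_compositions)
  also have "\<dots> = (\<Sum>k=1..m. vscale (1 / of_nat k) (X k (exp_word X r (m - k) v)))"
    unfolding exp_word_def by (simp add: lin_sum[OF assms] free.scale_sum_right)
  finally show ?thesis .
qed

lemma exp_word_large: "r > m \<Longrightarrow> exp_word X r m v = 0"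
proof -
  assume "r > m"
  then have "{ks :: nat list. length ks = r \<and> 0 \<notin> set ks \<and> sum_list ks = m} = {}"
    using length_le_sum_list by fastforce
  then show ?thesis unfolding exp_word_def by (simp only: sum.empty)
qed

lemma exp_coeff_words: "exp_coeff X m v = (\<Sum>r\<le>m. vscale (1 / fact r) (exp_word X r m v))"
proof -
  let ?C = "\<lambda>r. {ks :: nat list. length ks = r \<and> 0 \<notin> set ks \<and> sum_list ks = m}"
  have "{ks :: nat list. 0 \<notin> set ks \<and> sum_list ks = m} = (\<Union>r\<in>{..m}. ?C r)"
    using length_le_sum_list by auto
  then have "exp_coeff X m v = (\<Sum>ks\<in>(\<Union>r\<in>{..m}. ?C r).
      vscale (1 / fact (length ks)) (foldr (\<lambda>k w. vscale (1 / of_nat k) (X k w)) ks v))"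
    by (simp add: exp_coeff_def)
  also have "\<dots> = (\<Sum>r\<le>m. \<Sum>ks\<in>?C r. vscale (1 / fact (length ks)) (foldr (\<lambda>k w. vscale (1 / of_nat k) (X k w)) ks v))"
    by (rule sum.UNION_disjoint) (auto intro: finite_compositions)
  also have "\<dots> = (\<Sum>r\<le>m. vscale (1 / fact r) (exp_word X r m v))"
    unfolding exp_word_def free.scale_sum_right by (intro sum.cong refl) auto
  finally show ?thesis .
qed

lemma lin_exp_word: "(\<And>k. lin (X k)) \<Longrightarrow> lin (exp_word X r m)"
proof (induction r arbitrary: m)
  case 0
  then show ?case by (cases "m = 0") (simp_all add: exp_word_0 lin_id lin_const_zero)
next
  case (Suc r)
  have "exp_word X (Suc r) m = (\<lambda>v. \<Sum>k=1..m. vscale (1 / of_nat k) (X k (exp_word X r (m - k) v)))"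
    by (rule ext) (rule exp_word_Suc[OF Suc.prems])
  moreover have "lin \<dots>"
    by (rule lin_sum_op, rule lin_vscale, rule lin_comp[OF Suc.prems Suc.IH[OF Suc.prems]])
  ultimately show ?case by simp
qed

lemma lin_exp_coeff: "(\<And>k. lin (X k)) \<Longrightarrow> lin (exp_coeff X m)"
  unfolding exp_coeff_words[abs_def] by (rule lin_sum_op, rule lin_vscale, rule lin_exp_word)

lemma sum_triangle_swap:
  fixes f :: "nat \<Rightarrow> nat \<Rightarrow> 'a :: comm_monoid_add"
  shows "(\<Sum>k=1..m. \<Sum>j=1..m-k. f k j) = (\<Sum>j=1..m. \<Sum>k=1..m-j. f k j)"
proof -
  have 1: "{1..m-k} = {j \<in> {1..m}. k + j \<le> m}" for k by auto
  have 2: "{1..m-j} = {k \<in> {1..m}. k + j \<le> m}" for j by auto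
  have "(\<Sum>k=1..m. \<Sum>j\<in>{j \<in> {1..m}. k + j \<le> m}. f k j) = (\<Sum>j=1..m. \<Sum>k\<in>{k \<in> {1..m}. k + j \<le> m}. f k j)"
    by (rule sum.swap_restrict) auto
  then show ?thesis unfolding 1[symmetric] 2[symmetric] .
qed

text \<open>Apply x d/dx to \<open>L^(r+1)\<close>: commuting coefficients give (r + 1) (x L') L^r,
  and x L' is the series with coefficients \<open>X k\<close>.\<close>

lemma exp_word_degree:
  assumes lin: "\<And>k. lin (X k)" and comm: "\<And>j k v. X j (X k v) = X k (X j v)"
  shows "vscale (of_nat m) (exp_word X (Suc r) m v) = vscale (of_nat (Suc r)) (\<Sum>k=1..m. X k (exp_word X r (m - k) v))"
proof (induction r arbitrary: m)
  case 0
  have "(\<Sum>k=1..m. X k (exp_word X 0 (m - k) v)) = (\<Sum>k=1..m. if k = m then X m v else 0)"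
    by (intro sum.cong) (auto simp: exp_word_0 lin_zero[OF lin])
  moreover have "exp_word X (Suc 0) m v = (\<Sum>k=1..m. if k = m then vscale (1 / of_nat m) (X m v) else 0)"
    unfolding exp_word_Suc[where X = X, OF lin] by (intro sum.cong) (auto simp: exp_word_0 lin_zero[OF lin])
  ultimately show ?case by (cases "m = 0") auto
next
  case (Suc r)
  note SL = lin_sum[OF lin] and LS = lin_scale[OF lin]
  have "vscale (of_nat m) (exp_word X (Suc (Suc r)) m v) =
     (\<Sum>k=1..m. vscale (of_nat m / of_nat k) (X k (exp_word X (Suc r) (m - k) v)))"
    unfolding exp_word_Suc[where X = X, OF lin, where r = "Suc r"] free.scale_sum_right by simp
  also have "\<dots> = (\<Sum>k=1..m. X k (exp_word X (Suc r) (m - k) v) +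
      vscale (1 / of_nat k) (X k (vscale (of_nat (m - k)) (exp_word X (Suc r) (m - k) v))))"
  proof (intro sum.cong refl)
    fix k assume k: "k \<in> {1..m}"
    then have "of_nat m / of_nat k = 1 + 1 / of_nat k * (of_nat (m - k) :: complex)"
      by (simp add: field_simps of_nat_diff)
    then show "vscale (of_nat m / of_nat k) (X k (exp_word X (Suc r) (m - k) v)) = X k (exp_word X (Suc r) (m - k) v) +
      vscale (1 / of_nat k) (X k (vscale (of_nat (m - k)) (exp_word X (Suc r) (m - k) v)))"
      by (simp add: LS free.scale_left_distrib)
  qed
  also have "\<dots> = (\<Sum>k=1..m. X k (exp_word X (Suc r) (m - k) v)) +
      (\<Sum>k=1..m. \<Sum>j=1..m-k. vscale (of_nat (Suc r)) (vscale (1 / of_nat k) (X k (X j (exp_word X r (m - k - j) v)))))"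
    unfolding Suc.IH sum.distrib
    by (simp add: LS SL free.scale_sum_right mult.commute)
  also have "(\<Sum>k=1..m. \<Sum>j=1..m-k. vscale (of_nat (Suc r)) (vscale (1 / of_nat k) (X k (X j (exp_word X r (m - k - j) v)))))
    = (\<Sum>j=1..m. \<Sum>k=1..m-j. vscale (of_nat (Suc r)) (vscale (1 / of_nat k) (X k (X j (exp_word X r (m - k - j) v)))))"
    by (rule sum_triangle_swap)
  also have "\<dots> = (\<Sum>j=1..m. vscale (of_nat (Suc r)) (X j (exp_word X (Suc r) (m - j) v)))"
    unfolding exp_word_Suc[where X = X, OF lin]
    by (intro sum.cong refl) (simp add: SL LS free.scale_sum_right comm[of _ "_ :: nat"] diff_commute add.commute mult.commute)
  finally show ?case
    by (simp only: free.scale_sum_right[symmetric] of_nat_Suc[of "Suc r"] free.scale_left_distrib free.scale_one)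
qed

lemma exp_coeff_0 [simp]: "exp_coeff X 0 v = v"
  by (simp add: exp_coeff_words exp_word_0)

text \<open>The equation x E' = (x L') E for the exponential E of L. It determines the coefficients
  recursively, so later facts about exponentials follow by strong induction on the degree.\<close>

lemma exp_coeff_rec:
  assumes lin: "\<And>k. lin (X k)" and comm: "\<And>j k v. X j (X k v) = X k (X j v)"
  shows "vscale (of_nat m) (exp_coeff X m v) = (\<Sum>k=1..m. X k (exp_coeff X (m - k) v))"
proof (cases m)
  case (Suc n)
  have "vscale (of_nat m) (exp_coeff X m v) = (\<Sum>r\<le>Suc n. vscale (1 / fact r) (vscale (of_nat m) (exp_word X r m v)))"
    unfolding exp_coeff_words Suc free.scale_sum_right by (simp only: free.scale_left_commute)
  also have "\<dots> = (\<Sum>r\<le>n. vscale (1 / fact (Suc r)) (vscale (of_nat m) (exp_word X (Suc r) m v)))"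
    unfolding sum.atMost_Suc_shift using Suc by (simp add: exp_word_0)
  also have "\<dots> = (\<Sum>r\<le>n. \<Sum>k=1..m. X k (vscale (1 / fact r) (exp_word X r (m - k) v)))"
  proof (intro sum.cong refl)
    fix r
    have "1 / fact (Suc r) * of_nat (Suc r) = (1 / fact r :: complex)" by (simp add: fact_Suc del: of_nat_Suc)
    then show "vscale (1 / fact (Suc r)) (vscale (of_nat m) (exp_word X (Suc r) m v)) = (\<Sum>k=1..m. X k (vscale (1 / fact r) (exp_word X r (m - k) v)))"
      unfolding exp_word_degree[where X = X, OF lin comm] free.scale_scale by (simp only: lin_scale[OF lin] free.scale_sum_right)
  qed
  also have "\<dots> = (\<Sum>k=1..m. \<Sum>r\<le>n. X k (vscale (1 / fact r) (exp_word X r (m - k) v)))"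
    by (rule sum.swap)
  also have "\<dots> = (\<Sum>k=1..m. X k (exp_coeff X (m - k) v))"
  proof (intro sum.cong refl)
    fix k assume k: "k \<in> {1..m}"
    have "exp_coeff X (m - k) v = (\<Sum>r\<le>n. vscale (1 / fact r) (exp_word X r (m - k) v))"
      unfolding exp_coeff_words using k Suc
      by (intro sum.mono_neutral_left) (auto simp: exp_word_large)
    then show "(\<Sum>r\<le>n. X k (vscale (1 / fact r) (exp_word X r (m - k) v))) = X k (exp_coeff X (m - k) v)"
      by (simp add: lin_sum[OF lin])
  qed
  finally show ?thesis .
qed simp

lemma vscale_of_nat_cancel: "m > 0 \<Longrightarrow> vscale (of_nat m) u = vscale (of_nat m) w \<Longrightarrow> u = w"
  by (simp add: free.scale_left_imp_eq)

lemma exp_coeff_commute: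
  assumes lin: "\<And>k. lin (X k)" and comm: "\<And>j k v. X j (X k v) = X k (X j v)"
    and b: "lin b" "\<And>k v. k \<ge> 1 \<Longrightarrow> b (X k v) = X k (b v)"
  shows "b (exp_coeff X m v) = exp_coeff X m (b v)"
proof (induction m rule: less_induct)
  case (less m)
  show ?case
  proof (cases "m = 0")
    case False
    have "vscale (of_nat m) (b (exp_coeff X m v)) = b (vscale (of_nat m) (exp_coeff X m v))"
      by (simp add: lin_scale[OF b(1)])
    also have "\<dots> = (\<Sum>k=1..m. X k (exp_coeff X (m - k) (b v)))"
      unfolding exp_coeff_rec[where X = X, OF lin comm] lin_sum[OF b(1)] using less b(2)
      by (intro sum.cong refl) simp
    finally have "vscale (of_nat m) (b (exp_coeff X m v)) = vscale (of_nat m) (exp_coeff X m (b v))"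
      unfolding exp_coeff_rec[where X = X, OF lin comm, symmetric] .
    then show ?thesis by (rule vscale_of_nat_cancel[rotated]) (use False in simp)
  qed simp
qed

text \<open>The commutator of \<open>b\<close> with the exponent is the scalar series
  \<open>c x^j\<close>, so its commutator with the exponential is \<open>c x^j\<close> times the
  exponential.\<close>

lemma exp_coeff_derivation:
  assumes lin: "\<And>k. lin (X k)" and comm: "\<And>j k v. X j (X k v) = X k (X j v)"
    and b: "lin b" "\<And>k v. k \<ge> 1 \<Longrightarrow> b (X k v) = X k (b v) + (if k = j then vscale (of_nat j * c) v else 0)"
    and j: "j \<ge> 1"
  shows "b (exp_coeff X m v) = exp_coeff X m (b v) + (if j \<le> m then vscale c (exp_coeff X (m - j) v) else 0)"
proof (induction m rule: less_induct)
  case (less m)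
  show ?case
  proof (cases "m = 0")
    case False
    have "vscale (of_nat m) (b (exp_coeff X m v)) = b (vscale (of_nat m) (exp_coeff X m v))"
      by (simp add: lin_scale[OF b(1)])
    also have "\<dots> = (\<Sum>k=1..m. X k (b (exp_coeff X (m - k) v)) + (if k = j then vscale (of_nat j * c) (exp_coeff X (m - k) v) else 0))"
      unfolding exp_coeff_rec[where X = X, OF lin comm] lin_sum[OF b(1)] using b(2)
      by (intro sum.cong refl) simp
    also have "\<dots> = (\<Sum>k=1..m. X k (exp_coeff X (m - k) (b v))) +
        (\<Sum>k=1..m. X k (if j \<le> m - k then vscale c (exp_coeff X (m - k - j) v) else 0)) +
        (if j \<le> m then vscale (of_nat j * c) (exp_coeff X (m - j) v) else 0)"
    proof -
      have "(\<Sum>k=1..m. X k (b (exp_coeff X (m - k) v))) =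
        (\<Sum>k=1..m. X k (exp_coeff X (m - k) (b v)) + X k (if j \<le> m - k then vscale c (exp_coeff X (m - k - j) v) else 0))"
        by (intro sum.cong refl) (simp add: less lin_add[OF lin])
      moreover have "(\<Sum>k=1..m. if k = j then vscale (of_nat j * c) (exp_coeff X (m - k) v) else 0) =
        (if j \<le> m then vscale (of_nat j * c) (exp_coeff X (m - j) v) else 0)"
        using j by (simp cong: if_cong)
      ultimately show ?thesis by (simp only: sum.distrib)
    qed
    also have "(\<Sum>k=1..m. X k (if j \<le> m - k then vscale c (exp_coeff X (m - k - j) v) else 0)) =
      (if j \<le> m then vscale (of_nat (m - j) * c) (exp_coeff X (m - j) v) else 0)"
    proof (cases "j \<le> m")
      case True
      have "(\<Sum>k=1..m. X k (if j \<le> m - k then vscale c (exp_coeff X (m - k - j) v) else 0)) =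
        (\<Sum>k=1..m-j. X k (vscale c (exp_coeff X (m - j - k) v)))"
      proof (rule sum.mono_neutral_cong_right)
        show "X k (if j \<le> m - k then vscale c (exp_coeff X (m - k - j) v) else 0) = X k (vscale c (exp_coeff X (m - j - k) v))"
          if "k \<in> {1..m-j}" for k
        proof -
          have "j \<le> m - k" using that by auto
          then show ?thesis by (simp add: diff_commute add.commute)
        qed
      qed (use True in \<open>auto simp: lin_zero[OF lin]\<close>)
      also have "\<dots> = vscale c (vscale (of_nat (m - j)) (exp_coeff X (m - j) v))"
        unfolding exp_coeff_rec[where X = X, OF lin comm] by (simp add: lin_scale[OF lin] free.scale_sum_right)
      finally show ?thesis using True by (simp add: mult.commute)
    next
      case False
      then have "\<not> j \<le> m - k" for k by auto
      then show ?thesis using False by (simp add: lin_zero[OF lin])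
    qed
    \<comment> \<open>The two contributions carry the weights \<open>m - j\<close> and
      \<open>j\<close>, which add up to the factor \<open>m\<close> on the left.\<close>
    also have "(\<Sum>k=1..m. X k (exp_coeff X (m - k) (b v))) +
        (if j \<le> m then vscale (of_nat (m - j) * c) (exp_coeff X (m - j) v) else 0) +
        (if j \<le> m then vscale (of_nat j * c) (exp_coeff X (m - j) v) else 0)
      = vscale (of_nat m) (exp_coeff X m (b v) + (if j \<le> m then vscale c (exp_coeff X (m - j) v) else 0))"
    proof (cases "j \<le> m")
      case True
      then have "of_nat m * c = of_nat (m - j) * c + of_nat j * (c :: complex)"
        by (simp add: of_nat_diff algebra_simps)
      then show ?thesis
        unfolding exp_coeff_rec[where X = X, OF lin comm, symmetric] using True
        by (simp add: free.scale_right_distrib free.scale_left_distrib add.assoc)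
    next
      case False
      then show ?thesis unfolding exp_coeff_rec[where X = X, OF lin comm, symmetric] by simp
    qed
    finally show ?thesis by (rule vscale_of_nat_cancel[rotated]) (use False in simp)
  qed (use j in simp)
qed

section \<open>The Heisenberg field\<close>

lemma is_fieldI:
  assumes "\<And>m. lin (A m)" "\<And>b. \<exists>N. \<forall>m\<ge>N. A m (basis_vec b) = 0"
  shows "is_field A"
  unfolding is_field_def
proof (intro conjI allI assms(1))
  fix v :: "'a vec"
  have "keys v \<subseteq> UNIV" by simp
  then show "\<exists>N. \<forall>m\<ge>N. A m v = 0"
  proof (induction v rule: vec_induct)
    case (scale_add c u w)
    then obtain N M where "\<forall>m\<ge>N. A m u = 0" "\<forall>m\<ge>M. A m w = 0" by blast
    then show ?case
      by (intro exI[of _ "max N M"]) (simp add: lin_add[OF assms(1)] lin_scale[OF assms(1)])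
  qed (use assms in \<open>auto simp: lin_zero\<close>)
qed

lemma lin_heis [simp]: "lin (heis j)"
  by (simp add: heis_def)

lemma heis_basis_vec: "heis j (basis_vec b) = heis_basis j b"
  by (simp add: heis_def)

lemma heis_comm: "heis j (heis k v) = heis k (heis j v) + vscale (if j + k = 0 then of_int j else 0) v"
  using heis_commutator[of j k v] by (simp add: algebra_simps)

lemma heis_comm': "j + k \<noteq> 0 \<Longrightarrow> heis j (heis k v) = heis k (heis j v)"
  using heis_comm[of j k v] by simp

lemma field_heis: "is_field heis"
proof (rule is_fieldI)
  fix b :: boson_label
  obtain M l where b: "b = (M, l)" by (cases b)
  have "heis m (basis_vec b) = 0" if "m \<ge> int (Max (insert 0 (set_mset M))) + 2" for m
  proof -
    have "nat (m - 1) \<notin># M"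
    proof
      assume "nat (m - 1) \<in># M"
      then have "nat (m - 1) \<le> Max (insert 0 (set_mset M))" by (intro Max_ge) auto
      then show False using that by auto
    qed
    then show ?thesis using that by (auto simp: heis_basis_vec heis_basis_def b not_in_iff)
  qed
  then show "\<exists>N. \<forall>m\<ge>N. heis m (basis_vec b) = 0" by blast
qed simp

abbreviation exp_basis :: "int \<Rightarrow> boson_label vec" where
  "exp_basis l \<equiv> basis_vec ({#}, l)"

lemma heis_exp_basis: "k > 0 \<Longrightarrow> heis k (exp_basis l) = 0" "heis 0 (exp_basis l) = vscale (of_int l) (exp_basis l)"
  by (simp_all add: heis_basis_vec heis_basis_def)

lemma heis_create: "heis (- int k - 1) (basis_vec (M, l)) = basis_vec (add_mset k M, l)"
  by (simp add: heis_basis_vec heis_basis_def)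

definition charged :: "int \<Rightarrow> (boson_label vec \<Rightarrow> boson_label vec) \<Rightarrow> bool" where
  "charged d f \<longleftrightarrow> (\<forall>v l. keys v \<subseteq> {b. snd b = l} \<longrightarrow> keys (f v) \<subseteq> {b. snd b = l + d})"

lemma charged_linI:
  assumes "lin f" "\<And>b. keys (f (basis_vec b)) \<subseteq> {c. snd c = snd b + d}"
  shows "charged d f"
  unfolding charged_def
proof (intro allI impI)
  fix v :: "boson_label vec" and l
  assume v: "keys v \<subseteq> {b. snd b = l}"
  show "keys (f v) \<subseteq> {b. snd b = l + d}"
    unfolding lin_eq_lin_ext[OF assms(1), of v]
  proof (rule keys_lin_ext_subset)
    fix b assume "b \<in> keys v"
    then have "snd b = l" using v by auto
    then show "keys (f (basis_vec b)) \<subseteq> {b. snd b = l + d}" using assms(2)[of b] by simp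
  qed
qed

lemma charged_heis: "charged 0 (heis k)"
proof (rule charged_linI)
  fix b :: boson_label
  show "keys (heis k (basis_vec b)) \<subseteq> {c. snd c = snd b + 0}"
    by (cases b) (auto simp: heis_basis_vec heis_basis_def in_keys_iff lookup_vscale lookup_basis_vec split: if_splits)
qed simp

lemma heis_zero:
  assumes "keys v \<subseteq> {b. snd b = l}"
  shows "heis 0 v = vscale (of_int l) v"
proof (rule lin_eqI[where g = "vscale (of_int l)"])
  fix b assume "b \<in> keys v"
  then show "heis 0 (basis_vec b) = vscale (of_int l) (basis_vec b)"
    using assms by (cases b) (auto simp: heis_basis_vec heis_basis_def)
qed (simp_all add: lin_vscale_self)

text \<open>Annihilators are adjoint to creators up to positive constants. The index shift comes
  from label \<open>k\<close> standing for mode \<open>-k - 1\<close>, whose partner is mode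
  \<open>k + 1\<close>.\<close>

lemma lookup_heis:
  "lookup (heis (int k + 1) x) (M, l) =
    of_nat (Suc k) * of_nat (Suc (count M k)) * lookup x (add_mset k M, l)"
proof -
  have "lookup (heis_basis (int k + 1) b) (M, l) =
     (if b = (add_mset k M, l) then of_nat (Suc k) * of_nat (Suc (count M k)) else 0)" for b
  proof (cases b)
    case (Pair M' l')
    show ?thesis
    proof (cases "k \<in># M'")
      case True
      then obtain M'' where "M' = add_mset k M''" by (metis insert_DiffM)
      then show ?thesis using Pair
        by (auto simp: heis_basis_def lookup_vscale lookup_basis_vec)
    next
      case False
      then show ?thesis using Pair
        by (auto simp: heis_basis_def lookup_vscale not_in_iff)
    qed
  qed
  then have "lookup (heis (int k + 1) x) (M, l) =
     (\<Sum>b\<in>keys x. if b = (add_mset k M, l) then lookup x b * (of_nat (Suc k) * of_nat (Suc (count M k))) else 0)"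
    unfolding heis_def lookup_lin_ext by (intro sum.cong) auto
  then show ?thesis by (simp add: in_keys_iff)
qed

text \<open>Every coefficient of \<open>x\<close> is, up to a nonzero factor, the vacuum coefficient
  of a vector obtained from \<open>x\<close> by annihilators, and that vector is again in
  \<open>S\<close>.\<close>

lemma heis_nondegenerate:
  assumes "\<And>x k. x \<in> S \<Longrightarrow> k > 0 \<Longrightarrow> heis k x \<in> S"
    and "\<And>x l. x \<in> S \<Longrightarrow> lookup x ({#}, l) = 0" and "x \<in> S"
  shows "x = 0"
proof (rule poly_mapping_eqI)
  fix b
  have "lookup x (M, l) = 0" if "x \<in> S" for M l x
    using that
  proof (induction M arbitrary: x)
    case (add k M)
    have "lookup (heis (int k + 1) x) (M, l) = 0"
      using add assms(1)[of x "int k + 1"] by simp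
    then have "of_nat (Suc k) * of_nat (Suc (count M k)) * lookup x (add_mset k M, l) = 0"
      unfolding lookup_heis .
    moreover have "of_nat (Suc k) * of_nat (Suc (count M k)) \<noteq> (0 :: complex)"
      by (simp only: mult_eq_0_iff of_nat_eq_0_iff) simp
    ultimately show ?case by (metis mult_eq_0_iff)
  qed (use assms(2) in auto)
  then show "lookup x b = lookup 0 b"
    using assms(3) by (cases b) simp
qed

text \<open>
  The Fock spaces are irreducible, so the vacuum matrix elements determine such a family.
\<close>

lemma heis_family_zero:
  fixes D :: "'i \<Rightarrow> boson_label vec \<Rightarrow> boson_label vec"
  assumes lin: "\<And>i. lin (D i)"
    and comm: "\<And>i k. \<exists>cs. \<forall>v. heis k (D i v) = D i (heis k v) + (\<Sum>(c, j)\<leftarrow>cs. vscale c (D j v))"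
    and top: "\<And>i l l'. lookup (D i (exp_basis l)) ({#}, l') = 0"
  shows "D i v = 0"
proof -
  have e: "D i (exp_basis l) = 0" for i l
  proof -
    \<comment> \<open>Finite linear combinations of the family on one exponential vector, encoded by
      lists of coefficient and index. The commutation hypothesis makes this set stable under
      annihilators, since these kill the exponential vector.\<close>
    let ?S = "{x. \<exists>cs. x = (\<Sum>(c, j)\<leftarrow>cs. vscale c (D j (exp_basis l)))}"
    have "heis k x \<in> ?S" if x: "x \<in> ?S" and k: "k > 0" for x k
    proof -
      obtain cs where "x = (\<Sum>(c, j)\<leftarrow>cs. vscale c (D j (exp_basis l)))" using x by blast
      moreover have "heis k (\<Sum>(c, j)\<leftarrow>cs. vscale c (D j (exp_basis l))) \<in> ?S" for cs
      proof (induction cs)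
        case Nil
        show ?case by (auto simp: lin_zero intro!: exI[of _ "[]"])
      next
        case (Cons a cs)
        obtain c j where a: "a = (c, j)" by (cases a)
        obtain ds where ds: "heis k (D j (exp_basis l)) = D j (heis k (exp_basis l)) + (\<Sum>(c, j)\<leftarrow>ds. vscale c (D j (exp_basis l)))"
          using comm[of k j] by blast
        obtain es where es: "heis k (\<Sum>(c, j)\<leftarrow>cs. vscale c (D j (exp_basis l))) = (\<Sum>(c, j)\<leftarrow>es. vscale c (D j (exp_basis l)))"
          using Cons by blast
        have "vscale c (\<Sum>(c, j)\<leftarrow>ds. vscale c (D j (exp_basis l))) = (\<Sum>(c', j)\<leftarrow>map (\<lambda>(c', j). (c * c', j)) ds. vscale c' (D j (exp_basis l)))" for ds
          by (induction ds) (auto simp: free.scale_right_distrib)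
        then have "heis k (\<Sum>(c, j)\<leftarrow>a # cs. vscale c (D j (exp_basis l))) =
          (\<Sum>(c', j)\<leftarrow>map (\<lambda>(c', j). (c * c', j)) ds @ es. vscale c' (D j (exp_basis l)))"
          using ds es k by (simp add: a lin_add lin_scale heis_exp_basis lin_zero[OF lin])
        then show ?case by blast
      qed
      ultimately show ?thesis by blast
    qed
    moreover have "lookup x ({#}, l') = 0" if x: "x \<in> ?S" for x l'
    proof -
      obtain cs where "x = (\<Sum>(c, j)\<leftarrow>cs. vscale c (D j (exp_basis l)))" using x by blast
      moreover have "lookup (\<Sum>(c, j)\<leftarrow>cs. vscale c (D j (exp_basis l))) ({#}, l') = 0" for cs
        by (induction cs) (auto simp: lookup_add lookup_vscale top)
      ultimately show ?thesis by simp
    qed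
    moreover have "D i (exp_basis l) \<in> ?S"
      by (auto intro!: exI[of _ "[(1, i)]"])
    ultimately show ?thesis by (rule heis_nondegenerate[of ?S])
  qed
  have z: "(\<Sum>(c, j)\<leftarrow>cs. vscale c (D j v)) = 0" if "\<And>j. D j v = 0" for cs v
    using that by (induction cs) auto
  \<comment> \<open>Creators generate each Fock space from its exponential vector, and commuting one
    past \<open>D i\<close> produces only members of the family on smaller labels.\<close>
  have "D i (basis_vec (M, l)) = 0" for M l i
  proof (induction M arbitrary: i)
    case (add k M)
    obtain cs where "heis (- int k - 1) (D i (basis_vec (M, l))) =
        D i (heis (- int k - 1) (basis_vec (M, l))) + (\<Sum>(c, j)\<leftarrow>cs. vscale c (D j (basis_vec (M, l))))"
      using comm by blast
    moreover have "(\<Sum>(c, j)\<leftarrow>cs. vscale c (D j (basis_vec (M, l)))) = 0" by (rule z) (rule add)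
    ultimately show ?case by (simp add: add heis_create lin_zero)
  qed (simp add: e)
  then have "D i (basis_vec b) = 0" for b by (cases b) simp
  then show ?thesis using lin_eqI[OF lin[of i] lin_const_zero, of v] by simp
qed

text \<open>The Virasoro mode \<open>L_(-1)\<close>, half the sum over all integers \<open>j\<close>
  of the normally ordered products of \<open>a_j\<close> and \<open>a_(-1-j)\<close>; the terms for
  \<open>j\<close> and \<open>-1 - j\<close> coincide, which removes the factor 1/2.\<close>

definition transl :: "boson_label vec \<Rightarrow> boson_label vec" where
  "transl v = Sum_any (\<lambda>k :: nat. heis (- int k - 1) (heis (int k) v))"

lemma transl_fsupp: "fsupp (\<lambda>k. heis (- int k - 1) (heis (int k) v))"
proof -
  obtain N where N: "\<And>m. m \<ge> N \<Longrightarrow> heis m v = 0" by (rule is_fieldE[OF field_heis, of v]) blast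
  have "heis (- int k - 1) (heis (int k) v) = 0" if "k \<ge> nat N" for k
    using N[of "int k"] that by (simp add: lin_zero nat_le_iff)
  then show ?thesis unfolding fsupp_def by blast
qed

lemma lin_transl: "lin transl"
proof (rule linI)
  show "transl (u + v) = transl u + transl v" for u v
    unfolding transl_def
    by (simp only: lin_add[OF lin_heis] Sum_any.distrib[OF fsupp_finite[OF transl_fsupp] fsupp_finite[OF transl_fsupp]])
  show "transl (vscale c v) = vscale c (transl v)" for c v
    unfolding transl_def
    by (simp only: lin_scale[OF lin_heis] Sum_any_lin[OF lin_vscale_self fsupp_finite[OF transl_fsupp]])
qed

lemma transl_exp_basis: "transl (exp_basis l) = vscale (of_int l) (heis (-1) (exp_basis l))"
proof -
  have "transl (exp_basis l) = (\<Sum>k<Suc 0. heis (- int k - 1) (heis (int k) (exp_basis l)))"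
    unfolding transl_def by (rule fsupp_Sum_any) (auto simp: heis_exp_basis lin_zero)
  then show ?thesis by (simp add: heis_exp_basis lin_scale)
qed

lemma covariant_heis: "covariant transl heis"
  unfolding covariant_def
proof (intro allI)
  fix m v
  let ?f = "\<lambda>v k. heis (- int k - 1) (heis (int k) v)"
  obtain J1 where J1: "\<forall>k\<ge>J1. ?f v k = 0" using transl_fsupp[of v] unfolding fsupp_def by blast
  obtain J2 where J2: "\<forall>k\<ge>J2. ?f (heis m v) k = 0" using transl_fsupp[of "heis m v"] unfolding fsupp_def by blast
  \<comment> \<open>The finite range must also contain the exceptional indices
    \<open>nat (m - 1)\<close> and \<open>nat (- m)\<close>, the only ones where
    \<open>heis m\<close> can fail to commute with the summand.\<close>
  define J where "J = Suc (max (max J1 J2) (nat \<bar>m\<bar>))"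
  have 1: "transl v = (\<Sum>k<J. ?f v k)"
    unfolding transl_def using J1 by (intro fsupp_Sum_any) (auto simp: J_def)
  have 2: "transl (heis m v) = (\<Sum>k<J. ?f (heis m v) k)"
    unfolding transl_def using J2 by (intro fsupp_Sum_any) (auto simp: J_def)
  have c: "?f (heis m v) k = heis m (?f v k) - (if k = nat (m - 1) \<and> m \<ge> 1 then vscale (of_int m) (heis (m - 1) v) else 0)
       - (if k = nat (- m) \<and> m \<le> 0 then vscale (of_int m) (heis (m - 1) v) else 0)" for k
  proof -
    have "?f (heis m v) k = heis (- int k - 1) (heis m (heis (int k) v)) + heis (- int k - 1) (vscale (if int k + m = 0 then of_int (int k) else 0) v)"
      unfolding heis_comm[of "int k" m v] by (simp add: lin_add)
    moreover have "heis (- int k - 1) (vscale (if int k + m = 0 then of_int (int k) else 0) v) = 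
      - (if k = nat (- m) \<and> m \<le> 0 then vscale (of_int m) (heis (m - 1) v) else 0)"
    proof (cases "int k + m = 0")
      case True
      then have m: "m = - int k" by simp
      show ?thesis unfolding m by (simp add: lin_scale)
    next
      case False
      then have "\<not> (k = nat (- m) \<and> m \<le> 0)" by auto
      then show ?thesis using False by (simp only: if_False free.scale_zero_left lin_zero[OF lin_heis] simp_thms) simp
    qed
    moreover have "heis (- int k - 1) (heis m (heis (int k) v)) = heis m (?f v k) -
       (if k = nat (m - 1) \<and> m \<ge> 1 then vscale (of_int m) (heis (m - 1) v) else 0)"
    proof (cases "m = int k + 1")
      case True
      show ?thesis unfolding True heis_comm[of "- int k - 1" "int k + 1"] by (simp add: algebra_simps)
    next
      case False
      then have "\<not> (k = nat (m - 1) \<and> m \<ge> 1)" by auto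
      then show ?thesis using heis_comm'[of "- int k - 1" m "heis (int k) v"] False by (simp only: if_False) simp
    qed
    ultimately show ?thesis by simp
  qed
  have "transl (heis m v) = heis m (transl v) - (\<Sum>k<J. if k = nat (m - 1) \<and> m \<ge> 1 then vscale (of_int m) (heis (m - 1) v) else 0)
    - (\<Sum>k<J. if k = nat (- m) \<and> m \<le> 0 then vscale (of_int m) (heis (m - 1) v) else 0)"
    unfolding 1 2 c by (simp only: sum_subtractf lin_sum[OF lin_heis])
  moreover have "(\<Sum>k<J. if k = nat (m - 1) \<and> m \<ge> 1 then vscale (of_int m) (heis (m - 1) v) else 0) =
      (if m \<ge> 1 then vscale (of_int m) (heis (m - 1) v) else 0)"
  proof -
    have "nat (m - 1) < J" by (simp add: J_def)
    then show ?thesis by (cases "m \<ge> 1") simp_all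
  qed
  moreover have "(\<Sum>k<J. if k = nat (- m) \<and> m \<le> 0 then vscale (of_int m) (heis (m - 1) v) else 0) =
      (if m \<le> 0 then vscale (of_int m) (heis (m - 1) v) else 0)"
  proof -
    have "nat (- m) < J" by (simp add: J_def)
    then show ?thesis by (cases "m \<le> 0") simp_all
  qed
  ultimately show "transl (heis m v) = heis m (transl v) - vscale (of_int m) (heis (m - 1) v)"
    by (cases "m \<ge> 1") simp_all
qed

lemma lookup_heis_create_top: "k < 0 \<Longrightarrow> lookup (heis k x) ({#}, l) = 0"
  unfolding heis_def lookup_lin_ext
  by (intro sum.neutral) (auto simp: heis_basis_def lookup_basis_vec split_def)

lemma lookup_transl_top: "lookup (transl x) ({#}, l) = 0"
  unfolding transl_def Sum_any.expand_set lookup_sum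
  by (intro sum.neutral) (auto intro!: lookup_heis_create_top)

text \<open>The commutator is the derivative of the delta distribution, which (z - w)^2
  annihilates.\<close>

lemma mlocal_heis_heis: "mlocal 2 1 heis heis"
  unfolding mlocal_def
proof (intro allI ext)
  fix v m k
  have "(\<lambda>m k. heis m (heis k v) - vscale 1 (heis k (heis m v))) = (\<lambda>m k. vscale (if m + k = 0 then of_int m else 0) v)"
    by (simp add: fun_eq_iff heis_commutator)
  moreover have "(dl ^^ 2) (\<lambda>m k. vscale (if m + k = 0 then of_int m else 0) v) m k = 0"
  proof -
    have "vscale 2 v = v + v" by (metis free.scale_left_distrib one_add_one free.scale_one)
    then show ?thesis by (auto simp: numeral_2_eq_2 dl_def free.scale_left_distrib add.assoc add.commute add.left_commute)
  qed
  ultimately show "(dl ^^ 2) (\<lambda>m k. heis m (heis k v) - vscale 1 (heis k (heis m v))) m k = 0" by simp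
qed

section \<open>Vertex operators of the lattice of integers\<close>

text \<open>
  Coefficients of the creating and of the annihilating exponential in a vertex operator, extended
  by zero to negative indices so that commutators with Heisenberg modes need no case distinction.
\<close>

definition ecr :: "int \<Rightarrow> int \<Rightarrow> boson_label vec \<Rightarrow> boson_label vec" where
  "ecr l r v = (if r < 0 then 0 else exp_coeff (\<lambda>k w. vscale (of_int l) (heis (- int k) w)) (nat r) v)"

definition ean :: "int \<Rightarrow> int \<Rightarrow> boson_label vec \<Rightarrow> boson_label vec" where
  "ean l q v = (if q < 0 then 0 else exp_coeff (\<lambda>k w. vscale (- of_int l) (heis (int k) w)) (nat q) v)"

lemma lin_ops: "lin (\<lambda>w. vscale c (heis j w))"
  by (rule lin_vscale) simp

lemma comm_create: "vscale c (heis (- int j) (vscale c (heis (- int k) v))) = vscale c (heis (- int k) (vscale c (heis (- int j) v)))"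
  by (cases "j = 0 \<and> k = 0") (auto simp: lin_scale heis_comm'[of "- int j" "- int k"])

lemma comm_annih: "vscale c (heis (int j) (vscale c (heis (int k) v))) = vscale c (heis (int k) (vscale c (heis (int j) v)))"
  by (cases "j = 0 \<and> k = 0") (auto simp: lin_scale heis_comm'[of "int j" "int k"])

lemmas ecr_rec = exp_coeff_rec[where X = "\<lambda>k w. vscale c (heis (- int k) w)" for c, OF lin_ops comm_create]
lemmas ean_rec = exp_coeff_rec[where X = "\<lambda>k w. vscale c (heis (int k) w)" for c, OF lin_ops comm_annih]
lemmas ecr_commute = exp_coeff_commute[where X = "\<lambda>k w. vscale c (heis (- int k) w)" for c, OF lin_ops comm_create]
lemmas ean_commute = exp_coeff_commute[where X = "\<lambda>k w. vscale c (heis (int k) w)" for c, OF lin_ops comm_annih]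
lemmas ecr_derivation = exp_coeff_derivation[where X = "\<lambda>k w. vscale c (heis (- int k) w)" for c, OF lin_ops comm_create]
lemmas ean_derivation = exp_coeff_derivation[where X = "\<lambda>k w. vscale c (heis (int k) w)" for c, OF lin_ops comm_annih]

lemma lin_ecr [simp]: "lin (ecr l r)"
  by (cases "r < 0") (auto simp: ecr_def[abs_def] lin_const_zero intro!: lin_exp_coeff lin_ops)

lemma lin_ean [simp]: "lin (ean l q)"
  by (cases "q < 0") (auto simp: ean_def[abs_def] lin_const_zero simp del: free.scale_minus_left intro!: lin_exp_coeff lin_ops)

lemma ecr_0 [simp]: "ecr l 0 v = v" and ean_0 [simp]: "ean l 0 v = v"
  by (simp_all add: ecr_def ean_def)

lemma ecr_neg: "r < 0 \<Longrightarrow> ecr l r v = 0" and ean_neg: "q < 0 \<Longrightarrow> ean l q v = 0"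
  by (simp_all add: ecr_def ean_def)

text \<open>For positive \<open>k\<close> the mode \<open>a_k\<close> acts as \<open>k\<close> times
  the derivative with respect to \<open>a_(-k)\<close>, and the exponent is linear in
  \<open>a_(-k)\<close> with coefficient \<open>l / k\<close>; all other modes commute with the
  creating exponential.\<close>

lemma heis_ecr: "heis k (ecr l r v) = ecr l r (heis k v) + (if k > 0 then vscale (of_int l) (ecr l (r - k) v) else 0)"
proof (cases "r < 0")
  case True
  then show ?thesis by (simp add: ecr_neg lin_zero)
next
  case r: False
  show ?thesis
  proof (cases "k > 0")
    case True
    have b: "heis k (vscale (of_int l) (heis (- int j) v)) = vscale (of_int l) (heis (- int j) (heis k v))
       + (if j = nat k then vscale (of_nat (nat k) * of_int l) v else 0)" for j v
      using True by (auto simp: lin_scale heis_comm[of k "- int j"] free.scale_right_distrib mult.commute)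
    have "heis k (exp_coeff (\<lambda>k w. vscale (of_int l) (heis (- int k) w)) (nat r) v) =
      exp_coeff (\<lambda>k w. vscale (of_int l) (heis (- int k) w)) (nat r) (heis k v) +
      (if nat k \<le> nat r then vscale (of_int l) (exp_coeff (\<lambda>k w. vscale (of_int l) (heis (- int k) w)) (nat r - nat k) v) else 0)"
      using True by (intro ecr_derivation b lin_heis) auto
    moreover have "nat r - nat k = nat (r - k)" "(nat k \<le> nat r) = (\<not> r - k < 0)" using True r by auto
    ultimately show ?thesis using True r by (simp only: ecr_def if_True if_False not_False_eq_True) simp
  next
    case False
    have "heis k (vscale (of_int l) (heis (- int j) v)) = vscale (of_int l) (heis (- int j) (heis k v))" if "j \<ge> 1" for j v
      using False that by (simp add: lin_scale heis_comm'[of k "- int j"])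
    then have "heis k (exp_coeff (\<lambda>k w. vscale (of_int l) (heis (- int k) w)) (nat r) v) =
      exp_coeff (\<lambda>k w. vscale (of_int l) (heis (- int k) w)) (nat r) (heis k v)"
      by (intro ecr_commute lin_heis) auto
    then show ?thesis using False r by (simp add: ecr_def)
  qed
qed

lemma heis_ean: "heis k (ean l q v) = ean l q (heis k v) + (if k < 0 then vscale (of_int l) (ean l (q + k) v) else 0)"
proof (cases "q < 0")
  case True
  then show ?thesis by (simp add: ean_neg lin_zero)
next
  case r: False
  show ?thesis
  proof (cases "k < 0")
    case True
    have b: "heis k (vscale (- of_int l) (heis (int j) v)) = vscale (- of_int l) (heis (int j) (heis k v))
       + (if j = nat (- k) then vscale (of_nat (nat (- k)) * of_int l) v else 0)" for j v
      using True by (auto simp: lin_scale lin_uminus heis_comm[of k "int j"] free.scale_right_distrib mult.commute)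
    have "heis k (exp_coeff (\<lambda>k w. vscale (- of_int l) (heis (int k) w)) (nat q) v) =
      exp_coeff (\<lambda>k w. vscale (- of_int l) (heis (int k) w)) (nat q) (heis k v) +
      (if nat (- k) \<le> nat q then vscale (of_int l) (exp_coeff (\<lambda>k w. vscale (- of_int l) (heis (int k) w)) (nat q - nat (- k)) v) else 0)"
      using True by (intro ean_derivation b lin_heis) auto
    moreover have "nat q - nat (- k) = nat (q + k)" "(nat (- k) \<le> nat q) = (\<not> q + k < 0)" using True r by auto
    ultimately show ?thesis using True r by (simp only: ean_def if_True if_False not_False_eq_True) simp
  next
    case False
    have "heis k (vscale (- of_int l) (heis (int j) v)) = vscale (- of_int l) (heis (int j) (heis k v))" if "j \<ge> 1" for j v
      using False that by (simp add: lin_scale lin_uminus heis_comm'[of k "int j"])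
    then have "heis k (exp_coeff (\<lambda>k w. vscale (- of_int l) (heis (int k) w)) (nat q) v) =
      exp_coeff (\<lambda>k w. vscale (- of_int l) (heis (int k) w)) (nat q) (heis k v)"
      by (intro ean_commute lin_heis) auto
    then show ?thesis using False r by (simp add: ean_def)
  qed
qed

lemma ean_exp_basis: "q \<noteq> 0 \<Longrightarrow> ean l q (exp_basis L) = 0"
proof -
  have "exp_coeff (\<lambda>k w. vscale (- of_int l) (heis (int k) w)) q (exp_basis L) = 0" if "q \<noteq> 0" for q
    using that
  proof (induction q rule: less_induct)
    case (less q)
    have "vscale (of_nat q) (exp_coeff (\<lambda>k w. vscale (- of_int l) (heis (int k) w)) q (exp_basis L)) = 0"
      unfolding ean_rec
    proof (intro sum.neutral ballI)
      fix k assume k: "k \<in> {1..q}"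
      show "vscale (- of_int l) (heis (int k) (exp_coeff (\<lambda>k w. vscale (- of_int l) (heis (int k) w)) (q - k) (exp_basis L))) = 0"
        using k less.IH[of "q - k"] by (cases "k = q") (auto simp: heis_exp_basis lin_zero)
    qed
    then show ?case using less.prems by simp
  qed
  then show "q \<noteq> 0 \<Longrightarrow> ?thesis" by (auto simp: ean_def)
qed

text \<open>On exponential vectors only degree 0 survives, and pulling one creator
  \<open>a_(-k-1)\<close> out of the argument delays the vanishing by at most
  \<open>k + 1\<close>.\<close>

lemma field_ean: "is_field (ean l)"
proof (rule is_fieldI)
  fix b :: boson_label
  have "\<exists>N. \<forall>m\<ge>N. ean l m (basis_vec (M, L)) = 0" for M L
  proof (induction M)
    case empty
    then show ?case by (intro exI[of _ 1]) (auto simp: ean_exp_basis)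
  next
    case (add k M)
    then obtain N where N: "\<forall>m\<ge>N. ean l m (basis_vec (M, L)) = 0" by blast
    have "ean l m (basis_vec (add_mset k M, L)) = 0" if "m \<ge> N + int k + 1" for m
      using heis_ean[of "- int k - 1" l m "basis_vec (M, L)"] N that
      by (simp add: heis_create lin_zero)
    then show ?case by blast
  qed
  then show "\<exists>N. \<forall>m\<ge>N. ean l m (basis_vec b) = 0" by (cases b) simp
qed simp

text \<open>The vertex operator stripped of its zero-mode part: \<open>n\<close> is the excess of
  annihilating over creating degree, and both the shift of the charge and the factor
  \<open>z^(l a_0)\<close> are left to \<open>exp_field_charge\<close>.\<close>

definition vop :: "int \<Rightarrow> int \<Rightarrow> boson_label vec \<Rightarrow> boson_label vec" where
  "vop l n w = Sum_any (\<lambda>q :: int. ecr l (q - n) (ean l q w))"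

lemma vop_finite: "finite {q. ecr l (q - n) (ean l q w) \<noteq> 0}"
proof -
  obtain N where N: "\<And>m. m \<ge> N \<Longrightarrow> ean l m w = 0" by (rule is_fieldE[OF field_ean, of l w]) blast
  have "{q. ecr l (q - n) (ean l q w) \<noteq> 0} \<subseteq> {0..N}"
  proof
    fix q assume "q \<in> {q. ecr l (q - n) (ean l q w) \<noteq> 0}"
    then have "ean l q w \<noteq> 0" by (auto simp: lin_zero)
    then have "\<not> q < 0" "\<not> q \<ge> N" using N ean_neg by blast+
    then show "q \<in> {0..N}" by auto
  qed
  then show ?thesis by (rule finite_subset) simp
qed

lemma lin_vop: "lin (vop l n)"
proof (rule linI)
  show "vop l n (u + v) = vop l n u + vop l n v" for u v
    unfolding vop_def by (simp only: lin_add[OF lin_ecr] lin_add[OF lin_ean] Sum_any.distrib[OF vop_finite vop_finite])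
  show "vop l n (vscale c v) = vscale c (vop l n v)" for c v
    unfolding vop_def by (simp only: lin_scale[OF lin_ecr] lin_scale[OF lin_ean] Sum_any_lin[OF lin_vscale_self vop_finite])
qed

lemma Sum_any_shift: "Sum_any (\<lambda>q :: int. f (q + k)) = Sum_any f"
proof -
  have "bij (\<lambda>q :: int. q + k)" by (rule o_bij[of "\<lambda>q. q - k"]) auto
  then show ?thesis by (rule Sum_any.reindex_cong[symmetric]) (simp add: comp_def)
qed

lemma Collect_shift: "{q :: int. P (q + k)} = (\<lambda>q. q - k) ` {q. P q}"
proof (intro equalityI subsetI)
  fix q assume "q \<in> {q. P (q + k)}"
  then show "q \<in> (\<lambda>q. q - k) ` {q. P q}" by (intro image_eqI[of _ _ "q + k"]) auto
qed auto

lemma heis_vop: "heis k (vop l n w) = vop l n (heis k w) + (if k = 0 then 0 else vscale (of_int l) (vop l (n + k) w))"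
proof -
  have "heis k (vop l n w) = Sum_any (\<lambda>q. heis k (ecr l (q - n) (ean l q w)))"
    unfolding vop_def by (rule Sum_any_lin[OF lin_heis vop_finite])
  also have "\<dots> = Sum_any (\<lambda>q. ecr l (q - n) (ean l q (heis k w)) +
     (if k = 0 then 0 else if k > 0 then vscale (of_int l) (ecr l (q - (n + k)) (ean l q w))
       else vscale (of_int l) (ecr l (q - n) (ean l (q + k) w))))"
  proof (rule arg_cong[where f = Sum_any], rule ext)
    fix q
    have 1: "q - n - k = q - (n + k)" by simp
    show "heis k (ecr l (q - n) (ean l q w)) = ecr l (q - n) (ean l q (heis k w)) +
     (if k = 0 then 0 else if k > 0 then vscale (of_int l) (ecr l (q - (n + k)) (ean l q w))
       else vscale (of_int l) (ecr l (q - n) (ean l (q + k) w)))"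
      unfolding heis_ecr heis_ean 1 by (simp add: lin_add lin_scale lin_zero)
  qed
  also have "\<dots> = vop l n (heis k w) + (if k = 0 then 0 else vscale (of_int l) (vop l (n + k) w))"
  proof -
    consider "k = 0" | "k > 0" | "k < 0" by linarith
    then show ?thesis
    proof cases
      case 2
      have "finite {q. vscale (of_int l) (ecr l (q - (n + k)) (ean l q w)) \<noteq> 0}"
        by (rule finite_subset[OF _ vop_finite[of l "n + k" w]]) auto
      then show ?thesis using 2
        by (simp add: Sum_any.distrib vop_finite Sum_any_lin[OF lin_vscale_self vop_finite, symmetric] vop_def)
    next
      case 3
      \<comment> \<open>A negative mode shifts the annihilating index instead of the creating one;
        reindexing by \<open>k\<close> brings this to the common form
        \<open>vop l (n + k)\<close>.\<close>
      have e: "ecr l (q - n) (ean l (q + k) w) = ecr l (q + k - (n + k)) (ean l (q + k) w)" for q by simp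
      let ?g = "\<lambda>q. vscale (of_int l) (ecr l (q - (n + k)) (ean l q w))"
      have f: "finite {q. ?g q \<noteq> 0}"
        by (rule finite_subset[OF _ vop_finite[of l "n + k" w]]) auto
      have "{q. ?g (q + k) \<noteq> 0} = (\<lambda>q. q - k) ` {q. ?g q \<noteq> 0}"
        by (rule Collect_shift)
      then have f': "finite {q. ?g (q + k) \<noteq> 0}" using f by simp
      have "Sum_any (\<lambda>q. ecr l (q - n) (ean l q (heis k w)) + ?g (q + k)) = vop l n (heis k w) + Sum_any ?g"
        unfolding Sum_any.distrib[OF vop_finite f'] Sum_any_shift[of ?g] by (simp add: vop_def)
      moreover have "Sum_any ?g = vscale (of_int l) (vop l (n + k) w)"
        unfolding vop_def by (rule Sum_any_lin[OF lin_vscale_self vop_finite, symmetric])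
      ultimately show ?thesis using 3 unfolding e by simp
    qed (simp add: vop_def)
  qed
  finally show ?thesis .
qed

lemma vop_exp_basis: "vop l n (exp_basis L) = ecr l (- n) (exp_basis L)"
proof -
  have "vop l n (exp_basis L) = (\<Sum>q\<in>{0}. ecr l (q - n) (ean l q (exp_basis L)))"
    unfolding vop_def
  proof (rule Sum_any.expand_superset)
    show "{q. ecr l (q - n) (ean l q (exp_basis L)) \<noteq> 0} \<subseteq> {0}"
      using ean_exp_basis by (force simp: lin_zero)
  qed simp
  then show ?thesis by simp
qed

lemma lookup_ecr_top: "lookup (ecr l r x) ({#}, L) = (if r = 0 then lookup x ({#}, L) else 0)"
proof -
  have "lookup (exp_coeff (\<lambda>k w. vscale (of_int l) (heis (- int k) w)) r x) ({#}, L) = 0" if "r \<noteq> 0" for r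
  proof -
    let ?e = "exp_coeff (\<lambda>k w. vscale (of_int l) (heis (- int k) w))"
    have "of_nat r * lookup (?e r x) ({#}, L) = lookup (vscale (of_nat r) (?e r x)) ({#}, L)"
      by (simp add: lookup_vscale)
    also have "\<dots> = 0"
      unfolding ecr_rec lookup_sum by (intro sum.neutral) (auto simp: lookup_vscale lookup_heis_create_top)
    finally show ?thesis using that by simp
  qed
  then show ?thesis by (auto simp: ecr_def)
qed

text \<open>Creating exponentials of positive degree have no vacuum component, so only
  \<open>q = n\<close> contributes.\<close>

lemma lookup_vop_top: "lookup (vop l n w) ({#}, L) = lookup (ean l n w) ({#}, L)"
proof -
  let ?S = "{q. ecr l (q - n) (ean l q w) \<noteq> 0} \<union> {n}"
  have f: "finite ?S" using vop_finite by simp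
  have "vop l n w = (\<Sum>q\<in>?S. ecr l (q - n) (ean l q w))"
    unfolding vop_def by (rule Sum_any.expand_superset[OF f]) auto
  then have "lookup (vop l n w) ({#}, L) = (\<Sum>q\<in>?S. if q = n then lookup (ean l n w) ({#}, L) else 0)"
    unfolding lookup_sum[symmetric] by (simp add: lookup_sum lookup_ecr_top cong: if_cong)
  then show ?thesis using f by simp
qed

definition shift :: "int \<Rightarrow> boson_label vec \<Rightarrow> boson_label vec" where
  "shift l = lin_ext (\<lambda>(M, l'). basis_vec (M, l + l'))"

lemma lin_shift [simp]: "lin (shift l)"
  by (simp add: shift_def)

lemma shift_basis: "shift l (basis_vec (M, l')) = basis_vec (M, l + l')"
  by (simp add: shift_def)

lemma shift_heis: "k \<noteq> 0 \<Longrightarrow> shift l (heis k v) = heis k (shift l v)"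
proof -
  assume k: "k \<noteq> 0"
  show ?thesis
  proof (rule lin_eqI[where f = "\<lambda>v. shift l (heis k v)" and g = "\<lambda>v. heis k (shift l v)"])
    show "lin (\<lambda>v. shift l (heis k v))" "lin (\<lambda>v. heis k (shift l v))"
      by (rule lin_comp[OF lin_shift lin_heis], rule lin_comp[OF lin_heis lin_shift])
    fix b
    show "shift l (heis k (basis_vec b)) = heis k (shift l (basis_vec b))"
      using k by (cases b) (auto simp: heis_basis_vec heis_basis_def shift_basis lin_scale)
  qed
qed

lemma shift_ecr: "shift l (ecr m r v) = ecr m r (shift l v)"
proof -
  have "shift l (exp_coeff (\<lambda>k w. vscale (of_int m) (heis (- int k) w)) r v) =
      exp_coeff (\<lambda>k w. vscale (of_int m) (heis (- int k) w)) r (shift l v)" for r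
    by (intro ecr_commute lin_shift) (simp add: lin_scale shift_heis)
  then show ?thesis by (simp add: ecr_def lin_zero)
qed

lemma lin_exp_field [simp]: "lin (exp_field l m)"
  by (simp add: exp_field_def)

text \<open>The condition on \<open>(r, q)\<close> fixes \<open>r = q - (m + 1 + l * l')\<close>, so
  the double sum is a sum over \<open>q\<close>. Negative values of \<open>r\<close> are excluded by
  the type on one side and give 0 through \<open>ecr\<close> on the other.\<close>

lemma exp_field_basis: "exp_field l m (basis_vec (M, l')) = vop l (m + 1 + l * l') (basis_vec (M, l + l'))"
proof -
  let ?w = "basis_vec (M, l + l')" and ?n = "m + 1 + l * l'"
  let ?c = "exp_coeff (\<lambda>k w. vscale (of_int l) (heis (- int k) w))"
  let ?a = "exp_coeff (\<lambda>k w. vscale (- of_int l) (heis (int k) w))"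
  let ?F = "\<lambda>(r :: nat, q :: nat). ?c r (?a q ?w) when l * l' + int r - int q = - m - 1"
  obtain N where N: "\<And>q. q \<ge> N \<Longrightarrow> ean l q ?w = 0" by (rule is_fieldE[OF field_ean, of l ?w]) blast
  define A where "A = {q. q < nat N \<and> int q \<ge> ?n}"
  have A: "finite A" by (simp add: A_def)
  have aN: "?a q ?w = 0" if "\<not> q < nat N" for q
    using N[of "int q"] that by (auto simp: ean_def)
  have lc: "lin (?c r)" for r by (rule lin_exp_coeff) (rule lin_ops)
  have "exp_field l m (basis_vec (M, l')) = Sum_any ?F"
    by (simp add: exp_field_def)
  also have "\<dots> = sum ?F ((\<lambda>q. (nat (int q - ?n), q)) ` A)"
  proof (rule Sum_any.expand_superset)
    show "{x. ?F x \<noteq> 0} \<subseteq> (\<lambda>q. (nat (int q - ?n), q)) ` A"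
    proof
      fix x assume "x \<in> {x. ?F x \<noteq> 0}"
      then obtain r q where x: "x = (r, q)" "?c r (?a q ?w) \<noteq> 0" "l * l' + int r - int q = - m - 1"
        by (cases x) (auto simp: when_def split: if_splits)
      then have "?a q ?w \<noteq> 0" using lin_zero[OF lc] by metis
      then have "q \<in> A" using aN x(3) by (auto simp: A_def)
      moreover have "r = nat (int q - ?n)" using x(3) by auto
      ultimately show "x \<in> (\<lambda>q. (nat (int q - ?n), q)) ` A" using x(1) by blast
    qed
  qed (simp add: A)
  also have "\<dots> = (\<Sum>q\<in>A. ?c (nat (int q - ?n)) (?a q ?w))"
    by (subst sum.reindex) (auto simp: inj_on_def A_def when_def intro!: sum.cong)
  also have "\<dots> = (\<Sum>q\<in>A. ecr l (int q - ?n) (ean l (int q) ?w))"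
    by (intro sum.cong) (auto simp: A_def ecr_def ean_def)
  also have "\<dots> = (\<Sum>q\<in>int ` A. ecr l (q - ?n) (ean l q ?w))"
    by (subst sum.reindex) auto
  also have "\<dots> = vop l ?n ?w"
    unfolding vop_def
  proof (rule Sum_any.expand_superset[symmetric])
    show "{q. ecr l (q - ?n) (ean l q ?w) \<noteq> 0} \<subseteq> int ` A"
    proof
      fix q assume q: "q \<in> {q. ecr l (q - ?n) (ean l q ?w) \<noteq> 0}"
      then have "ean l q ?w \<noteq> 0" by (auto simp: lin_zero)
      then have "\<not> q < 0" "\<not> q \<ge> N" using N ean_neg by blast+
      moreover have "\<not> q - ?n < 0" using q ecr_neg[of "q - ?n" l] by fastforce
      ultimately have "nat q \<in> A" "q = int (nat q)" by (auto simp: A_def)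
      then show "q \<in> int ` A" by blast
    qed
  qed (simp add: A)
  finally show ?thesis .
qed

lemma exp_field_charge:
  assumes "keys v \<subseteq> {b. snd b = l'}"
  shows "exp_field l m v = vop l (m + 1 + l * l') (shift l v)"
proof (rule lin_eqI[where g = "\<lambda>v. vop l (m + 1 + l * l') (shift l v)"])
  show "lin (\<lambda>v. vop l (m + 1 + l * l') (shift l v))" by (rule lin_comp[OF lin_vop lin_shift])
  fix b assume "b \<in> keys v"
  then obtain M where "b = (M, l')" using assms by (cases b) auto
  then show "exp_field l m (basis_vec b) = vop l (m + 1 + l * l') (shift l (basis_vec b))"
    by (simp add: exp_field_basis shift_basis)
qed simp

lemma charged_basis: "charged d f \<Longrightarrow> keys (f (basis_vec (M, l))) \<subseteq> {b. snd b = l + d}"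
  unfolding charged_def by simp

text \<open>For nonzero \<open>k\<close> the correction comes from \<open>heis_vop\<close>, for
  \<open>k = 0\<close> from the shift of the charge; the zero mode included in
  \<open>exp_field\<close> makes the formula uniform.\<close>

lemma heis_exp_field: "heis k (exp_field l m v) = exp_field l m (heis k v) + vscale (of_int l) (exp_field l (m + k) v)"
proof (rule lin_eqI[where f = "\<lambda>v. heis k (exp_field l m v)" and g = "\<lambda>v. exp_field l m (heis k v) + vscale (of_int l) (exp_field l (m + k) v)"])
  show "lin (\<lambda>v. heis k (exp_field l m v))"
    by (rule lin_comp) simp_all
  show "lin (\<lambda>v. exp_field l m (heis k v) + vscale (of_int l) (exp_field l (m + k) v))"
    by (rule lin_plus, rule lin_comp[OF lin_exp_field lin_heis], rule lin_vscale, rule lin_exp_field)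
  fix b :: boson_label
  obtain M l' where b: "b = (M, l')" by (cases b)
  have "keys (heis k (basis_vec (M, l'))) \<subseteq> {b. snd b = l'}"
    using charged_basis[OF charged_heis[of k], of M l'] by simp
  note eh = exp_field_charge[OF this, of l m]
  show "heis k (exp_field l m (basis_vec b)) = exp_field l m (heis k (basis_vec b)) + vscale (of_int l) (exp_field l (m + k) (basis_vec b))"
  proof (cases "k = 0")
    case True
    have "heis 0 (basis_vec (M, L)) = vscale (of_int L) (basis_vec (M, L))" for L
      by (simp add: heis_basis_vec heis_basis_def)
    then show ?thesis unfolding b True
      by (simp add: exp_field_basis heis_vop lin_scale[OF lin_vop] lin_add[OF lin_vop] lin_scale[OF lin_exp_field] free.scale_left_distrib add.commute)
  next
    case False
    have n: "m + k + 1 + l * l' = m + 1 + l * l' + k" by simp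
    from False show ?thesis unfolding b eh exp_field_basis heis_vop shift_heis[OF False] shift_basis n by simp
  qed
qed

lemma exp_field_exp_basis: "exp_field l m (exp_basis L) = ecr l (- m - 1 - l * L) (exp_basis (l + L))"
proof -
  have "- (m + 1 + l * L) = - m - 1 - l * L" by simp
  then show ?thesis by (simp only: exp_field_basis vop_exp_basis)
qed

lemma field_exp: "is_field (exp_field l)"
proof (rule is_fieldI)
  fix b :: boson_label
  obtain M l' where b: "b = (M, l')" by (cases b)
  obtain N where N: "\<And>q. q \<ge> N \<Longrightarrow> ean l q (basis_vec (M, l + l')) = 0"
    by (rule is_fieldE[OF field_ean, of l "basis_vec (M, l + l')"]) blast
  have "exp_field l m (basis_vec b) = 0" if "m \<ge> N - l * l'" for m
  proof -
    have "ecr l (q - (m + 1 + l * l')) (ean l q (basis_vec (M, l + l'))) = 0" for q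
      using that N[of q] by (cases "q \<ge> N") (auto simp: lin_zero intro!: ecr_neg)
    then show ?thesis by (simp add: b exp_field_basis vop_def)
  qed
  then show "\<exists>N. \<forall>m\<ge>N. exp_field l m (basis_vec b) = 0" by blast
qed simp

lemma charge_from_heis_zero:
  assumes "heis 0 v = vscale (of_int l) v"
  shows "keys v \<subseteq> {b. snd b = l}"
proof
  fix b assume b: "b \<in> keys v"
  have "lookup (heis 0 v) b = (\<Sum>b'\<in>keys v. if b' = b then lookup v b * of_int (snd b) else 0)"
    unfolding heis_def lookup_lin_ext
    by (intro sum.cong) (auto simp: heis_basis_def lookup_vscale lookup_basis_vec split_def)
  then have "lookup (heis 0 v) b = lookup v b * of_int (snd b)"
    using b by simp
  then have "of_int l * lookup v b = lookup v b * of_int (snd b)"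
    unfolding assms lookup_vscale .
  moreover have "lookup v b \<noteq> 0" using b unfolding in_keys_iff .
  ultimately have "of_int (snd b) = (of_int l :: complex)" by (simp add: mult.commute)
  then show "b \<in> {b. snd b = l}" by simp
qed

lemma charged_exp_field: "charged l (exp_field l m)"
proof (rule charged_linI)
  fix b
  have "heis 0 (basis_vec b) = vscale (of_int (snd b)) (basis_vec b)" by (rule heis_zero) simp
  then have "heis 0 (exp_field l m (basis_vec b)) = vscale (of_int (snd b + l)) (exp_field l m (basis_vec b))"
    by (simp add: heis_exp_field lin_scale free.scale_left_distrib)
  then show "keys (exp_field l m (basis_vec b)) \<subseteq> {c. snd c = snd b + l}"
    by (rule charge_from_heis_zero)
qed simp

section \<open>Two-point functions of exponentials and their locality\<close>

definition bint :: "int \<Rightarrow> int \<Rightarrow> complex" where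
  "bint K r = (if r < 0 then 0 else bco K (nat r))"

lemma bint_pascal: "bint (K + 1) r = bint K r - bint K (r - 1)"
proof (cases "r \<le> 0")
  case True
  then show ?thesis by (cases "r = 0") (auto simp: bint_def)
next
  case False
  then obtain j where "r = int (Suc j)" by (metis Suc_pred' not_le nat_0_le zero_less_nat_eq order_less_imp_le)
  then show ?thesis by (auto simp: bint_def bco_Suc nat_add_distrib nat_diff_distrib)
qed

lemma bco_lower_sum: "of_int K * (\<Sum>j<r. bco K j) = - (of_nat r * bco K r)"
proof (induction r)
  case (Suc r)
  have "of_int K * (\<Sum>j<Suc r. bco K j) = - (of_nat r * bco K r) + of_int K * bco K r"
    using Suc by (simp add: distrib_left)
  also have "\<dots> = - ((of_nat r - of_int K) * bco K r)" by (simp add: algebra_simps)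
  finally show ?case unfolding bco_absorb .
qed simp

text \<open>Moving the annihilating exponential past the creating one produces the scalar series
  \<open>(1 - x)^(l m)\<close>. The proof compares recursions in the degree, with the sum of lower
  coefficients evaluated by \<open>bco_lower_sum\<close>.\<close>

lemma lookup_pairing:
  "lookup (ean l s (ecr m r (exp_basis L0))) ({#}, L) = (if L = L0 \<and> s = r then bint (l * m) r else 0)"
proof (cases "r < 0")
  case True
  then show ?thesis by (simp add: ecr_neg lin_zero bint_def)
next
  case False
  let ?e = "exp_coeff (\<lambda>k w. vscale (of_int m) (heis (- int k) w))"
  have "lookup (ean l s (?e r (exp_basis L0))) ({#}, L) = (if L = L0 \<and> s = int r then bco (l * m) r else 0)" for r s
  proof (induction r arbitrary: s rule: less_induct)
    case (less r)
    show ?case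
    proof (cases "r = 0")
      case True
      then show ?thesis by (cases "s = 0") (auto simp: ean_exp_basis lookup_basis_vec)
    next
      case r: False
      have h: "ean l s (heis (- int k) x) = heis (- int k) (ean l s x) - vscale (of_int l) (ean l (s - int k) x)" if "k \<ge> 1" for k x
        using heis_ean[of "- int k" l s x] that by simp
      have "of_nat r * lookup (ean l s (?e r (exp_basis L0))) ({#}, L)
        = lookup (ean l s (vscale (of_nat r) (?e r (exp_basis L0)))) ({#}, L)"
        by (simp add: lin_scale lookup_vscale)
      also have "\<dots> = (\<Sum>k=1..r. of_int m * lookup (ean l s (heis (- int k) (?e (r - k) (exp_basis L0)))) ({#}, L))"
        unfolding ecr_rec by (simp add: lin_sum lin_scale lookup_sum lookup_vscale)
      also have "\<dots> = (\<Sum>k=1..r. if L = L0 \<and> s = int r then - (of_int (l * m) * bco (l * m) (r - k)) else 0)"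
      proof (intro sum.cong refl)
        fix k assume k: "k \<in> {1..r}"
        then have "k \<ge> 1" "r - k < r" by auto
        then show "of_int m * lookup (ean l s (heis (- int k) (?e (r - k) (exp_basis L0)))) ({#}, L) =
          (if L = L0 \<and> s = int r then - (of_int (l * m) * bco (l * m) (r - k)) else 0)"
          using k by (auto simp: h less.IH lookup_minus lookup_vscale lookup_heis_create_top of_nat_diff)
      qed
      also have "\<dots> = (if L = L0 \<and> s = int r then - (of_int (l * m) * (\<Sum>k=1..r. bco (l * m) (r - k))) else 0)"
        by (cases "L = L0 \<and> s = int r") (simp_all only: simp_thms if_True if_False sum.neutral_const sum_distrib_left sum_negf)
      also have "(\<Sum>k=1..r. bco (l * m) (r - k)) = (\<Sum>j<r. bco (l * m) j)"
        by (rule sum.reindex_bij_witness[of _ "\<lambda>j. r - j" "\<lambda>k. r - k"]) auto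
      finally have "of_nat r * lookup (ean l s (?e r (exp_basis L0))) ({#}, L) =
          of_nat r * (if L = L0 \<and> s = int r then bco (l * m) r else 0)"
        unfolding bco_lower_sum by (simp only: minus_minus if_distrib mult_zero_right)
      moreover have "of_nat r \<noteq> (0 :: complex)" using r by simp
      ultimately show ?thesis by (simp only: mult_left_cancel simp_thms)
    qed
  qed
  from this[of s "nat r"] False show ?thesis by (simp add: ecr_def bint_def)
qed

text \<open>These are the coefficients of \<open>z^(l l') w^(m l') (z - w)^(l m)\<close> expanded
  for |z| > |w|.\<close>

lemma lookup_exp_exp:
  "lookup (exp_field l p (exp_field m q (exp_basis l'))) ({#}, L) =
    (if L = l + m + l' \<and> p + q + 2 + l * l' + m * l' + l * m = 0 then bint (l * m) (- q - 1 - m * l') else 0)"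
proof -
  have "keys (exp_field m q (exp_basis l')) \<subseteq> {b. snd b = l' + m}"
    using charged_exp_field by (rule charged_basis)
  then have "exp_field l p (exp_field m q (exp_basis l')) = vop l (p + 1 + l * (l' + m)) (shift l (exp_field m q (exp_basis l')))"
    by (rule exp_field_charge)
  also have "shift l (exp_field m q (exp_basis l')) = ecr m (- q - 1 - m * l') (exp_basis (l + m + l'))"
    by (simp add: exp_field_exp_basis shift_ecr shift_basis add.assoc)
  finally show ?thesis
    by (simp add: lookup_vop_top lookup_pairing) (auto simp: algebra_simps)
qed

lemma lookup_exp_field_top:
  "lookup (exp_field l m (exp_basis l')) ({#}, L) = (if m + 1 + l * l' = 0 \<and> L = l + l' then 1 else 0)"
  by (auto simp: exp_field_exp_basis lookup_ecr_top lookup_basis_vec)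

text \<open>The defects \<open>D m\<close> commute with Heisenberg modes up to other members of the
  family, so \<open>heis_family_zero\<close> reduces the claim to vacuum matrix elements.\<close>

lemma covariant_exp_field: "covariant transl (exp_field l)"
proof -
  define D where "D m v = transl (exp_field l m v) - exp_field l m (transl v) + vscale (of_int m) (exp_field l (m - 1) v)" for m v
  have "D m v = 0" for m v
  proof (rule heis_family_zero[where D = D])
    show "lin (D m)" for m
      unfolding D_def[abs_def]
      by (rule lin_plus, rule lin_minus, rule lin_comp[OF lin_transl lin_exp_field],
          rule lin_comp[OF lin_exp_field lin_transl], rule lin_vscale, rule lin_exp_field)
    have hT: "heis k (transl x) = transl (heis k x) + vscale (of_int k) (heis (k - 1) x)" for k x
      using covariant_heis unfolding covariant_def by (metis diff_add_cancel)
    show "\<exists>cs. \<forall>v. heis k (D m v) = D m (heis k v) + (\<Sum>(c, j)\<leftarrow>cs. vscale c (D j v))" for m k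
    proof (intro exI allI)
      fix v
      have i: "m - 1 + k = m + k - 1" "m + (k - 1) = m + k - 1" by simp_all
      show "heis k (D m v) = D m (heis k v) + (\<Sum>(c, j)\<leftarrow>[(of_int l, m + k)]. vscale c (D j v))"
        unfolding D_def
        by (simp add: lin_add[OF lin_heis] lin_diff[OF lin_heis] lin_scale[OF lin_heis] hT heis_exp_field i
            lin_add[OF lin_transl] lin_scale[OF lin_transl] lin_add[OF lin_exp_field] lin_scale[OF lin_exp_field] algebra_simps)
    qed
    show "lookup (D m (exp_basis l')) ({#}, L) = 0" for m l' L
    proof -
      have fa: "exp_field l m (heis (-1) (exp_basis l')) = heis (-1) (exp_field l m (exp_basis l')) - vscale (of_int l) (exp_field l (m - 1) (exp_basis l'))"
        using heis_exp_field[of "-1" l m "exp_basis l'"] by simp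
      have "lookup (exp_field l m (heis (-1) (exp_basis l'))) ({#}, L) =
          - of_int l * lookup (exp_field l (m - 1) (exp_basis l')) ({#}, L)"
        unfolding fa by (simp add: lookup_minus lookup_vscale lookup_heis_create_top)
      then have "lookup (D m (exp_basis l')) ({#}, L) =
          of_int (l * l' + m) * lookup (exp_field l (m - 1) (exp_basis l')) ({#}, L)"
        by (simp add: D_def lookup_add lookup_minus lookup_transl_top lookup_vscale transl_exp_basis lin_scale[OF lin_exp_field]
            lookup_heis_create_top algebra_simps)
      \<comment> \<open>The remaining matrix element is nonzero only if
        \<open>m + l * l' = 0\<close>, and there the factor vanishes.\<close>
      also have "\<dots> = 0"
      proof (cases "l * l' + m = 0")
        case False
        then show ?thesis by (simp add: lookup_exp_field_top)
      qed simp
      finally show ?thesis .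
    qed
  qed
  then have "transl (exp_field l m v) = exp_field l m (transl v) - vscale (of_int m) (exp_field l (m - 1) v)" for m v
  proof -
    have "a - b + c = 0 \<Longrightarrow> a = b - c" for a b c :: "boson_label vec" by (simp add: algebra_simps)
    then show ?thesis using \<open>\<And>v m. D m v = 0\<close> unfolding D_def by blast
  qed
  then show ?thesis unfolding covariant_def by blast
qed

lemma creates_exp_field: "creates (exp_basis 0) (exp_field l) (exp_basis l)"
  unfolding creates_def by (auto simp: exp_field_exp_basis ecr_neg)

lemma exp_field_0: "exp_field 0 = id_field"
proof (intro ext)
  fix m v
  have e: "exp_coeff (\<lambda>k w. 0) r x = (if r = 0 then x else 0)" for r and x :: "boson_label vec"
  proof (cases "r = 0")
    case False
    have "vscale (of_nat r) (exp_coeff (\<lambda>k w. 0) r x) = 0"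
      by (subst exp_coeff_rec) (auto simp: lin_const_zero)
    then show ?thesis using False by simp
  qed simp
  have ee: "ecr 0 r x = (if r = 0 then x else 0)" "ean 0 r x = (if r = 0 then x else 0)" for r x
    by (auto simp: ecr_def ean_def e)
  have "vop 0 n x = (if n = 0 then x else 0)" for n x
  proof -
    have "vop 0 n x = (\<Sum>q\<in>{0}. ecr 0 (q - n) (ean 0 q x))"
      unfolding vop_def by (rule Sum_any.expand_superset) (auto simp: ee split: if_splits)
    then show ?thesis by (simp add: ee)
  qed
  then have "exp_field 0 m (basis_vec b) = id_field m (basis_vec b)" for b
    by (cases b) (auto simp: exp_field_basis id_field_def when_def)
  moreover have "lin (id_field m :: boson_label vec \<Rightarrow> _)" by (auto simp: id_field_def when_def intro!: linI)
  ultimately show "exp_field 0 m v = id_field m v"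
    using lin_eqI[of "exp_field 0 m" "id_field m" v] by simp
qed

lemma mlocal_heis_exp: "mlocal 1 1 heis (exp_field l)"
  unfolding mlocal_def by (auto simp: dl_def fun_eq_iff heis_exp_field algebra_simps)

text \<open>Expansions of \<open>z\<^sup>A w\<^sup>B (z - w)\<^sup>K\<close> in the domains \<open>|z| > |w|\<close> and \<open>|w| > |z|\<close>.\<close>

definition expand1 :: "int \<Rightarrow> int \<Rightarrow> int \<Rightarrow> int \<Rightarrow> int \<Rightarrow> complex" where
  "expand1 A B K p q = (if p + q + 2 + A + B + K = 0 then bint K (- q - 1 - B) else 0)"

definition expand2 :: "int \<Rightarrow> int \<Rightarrow> int \<Rightarrow> int \<Rightarrow> int \<Rightarrow> complex" where
  "expand2 A B K p q = (if p + q + 2 + A + B + K = 0 then bint K (- p - 1 - A) else 0)"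

lemma dl_expand1: "(dl ^^ N) (expand1 A B K) = expand1 A B (K + int N)"
proof (induction N)
  case (Suc N)
  have "dl (expand1 A B L) = expand1 A B (L + 1)" for L
  proof (intro ext)
    fix p q
    have a: "- (q + 1) - 1 - B = - q - 1 - B - 1" by simp
    show "dl (expand1 A B L) p q = expand1 A B (L + 1) p q"
      unfolding dl_def expand1_def a bint_pascal by (auto simp: algebra_simps)
  qed
  then show ?case using Suc by (simp add: add_ac)
qed simp

lemma dl_expand2: "(dl ^^ N) (expand2 A B K) = (\<lambda>p q. (-1) ^ N * expand2 A B (K + int N) p q)"
proof (induction N)
  case (Suc N)
  have "dl (\<lambda>p q. c * expand2 A B L p q) = (\<lambda>p q. - c * expand2 A B (L + 1) p q)" for c L
  proof (intro ext)
    fix p q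
    have a: "- (p + 1) - 1 - A = - p - 1 - A - 1" by simp
    show "dl (\<lambda>p q. c * expand2 A B L p q) p q = - c * expand2 A B (L + 1) p q"
      unfolding dl_def expand2_def a bint_pascal by (auto simp: algebra_simps)
  qed
  then show ?case using Suc by (simp add: add_ac)
qed simp

lemma bint_nat: "bint (int n) r = (if 0 \<le> r \<and> r \<le> int n then (-1) ^ nat r * of_nat (n choose nat r) else 0)"
proof (cases "r < 0")
  case False
  have "bint (int n) r = (-1) ^ nat r * of_nat (n choose nat r)"
    using False by (simp add: bint_def bco_def binomial_gbinomial)
  moreover have "n choose nat r = 0" if "\<not> r \<le> int n" using that by (simp add: binomial_eq_0)
  ultimately show ?thesis using False by auto
qed (simp add: bint_def)

lemma bint_reflect: "bint (int n) (int n - r) = (-1) ^ n * bint (int n) r"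
proof (cases "0 \<le> r \<and> r \<le> int n")
  case True
  define j where "j = nat r"
  have j: "r = int j" "j \<le> n" using True by (auto simp: j_def)
  have "(-1 :: complex) ^ (n - j) = (-1) ^ n * (-1) ^ j"
    using j(2) by (metis (no_types, lifting) minus_one_power_iff even_diff_nat even_add mult.right_neutral mult_minus_left mult_minus_right nle_le not_less power_add)
  moreover have "nat (int n - int j) = n - j" by auto
  ultimately show ?thesis
    unfolding j bint_nat using j(2) by (simp add: binomial_symmetric[symmetric])
next
  case False
  then show ?thesis by (auto simp: bint_nat)
qed

text \<open>For \<open>K \<ge> 0\<close> both sides expand the same polynomial and the symmetry of
  binomial coefficients suffices. For negative \<open>K\<close>, multiplication by
  \<open>(z - w)^(-K)\<close> raises the exponent to 0, where both expansions are the same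
  monomial.\<close>

lemma expand_agree:
  "(dl ^^ nat (- K)) (\<lambda>p q. expand1 A B K p q - (-1) ^ nat \<bar>K\<bar> * expand2 A B K p q) = (\<lambda>p q. 0)"
proof -
  have d: "(dl ^^ N) (\<lambda>p q. F p q - c * G p q) = (\<lambda>p q. (dl ^^ N) F p q - c * (dl ^^ N) G p q)" for N c and F G :: "int \<Rightarrow> int \<Rightarrow> complex"
    by (induction N) (auto simp: dl_def fun_eq_iff algebra_simps)
  show ?thesis
  proof (cases "K \<ge> 0")
    case True
    define n where "n = nat K"
    have K: "K = int n" using True by (simp add: n_def)
    have "bint K (- q - 1 - B) = (-1) ^ n * bint K (- p - 1 - A)" if "p + q + 2 + A + B + K = 0" for p q
    proof -
      have "- q - 1 - B = int n - (- p - 1 - A)" using that K by linarith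
      then show ?thesis unfolding K by (simp only: bint_reflect)
    qed
    then show ?thesis using K by (auto simp: expand1_def expand2_def fun_eq_iff)
  next
    case False
    define n where "n = nat (- K)"
    have K: "K = - int n" using False by (simp add: n_def)
    have "bint 0 (- q - 1 - B) = bint 0 (- p - 1 - A)" if "p + q + 2 + A + B = 0" for p q
      using that by (auto simp: bint_def bco_zero_exp)
    then show ?thesis
      unfolding d dl_expand1 dl_expand2 unfolding K
      by (auto simp: expand1_def expand2_def fun_eq_iff simp flip: power_add mult.assoc)
  qed
qed

lemma dl_pow_shift:
  "(dl ^^ N) (\<lambda>p q. F (p + k) q) = (\<lambda>p q. (dl ^^ N) F (p + k) q)"
  "(dl ^^ N) (\<lambda>p q. F p (q + k)) = (\<lambda>p q. (dl ^^ N) F p (q + k))"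
  by (induction N) (auto simp: dl_def fun_eq_iff add.commute add.left_commute)

lemma dl_pow_lookup: "lookup ((dl ^^ N) F p q) x = (dl ^^ N) (\<lambda>p q. lookup (F p q) x) p q"
  by (induction N arbitrary: p q) (auto simp: dl_def lookup_minus)

lemma lin_dl_pow: "(\<And>p q. lin (\<lambda>v. F v p q)) \<Longrightarrow> lin (\<lambda>v. (dl ^^ N) (F v) p q)"
  by (induction N arbitrary: p q) (auto simp: dl_def intro: lin_minus)

text \<open>The supercommutators multiplied by the power of \<open>z - w\<close> form a family
  indexed by pairs of modes that is stable under commutation with Heisenberg modes; its vacuum
  matrix elements compare the two expansions of one function.\<close>

lemma mlocal_exp_exp: "mlocal (nat (- (l * m))) ((-1) ^ nat \<bar>l * m\<bar>) (exp_field l) (exp_field m)"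
proof -
  define s :: complex where "s = (-1) ^ nat \<bar>l * m\<bar>"
  define C where "C v p q = exp_field l p (exp_field m q v) - vscale s (exp_field m q (exp_field l p v))" for v p q
  define D where "D = (\<lambda>(p, q) v. (dl ^^ nat (- (l * m))) (C v) p q)"
  have linC: "lin (\<lambda>v. C v p q)" for p q
    unfolding C_def
    by (rule lin_minus, rule lin_comp[OF lin_exp_field lin_exp_field], rule lin_vscale, rule lin_comp[OF lin_exp_field lin_exp_field])
  have "D pq v = 0" for pq v
  proof (rule heis_family_zero[where D = D])
    show "lin (D pq)" for pq
      unfolding D_def split_def by (rule lin_dl_pow) (rule linC)
    show "\<exists>cs. \<forall>v. heis k (D pq v) = D pq (heis k v) + (\<Sum>(c, j)\<leftarrow>cs. vscale c (D j v))" for pq k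
    proof (cases pq)
      case (Pair p q)
      have "heis k (C v p q) = C (heis k v) p q + (vscale (of_int l) (C v (p + k) q) + vscale (of_int m) (C v p (q + k)))" for v p q
        unfolding C_def
        by (simp add: lin_diff[OF lin_heis] lin_scale[OF lin_heis] heis_exp_field lin_add[OF lin_exp_field] lin_scale[OF lin_exp_field] algebra_simps)
      then have h: "(\<lambda>p q. heis k (C v p q)) = 
        (\<lambda>p q. C (heis k v) p q + (vscale (of_int l) (C v (p + k) q) + vscale (of_int m) (C v p (q + k))))" for v
        by (intro ext)
      have "heis k (D (p, q) v) = D (p, q) (heis k v) + (vscale (of_int l) (D (p + k, q) v) + vscale (of_int m) (D (p, q + k) v))" for v
      proof -
        have "heis k ((dl ^^ nat (- (l * m))) (C v) p q) = (dl ^^ nat (- (l * m))) (\<lambda>p q. heis k (C v p q)) p q"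
          by (simp add: dl_pow_lin)
        then show ?thesis
          unfolding D_def split_conv h by (simp only: dl_pow_add dl_pow_lin[OF lin_vscale_self] dl_pow_shift)
      qed
      then show ?thesis
        unfolding Pair by (intro exI[of _ "[(of_int l, (p + k, q)), (of_int m, (p, q + k))]"]) simp
    qed
    show "lookup (D pq (exp_basis l')) ({#}, L) = 0" for pq l' L
    proof (cases pq)
      case (Pair p q)
      let ?c = "if L = l + m + l' then 1 else 0 :: complex"
      let ?G = "\<lambda>p q. expand1 (l * l') (m * l') (l * m) p q - s * expand2 (l * l') (m * l') (l * m) p q"
      have 1: "(\<lambda>p q. lookup (C (exp_basis l') p q) ({#}, L)) = (\<lambda>p q. ?c * ?G p q)"
        by (intro ext) (auto simp: C_def lookup_minus lookup_vscale lookup_exp_exp expand1_def expand2_def algebra_simps)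
      have 2: "(dl ^^ N) (\<lambda>p q. c * G p q) = (\<lambda>p q. c * (dl ^^ N) G p q)" for N c and G :: "int \<Rightarrow> int \<Rightarrow> complex"
        by (induction N) (auto simp: dl_def fun_eq_iff algebra_simps)
      have 3: "(dl ^^ nat (- (l * m))) ?G = (\<lambda>p q. 0)"
        unfolding s_def by (rule expand_agree)
      show ?thesis
        unfolding Pair D_def split_conv dl_pow_lookup 1 2[of _ ?c ?G] 3 by simp
    qed
  qed
  then have "(dl ^^ nat (- (l * m))) (C v) p q = 0" for v p q
    unfolding D_def by (metis split_conv)
  then show ?thesis
    unfolding mlocal_def C_def[abs_def] s_def by (auto simp: fun_eq_iff)
qed

section \<open>The lattice vertex superalgebra of the integers\<close>

definition boson_word :: "nat list \<Rightarrow> int \<Rightarrow> boson_label field_modes" where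
  "boson_word ks l = foldr (\<lambda>k. field_prod 1 heis (- int k - 1)) ks (exp_field l)"

lemma boson_word_simps [simp]:
  "boson_word [] l = exp_field l"
  "boson_word (k # ks) l = field_prod 1 heis (- int k - 1) (boson_word ks l)"
  by (simp_all add: boson_word_def)

lemma boson_field_word: "boson_field (M, l) = boson_word (sorted_list_of_multiset M) l"
  by (simp add: boson_field_def boson_word_def)

lemma field_boson_word: "is_field (boson_word ks l)"
  by (induction ks) (auto intro: field_exp field_heis is_field_field_prod)

lemma covariant_boson_word: "covariant transl (boson_word ks l)"
  by (induction ks)
    (auto intro: covariant_exp_field covariant_field_prod field_heis field_boson_word lin_transl covariant_heis)

lemma creates_heis: "creates (exp_basis 0) heis (basis_vec ({#0#}, 0))"
  using heis_create[of 0 "{#}" 0] heis_exp_basis(1)[of _ 0] heis_exp_basis(2)[of 0]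
  by (auto simp: creates_def le_less)

lemma creates_boson_word: "creates (exp_basis 0) (boson_word ks l) (basis_vec (mset ks, l))"
proof (induction ks)
  case (Cons k ks)
  have "creates (exp_basis 0) (boson_word (k # ks) l) (heis (- int k - 1) (basis_vec (mset ks, l)))"
    unfolding boson_word_simps by (rule creates_field_prod[OF field_heis field_boson_word creates_heis Cons])
  then show ?case by (simp add: heis_create)
qed (simp add: creates_exp_field)

lemma charged_boson_word: "charged l (boson_word ks l m)"
proof (induction ks arbitrary: m)
  case (Cons k ks)
  show ?case
    unfolding charged_def
  proof (intro allI impI)
    fix v :: "boson_label vec" and l'
    assume v: "keys v \<subseteq> {b. snd b = l'}"
    have h: "keys (heis j w) \<subseteq> {b. snd b = L}" if "keys w \<subseteq> {b. snd b = L}" for j w L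
      using charged_heis[of j] that unfolding charged_def by auto
    have w: "keys (boson_word ks l j w) \<subseteq> {b. snd b = l' + l}" if "keys w \<subseteq> {b. snd b = l'}" for j w
      using Cons.IH[of j] that unfolding charged_def by blast
    have minus: "keys (a - b) \<subseteq> S" if "keys a \<subseteq> S" "keys b \<subseteq> S" for a b :: "boson_label vec" and S
    proof
      fix k assume "k \<in> keys (a - b)"
      then have "lookup a k \<noteq> 0 \<or> lookup b k \<noteq> 0"
        unfolding in_keys_iff lookup_minus by auto
      then show "k \<in> S" using that unfolding in_keys_iff[symmetric] by blast
    qed
    show "keys (boson_word (k # ks) l m v) \<subseteq> {b. snd b = l' + l}"
      unfolding boson_word_simps field_prod_def
      by (intro keys_Sum_any_subset order_trans[OF keys_vscale] minus h w v)
  qed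
qed (simp add: charged_exp_field)

text \<open>Repeated use of Dong's lemma with the even field \<open>heis\<close>, which leaves the
  sign \<open>s\<close> unchanged.\<close>

lemma mlocal_boson_word:
  assumes C: "is_field C" and h: "\<exists>N. mlocal N 1 heis C" and e: "\<exists>N. mlocal N s (exp_field l) C"
  shows "\<exists>N. mlocal N s (boson_word ks l) C"
proof (induction ks)
  case (Cons k ks)
  have hh: "\<exists>N. mlocal N 1 heis (boson_word ks l)"
  proof (induction ks)
    case Nil
    then show ?case using mlocal_heis_exp by auto
  next
    case (Cons k ks)
    then obtain N where "mlocal N 1 heis (boson_word ks l)" by blast
    then have "mlocal N 1 (boson_word ks l) heis" by (rule mlocal_sym) simp
    from dong[OF field_heis field_boson_word field_heis \<open>mlocal N 1 heis (boson_word ks l)\<close> mlocal_heis_heis this]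
    obtain M where "mlocal M 1 (boson_word (k # ks) l) heis" by fastforce
    then have "mlocal M 1 heis (boson_word (k # ks) l)" by (rule mlocal_sym) simp
    then show ?case by blast
  qed
  obtain N1 N2 N3 where "mlocal N1 1 heis (boson_word ks l)" "mlocal N2 1 heis C" "mlocal N3 s (boson_word ks l) C"
    using hh h Cons by blast
  from dong[OF field_heis field_boson_word C this] show ?case by simp
qed (use e in simp)

lemma sign_super: "(-1) ^ nat \<bar>l * m\<bar> = super_sign (odd l) (odd m)"
  by (simp add: super_sign_def minus_one_power_iff even_nat_iff)

lemma mlocal_words: "\<exists>N. mlocal N (super_sign (odd l) (odd m)) (boson_word ks l) (boson_word js m)"
proof -
  have hh: "\<exists>N. mlocal N 1 (boson_word js m) heis"
    using mlocal_boson_word[OF field_heis, of 1 m js] mlocal_heis_heis mlocal_sym[OF mlocal_heis_exp] by auto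
  then have h: "\<exists>N. mlocal N 1 heis (boson_word js m)" using mlocal_sym by fastforce
  have ss: "super_sign (odd l) (odd m) * super_sign (odd l) (odd m) = 1" by (simp add: super_sign_def)
  have "\<exists>N. mlocal N (super_sign (odd l) (odd m)) (exp_field m) (exp_field l)"
    using mlocal_sym[OF mlocal_exp_exp[of l m, unfolded sign_super] ss] by blast
  moreover have "\<exists>N. mlocal N 1 heis (exp_field l)" using mlocal_heis_exp by blast
  ultimately obtain N where "mlocal N (super_sign (odd l) (odd m)) (boson_word js m) (exp_field l)"
    using mlocal_boson_word[OF field_exp] by blast
  then have "\<exists>N. mlocal N (super_sign (odd l) (odd m)) (exp_field l) (boson_word js m)"
    using mlocal_sym[OF _ ss] by blast
  from mlocal_boson_word[OF field_boson_word h this] show ?thesis .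
qed

interpretation VZ: state_field boson_field "\<lambda>b. odd (snd b)" "({#}, 0)" transl
proof
  fix a b :: boson_label
  obtain M l where a: "a = (M, l)" by (cases a)
  obtain M' l' where b: "b = (M', l')" by (cases b)
  show "is_field (boson_field a)" "covariant transl (boson_field a)"
    unfolding a boson_field_word by (rule field_boson_word covariant_boson_word)+
  show "creates (exp_basis 0) (boson_field a) (basis_vec a)"
    using creates_boson_word[of "sorted_list_of_multiset M" l] by (simp add: a boson_field_word)
  show "\<exists>N. mlocal N (super_sign (odd (snd a)) (odd (snd b))) (boson_field a) (boson_field b)"
    unfolding a b boson_field_word snd_conv by (rule mlocal_words)
  show "boson_field ({#}, 0) = id_field"
    by (simp add: boson_field_word exp_field_0)
  show "keys (boson_field a m (basis_vec b)) \<subseteq> {c. odd (snd c) = (odd (snd a) \<noteq> odd (snd b))}" for m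
    using charged_basis[OF charged_boson_word[of l "sorted_list_of_multiset M" m], of M' l'] unfolding a b boson_field_word
    by auto
  show "transl (exp_basis 0) = 0" by (simp add: transl_exp_basis)
qed (auto simp: lin_transl)

lemma boson_field_exp: "boson_field ({#}, l) = exp_field l"
  by (simp add: boson_field_word)

section \<open>Charged fermions inside the lattice vertex superalgebra\<close>

abbreviation fb :: "boson_label field_modes" where "fb \<equiv> exp_field 1"
abbreviation fc :: "boson_label field_modes" where "fc \<equiv> exp_field (-1)"

text \<open>For norm 1 the order of locality \<open>nat (- (l * l))\<close> is 0, so locality is
  already an anticommutation relation.\<close>

lemma fermion_same: "l * l = 1 \<Longrightarrow> exp_field l j (exp_field l k v) = - exp_field l k (exp_field l j v)"
  using mlocal_exp_exp[of l l] unfolding mlocal_def by (auto simp: fun_eq_iff eq_neg_iff_add_eq_0)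

lemma field_prod_0:
  assumes "is_field A" "is_field B"
  shows "field_prod s A 0 B m v = A 0 (B m v) - vscale s (B m (A 0 v))"
  using field_prod_eq[OF assms, where p = 0 and m = m and v = v] by (simp add: csum_zero_exp)

lemma exp_odd: "odd l \<Longrightarrow> keys (exp_basis l) \<subseteq> {b :: boson_label. odd (snd b) = True}"
  by simp

text \<open>Locality of order 1 makes the anticommutator a function of \<open>j + k\<close>, and for
  \<open>j = 0\<close> it is a mode of the field of the state \<open>b_(0) c\<close>, which is the
  vacuum.\<close>

lemma fermion_anticomm: "fb j (fc k v) + fc k (fb j v) = (if j + k = -1 then v else 0)"
proof -
  let ?F = "\<lambda>j k. fb j (fc k v) + fc k (fb j v)"
  have "dl ?F = (\<lambda>m k. 0)"
    using mlocal_exp_exp[of 1 "-1"] unfolding mlocal_def by simp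
  then have step: "?F (j + 1) k = ?F j (k + 1)" for j k
    unfolding dl_def by (simp add: fun_eq_iff)
  have F: "?F j k = ?F 0 (j + k)"
  proof (induction j arbitrary: k rule: int_induct[of _ 0])
    case (step1 i)
    then show ?case using step[of i k] by (simp add: add.commute add.left_commute)
  next
    case (step2 i)
    then show ?case using step[of "i - 1" "k - 1"] by (simp add: algebra_simps)
  qed simp
  have "?F 0 m = (if m = -1 then v else 0)" for m
  proof -
    have 1: "field_prod (super_sign True True) fb 0 fc = VZ.Yv (VZ.Yv (exp_basis 1) 0 (exp_basis (-1)))"
      using VZ.Yv_assoc[OF exp_odd[of 1] exp_odd[of "-1"], of 0] by (simp add: boson_field_exp)
    have 2: "VZ.Yv (exp_basis 1) 0 (exp_basis (-1)) = exp_basis 0"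
      by (simp add: boson_field_exp exp_field_exp_basis)
    have "?F 0 m = field_prod (super_sign True True) fb 0 fc m v"
      by (simp add: field_prod_0 field_exp super_sign_def)
    also have "\<dots> = (if m = -1 then v else 0)"
      unfolding 1 2 by (simp add: boson_field_exp exp_field_0 id_field_def when_def)
    finally show ?thesis .
  qed
  then show ?thesis unfolding F .
qed

section \<open>Products with the identity field, and the Heisenberg field in terms of
  fermions\<close>

lemma bco_minus_1: "bco (-1) j = 1"
proof (induction j)
  case (Suc j)
  then show ?case using bco_Suc[of "-1" j] by (simp add: bco_zero_exp)
qed simp

lemma bco_minus_2: "bco (-2) j = of_nat j + 1"
proof (induction j)
  case (Suc j)
  then show ?case using bco_Suc[of "-2" j] by (simp add: bco_minus_1 algebra_simps)
qed simp

lemma field_id: "is_field id_field"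
  unfolding is_field_def
proof (intro conjI allI)
  show "lin (id_field m :: 'a vec \<Rightarrow> _)" for m by (auto simp: id_field_def when_def intro!: linI)
  show "\<exists>N. \<forall>m\<ge>N. id_field m v = 0" for v :: "'a vec" by (intro exI[of _ 0]) (auto simp: id_field_def)
qed

text \<open>The identity field has a single nonzero mode, so each half of the product keeps at most
  one summand: \<open>j = - m - 1\<close> in the first and \<open>j = p + m + 1\<close> in the
  second, when these are nonnegative.\<close>

lemma field_prod_id:
  assumes A: "is_field A"
  shows "field_prod 1 A p id_field m v =
    (if m < 0 then vscale (bco p (nat (- m - 1))) (A (p + m + 1) v) else 0)
    - (if p + m + 1 \<ge> 0 then vscale ((-1) powi p * bco p (nat (p + m + 1))) (A (p + m + 1) v) else 0)"
proof -
  note l = lin_zero[OF is_field_lin[OF A]]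
  have 1: "csum p (\<lambda>j. A (p - int j) (id_field (m + int j) v)) = (if m < 0 then vscale (bco p (nat (- m - 1))) (A (p + m + 1) v) else 0)"
  proof -
    have "csum p (\<lambda>j. A (p - int j) (id_field (m + int j) v)) =
       (\<Sum>j<Suc (nat (- m)). vscale (bco p j) (A (p - int j) (id_field (m + int j) v)))"
      by (rule csum_eq) (auto simp: id_field_def when_def l)
    also have "\<dots> = (\<Sum>j<Suc (nat (- m)). if j = nat (- m - 1) \<and> m < 0 then vscale (bco p j) (A (p + m + 1) v) else 0)"
    proof (intro sum.cong refl)
      fix j
      show "vscale (bco p j) (A (p - int j) (id_field (m + int j) v)) = (if j = nat (- m - 1) \<and> m < 0 then vscale (bco p j) (A (p + m + 1) v) else 0)"
      proof (cases "m + int j = -1")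
        case True
        then have h: "p - int j = p + m + 1" "(j = nat (- m - 1) \<and> m < 0) = True" by auto
        show ?thesis by (simp only: id_field_def when_def True h if_True simp_thms)
      next
        case False
        then have "\<not> (j = nat (- m - 1) \<and> m < 0)" by auto
        then show ?thesis using False by (simp only: id_field_def when_def if_False l free.scale_zero_right)
      qed
    qed
    also have "\<dots> = (if m < 0 then vscale (bco p (nat (- m - 1))) (A (p + m + 1) v) else 0)"
      by (cases "m < 0") (auto simp: less_Suc_eq_le)
    finally show ?thesis .
  qed
  have 2: "csum p (\<lambda>j. id_field (p + m - int j) (A (int j) v)) = (if p + m + 1 \<ge> 0 then vscale (bco p (nat (p + m + 1))) (A (p + m + 1) v) else 0)"
  proof -
    have "csum p (\<lambda>j. id_field (p + m - int j) (A (int j) v)) =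
       (\<Sum>j<Suc (nat (p + m + 1)). vscale (bco p j) (id_field (p + m - int j) (A (int j) v)))"
      by (rule csum_eq) (auto simp: id_field_def when_def)
    also have "\<dots> = (\<Sum>j<Suc (nat (p + m + 1)). if j = nat (p + m + 1) \<and> p + m + 1 \<ge> 0 then vscale (bco p j) (A (p + m + 1) v) else 0)"
    proof (intro sum.cong refl)
      fix j
      show "vscale (bco p j) (id_field (p + m - int j) (A (int j) v)) = (if j = nat (p + m + 1) \<and> p + m + 1 \<ge> 0 then vscale (bco p j) (A (p + m + 1) v) else 0)"
      proof (cases "int j = p + m + 1")
        case True
        then have h: "p + m - int j = -1" "(j = nat (p + m + 1) \<and> p + m + 1 \<ge> 0) = True" by auto
        show ?thesis unfolding h by (simp only: id_field_def when_def True if_True simp_thms)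
      next
        case False
        then have "\<not> (j = nat (p + m + 1) \<and> p + m + 1 \<ge> 0)" "p + m - int j \<noteq> -1" by auto
        then show ?thesis by (simp only: id_field_def when_def if_False free.scale_zero_right)
      qed
    qed
    also have "\<dots> = (if p + m + 1 \<ge> 0 then vscale (bco p (nat (p + m + 1))) (A (p + m + 1) v) else 0)"
      by (cases "p + m + 1 \<ge> 0") (auto simp: less_Suc_eq_le)
    finally show ?thesis .
  qed
  show ?thesis
    unfolding field_prod_eq(3)[OF A field_id] 1 2 by simp
qed

lemma field_prod_id_1: "is_field A \<Longrightarrow> field_prod 1 A (-1) id_field = A"
  by (intro ext) (simp add: field_prod_id bco_minus_1 power_int_minus)

lemma field_prod_id_2: "is_field A \<Longrightarrow> field_prod 1 A (-2) id_field m v = vscale (- of_int m) (A (m - 1) v)"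
  by (cases "m < 0"; cases "m = 0") (auto simp: field_prod_id bco_minus_2 power_int_minus algebra_simps)

lemma heis_fermions: "heis = field_prod (super_sign True True) fb (-1) fc"
proof -
  have "field_prod (super_sign True True) fb (-1) fc = VZ.Yv (VZ.Yv (exp_basis 1) (-1) (exp_basis (-1)))"
    using VZ.Yv_assoc[OF exp_odd[of 1] exp_odd[of "-1"], of "-1"] by (simp add: boson_field_exp)
  also have "VZ.Yv (exp_basis 1) (-1) (exp_basis (-1)) = basis_vec ({#0#}, 0)"
  proof -
    \<comment> \<open>In degree 1 the creating exponential reduces to its linear term.\<close>
    have "vscale (of_nat 1) (exp_coeff (\<lambda>k w. vscale (of_int 1) (heis (- int k) w)) 1 (exp_basis 0)) = heis (-1) (exp_basis 0)"
      unfolding ecr_rec by simp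
    then have "ecr 1 1 (exp_basis 0) = heis (-1) (exp_basis 0)" by (simp add: ecr_def)
    then show ?thesis using heis_create[of 0 "{#}" 0] by (simp add: boson_field_exp exp_field_exp_basis)
  qed
  also have "VZ.Yv (basis_vec ({#0#}, 0)) = heis"
    by (simp add: boson_field_word exp_field_0 field_prod_id_1[OF field_heis])
  finally show ?thesis by simp
qed

lemma csum_subspace:
  assumes "free.subspace U" "\<And>j. x j \<in> U"
  shows "csum p x \<in> U"
  unfolding csum_def Sum_any.expand_set
  by (intro free.subspace_sum free.subspace_scale assms)

text \<open>The bosonic modes come from \<open>\<partial>\<phi> = :bc:\<close>, and \<open>b\<close> and \<open>c\<close> move between the charges.\<close>

lemma fermion_closed_UNIV:
  assumes U: "free.subspace U" and vac: "exp_basis 0 \<in> U"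
    and b: "\<And>k v. v \<in> U \<Longrightarrow> fb k v \<in> U" and c: "\<And>k v. v \<in> U \<Longrightarrow> fc k v \<in> U"
  shows "v \<in> U"
proof -
  have h: "heis k v \<in> U" if "v \<in> U" for k v
    unfolding heis_fermions field_prod_eq(3)[OF field_exp field_exp]
    by (intro free.subspace_diff free.subspace_scale csum_subspace U b c that)
  have e: "exp_basis l \<in> U" for l
  proof (induction l rule: int_induct[of _ 0])
    case (step1 i)
    \<comment> \<open>The mode is chosen so that the creating exponential has degree 0 and only the
      charge changes.\<close>
    have "fb (- i - 1) (exp_basis i) = exp_basis (i + 1)" by (simp add: exp_field_exp_basis add.commute)
    then show ?case using b step1 by metis
  next
    case (step2 i)
    have "fc (i - 1) (exp_basis i) = exp_basis (i - 1)" by (simp add: exp_field_exp_basis)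
    then show ?case using c step2 by metis
  qed (rule vac)
  have "basis_vec (M, l) \<in> U" for M l
    by (induction M) (auto simp: e heis_create[symmetric] h)
  then have "basis_vec b \<in> U" for b by (cases b) simp
  then show ?thesis
    using vec_induct[of v UNIV "\<lambda>v. v \<in> U"] free.subspace_0[OF U] free.subspace_add[OF U] free.subspace_scale[OF U] by auto
qed

section \<open>Symplectic fermions inside the lattice vertex superalgebra\<close>

text \<open>The case \<open>s\<close> is the derivative of \<open>fb\<close>, whose mode
  \<open>m\<close> is \<open>- m\<close> times mode \<open>m - 1\<close>. The factor vanishes at
  \<open>m = 0\<close>, which is how \<open>fb (-1)\<close> drops out.\<close>

definition psi :: "bool \<Rightarrow> boson_label field_modes" where
  "psi s m v = (if s then vscale (- of_int m) (fb (m - 1) v) else fc m v)"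

lemma psi_simps: "psi False m v = fc m v" "psi True m v = vscale (- of_int m) (fb (m - 1) v)"
  by (simp_all add: psi_def)

lemma lin_psi [simp]: "lin (psi s m)"
  by (cases s) (simp_all only: psi_def[abs_def] if_True if_False lin_vscale lin_exp_field)

lemma fermion_same': "fb j (fb k v) = - fb k (fb j v)" "fc j (fc k v) = - fc k (fc j v)"
  by (rule fermion_same; simp)+

lemma psi_anticomm:
  "psi s j (psi t k v) + psi t k (psi s j v)
     = vscale (if j + k = 0 \<and> s \<noteq> t then (if s then of_int k else of_int j) else 0) v"
proof -
  have ft: "psi False j (psi True k v) + psi True k (psi False j v) = vscale (if j + k = 0 then of_int j else 0) v" for j k
  proof -
    have "psi False j (psi True k v) + psi True k (psi False j v) =
        vscale (- of_int k) (fb (k - 1) (fc j v) + fc j (fb (k - 1) v))"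
      by (simp add: psi_simps lin_scale lin_uminus free.scale_right_distrib)
    also have "\<dots> = vscale (if j + k = 0 then of_int j else 0) v"
      unfolding fermion_anticomm by (auto simp: eq_neg_iff_add_eq_0 free.scale_right_distrib simp flip: free.scale_minus_left of_int_minus intro: arg_cong2[where f = vscale])
    finally show ?thesis .
  qed
  consider "s" "t" | "\<not> s" "\<not> t" | "s" "\<not> t" | "\<not> s" "t" by blast
  then show ?thesis
  proof cases
    case 1
    then show ?thesis using fermion_same'(1)[of "j - 1" "k - 1" v]
      by (simp add: psi_simps lin_scale lin_uminus mult.commute)
  next
    case 2
    then show ?thesis using fermion_same'(2)[of j k v] by (simp add: psi_simps)
  next
    case 3
    then show ?thesis using ft[of k j] by (simp add: add.commute)
  next
    case 4
    then show ?thesis using ft[of j k] by simp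
  qed
qed

lemma psi_vac: "m \<ge> 0 \<Longrightarrow> psi s m (exp_basis 0) = 0"
  by (cases s; cases "m = 0") (auto simp: psi_simps exp_field_exp_basis ecr_neg)

definition psi_state :: "bool \<Rightarrow> boson_label vec" where
  "psi_state s = psi s (-1) (exp_basis 0)"

lemma psi_charge:
  "keys v \<subseteq> {b. snd b = l} \<Longrightarrow> keys (psi s m v) \<subseteq> {b. snd b = l + (if s then 1 else -1)}"
  using charged_exp_field[of 1 "m - 1"] charged_exp_field[of "-1" m] order_trans[OF keys_vscale[of "- of_int m" "fb (m - 1) v"]]
  unfolding charged_def by (cases s) (simp_all only: psi_simps if_True if_False)

lemma psi_parity:
  assumes "keys v \<subseteq> {b. odd (snd b) = p}"
  shows "keys (psi s m v) \<subseteq> {b. odd (snd b) = (\<not> p)}"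
  unfolding lin_eq_lin_ext[OF lin_psi, of s m v]
proof (rule keys_lin_ext_subset)
  fix b :: boson_label assume b: "b \<in> keys v"
  then have "odd (snd b) = p" using assms by auto
  then show "keys (psi s m (basis_vec b)) \<subseteq> {b. odd (snd b) = (\<not> p)}"
    using psi_charge[of "basis_vec b" "snd b" s m] by (cases s) auto
qed

lemma psi_state_parity: "keys (psi_state s) \<subseteq> {b. odd (snd b) = True}"
  unfolding psi_state_def using psi_parity[of "exp_basis 0" False s "-1"] by simp

text \<open>The state of \<open>psi True\<close> is \<open>fb (-2)\<close> applied to the vacuum,
  and the product of exponent -2 with the identity field is the derivative.\<close>

lemma Yv_psi_state: "VZ.Yv (psi_state s) = psi s"
proof (cases s)
  case True
  have "psi_state True = VZ.Yv (exp_basis 1) (-2) (exp_basis 0)"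
    by (simp add: psi_state_def psi_simps boson_field_exp)
  then have "VZ.Yv (psi_state True) = field_prod (super_sign True False) (VZ.Yv (exp_basis 1)) (-2) (VZ.Yv (exp_basis 0))"
    using VZ.Yv_assoc[OF exp_odd[of 1], of "exp_basis 0" False "-2"] by simp
  also have "\<dots> = psi True"
    by (intro ext) (simp add: boson_field_exp exp_field_0 super_sign_def field_prod_id_2 field_exp psi_simps)
  finally show ?thesis using True by simp
next
  case False
  have "psi_state False = exp_basis (-1)"
    by (simp add: psi_state_def psi_simps exp_field_exp_basis)
  then show ?thesis using False by (simp add: boson_field_exp fun_eq_iff psi_simps)
qed

definition fword :: "(bool \<times> nat) list \<Rightarrow> boson_label vec" where
  "fword gs = foldr (\<lambda>g. psi (fst g) (- int (snd g) - 1)) gs (exp_basis 0)"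

lemma fword_simps [simp]: "fword [] = exp_basis 0" "fword (g # gs) = psi (fst g) (- int (snd g) - 1) (fword gs)"
  by (simp_all add: fword_def)

lemma fword_parity: "keys (fword gs) \<subseteq> {b. odd (snd b) = odd (length gs)}"
proof (induction gs)
  case (Cons g gs)
  then show ?case using psi_parity[of "fword gs" "odd (length gs)"] by simp
qed simp

lemma Yv_fword:
  "VZ.Yv (fword []) = id_field"
  "VZ.Yv (fword (g # gs)) = field_prod ((-1) ^ length gs) (psi (fst g)) (- int (snd g) - 1) (VZ.Yv (fword gs))"
proof -
  show "VZ.Yv (fword []) = id_field" by (simp add: boson_field_exp exp_field_0)
  have "super_sign True (odd (length gs)) = (-1) ^ length gs"
    by (simp add: super_sign_def minus_one_power_iff)
  then show "VZ.Yv (fword (g # gs)) = field_prod ((-1) ^ length gs) (psi (fst g)) (- int (snd g) - 1) (VZ.Yv (fword gs))"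
    using VZ.Yv_assoc[OF psi_state_parity fword_parity, of "fst g" "- int (snd g) - 1" gs] by (simp add: Yv_psi_state)
qed

section \<open>Ordered monomials in the symplectic generators\<close>

definition glt :: "bool \<times> nat \<Rightarrow> bool \<times> nat \<Rightarrow> bool" where
  "glt g h \<longleftrightarrow> (\<not> fst g \<and> fst h) \<or> (fst g = fst h \<and> snd g < snd h)"

fun gins :: "bool \<times> nat \<Rightarrow> (bool \<times> nat) list \<Rightarrow> (bool \<times> nat) list" where
  "gins x [] = [x]"
| "gins x (g # gs) = (if glt x g then x # g # gs else g # gins x gs)"

abbreviation psi_gen :: "bool \<times> nat \<Rightarrow> boson_label vec \<Rightarrow> boson_label vec" where
  "psi_gen x \<equiv> psi (fst x) (- int (snd x) - 1)"

lemma psi_gen_swap: "psi_gen x (psi_gen g v) = - psi_gen g (psi_gen x v)"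
  using psi_anticomm[of "fst x" "- int (snd x) - 1" "fst g" "- int (snd g) - 1" v] by (simp add: eq_neg_iff_add_eq_0)

lemma vec_self_neg: "u = - u \<Longrightarrow> u = (0 :: 'b vec)"
proof -
  assume "u = - u"
  then have "vscale 2 u = 0" using free.scale_left_distrib[of 1 1 u] by (metis add.right_inverse free.scale_one one_add_one)
  then show ?thesis by simp
qed

text \<open>The new factor is anticommuted up to its twin, where the square of an odd creating mode
  vanishes.\<close>

lemma psi_gen_zero: "x \<in> set gs \<Longrightarrow> psi_gen x (fword gs) = 0"
proof (induction gs)
  case (Cons g gs)
  show ?case
  proof (cases "x = g")
    case True
    then show ?thesis using psi_gen_swap[of g g "fword gs"] vec_self_neg by simp
  next
    case False
    then show ?thesis using Cons psi_gen_swap[of x g "fword gs"] by (simp add: lin_zero)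
  qed
qed simp

text \<open>Each smaller generator is passed by an anticommutation, which contributes one
  sign.\<close>

lemma psi_gen_insert:
  "sorted_wrt glt gs \<Longrightarrow> x \<notin> set gs \<Longrightarrow>
    psi_gen x (fword gs) = vscale ((-1) ^ length (filter (\<lambda>g. glt g x) gs)) (fword (gins x gs))"
proof (induction gs)
  case (Cons g gs)
  show ?case
  proof (cases "glt x g")
    case True
    have "\<not> glt h x" if "h \<in> set (g # gs)" for h
    proof -
      have "h = g \<or> glt g h" using that Cons.prems by auto
      then show ?thesis using True by (auto simp: glt_def)
    qed
    then have "filter (\<lambda>g. glt g x) (g # gs) = []" unfolding filter_empty_conv by blast
    then show ?thesis using True by (simp only: list.size power_0 free.scale_one gins.simps if_True fword_simps)
  next
    case False
    have "x \<noteq> g" using Cons.prems by auto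
    then have gx: "glt g x" using False by (cases x; cases g) (auto simp: glt_def)
    have "psi_gen x (fword (g # gs)) = - psi_gen g (psi_gen x (fword gs))"
      unfolding fword_simps by (rule psi_gen_swap)
    also have "psi_gen x (fword gs) = vscale ((-1) ^ length (filter (\<lambda>g. glt g x) gs)) (fword (gins x gs))"
      using Cons by auto
    finally show ?thesis using False gx by (simp add: lin_scale)
  qed
qed simp

definition gens :: "sf_label \<Rightarrow> (bool \<times> nat) list" where
  "gens = (\<lambda>(A, B). map (Pair False) (sorted_list_of_fset A) @ map (Pair True) (sorted_list_of_fset B))"

lemma sorted_fset: "sorted_wrt (<) (sorted_list_of_fset S)" "set (sorted_list_of_fset S) = fset S" for S :: "nat fset"
  by (auto simp: sorted_list_of_fset.rep_eq)

lemma sorted_list_fempty: "sorted_list_of_fset {||} = []"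
  by (simp add: sorted_list_of_fset.rep_eq)

lemma gens_sorted: "sorted_wrt glt (gens a)"
proof -
  have "sorted_wrt glt (map (Pair s) xs)" if "sorted_wrt (<) xs" for s xs
    using that by (induction xs) (auto simp: glt_def)
  then show ?thesis
    by (cases a) (auto simp: gens_def sorted_wrt_append sorted_fset glt_def)
qed

lemma gens_set: "(s, k) \<in> set (gens (A, B)) \<longleftrightarrow> (if s then k |\<in>| B else k |\<in>| A)"
  by (auto simp: gens_def sorted_fset)

lemma gins_map: "gins (s, k) (map (Pair s) xs) = map (Pair s) (insort k xs)" if "k \<notin> set xs"
  using that by (induction xs) (auto simp: glt_def)

lemma gins_skip: "gins (True, k) (map (Pair False) xs @ ys) = map (Pair False) xs @ gins (True, k) ys"
  by (induction xs) (auto simp: glt_def)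

lemma gins_stop: "gins (False, k) (xs @ map (Pair True) ys) = gins (False, k) xs @ map (Pair True) ys"
  by (induction xs) (cases ys; auto simp: glt_def)+

lemma sorted_list_finsert: "k |\<notin>| A \<Longrightarrow> sorted_list_of_fset (finsert k A) = insort k (sorted_list_of_fset A)" for k :: nat
  by (simp add: sorted_list_of_fset.rep_eq sorted_list_of_set_insert_remove)

lemma length_filter_below: "length (filter (\<lambda>j. j < k) (sorted_list_of_fset A)) = below k A"
proof -
  have "distinct (sorted_list_of_fset A)" by (simp add: sorted_list_of_fset.rep_eq)
  then have "length (filter (\<lambda>j. j < k) (sorted_list_of_fset A)) = card (set (filter (\<lambda>j. j < k) (sorted_list_of_fset A)))"
    by (simp only: distinct_card[OF distinct_filter])
  also have "set (filter (\<lambda>j. j < k) (sorted_list_of_fset A)) = fset (ffilter (\<lambda>j. j < k) A)"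
    by (auto simp: sorted_fset)
  finally show ?thesis by (simp add: below_def fcard.rep_eq)
qed

lemma length_sorted_fset: "length (sorted_list_of_fset A) = fcard A"
  by (simp add: sorted_list_of_fset.rep_eq fcard.rep_eq)

definition emb :: "sf_label vec \<Rightarrow> boson_label vec" where
  "emb = lin_ext (\<lambda>a. fword (gens a))"

lemma lin_emb [simp]: "lin emb"
  by (simp add: emb_def)

lemma emb_basis: "emb (basis_vec a) = fword (gens a)"
  by (simp add: emb_def)

lemma emb_vac: "emb (basis_vec ({||}, {||})) = exp_basis 0"
  by (simp add: emb_basis gens_def sorted_list_fempty)

lemma lin_sf_mode [simp]: "lin (sf_mode s m)"
  by (simp add: sf_mode_def)

text \<open>In a sorted word the number of generators before \<open>(s, k)\<close> is
  \<open>below k A\<close> in the first block and \<open>fcard A + below k B\<close> in the second,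
  so the sign of the sorting is the sign built into \<open>sf_basis\<close>.\<close>

lemma emb_create: "emb (sf_mode s (- int k - 1) v) = psi s (- int k - 1) (emb v)"
proof (rule lin_eqI[where f = "\<lambda>v. emb (sf_mode s (- int k - 1) v)" and g = "\<lambda>v. psi s (- int k - 1) (emb v)"])
  show "lin (\<lambda>v. emb (sf_mode s (- int k - 1) v))" "lin (\<lambda>v. psi s (- int k - 1) (emb v))"
    by (rule lin_comp; simp)+
  fix a :: sf_label
  obtain A B where a: "a = (A, B)" by (cases a)
  have kn: "nat (- (- int k - 1) - 1) = k" "- int k - 1 < 0" by auto
  show "emb (sf_mode s (- int k - 1) (basis_vec a)) = psi s (- int k - 1) (emb (basis_vec a))"
  proof (cases "(s, k) \<in> set (gens a)")
    case True
    then show ?thesis using psi_gen_zero[OF True]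
      by (auto simp: a gens_set emb_basis sf_mode_def sf_basis_def Let_def lin_zero split: if_splits)
  next
    case False
    have f: "length (filter (\<lambda>g. glt g (s, k)) (gens (A, B))) = (if s then fcard A + below k B else below k A)"
      by (simp add: gens_def filter_map glt_def comp_def length_filter_below length_sorted_fset)
    have g: "gins (s, k) (gens (A, B)) = gens (if s then (A, finsert k B) else (finsert k A, B))"
    proof -
      have "if s then k |\<notin>| B else k |\<notin>| A" using False by (auto simp: a gens_set split: if_splits)
      then show ?thesis
        by (cases s) (simp_all add: gens_def gins_skip gins_stop gins_map sorted_fset sorted_list_finsert)
    qed
    have "psi s (- int k - 1) (emb (basis_vec a)) = vscale ((-1) ^ (if s then fcard A + below k B else below k A))
        (emb (basis_vec (if s then (A, finsert k B) else (finsert k A, B))))"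
      using psi_gen_insert[OF gens_sorted False] unfolding a f g by (simp add: emb_basis)
    then show ?thesis using False
      by (cases s) (simp_all add: a gens_set sf_mode_def sf_basis_def Let_def lin_scale)
  qed
qed

lemma sf_basis_word: "basis_vec a = foldr (\<lambda>g. sf_mode (fst g) (- int (snd g) - 1)) (gens a) (basis_vec ({||}, {||}))"
proof (cases a)
  case (Pair A B)
  then show ?thesis using sf_basis_vec[of A B] by (simp add: gens_def foldr_map comp_def)
qed

text \<open>Creating modes are covered by \<open>emb_create\<close>. The remaining ones are moved
  through a word by the anticommutators, which agree on both sides, until they kill the
  vacuum.\<close>

theorem emb_mode: "emb (sf_mode s m v) = psi s m (emb v)"
proof (cases "m < 0")
  case True
  then show ?thesis using emb_create[of s "nat (- m - 1)" v] by simp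
next
  case False
  show ?thesis
  proof (rule lin_eqI[where f = "\<lambda>v. emb (sf_mode s m v)" and g = "\<lambda>v. psi s m (emb v)"])
    show "lin (\<lambda>v. emb (sf_mode s m v))" "lin (\<lambda>v. psi s m (emb v))"
      by (rule lin_comp; simp)+
    fix a :: sf_label
    have "emb (sf_mode s m w) = psi s m (emb w)"
      if "w = foldr (\<lambda>g. sf_mode (fst g) (- int (snd g) - 1)) gs (basis_vec ({||}, {||}))" for gs w
      using that
    proof (induction gs arbitrary: w)
      case Nil
      then show ?case using False by (simp add: emb_vac sf_mode_vac psi_vac lin_zero)
    next
      case (Cons g gs)
      define w' where "w' = foldr (\<lambda>g. sf_mode (fst g) (- int (snd g) - 1)) gs (basis_vec ({||}, {||}))"
      let ?t = "fst g" and ?k = "- int (snd g) - 1"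
      let ?c = "if m + ?k = 0 \<and> s \<noteq> ?t then (if s then of_int ?k else of_int m) else 0 :: complex"
      have w: "w = sf_mode ?t ?k w'" using Cons.prems by (simp add: w'_def)
      have IH: "emb (sf_mode s m w') = psi s m (emb w')" by (rule Cons.IH) (simp add: w'_def)
      have "sf_mode s m (sf_mode ?t ?k w') = vscale ?c w' - sf_mode ?t ?k (sf_mode s m w')"
        using sf_anticommutator[of s m ?t ?k w'] by (simp add: eq_diff_eq)
      moreover have "psi s m (psi ?t ?k (emb w')) = vscale ?c (emb w') - psi ?t ?k (psi s m (emb w'))"
        using psi_anticomm[of s m ?t ?k "emb w'"] by (simp add: eq_diff_eq)
      ultimately show ?case
        unfolding w emb_create by (simp only: lin_diff[OF lin_emb] lin_scale[OF lin_emb] emb_create IH)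
    qed
    from this[OF sf_basis_word] show "emb (sf_mode s m (basis_vec a)) = psi s m (emb (basis_vec a))" .
  qed
qed

section \<open>Injectivity of the embedding\<close>

definition labs :: "sf_label \<Rightarrow> (bool \<times> nat) set" where
  "labs a = set (gens a)"

lemma labs_iff: "(s, k) \<in> labs (A, B) \<longleftrightarrow> (if s then k |\<in>| B else k |\<in>| A)"
  by (simp add: labs_def gens_set)

definition addl :: "bool \<times> nat \<Rightarrow> sf_label \<Rightarrow> sf_label" where
  "addl x a = (if fst x then (fst a, finsert (snd x) (snd a)) else (finsert (snd x) (fst a), snd a))"

definition reml :: "bool \<times> nat \<Rightarrow> sf_label \<Rightarrow> sf_label" where
  "reml x a = (if fst x then (fst a, snd a |-| {|snd x|}) else (fst a |-| {|snd x|}, snd a))"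

lemma addl_reml: "x \<in> labs a \<Longrightarrow> addl x (reml x a) = a" "x \<notin> labs (reml x a)" "x \<notin> labs a \<Longrightarrow> reml x (addl x a) = a"
  by (cases a; cases x; auto simp: addl_def reml_def labs_iff split: if_splits)+

lemma labs_reml: "labs (reml x a) \<subseteq> labs a"
  by (cases a; cases x) (auto simp: reml_def labs_iff split: if_splits)

text \<open>The mode conjugate to the generator \<open>x\<close> acts as a derivative with respect
  to \<open>x\<close>. Its constants combine a sign and the mode number; their nonvanishing is what
  the injectivity argument uses.\<close>

lemma sf_annihilate: "\<exists>c. (\<forall>a. c a \<noteq> 0) \<and>
    (\<forall>a. sf_mode (\<not> fst x) (int (snd x) + 1) (basis_vec a) = (if x \<in> labs a then vscale (c a) (basis_vec (reml x a)) else 0))"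
proof -
  obtain s k where x: "x = (s, k)" by (cases x)
  let ?c = "\<lambda>(A, B). if s then of_int (int k + 1) * (-1) ^ (fcard A + below k B) else - of_int (int k + 1) * (-1) ^ below k A :: complex"
  have nz: "of_int (int k + 1) \<noteq> (0 :: complex)" by (simp only: of_int_eq_0_iff)
  show ?thesis
  proof (intro exI[of _ ?c] conjI allI)
    fix a :: sf_label
    have "(-1) ^ i \<noteq> (0 :: complex)" for i by simp
    with nz show "?c a \<noteq> 0"
      by (cases a; cases s)
        (simp_all only: split_conv if_True if_False mult_eq_0_iff neg_equal_0_iff_equal simp_thms not_False_eq_True)
    show "sf_mode (\<not> fst x) (int (snd x) + 1) (basis_vec a) = (if x \<in> labs a then vscale (?c a) (basis_vec (reml x a)) else 0)"
      by (cases a) (auto simp: x sf_mode_def sf_basis_def Let_def labs_iff reml_def)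
  qed
qed

text \<open>Induction on a finite set of generators containing all those that occur in
  \<open>v\<close>. The mode conjugate to \<open>x\<close> removes \<open>x\<close>, so by induction
  it kills \<open>v\<close>; distinct labels containing \<open>x\<close> have distinct reductions,
  hence no label of \<open>v\<close> contains \<open>x\<close>. Without generators \<open>v\<close>
  is a multiple of the vacuum.\<close>

lemma emb_eq_zero: "emb v = 0 \<Longrightarrow> v = 0"
proof -
  have "v = 0" if "finite F" "emb v = 0" "\<forall>a\<in>keys v. labs a \<subseteq> F" for F v
    using that
  proof (induction F arbitrary: v)
    case empty
    have "a = ({||}, {||})" if "labs a = {}" for a
      using that by (cases a) (auto simp: labs_def gens_def sorted_fset fset_eq_iff)
    then have k: "keys v \<subseteq> {({||}, {||})}" using empty by auto
    have "v = vscale (lookup v ({||}, {||})) (basis_vec ({||}, {||}))"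
      by (rule poly_mapping_eqI) (use k in \<open>auto simp: lookup_vscale lookup_basis_vec not_in_keys_iff_lookup_eq_zero[symmetric]\<close>)
    then have "emb v = vscale (lookup v ({||}, {||})) (exp_basis 0)"
      by (metis emb_vac lin_emb lin_scale)
    then have "lookup v ({||}, {||}) = 0" using empty by simp
    then show ?case using \<open>v = vscale _ _\<close> by simp
  next
    case (insert x F)
    obtain c where c: "\<And>a. c a \<noteq> 0" and ann: "\<And>a. sf_mode (\<not> fst x) (int (snd x) + 1) (basis_vec a) =
        (if x \<in> labs a then vscale (c a) (basis_vec (reml x a)) else 0)"
      using sf_annihilate[of x] by blast
    let ?D = "sf_mode (\<not> fst x) (int (snd x) + 1)"
    have D: "?D v = lin_ext (\<lambda>a. if x \<in> labs a then vscale (c a) (basis_vec (reml x a)) else 0) v"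
      using lin_eq_lin_ext[OF lin_sf_mode, of "\<not> fst x" "int (snd x) + 1" v] by (simp only: ann)
    have "?D v = 0"
    proof (rule insert.IH)
      show "emb (?D v) = 0" unfolding emb_mode insert.prems by (simp add: lin_zero)
      have "keys (?D v) \<subseteq> {a. labs a \<subseteq> F}"
        unfolding D
      proof (rule keys_lin_ext_subset)
        fix a assume "a \<in> keys v"
        then have "labs a \<subseteq> insert x F" using insert.prems by blast
        then have "labs (reml x a) \<subseteq> F" using labs_reml[of x a] addl_reml(2)[of x a] by blast
        then show "keys (if x \<in> labs a then vscale (c a) (basis_vec (reml x a)) else 0) \<subseteq> {a. labs a \<subseteq> F}"
          using order_trans[OF keys_vscale, of "basis_vec (reml x a)" "{a. labs a \<subseteq> F}" "c a"] by simp
      qed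
      then show "\<forall>a\<in>keys (?D v). labs a \<subseteq> F" by blast
    qed
    have "x \<notin> labs a" if a: "a \<in> keys v" for a
    proof
      assume x: "x \<in> labs a"
      have "0 = lookup (?D v) (reml x a)" using \<open>?D v = 0\<close> by simp
      also have "\<dots> = (\<Sum>b\<in>keys v. if b = a then lookup v a * c a else 0)"
        unfolding D lookup_lin_ext
      proof (intro sum.cong refl)
        fix b
        have "b = a" if "x \<in> labs b" "reml x b = reml x a" using addl_reml(1) x that by metis
        then show "lookup v b * lookup (if x \<in> labs b then vscale (c b) (basis_vec (reml x b)) else 0) (reml x a)
          = (if b = a then lookup v a * c a else 0)"
          using x by (auto simp: lookup_vscale lookup_basis_vec)
      qed
      also have "\<dots> = lookup v a * c a" using a by simp
      finally show False using c[of a] a unfolding in_keys_iff by simp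
    qed
    then have "\<forall>a\<in>keys v. labs a \<subseteq> F" using insert.prems by blast
    then show ?case using insert by blast
  qed
  from this[of "\<Union>a\<in>keys v. labs a" v]
  show "emb v = 0 \<Longrightarrow> v = 0" by (simp add: labs_def) blast
qed

lemma emb_inj: "emb u = emb v \<Longrightarrow> u = v"
  using emb_eq_zero[of "u - v"] by (simp add: lin_diff)

text \<open>Both fields are nested normally ordered products along the same sorted word: on the left
  by definition, on the right by associativity. The mode sum is pulled through \<open>emb\<close> by
  injectivity.\<close>

theorem emb_prod: "emb (sf_field a m v) = VZ.Yv (emb (basis_vec a)) m (emb v)"
proof -
  have "emb (sf_field_word gs m v) = VZ.Yv (fword gs) m (emb v)" for gs m v
  proof (induction gs arbitrary: m v)
    case Nil
    then show ?case unfolding Yv_fword sf_field_word.simps by (auto simp: id_field_def when_def lin_zero)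
  next
    case (Cons g gs)
    show ?case
      unfolding Yv_fword(2) sf_field_word.simps field_prod_def
      by (subst Sum_any_inj_lin[OF lin_emb emb_eq_zero])
        (simp_all add: lin_scale[OF lin_emb] lin_diff[OF lin_emb] emb_mode Cons)
  qed
  then show ?thesis by (cases a) (simp add: sf_field_def emb_basis gens_def)
qed

lemma emb_parity: "keys (emb (basis_vec (A, B))) \<subseteq> {b. odd (snd b) = odd (fcard A + fcard B)}"
  using fword_parity[of "gens (A, B)"] by (simp add: emb_basis gens_def length_sorted_fset)

section \<open>The image is the kernel of the screening operator\<close>

lemma emb_decompose: "\<exists>u w. x = emb u + fb (-1) (emb w)"
proof -
  let ?U = "{x. \<exists>u w. x = emb u + fb (-1) (emb w)}"
  have sub: "free.subspace ?U"
    unfolding free.subspace_def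
  proof (intro conjI ballI allI)
    have "0 = emb 0 + fb (-1) (emb 0)" by (simp add: lin_zero)
    then show "0 \<in> ?U" by blast
    fix x assume "x \<in> ?U"
    then obtain u w where x: "x = emb u + fb (-1) (emb w)" by blast
    have "vscale c x = emb (vscale c u) + fb (-1) (emb (vscale c w))" for c
      unfolding x by (simp only: lin_scale[OF lin_emb] lin_scale[OF lin_exp_field] free.scale_right_distrib)
    then show "vscale c x \<in> ?U" for c by blast
    fix y assume "y \<in> ?U"
    then obtain u' w' where y: "y = emb u' + fb (-1) (emb w')" by blast
    have "x + y = emb (u + u') + fb (-1) (emb (w + w'))"
      unfolding x y by (simp add: lin_add)
    then show "x + y \<in> ?U" by blast
  qed
  have U1: "emb u \<in> ?U" for u
  proof -
    have "emb u = emb u + fb (-1) (emb 0)" by (simp add: lin_zero)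
    then show ?thesis by blast
  qed
  have U2: "fb (-1) (emb w) \<in> ?U" for w
  proof -
    have "fb (-1) (emb w) = emb 0 + fb (-1) (emb w)" by (simp add: lin_zero)
    then show ?thesis by blast
  qed
  have c: "fc k (emb u) = emb (sf_mode False k u)" for k u by (simp add: emb_mode psi_simps)
  \<comment> \<open>Every mode of \<open>fb\<close> other than -1 is a multiple of a mode of
    \<open>psi True\<close>, since the factor \<open>- (k + 1)\<close> is invertible there.\<close>
  have b: "fb k (emb u) = emb (vscale (- 1 / of_int (k + 1)) (sf_mode True (k + 1) u))" if "k \<noteq> -1" for k u
  proof -
    have "of_int (k + 1) \<noteq> (0 :: complex)" using that by (simp only: of_int_eq_0_iff)
    then have "- 1 / of_int (k + 1) * - of_int (k + 1) = (1 :: complex)"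
      by (simp only: divide_minus_left mult_minus_left mult_minus_right minus_minus nonzero_eq_divide_eq[symmetric] divide_self_if if_False times_divide_eq_left mult_1_left)
    moreover have "k + 1 - 1 = k" by simp
    ultimately show ?thesis
      by (simp only: lin_scale[OF lin_emb] emb_mode psi_simps free.scale_scale free.scale_one)
  qed
  have bb: "fb (-1) (fb (-1) v) = 0" for v using fermion_same'(1)[of "-1" "-1" v] vec_self_neg by blast
  have "x \<in> ?U"
  proof (rule fermion_closed_UNIV[OF sub])
    show "exp_basis 0 \<in> ?U" using U1[of "basis_vec ({||}, {||})"] by (simp add: emb_vac)
    fix k v assume "v \<in> ?U"
    then obtain u w where v: "v = emb u + fb (-1) (emb w)" by blast
    show "fb k v \<in> ?U"
    proof (cases "k = -1")
      case True
      then show ?thesis unfolding v using U2 by (simp add: lin_add bb)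
    next
      case False
      have "fb k (fb (-1) (emb w)) \<in> ?U"
        unfolding fermion_same'(1)[of k "-1"] b[OF False] using U2 by (intro free.subspace_neg[OF sub])
      then show ?thesis
        unfolding v lin_add[OF lin_exp_field] using U1 b[OF False] by (intro free.subspace_add[OF sub]) auto
    qed
    have "fc k (fb (-1) (emb w)) = (if k = 0 then emb w else 0) - fb (-1) (fc k (emb w))"
      using fermion_anticomm[of "-1" k "emb w"] by (simp add: eq_diff_eq add.commute)
    also have "\<dots> \<in> ?U"
      unfolding c using U1[of w] U1[of 0] U2 by (intro free.subspace_diff[OF sub]) (auto simp: lin_zero)
    finally show "fc k v \<in> ?U"
      unfolding v lin_add[OF lin_exp_field] c using U1 by (intro free.subspace_add[OF sub]) auto
  qed
  then show ?thesis by blast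
qed

lemma screening_emb: "fc 0 (emb u) = 0"
proof -
  have "sf_mode False 0 u = 0"
  proof -
    have "sf_basis False 0 = (\<lambda>_. 0)" by (auto simp: sf_basis_def fun_eq_iff)
    then show ?thesis by (simp add: sf_mode_def lin_ext_def)
  qed
  then show ?thesis using emb_mode[of False 0 u] by (simp add: psi_simps lin_zero)
qed

text \<open>On \<open>emb u + fb (-1) (emb w)\<close> the square of \<open>fb (-1)\<close> removes
  the second summand, and \<open>fc 0 (fb (-1) (emb u)) = emb u\<close> because \<open>fc 0\<close>
  kills \<open>emb u\<close>. Uniqueness is injectivity of \<open>emb\<close>.\<close>

lemma screening_projection: "\<exists>!u. emb u = fc 0 (fb (-1) x)"
proof -
  obtain u w where x: "x = emb u + fb (-1) (emb w)" using emb_decompose by blast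
  have "fb (-1) (fb (-1) v) = 0" for v using fermion_same'(1)[of "-1" "-1" v] vec_self_neg by blast
  then have "fc 0 (fb (-1) x) = fc 0 (fb (-1) (emb u))" unfolding x by (simp add: lin_add)
  also have "\<dots> = emb u"
    using fermion_anticomm[of "-1" 0 "emb u"] by (simp add: screening_emb lin_zero)
  finally show ?thesis using emb_inj by metis
qed

text \<open>A left inverse of \<open>emb\<close>: \<open>c\<^sub>(\<^sub>0\<^sub>) b\<^sub>(\<^sub>-\<^sub>1\<^sub>)\<close> is a projection onto the kernel of \<open>c\<^sub>(\<^sub>0\<^sub>)\<close>.\<close>

definition ret :: "boson_label vec \<Rightarrow> sf_label vec" where
  "ret x = (THE u. emb u = fc 0 (fb (-1) x))"

lemma emb_ret: "emb (ret x) = fc 0 (fb (-1) x)"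
  unfolding ret_def by (rule theI'[OF screening_projection])

text \<open>The projection seen through its complement; this form shows, also inside a tensor
  product, that a vector killed by the screening is fixed.\<close>

lemma emb_ret': "emb (ret x) = x - fb (-1) (fc 0 x)"
  unfolding emb_ret using fermion_anticomm[of "-1" 0 x] by (simp add: eq_diff_eq add.commute)

lemma lin_ret: "lin ret"
  by (rule linI; rule emb_inj) (simp_all add: lin_add lin_scale emb_ret)

lemma ret_emb: "ret (emb u) = u"
  by (rule emb_inj) (simp add: emb_ret' screening_emb lin_zero)

section \<open>Vertex superalgebras with a homogeneous basis\<close>

definition bprod :: "'b based_vertex_data \<Rightarrow> 'b vec \<Rightarrow> int \<Rightarrow> 'b vec \<Rightarrow> 'b vec" where
  "bprod X u m v = lin_ext (\<lambda>a. lin_ext (\<lambda>b. bas_prod X a m b) v) u"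

definition carr :: "'b based_vertex_data \<Rightarrow> 'b vec set" where
  "carr X = {v. keys v \<subseteq> bas_set X}"

definition ppart :: "'b based_vertex_data \<Rightarrow> bool \<Rightarrow> 'b vec set" where
  "ppart X p = {v. keys v \<subseteq> {b \<in> bas_set X. bas_odd X b = p}}"

lemma span_va_simps [simp]:
  "va_carrier (span_va X) = carr X" "va_part (span_va X) = ppart X" "va_vac (span_va X) = basis_vec (bas_vac X)"
  "va_prod (span_va X) = bprod X"
  by (auto simp: span_va_def carr_def ppart_def bprod_def fun_eq_iff)

lemma lin_bprod1: "lin (\<lambda>u. bprod X u m v)"
  by (simp add: bprod_def)

lemma lin_bprod2: "lin (bprod X u m)"
proof (rule linI)
  show "bprod X u m (v + w) = bprod X u m v + bprod X u m w" for v w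
    by (simp add: bprod_def lin_ext_add lin_ext_plus)
  show "bprod X u m (vscale c v) = vscale c (bprod X u m v)" for c v
    unfolding bprod_def by (simp add: lin_ext_vscale lin_ext_def[of _ u] free.scale_sum_right mult.commute)
qed

lemma bprod_basis [simp]: "bprod X (basis_vec a) m (basis_vec b) = bas_prod X a m b"
  by (simp add: bprod_def)

lemma bprod_basis1: "bprod X (basis_vec a) m v = lin_ext (bas_prod X a m) v"
  by (simp add: bprod_def)

lemmas bprod_add1 = lin_add[OF lin_bprod1] and bprod_add2 = lin_add[OF lin_bprod2]
  and bprod_scale1 = lin_scale[OF lin_bprod1] and bprod_scale2 = lin_scale[OF lin_bprod2]
  and bprod_zero1 = lin_zero[OF lin_bprod1] and bprod_zero2 = lin_zero[OF lin_bprod2]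
  and bprod_diff2 = lin_diff[OF lin_bprod2]

lemma subspace_keys: "free.subspace {v. keys v \<subseteq> S}"
  unfolding free.subspace_def mem_Collect_eq
  by (intro conjI ballI allI order_trans[OF Poly_Mapping.keys_add] order_trans[OF keys_vscale] Un_least) simp_all

text \<open>Axioms on labels from which the multilinear ones follow, relative to
  \<open>bas_set\<close> because a tensor power uses lists of one fixed length. In
  \<open>loc\<close> the order \<open>N\<close> is chosen before \<open>c\<close>, as the order of
  locality must not depend on the vector acted upon.\<close>

locale based_vsa =
  fixes X :: "'b based_vertex_data"
  assumes vac_in: "bas_vac X \<in> bas_set X" and vac_even: "\<not> bas_odd X (bas_vac X)"
    and prod_keys: "\<lbrakk>a \<in> bas_set X; b \<in> bas_set X\<rbrakk> \<Longrightarrow>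
      keys (bas_prod X a m b) \<subseteq> {c \<in> bas_set X. bas_odd X c = (bas_odd X a \<noteq> bas_odd X b)}"
    and trunc: "\<lbrakk>a \<in> bas_set X; b \<in> bas_set X\<rbrakk> \<Longrightarrow> \<exists>N. \<forall>m\<ge>N. bas_prod X a m b = 0"
    and vac_prod: "a \<in> bas_set X \<Longrightarrow> bas_prod X (bas_vac X) m a = (if m = -1 then basis_vec a else 0)"
    and create: "a \<in> bas_set X \<Longrightarrow> bas_prod X a (-1) (bas_vac X) = basis_vec a"
      "\<lbrakk>a \<in> bas_set X; m \<ge> 0\<rbrakk> \<Longrightarrow> bas_prod X a m (bas_vac X) = 0"
    and transl: "\<lbrakk>a \<in> bas_set X; b \<in> bas_set X\<rbrakk> \<Longrightarrow>
      bprod X (bas_prod X a m b) (-2) (basis_vec (bas_vac X)) - bprod X (basis_vec a) m (bas_prod X b (-2) (bas_vac X))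
        = vscale (- of_int m) (bas_prod X a (m - 1) b)"
    and loc: "\<lbrakk>a \<in> bas_set X; b \<in> bas_set X\<rbrakk> \<Longrightarrow> \<exists>N. \<forall>c\<in>bas_set X.
      (dl ^^ N) (\<lambda>m k. bprod X (basis_vec a) m (bas_prod X b k c)
        - vscale (super_sign (bas_odd X a) (bas_odd X b)) (bprod X (basis_vec b) k (bas_prod X a m c))) = (\<lambda>m k. 0)"
begin

lemma ppart_carr: "v \<in> ppart X p \<Longrightarrow> v \<in> carr X"
  by (auto simp: ppart_def carr_def)

lemma bprod_ppart:
  assumes "u \<in> ppart X p" "v \<in> ppart X q"
  shows "bprod X u m v \<in> ppart X (p \<noteq> q)"
proof -
  have "keys (bas_prod X a m b) \<subseteq> {c \<in> bas_set X. bas_odd X c = (p \<noteq> q)}"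
    if "a \<in> keys u" "b \<in> keys v" for a b
  proof -
    have "a \<in> bas_set X" "bas_odd X a = p" "b \<in> bas_set X" "bas_odd X b = q"
      using that assms by (auto simp: ppart_def)
    then show ?thesis using prod_keys[of a b m] by simp
  qed
  then have "keys (bprod X u m v) \<subseteq> {c \<in> bas_set X. bas_odd X c = (p \<noteq> q)}"
    unfolding bprod_def by (intro keys_lin_ext_subset) auto
  then show ?thesis by (simp add: ppart_def)
qed

lemma bprod_trunc:
  assumes u: "u \<in> carr X" and v: "v \<in> carr X"
  shows "\<exists>N. \<forall>m\<ge>N. bprod X u m v = 0"
proof -
  have 1: "\<exists>N. \<forall>m\<ge>N. bprod X (basis_vec a) m v = 0" if a: "a \<in> bas_set X" for a
    using v unfolding carr_def mem_Collect_eq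
  proof (induction v rule: vec_induct)
    case zero
    then show ?case by (simp add: bprod_zero2)
  next
    case (basis b)
    then show ?case using trunc[OF a] by simp
  next
    case (scale_add c w w')
    then obtain N M where "\<forall>m\<ge>N. bprod X (basis_vec a) m w = 0" "\<forall>m\<ge>M. bprod X (basis_vec a) m w' = 0" by blast
    then show ?case by (intro exI[of _ "max N M"]) (simp add: bprod_add2 bprod_scale2)
  qed
  show ?thesis
    using u unfolding carr_def mem_Collect_eq
  proof (induction u rule: vec_induct)
    case zero
    then show ?case by (simp add: bprod_zero1)
  next
    case (basis b)
    then show ?case using 1 by simp
  next
    case (scale_add c w w')
    then obtain N M where "\<forall>m\<ge>N. bprod X w m v = 0" "\<forall>m\<ge>M. bprod X w' m v = 0" by blast
    then show ?case by (intro exI[of _ "max N M"]) (simp add: bprod_add1 bprod_scale1)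
  qed
qed

lemma bprod_vac: "v \<in> carr X \<Longrightarrow> bprod X (basis_vec (bas_vac X)) m v = (if m = -1 then v else 0)"
proof -
  assume v: "v \<in> carr X"
  show ?thesis
  proof (rule lin_eqI[where f = "bprod X (basis_vec (bas_vac X)) m" and g = "\<lambda>v. if m = -1 then v else 0"])
    show "lin (\<lambda>v. if m = -1 then v else 0)" by (cases "m = -1") (simp_all add: lin_id lin_const_zero)
    fix b assume "b \<in> keys v"
    then show "bprod X (basis_vec (bas_vac X)) m (basis_vec b) = (if m = -1 then basis_vec b else 0)"
      using v vac_prod unfolding carr_def by auto
  qed (rule lin_bprod2)
qed

lemma bprod_create:
  assumes "u \<in> carr X"
  shows "bprod X u (-1) (basis_vec (bas_vac X)) = u" "m \<ge> 0 \<Longrightarrow> bprod X u m (basis_vec (bas_vac X)) = 0"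
proof -
  show "bprod X u (-1) (basis_vec (bas_vac X)) = u"
    by (rule lin_eqI[where f = "\<lambda>u. bprod X u (-1) (basis_vec (bas_vac X))" and g = "\<lambda>u. u"])
      (use assms create in \<open>auto simp: lin_bprod1 lin_id carr_def\<close>)
  show "bprod X u m (basis_vec (bas_vac X)) = 0" if "m \<ge> 0"
    by (rule lin_eqI[where f = "\<lambda>u. bprod X u m (basis_vec (bas_vac X))" and g = "\<lambda>u. 0"])
      (use assms create that in \<open>auto simp: lin_bprod1 lin_const_zero carr_def\<close>)
qed

abbreviation btransl :: "'b vec \<Rightarrow> 'b vec" where
  "btransl u \<equiv> bprod X u (-2) (basis_vec (bas_vac X))"

lemma bprod_transl:
  assumes u: "u \<in> carr X" and v: "v \<in> carr X"
  shows "btransl (bprod X u m v) - bprod X u m (btransl v) = vscale (- of_int m) (bprod X u (m - 1) v)"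
proof (rule lin_eqI[where v = u and f = "\<lambda>u. btransl (bprod X u m v) - bprod X u m (btransl v)"
      and g = "\<lambda>u. vscale (- of_int m) (bprod X u (m - 1) v)"])
  show "lin (\<lambda>u. btransl (bprod X u m v) - bprod X u m (btransl v))"
    by (rule lin_minus[OF lin_comp[OF lin_bprod1 lin_bprod1] lin_bprod1])
  show "lin (\<lambda>u. vscale (- of_int m) (bprod X u (m - 1) v))"
    by (rule lin_vscale[OF lin_bprod1])
  fix a assume a: "a \<in> keys u"
  show "btransl (bprod X (basis_vec a) m v) - bprod X (basis_vec a) m (btransl v) = vscale (- of_int m) (bprod X (basis_vec a) (m - 1) v)"
  proof (rule lin_eqI[where v = v and f = "\<lambda>v. btransl (bprod X (basis_vec a) m v) - bprod X (basis_vec a) m (btransl v)"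
      and g = "\<lambda>v. vscale (- of_int m) (bprod X (basis_vec a) (m - 1) v)"])
    show "lin (\<lambda>v. btransl (bprod X (basis_vec a) m v) - bprod X (basis_vec a) m (btransl v))"
      by (rule lin_minus[OF lin_comp[OF lin_bprod1 lin_bprod2] lin_comp[OF lin_bprod2 lin_bprod1]])
    show "lin (\<lambda>v. vscale (- of_int m) (bprod X (basis_vec a) (m - 1) v))"
      by (rule lin_vscale[OF lin_bprod2])
    fix b assume "b \<in> keys v"
    then show "btransl (bprod X (basis_vec a) m (basis_vec b)) - bprod X (basis_vec a) m (btransl (basis_vec b))
        = vscale (- of_int m) (bprod X (basis_vec a) (m - 1) (basis_vec b))"
      using transl[of a b m] a u v by (auto simp: carr_def)
  qed
qed

lemma bprod_local:
  assumes u: "u \<in> ppart X p" and w: "w \<in> ppart X q"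
  shows "\<exists>N. \<forall>v\<in>carr X. (dl ^^ N) (\<lambda>m k. bprod X u m (bprod X w k v)
    - vscale (super_sign p q) (bprod X w k (bprod X u m v))) = (\<lambda>m k. 0)"
proof -
  let ?L = "\<lambda>u w v m k. bprod X u m (bprod X w k v) - vscale (super_sign p q) (bprod X w k (bprod X u m v))"
  have Lu: "?L (vscale c u + u') w v = (\<lambda>m k. vscale c (?L u w v m k) + ?L u' w v m k)" for c u u' w v
    by (simp add: fun_eq_iff bprod_add1 bprod_add2 bprod_scale1 bprod_scale2 free.scale_right_distrib free.scale_right_diff_distrib mult.commute)
  have Lw: "?L u (vscale c w + w') v = (\<lambda>m k. vscale c (?L u w v m k) + ?L u w' v m k)" for c u w w' v
    by (simp add: fun_eq_iff bprod_add1 bprod_add2 bprod_scale1 bprod_scale2 free.scale_right_distrib free.scale_right_diff_distrib mult.commute)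
  have Lv: "?L u w (vscale c v + v') = (\<lambda>m k. vscale c (?L u w v m k) + ?L u w v' m k)" for c u w v v'
    by (simp add: fun_eq_iff bprod_add2 bprod_scale2 free.scale_right_distrib free.scale_right_diff_distrib mult.commute)
  have comb: "(dl ^^ N) (\<lambda>m k. vscale c (F m k) + G m k) = (\<lambda>m k. 0)"
    if "(dl ^^ N) F = (\<lambda>m k. 0)" "(dl ^^ N) G = (\<lambda>m k. 0)" for N c and F G :: "int \<Rightarrow> int \<Rightarrow> 'b vec"
    using that by (simp add: dl_pow_add dl_pow_lin[OF lin_vscale_self])
  have ab: "\<exists>N. \<forall>v\<in>carr X. (dl ^^ N) (?L (basis_vec a) (basis_vec b) v) = (\<lambda>m k. 0)"
    if a: "a \<in> bas_set X" "bas_odd X a = p" and b: "b \<in> bas_set X" "bas_odd X b = q" for a b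
  proof -
    obtain N where N: "\<forall>c\<in>bas_set X. (dl ^^ N) (?L (basis_vec a) (basis_vec b) (basis_vec c)) = (\<lambda>m k. 0)"
      using loc[OF a(1) b(1)] a(2) b(2) by auto
    have "(dl ^^ N) (?L (basis_vec a) (basis_vec b) v) = (\<lambda>m k. 0)" if "v \<in> carr X" for v
      using that unfolding carr_def mem_Collect_eq
    proof (induction v rule: vec_induct)
      case zero
      then show ?case by (simp add: bprod_zero2 dl_pow_zero)
    next
      case (basis c)
      then show ?case using N by blast
    next
      case (scale_add c w w')
      then show ?case unfolding Lv by (intro comb)
    qed
    then show ?thesis by blast
  qed
  have au: "\<exists>N. \<forall>v\<in>carr X. (dl ^^ N) (?L (basis_vec a) w v) = (\<lambda>m k. 0)"
    if a: "a \<in> bas_set X" "bas_odd X a = p" for a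
    using w unfolding ppart_def mem_Collect_eq
  proof (induction w rule: vec_induct)
    case zero
    then show ?case by (simp add: bprod_zero1 bprod_zero2 dl_pow_zero)
  next
    case (basis b)
    then show ?case using ab[OF a] by simp
  next
    case (scale_add c w w')
    then obtain N M where "\<forall>v\<in>carr X. (dl ^^ N) (?L (basis_vec a) w v) = (\<lambda>m k. 0)" "\<forall>v\<in>carr X. (dl ^^ M) (?L (basis_vec a) w' v) = (\<lambda>m k. 0)"
      by blast
    then have "\<forall>v\<in>carr X. (dl ^^ max N M) (?L (basis_vec a) w v) = (\<lambda>m k. 0)" "\<forall>v\<in>carr X. (dl ^^ max N M) (?L (basis_vec a) w' v) = (\<lambda>m k. 0)"
      by (blast intro: dl_pow_mono max.cobounded1 max.cobounded2)+
    then have "\<forall>v\<in>carr X. (dl ^^ max N M) (?L (basis_vec a) (vscale c w + w') v) = (\<lambda>m k. 0)"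
      unfolding Lw using comb by blast
    then show ?case by blast
  qed
  show ?thesis
    using u unfolding ppart_def mem_Collect_eq
  proof (induction u rule: vec_induct)
    case zero
    then show ?case by (simp add: bprod_zero1 bprod_zero2 dl_pow_zero)
  next
    case (basis a)
    then show ?case using au by simp
  next
    case (scale_add c u u')
    then obtain N M where "\<forall>v\<in>carr X. (dl ^^ N) (?L u w v) = (\<lambda>m k. 0)" "\<forall>v\<in>carr X. (dl ^^ M) (?L u' w v) = (\<lambda>m k. 0)"
      by blast
    then have "\<forall>v\<in>carr X. (dl ^^ max N M) (?L u w v) = (\<lambda>m k. 0)" "\<forall>v\<in>carr X. (dl ^^ max N M) (?L u' w v) = (\<lambda>m k. 0)"
      by (blast intro: dl_pow_mono max.cobounded1 max.cobounded2)+
    then have "\<forall>v\<in>carr X. (dl ^^ max N M) (?L (vscale c u + u') w v) = (\<lambda>m k. 0)"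
      unfolding Lu using comb by blast
    then show ?case by blast
  qed
qed

lemma carr_grading: "carr X = {u + v | u v. u \<in> ppart X False \<and> v \<in> ppart X True}"
proof (intro equalityI subsetI)
  fix v assume v: "v \<in> carr X"
  let ?e = "\<lambda>p. lin_ext (\<lambda>b. if bas_odd X b = p then basis_vec b else 0) v"
  have "?e False + ?e True = lin_ext basis_vec v"
    unfolding lin_ext_plus by (rule lin_ext_cong) auto
  moreover have "lin_ext basis_vec v = v" using lin_ext_id[of 1 v] by simp
  ultimately have "v = ?e False + ?e True" by metis
  moreover have "?e p \<in> ppart X p" for p
    unfolding ppart_def mem_Collect_eq using v by (intro keys_lin_ext_subset) (auto simp: carr_def)
  ultimately show "v \<in> {u + v | u v. u \<in> ppart X False \<and> v \<in> ppart X True}" by blast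
next
  fix w assume "w \<in> {u + v | u v. u \<in> ppart X False \<and> v \<in> ppart X True}"
  then obtain u v where w: "w = u + v" "u \<in> carr X" "v \<in> carr X" using ppart_carr by blast
  then show "w \<in> carr X" using free.subspace_add[OF subspace_keys] unfolding carr_def by blast
qed

theorem vertex_superalgebra_span: "vertex_superalgebra (span_va X)"
proof (unfold_locales, unfold span_va_simps va_transl_def)
  show "free.subspace (carr X)" "free.subspace (ppart X p)" for p
    unfolding carr_def ppart_def by (rule subspace_keys)+
  show "carr X = {u + v | u v. u \<in> ppart X False \<and> v \<in> ppart X True}" by (rule carr_grading)
  show "ppart X False \<inter> ppart X True = {0}"
  proof -
    have "v = 0" if "v \<in> ppart X False" "v \<in> ppart X True" for v
    proof -
      have "keys v = {}" using that unfolding ppart_def by blast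
      then show ?thesis by (simp only: keys_eq_empty)
    qed
    then show ?thesis by (auto simp: ppart_def)
  qed
  show "basis_vec (bas_vac X) \<in> ppart X False" using vac_in vac_even by (simp add: ppart_def)
  show "bprod X a m b \<in> ppart X (p \<noteq> q)" if "a \<in> ppart X p" "b \<in> ppart X q" for a b p q m
    using that by (rule bprod_ppart)
  show "\<exists>N::nat. \<forall>m k. \<forall>v\<in>carr X. (\<Sum>j\<le>N. vscale ((-1) ^ j * of_nat (N choose j))
            (bprod X a (m + int (N - j)) (bprod X b (k + int j) v)
             - vscale (super_sign p q) (bprod X b (k + int j) (bprod X a (m + int (N - j)) v)))) = 0"
    if ab: "a \<in> ppart X p" "b \<in> ppart X q" for a b p q
  proof -
    obtain N where N: "\<forall>v\<in>carr X. (dl ^^ N) (\<lambda>m k. bprod X a m (bprod X b k v)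
      - vscale (super_sign p q) (bprod X b k (bprod X a m v))) = (\<lambda>m k. 0)"
      using bprod_local[OF ab] by blast
    show ?thesis
    proof (intro exI[of _ N] allI ballI)
      fix m k v assume "v \<in> carr X"
      then have "(dl ^^ N) (\<lambda>m k. bprod X a m (bprod X b k v)
        - vscale (super_sign p q) (bprod X b k (bprod X a m v))) m k = 0" using N by simp
      then show "(\<Sum>j\<le>N. vscale ((-1) ^ j * of_nat (N choose j))
            (bprod X a (m + int (N - j)) (bprod X b (k + int j) v)
             - vscale (super_sign p q) (bprod X b (k + int j) (bprod X a (m + int (N - j)) v)))) = 0"
        unfolding dl_pow_expand .
    qed
  qed
qed (simp_all add: bprod_add1 bprod_add2 bprod_scale1 bprod_scale2 bprod_trunc bprod_vac bprod_create bprod_transl)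

end

lemma VZ_simps [simp]: "bas_set VZ = UNIV" "bas_vac VZ = ({#}, 0)" "bas_odd VZ b = odd (snd b)"
  "bas_prod VZ a m b = boson_field a m (basis_vec b)"
  by (simp_all add: VZ_def split_def)

lemma bprod_VZ_basis: "bprod VZ (basis_vec a) m v = boson_field a m v"
proof -
  have "bas_prod VZ a m = (\<lambda>b. boson_field a m (basis_vec b))" by (rule ext) simp
  then show ?thesis
    unfolding bprod_basis1 using lin_eq_lin_ext[OF is_field_lin[OF VZ.field], of a m v] by simp
qed

lemma bprod_VZ: "bprod VZ = VZ.Yv"
  by (intro ext) (simp only: bprod_def VZ.Yv_def bprod_VZ_basis[unfolded bprod_basis1])

text \<open>Covariance at mode -1, applied to the vacuum, turns \<open>transl\<close> of a state
  into its mode -2 on the vacuum.\<close>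

lemma transl_basis: "transl v = VZ.Yv v (-2) (exp_basis 0)"
proof (rule lin_eqI[where f = transl and g = "\<lambda>v. VZ.Yv v (-2) (exp_basis 0)"])
  fix b
  have "transl (boson_field b (-1) (exp_basis 0)) = boson_field b (-1) (transl (exp_basis 0)) - vscale (of_int (-1)) (boson_field b (-1 - 1) (exp_basis 0))"
    using VZ.cov[of b] unfolding covariant_def by blast
  then show "transl (basis_vec b) = VZ.Yv (basis_vec b) (-2) (exp_basis 0)"
    using VZ.creation[of b] by (simp add: creates_def VZ.T_vac lin_zero[OF is_field_lin[OF VZ.field]])
qed (simp_all add: lin_transl VZ.Yv_lin1)

lemma based_VZ: "based_vsa VZ"
proof
  fix a b :: boson_label
  show "\<exists>N. \<forall>c\<in>bas_set VZ. (dl ^^ N) (\<lambda>m k. bprod VZ (basis_vec a) m (bas_prod VZ b k c)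
        - vscale (super_sign (bas_odd VZ a) (bas_odd VZ b)) (bprod VZ (basis_vec b) k (bas_prod VZ a m c))) = (\<lambda>m k. 0)"
    using VZ.loc[of a b] unfolding mlocal_def by (auto simp: bprod_VZ_basis)
  show "bprod VZ (bas_prod VZ a m b) (-2) (basis_vec (bas_vac VZ)) - bprod VZ (basis_vec a) m (bas_prod VZ b (-2) (bas_vac VZ))
        = vscale (- of_int m) (bas_prod VZ a (m - 1) b)" for m
  proof -
    have "transl (boson_field a m (basis_vec b)) = boson_field a m (transl (basis_vec b)) - vscale (of_int m) (boson_field a (m - 1) (basis_vec b))"
      using VZ.cov[of a] unfolding covariant_def by blast
    then show ?thesis by (simp add: bprod_VZ bprod_VZ_basis transl_basis)
  qed
  show "\<exists>N. \<forall>m\<ge>N. bas_prod VZ a m b = 0"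
    using VZ.field[of a] by (simp add: is_field_def)
  show "keys (bas_prod VZ a m b) \<subseteq> {c \<in> bas_set VZ. bas_odd VZ c = (bas_odd VZ a \<noteq> bas_odd VZ b)}" for m
    using VZ.parity[of a m b] by simp
qed (use VZ.creation in \<open>auto simp: creates_def VZ.vac_field id_field_def\<close>)

section \<open>Super tensor powers\<close>

definition tens :: "'b vec \<Rightarrow> 'b list vec \<Rightarrow> 'b list vec" where
  "tens u v = lin_ext (\<lambda>b. lin_ext (\<lambda>bs. basis_vec (b # bs)) v) u"

lemma lin_tens1: "lin (\<lambda>u. tens u v)"
  by (simp add: tens_def)

lemma lin_tens2: "lin (tens u)"
proof (rule linI)
  show "tens u (v + w) = tens u v + tens u w" for v w
    by (simp add: tens_def lin_ext_add lin_ext_plus)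
  show "tens u (vscale c v) = vscale c (tens u v)" for c v
    unfolding tens_def by (simp add: lin_ext_vscale lin_ext_def[of _ u] free.scale_sum_right mult.commute)
qed

lemma tens_basis: "tens (basis_vec b) (basis_vec bs) = basis_vec (b # bs)"
  by (simp add: tens_def)

lemmas tens_add1 = lin_add[OF lin_tens1] and tens_add2 = lin_add[OF lin_tens2]
  and tens_scale1 = lin_scale[OF lin_tens1] and tens_scale2 = lin_scale[OF lin_tens2]
  and tens_zero1 [simp] = lin_zero[OF lin_tens1] and tens_zero2 [simp] = lin_zero[OF lin_tens2]
  and tens_diff1 = lin_diff[OF lin_tens1] and tens_diff2 = lin_diff[OF lin_tens2]

lemma keys_tens_subset:
  assumes "\<And>b bs. b \<in> keys u \<Longrightarrow> bs \<in> keys v \<Longrightarrow> b # bs \<in> S"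
  shows "keys (tens u v) \<subseteq> S"
  unfolding tens_def using assms by (intro keys_lin_ext_subset) simp

definition truncated :: "(int \<Rightarrow> 'b vec) \<Rightarrow> bool" where
  "truncated f \<longleftrightarrow> (\<exists>N. \<forall>k\<ge>N. f k = 0)"

text \<open>Coefficient of \<open>z^(-m-1)\<close> in a tensor product of two series: the mode
  indices add up to \<open>m - 1\<close> rather than \<open>m\<close>, because each series brings
  its own shift by \<open>z^(-1)\<close>.\<close>

definition cv :: "(int \<Rightarrow> 'b vec) \<Rightarrow> (int \<Rightarrow> 'b list vec) \<Rightarrow> int \<Rightarrow> 'b list vec" where
  "cv f g m = Sum_any (\<lambda>k. tens (f k) (g (m - 1 - k)))"

lemma cv_support: "truncated f \<Longrightarrow> truncated g \<Longrightarrow> finite {k. f k \<noteq> 0 \<and> g (m - 1 - k) \<noteq> 0}"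
proof -
  assume "truncated f" "truncated g"
  then obtain N M where N: "\<forall>k\<ge>N. f k = 0" and M: "\<forall>k\<ge>M. g k = 0" unfolding truncated_def by blast
  have "{k. f k \<noteq> 0 \<and> g (m - 1 - k) \<noteq> 0} \<subseteq> {m - M..N}"
  proof
    fix k assume "k \<in> {k. f k \<noteq> 0 \<and> g (m - 1 - k) \<noteq> 0}"
    then have "\<not> k \<ge> N" "\<not> m - 1 - k \<ge> M" using N M by blast+
    then show "k \<in> {m - M..N}" by simp
  qed
  then show ?thesis by (rule finite_subset) simp
qed

lemma cv_finite: "truncated f \<Longrightarrow> truncated g \<Longrightarrow> finite {k. tens (f k) (g (m - 1 - k)) \<noteq> 0}"
  by (rule finite_subset[OF _ cv_support[of f g m]]) auto

lemma cv_comb1: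
  assumes "truncated f" "truncated f'" "truncated g"
  shows "cv (\<lambda>k. vscale c (f k) + f' k) g m = vscale c (cv f g m) + cv f' g m"
proof -
  have "finite {k. vscale c (tens (f k) (g (m - 1 - k))) \<noteq> 0}"
    by (rule finite_subset[OF _ cv_finite[OF assms(1,3), of m]]) auto
  then show ?thesis
    unfolding cv_def tens_add1 tens_scale1
    by (simp add: Sum_any.distrib cv_finite assms Sum_any_lin[OF lin_vscale_self cv_finite, symmetric])
qed

lemma cv_comb2:
  assumes "truncated f" "truncated g" "truncated g'"
  shows "cv f (\<lambda>k. vscale c (g k) + g' k) m = vscale c (cv f g m) + cv f g' m"
proof -
  have "finite {k. vscale c (tens (f k) (g (m - 1 - k))) \<noteq> 0}"
    by (rule finite_subset[OF _ cv_finite[OF assms(1,2), of m]]) auto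
  then show ?thesis
    unfolding cv_def tens_add2 tens_scale2
    by (simp add: Sum_any.distrib cv_finite assms Sum_any_lin[OF lin_vscale_self cv_finite, symmetric])
qed

lemma cv_zero: "cv (\<lambda>k. 0) g m = 0" "cv f (\<lambda>k. 0) m = 0"
  by (simp_all add: cv_def)

lemma cv_delta: "cv (\<lambda>k. if k = -1 then u else 0) g m = tens u (g m)"
proof -
  have "cv (\<lambda>k. if k = -1 then u else 0) g m = (\<Sum>k\<in>{-1}. tens (if k = -1 then u else 0) (g (m - 1 - k)))"
    unfolding cv_def by (rule Sum_any.expand_superset) auto
  then show ?thesis by simp
qed

text \<open>For two series without negative powers of z only the indices from \<open>m\<close> to -1
  contribute; the two terms at mode -2 give translation its Leibniz form.\<close>

lemma cv_create:
  assumes "\<And>k. k \<ge> 0 \<Longrightarrow> f k = 0" "\<And>k. k \<ge> 0 \<Longrightarrow> g k = 0"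
  shows "cv f g (-1) = tens (f (-1)) (g (-1))"
    and "m \<ge> 0 \<Longrightarrow> cv f g m = 0"
    and "cv f g (-2) = tens (f (-1)) (g (-2)) + tens (f (-2)) (g (-1))"
proof -
  have z: "f k = 0 \<or> g (m - 1 - k) = 0" if "\<not> (m \<le> k \<and> k \<le> -1)" for k m
    using that assms(1)[of k] assms(2)[of "m - 1 - k"] by linarith
  have s: "cv f g m = (\<Sum>k\<in>{m..-1}. tens (f k) (g (m - 1 - k)))" for m
    unfolding cv_def by (rule Sum_any.expand_superset) (use z[of m] in fastforce)+
  show "cv f g (-1) = tens (f (-1)) (g (-1))" unfolding s by simp
  show "m \<ge> 0 \<Longrightarrow> cv f g m = 0" unfolding s by simp
  have "{-2..-1::int} = {-2, -1}" by auto
  then show "cv f g (-2) = tens (f (-1)) (g (-2)) + tens (f (-2)) (g (-1))" unfolding s by simp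
qed

text \<open>The Leibniz rule for the derivative in z: after reindexing, the factors
  \<open>k + 1\<close> and \<open>m - 1 - k\<close> add up to \<open>m\<close>.\<close>

lemma cv_deriv:
  assumes f: "truncated f" and g: "truncated g"
  shows "cv (\<lambda>k. vscale (- of_int k) (f (k - 1))) g m + cv f (\<lambda>k. vscale (- of_int k) (g (k - 1))) m
    = vscale (- of_int m) (cv f g (m - 1))"
proof -
  let ?t = "\<lambda>k. tens (f k) (g (m - 1 - 1 - k))"
  have fin: "finite {k. vscale (c k) (?t k) \<noteq> 0}" for c
    by (rule finite_subset[OF _ cv_finite[OF f g, of "m - 1"]]) auto
  have "cv (\<lambda>k. vscale (- of_int k) (f (k - 1))) g m = Sum_any (\<lambda>k. vscale (- of_int (k + 1)) (?t k))"
  proof -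
    let ?h = "\<lambda>k. vscale (- of_int k) (tens (f (k - 1)) (g (m - 1 - k)))"
    have "vscale (- of_int (k + 1)) (?t k) = ?h (k + 1)" for k
    proof -
      have "k + 1 - 1 = k" "m - 1 - (k + 1) = m - 1 - 1 - k" by simp_all
      then show ?thesis by (simp only:)
    qed
    then have "Sum_any (\<lambda>k. vscale (- of_int (k + 1)) (?t k)) = Sum_any (\<lambda>k. ?h (k + 1))"
      by (simp only:)
    then show ?thesis
      unfolding Sum_any_shift[of ?h] cv_def tens_scale1 by simp
  qed
  moreover have "cv f (\<lambda>k. vscale (- of_int k) (g (k - 1))) m = Sum_any (\<lambda>k. vscale (- of_int (m - 1 - k)) (?t k))"
    unfolding cv_def tens_scale2 by (simp add: algebra_simps)
  ultimately have "cv (\<lambda>k. vscale (- of_int k) (f (k - 1))) g m + cv f (\<lambda>k. vscale (- of_int k) (g (k - 1))) m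
      = Sum_any (\<lambda>k. vscale (- of_int (k + 1)) (?t k) + vscale (- of_int (m - 1 - k)) (?t k))"
    by (simp only: Sum_any.distrib[OF fin fin])
  also have "\<dots> = Sum_any (\<lambda>k. vscale (- of_int m) (?t k))"
    by (rule arg_cong[where f = Sum_any], rule ext) (simp add: free.scale_left_distrib[symmetric] del: free.scale_minus_left)
  also have "\<dots> = vscale (- of_int m) (cv f g (m - 1))"
    unfolding cv_def by (rule Sum_any_lin[OF lin_vscale_self cv_finite[OF f g], symmetric])
  finally show ?thesis .
qed

section \<open>Two-variable convolutions, for locality in a tensor product\<close>

definition conv :: "(int \<Rightarrow> int \<Rightarrow> 'b vec) \<Rightarrow> (int \<Rightarrow> int \<Rightarrow> 'b list vec) \<Rightarrow> int \<Rightarrow> int \<Rightarrow> 'b list vec" where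
  "conv F G m k = Sum_any (\<lambda>(i, j). tens (F i j) (G (m - 1 - i) (k - 1 - j)))"

definition convergent2 :: "(int \<Rightarrow> int \<Rightarrow> 'b vec) \<Rightarrow> (int \<Rightarrow> int \<Rightarrow> 'b list vec) \<Rightarrow> bool" where
  "convergent2 F G \<longleftrightarrow> (\<forall>m k. finite {(i, j). F i j \<noteq> 0 \<and> G (m - 1 - i) (k - 1 - j) \<noteq> 0})"

lemma convergent2_finite:
  assumes "convergent2 F G"
  shows "finite {x. (case x of (i, j) \<Rightarrow> tens (F i j) (G (m - 1 - i) (k - 1 - j))) \<noteq> 0}"
proof -
  have "finite {(i, j). F i j \<noteq> 0 \<and> G (m - 1 - i) (k - 1 - j) \<noteq> 0}"
    using assms unfolding convergent2_def by blast
  then show ?thesis by (rule rev_finite_subset) auto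
qed

lemma convergent2_dl:
  assumes "convergent2 F G"
  shows "convergent2 (dl F) G" "convergent2 F (dl G)"
proof -
  let ?S = "\<lambda>m k. {(i, j). F i j \<noteq> 0 \<and> G (m - 1 - i) (k - 1 - j) \<noteq> 0}"
  have fin: "finite (?S m k)" for m k using assms unfolding convergent2_def by blast
  have "finite {(i, j). dl F i j \<noteq> 0 \<and> G (m - 1 - i) (k - 1 - j) \<noteq> 0}" for m k
  proof (rule finite_subset)
    show "{(i, j). dl F i j \<noteq> 0 \<and> G (m - 1 - i) (k - 1 - j) \<noteq> 0} \<subseteq>
      (\<lambda>(i, j). (i - 1, j)) ` ?S (m + 1) k \<union> (\<lambda>(i, j). (i, j - 1)) ` ?S m (k + 1)"
    proof
      fix x assume x: "x \<in> {(i, j). dl F i j \<noteq> 0 \<and> G (m - 1 - i) (k - 1 - j) \<noteq> 0}"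
      obtain i j where ij: "x = (i, j)" by (cases x)
      have G: "G (m - 1 - i) (k - 1 - j) \<noteq> 0" and "F (i + 1) j \<noteq> 0 \<or> F i (j + 1) \<noteq> 0"
        using x by (auto simp: ij dl_def)
      then show "x \<in> (\<lambda>(i, j). (i - 1, j)) ` ?S (m + 1) k \<union> (\<lambda>(i, j). (i, j - 1)) ` ?S m (k + 1)"
      proof (elim disjE)
        assume "F (i + 1) j \<noteq> 0"
        then have "(i + 1, j) \<in> ?S (m + 1) k" using G by (simp add: algebra_simps)
        then show ?thesis unfolding ij by (intro UnI1 image_eqI[of _ _ "(i + 1, j)"]) simp_all
      next
        assume "F i (j + 1) \<noteq> 0"
        then have "(i, j + 1) \<in> ?S m (k + 1)" using G by (simp add: algebra_simps)
        then show ?thesis unfolding ij by (intro UnI2 image_eqI[of _ _ "(i, j + 1)"]) simp_all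
      qed
    qed
  qed (intro finite_UnI finite_imageI fin)
  then show "convergent2 (dl F) G" unfolding convergent2_def by blast
  have "finite {(i, j). F i j \<noteq> 0 \<and> dl G (m - 1 - i) (k - 1 - j) \<noteq> 0}" for m k
  proof (rule finite_subset)
    show "{(i, j). F i j \<noteq> 0 \<and> dl G (m - 1 - i) (k - 1 - j) \<noteq> 0} \<subseteq> ?S (m + 1) k \<union> ?S m (k + 1)"
      by (auto simp: dl_def algebra_simps)
  qed (intro finite_UnI fin)
  then show "convergent2 F (dl G)" unfolding convergent2_def by blast
qed

lemma Sum_any_shift_pair:
  fixes f :: "int \<times> int \<Rightarrow> 'a :: comm_monoid_add"
  shows "Sum_any (\<lambda>(i, j). f (i + 1, j)) = Sum_any f" "Sum_any (\<lambda>(i, j). f (i, j + 1)) = Sum_any f"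
proof -
  have "bij (\<lambda>(i :: int, j :: int). (i + 1, j))" by (rule o_bij[of "\<lambda>(i, j). (i - 1, j)"]) auto
  then show "Sum_any (\<lambda>(i, j). f (i + 1, j)) = Sum_any f"
    by (rule Sum_any.reindex_cong[symmetric]) auto
  have "bij (\<lambda>(i :: int, j :: int). (i, j + 1))" by (rule o_bij[of "\<lambda>(i, j). (i, j - 1)"]) auto
  then show "Sum_any (\<lambda>(i, j). f (i, j + 1)) = Sum_any f"
    by (rule Sum_any.reindex_cong[symmetric]) auto
qed

text \<open>A factor z - w in front of a product of two series may be given to either of them;
  iterated, \<open>N + M\<close> copies can be divided as \<open>N\<close> and
  \<open>M\<close>.\<close>

lemma dl_conv:
  assumes "convergent2 F G"
  shows "dl (conv F G) = conv (dl F) G" "dl (conv F G) = conv F (dl G)"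
proof -
  note fin = convergent2_finite[OF assms]
  have d: "dl (conv F G) m k = Sum_any (\<lambda>(i, j). tens (F i j) (G (m + 1 - 1 - i) (k - 1 - j)))
      - Sum_any (\<lambda>(i, j). tens (F i j) (G (m - 1 - i) (k + 1 - 1 - j)))" for m k
    by (simp add: dl_def conv_def)
  show "dl (conv F G) = conv F (dl G)"
  proof (intro ext)
    fix m k
    show "dl (conv F G) m k = conv F (dl G) m k"
      unfolding d Sum_any_minus[OF fin fin, symmetric] unfolding conv_def
      by (rule arg_cong[where f = Sum_any], rule ext) (auto simp: dl_def tens_diff2 algebra_simps)
  qed
  show "dl (conv F G) = conv (dl F) G"
  proof (intro ext)
    fix m k
    let ?a = "\<lambda>(i, j). tens (F i j) (G (m + 1 - 1 - i) (k - 1 - j))"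
    let ?b = "\<lambda>(i, j). tens (F i j) (G (m - 1 - i) (k + 1 - 1 - j))"
    have fa: "finite {x. (case x of (i, j) \<Rightarrow> ?a (i + 1, j)) \<noteq> 0}"
    proof -
      have "{x. (case x of (i, j) \<Rightarrow> ?a (i + 1, j)) \<noteq> 0} \<subseteq> (\<lambda>(i, j). (i - 1, j)) ` {x. ?a x \<noteq> 0}"
      proof
        fix x assume "x \<in> {x. (case x of (i, j) \<Rightarrow> ?a (i + 1, j)) \<noteq> 0}"
        then show "x \<in> (\<lambda>(i, j). (i - 1, j)) ` {x. ?a x \<noteq> 0}"
          by (cases x) (rule image_eqI[of _ _ "(fst x + 1, snd x)"], auto)
      qed
      then show ?thesis using finite_subset finite_imageI fin[of "m + 1" k] by blast
    qed
    have fb: "finite {x. (case x of (i, j) \<Rightarrow> ?b (i, j + 1)) \<noteq> 0}"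
    proof -
      have "{x. (case x of (i, j) \<Rightarrow> ?b (i, j + 1)) \<noteq> 0} \<subseteq> (\<lambda>(i, j). (i, j - 1)) ` {x. ?b x \<noteq> 0}"
      proof
        fix x assume "x \<in> {x. (case x of (i, j) \<Rightarrow> ?b (i, j + 1)) \<noteq> 0}"
        then show "x \<in> (\<lambda>(i, j). (i, j - 1)) ` {x. ?b x \<noteq> 0}"
          by (cases x) (rule image_eqI[of _ _ "(fst x, snd x + 1)"], auto)
      qed
      then show ?thesis using finite_subset finite_imageI fin[of m "k + 1"] by blast
    qed
    have "dl (conv F G) m k = Sum_any (\<lambda>(i, j). ?a (i + 1, j)) - Sum_any (\<lambda>(i, j). ?b (i, j + 1))"
      unfolding d Sum_any_shift_pair ..
    also have "\<dots> = conv (dl F) G m k"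
      unfolding Sum_any_minus[OF fa fb, symmetric] unfolding conv_def
      by (rule arg_cong[where f = Sum_any], rule ext) (auto simp: dl_def tens_diff1 algebra_simps)
    finally show "dl (conv F G) m k = conv (dl F) G m k" .
  qed
qed

lemma dl_pow_conv:
  assumes "convergent2 F G"
  shows "(dl ^^ (N + M)) (conv F G) = conv ((dl ^^ N) F) ((dl ^^ M) G)"
proof -
  have c1: "convergent2 F ((dl ^^ M) G)" for M by (induction M) (auto simp: assms convergent2_dl)
  have c2: "convergent2 ((dl ^^ N) F) ((dl ^^ M) G)" for N by (induction N) (auto simp: c1 convergent2_dl)
  have 1: "(dl ^^ M) (conv F G) = conv F ((dl ^^ M) G)"
  proof (induction M)
    case (Suc M)
    have c1: "convergent2 F ((dl ^^ M) G)" by (induction M) (auto simp: assms convergent2_dl)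
    then show ?case using Suc dl_conv(2)[OF c1] by simp
  qed simp
  have "(dl ^^ N) (conv F ((dl ^^ M) G)) = conv ((dl ^^ N) F) ((dl ^^ M) G)"
    by (induction N) (auto simp: dl_conv(1)[OF c2])
  then show ?thesis by (simp add: funpow_add 1)
qed

text \<open>The support of \<open>(m, k) \<mapsto> a_(m) b_(k) c\<close> is bounded above in
  \<open>k\<close> for all \<open>m\<close> at once, but in \<open>m\<close> only for each
  \<open>k\<close> separately. The opposite order of operators has this property with the indices
  exchanged.\<close>

definition trunc2 :: "(int \<Rightarrow> int \<Rightarrow> 'b vec) \<Rightarrow> bool" where
  "trunc2 F \<longleftrightarrow> (\<exists>K. \<forall>k\<ge>K. \<forall>m. F m k = 0) \<and> (\<forall>k. truncated (\<lambda>m. F m k))"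

lemma trunc2_convergent:
  assumes "trunc2 F" "trunc2 G"
  shows "convergent2 F G"
  unfolding convergent2_def
proof (intro allI)
  fix m k
  obtain K where K: "\<And>j i. j \<ge> K \<Longrightarrow> F i j = 0" using assms(1) unfolding trunc2_def by blast
  obtain L where L: "\<And>j i. j \<ge> L \<Longrightarrow> G i j = 0" using assms(2) unfolding trunc2_def by blast
  have "{(i, j). F i j \<noteq> 0 \<and> G (m - 1 - i) (k - 1 - j) \<noteq> 0} \<subseteq>
      (\<Union>j\<in>{k - L..K}. (\<lambda>i. (i, j)) ` {i. F i j \<noteq> 0 \<and> G (m - 1 - i) (k - 1 - j) \<noteq> 0})"
  proof
    fix x assume x: "x \<in> {(i, j). F i j \<noteq> 0 \<and> G (m - 1 - i) (k - 1 - j) \<noteq> 0}"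
    obtain i j where ij: "x = (i, j)" by (cases x)
    have "\<not> j \<ge> K" "\<not> k - 1 - j \<ge> L" using x K L unfolding ij by blast+
    then have "j \<in> {k - L..K}" by simp
    then show "x \<in> (\<Union>j\<in>{k - L..K}. (\<lambda>i. (i, j)) ` {i. F i j \<noteq> 0 \<and> G (m - 1 - i) (k - 1 - j) \<noteq> 0})"
      using x unfolding ij by blast
  qed
  moreover have "finite {i. F i j \<noteq> 0 \<and> G (m - 1 - i) (k - 1 - j) \<noteq> 0}" for j
    using assms unfolding trunc2_def by (intro cv_support[of "\<lambda>i. F i j" "\<lambda>i. G i (k - 1 - j)"]) auto
  then have "finite (\<Union>j\<in>{k - L..K}. (\<lambda>i. (i, j)) ` {i. F i j \<noteq> 0 \<and> G (m - 1 - i) (k - 1 - j) \<noteq> 0})"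
    by (intro finite_UN_I finite_imageI) simp_all
  ultimately show "finite {(i, j). F i j \<noteq> 0 \<and> G (m - 1 - i) (k - 1 - j) \<noteq> 0}"
    by (rule finite_subset)
qed

lemma convergent2_flip: "convergent2 (\<lambda>k m. F m k) (\<lambda>k m. G m k) \<Longrightarrow> convergent2 F G"
  unfolding convergent2_def
proof (intro allI)
  fix m k
  assume "\<forall>k m. finite {(j, i). F i j \<noteq> 0 \<and> G (m - 1 - i) (k - 1 - j) \<noteq> 0}"
  then have "finite (prod.swap ` {(j, i). F i j \<noteq> 0 \<and> G (m - 1 - i) (k - 1 - j) \<noteq> 0})" by blast
  moreover have "prod.swap ` {(j, i). F i j \<noteq> 0 \<and> G (m - 1 - i) (k - 1 - j) \<noteq> 0} = {(i, j). F i j \<noteq> 0 \<and> G (m - 1 - i) (k - 1 - j) \<noteq> 0}"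
    by (auto simp: image_iff)
  ultimately show "finite {(i, j). F i j \<noteq> 0 \<and> G (m - 1 - i) (k - 1 - j) \<noteq> 0}" by simp
qed

lemma Sum_any_nested:
  fixes h :: "int \<Rightarrow> int \<Rightarrow> 'b vec"
  assumes "finite {x. (case x of (i, j) \<Rightarrow> h i j) \<noteq> 0}"
  shows "Sum_any (\<lambda>i. Sum_any (\<lambda>j. h i j)) = Sum_any (\<lambda>(i, j). h i j)"
    and "Sum_any (\<lambda>j. Sum_any (\<lambda>i. h i j)) = Sum_any (\<lambda>(i, j). h i j)"
proof -
  let ?S = "{x. (case x of (i, j) \<Rightarrow> h i j) \<noteq> 0}"
  have C: "finite (fst ` ?S \<times> snd ` ?S)" using assms by simp
  have sub: "{i. \<exists>j. h i j \<noteq> 0} \<times> {j. \<exists>i. h i j \<noteq> 0} \<subseteq> fst ` ?S \<times> snd ` ?S"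
  proof
    fix x assume "x \<in> {i. \<exists>j. h i j \<noteq> 0} \<times> {j. \<exists>i. h i j \<noteq> 0}"
    then obtain i j i' j' where x: "x = (i, j)" "h i j' \<noteq> 0" "h i' j \<noteq> 0" by blast
    then have "(i, j') \<in> ?S" "(i', j) \<in> ?S" by simp_all
    then have "fst (i, j') \<in> fst ` ?S" "snd (i', j) \<in> snd ` ?S" by (blast intro: imageI)+
    then show "x \<in> fst ` ?S \<times> snd ` ?S" using x(1) by simp
  qed
  show 1: "Sum_any (\<lambda>i. Sum_any (\<lambda>j. h i j)) = Sum_any (\<lambda>(i, j). h i j)"
    by (rule Sum_any.cartesian_product[OF C sub])
  show "Sum_any (\<lambda>j. Sum_any (\<lambda>i. h i j)) = Sum_any (\<lambda>(i, j). h i j)"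
    unfolding 1[symmetric] by (rule Sum_any.swap[OF C sub, symmetric])
qed

text \<open>One step of the tensor power. Only the sign of moving \<open>as\<close> past
  \<open>b\<close> is visible; all other Koszul signs are hidden in the product of
  \<open>Y\<close>.\<close>

locale tensor_cons = X: based_vsa X + Y: based_vsa Y
  for X :: "'b based_vertex_data" and Y :: "'b list based_vertex_data" +
  fixes Z :: "'b list based_vertex_data"
  assumes Zset: "bas_set Z = {b # bs | b bs. b \<in> bas_set X \<and> bs \<in> bas_set Y}"
    and Zodd: "\<lbrakk>b \<in> bas_set X; bs \<in> bas_set Y\<rbrakk> \<Longrightarrow> bas_odd Z (b # bs) = (bas_odd X b \<noteq> bas_odd Y bs)"
    and Zvac: "bas_vac Z = bas_vac X # bas_vac Y"
    and Zprod: "\<lbrakk>a \<in> bas_set X; b \<in> bas_set X; as \<in> bas_set Y; bs \<in> bas_set Y\<rbrakk> \<Longrightarrow>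
      bas_prod Z (a # as) m (b # bs) =
        vscale (super_sign (bas_odd Y as) (bas_odd X b)) (cv (\<lambda>k. bas_prod X a k b) (\<lambda>k. bas_prod Y as k bs) m)"
begin

lemma Xtr: "u \<in> carr X \<Longrightarrow> u' \<in> carr X \<Longrightarrow> truncated (\<lambda>k. bprod X u k u')"
  unfolding truncated_def by (rule X.bprod_trunc)

lemma Ytr: "u \<in> carr Y \<Longrightarrow> u' \<in> carr Y \<Longrightarrow> truncated (\<lambda>k. bprod Y u k u')"
  unfolding truncated_def by (rule Y.bprod_trunc)

lemma basis_carr: "b \<in> bas_set X \<Longrightarrow> basis_vec b \<in> carr X" "bs \<in> bas_set Y \<Longrightarrow> basis_vec bs \<in> carr Y"
  by (simp_all add: carr_def)

text \<open>Extension of \<open>Zprod\<close> to vectors, one argument at a time. \<open>v\<close>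
  and \<open>u'\<close> are homogeneous because their parities determine the sign.\<close>

lemma bprod_tens:
  assumes u: "u \<in> carr X" and v: "v \<in> ppart Y p" and u': "u' \<in> ppart X q" and v': "v' \<in> carr Y"
  shows "bprod Z (tens u v) m (tens u' v') = vscale (super_sign p q) (cv (\<lambda>k. bprod X u k u') (\<lambda>k. bprod Y v k v') m)"
proof -
  let ?P = "\<lambda>u v u' v'. bprod Z (tens u v) m (tens u' v') = vscale (super_sign p q) (cv (\<lambda>k. bprod X u k u') (\<lambda>k. bprod Y v k v') m)"
  note bt = bprod_add1 bprod_add2 bprod_scale1 bprod_scale2 tens_add1 tens_add2 tens_scale1 tens_scale2
    free.scale_right_distrib free.scale_left_commute[of "super_sign p q"]
  note z = bprod_zero1 bprod_zero2 cv_zero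
  have 1: "?P (basis_vec a) (basis_vec as) (basis_vec b) v'"
    if "a \<in> bas_set X" "as \<in> bas_set Y" "bas_odd Y as = p" "b \<in> bas_set X" "bas_odd X b = q" for a as b
    using v' unfolding carr_def mem_Collect_eq
  proof (induction v' rule: vec_induct)
    case (basis bs)
    then show ?case using Zprod[OF that(1) that(4) that(2) basis, of m] that by (simp add: tens_basis)
  next
    case (scale_add c w w')
    then have c: "w \<in> carr Y" "w' \<in> carr Y" by (simp_all add: carr_def)
    show ?case
      using cv_comb2[OF Xtr[OF basis_carr(1)[OF that(1)] basis_carr(1)[OF that(4)]] Ytr[OF basis_carr(2)[OF that(2)] c(1)] Ytr[OF basis_carr(2)[OF that(2)] c(2)], of c m]
        scale_add by (simp only: bt)
  qed (simp add: z)
  have 2: "?P (basis_vec a) (basis_vec as) u' v'"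
    if "a \<in> bas_set X" "as \<in> bas_set Y" "bas_odd Y as = p" for a as
    using u' unfolding ppart_def mem_Collect_eq
  proof (induction u' rule: vec_induct)
    case (scale_add c w w')
    then have c: "w \<in> carr X" "w' \<in> carr X" by (auto simp: carr_def)
    show ?case
      using cv_comb1[OF Xtr[OF basis_carr(1)[OF that(1)] c(1)] Xtr[OF basis_carr(1)[OF that(1)] c(2)] Ytr[OF basis_carr(2)[OF that(2)] v'], of c m]
        scale_add by (simp only: bt)
  qed (use 1 that in \<open>simp_all add: z\<close>)
  have uc: "u' \<in> carr X" using u' by (rule X.ppart_carr)
  have 3: "?P (basis_vec a) v u' v'" if "a \<in> bas_set X" for a
    using v unfolding ppart_def mem_Collect_eq
  proof (induction v rule: vec_induct)
    case (scale_add c w w')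
    then have c: "w \<in> carr Y" "w' \<in> carr Y" by (auto simp: carr_def)
    show ?case
      using cv_comb2[OF Xtr[OF basis_carr(1)[OF that] uc] Ytr[OF c(1) v'] Ytr[OF c(2) v'], of c m]
        scale_add by (simp only: bt)
  qed (use 2 that in \<open>simp_all add: z\<close>)
  have vc: "v \<in> carr Y" using v by (rule Y.ppart_carr)
  show ?thesis
    using u unfolding carr_def mem_Collect_eq
  proof (induction u rule: vec_induct)
    case (scale_add c w w')
    then have c: "w \<in> carr X" "w' \<in> carr X" by (auto simp: carr_def)
    show ?case
      using cv_comb1[OF Xtr[OF c(1) uc] Xtr[OF c(2) uc] Ytr[OF vc v'], of c m]
        scale_add by (simp only: bt)
  qed (use 3 in \<open>simp_all add: z\<close>)
qed

lemma Zelem: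
  assumes "x \<in> bas_set Z"
  obtains b bs where "x = b # bs" "b \<in> bas_set X" "bs \<in> bas_set Y"
  using assms unfolding Zset by blast

lemma basis_ppart: "b \<in> bas_set X \<Longrightarrow> basis_vec b \<in> ppart X (bas_odd X b)"
  "bs \<in> bas_set Y \<Longrightarrow> basis_vec bs \<in> ppart Y (bas_odd Y bs)"
  by (simp_all add: ppart_def)

lemma prod_ppart:
  "a \<in> bas_set X \<Longrightarrow> b \<in> bas_set X \<Longrightarrow> bas_prod X a m b \<in> ppart X (bas_odd X a \<noteq> bas_odd X b)"
  "as \<in> bas_set Y \<Longrightarrow> bs \<in> bas_set Y \<Longrightarrow> bas_prod Y as m bs \<in> ppart Y (bas_odd Y as \<noteq> bas_odd Y bs)"
  using X.prod_keys Y.prod_keys by (simp_all add: ppart_def)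

lemma vac_tens: "basis_vec (bas_vac Z) = tens (basis_vec (bas_vac X)) (basis_vec (bas_vac Y))"
  by (simp add: Zvac tens_basis)

lemma vac_ppart: "basis_vec (bas_vac X) \<in> ppart X False" "basis_vec (bas_vac Y) \<in> carr Y"
  using X.vac_in X.vac_even Y.vac_in by (simp_all add: ppart_def carr_def)

lemma transl_tens:
  assumes "u \<in> carr X" "v \<in> ppart Y p"
  shows "bprod Z (tens u v) (-2) (basis_vec (bas_vac Z)) = tens u (Y.btransl v) + tens (X.btransl u) v"
proof -
  have v: "v \<in> carr Y" using assms(2) by (rule Y.ppart_carr)
  have "bprod Z (tens u v) (-2) (basis_vec (bas_vac Z)) =
      cv (\<lambda>k. bprod X u k (basis_vec (bas_vac X))) (\<lambda>k. bprod Y v k (basis_vec (bas_vac Y))) (-2)"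
    unfolding vac_tens bprod_tens[OF assms vac_ppart] by (simp add: super_sign_def)
  also have "\<dots> = tens u (Y.btransl v) + tens (X.btransl u) v"
    by (subst cv_create(3)) (simp_all add: X.bprod_create assms Y.bprod_create v)
  finally show ?thesis .
qed

text \<open>Translation of the product is the sum of the translations of the factors; the two
  commutators are evaluated by the axioms of \<open>X\<close> and \<open>Y\<close> and recombined by
  \<open>cv_deriv\<close>.\<close>

lemma Z_transl:
  assumes a: "a \<in> bas_set X" and b: "b \<in> bas_set X" and as: "as \<in> bas_set Y" and bs: "bs \<in> bas_set Y"
  shows "bprod Z (bas_prod Z (a # as) m (b # bs)) (-2) (basis_vec (bas_vac Z))
      - bprod Z (basis_vec (a # as)) m (bas_prod Z (b # bs) (-2) (bas_vac Z))
    = vscale (- of_int m) (bas_prod Z (a # as) (m - 1) (b # bs))"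
proof -
  let ?s = "super_sign (bas_odd Y as) (bas_odd X b)"
  let ?f = "\<lambda>k. bas_prod X a k b" and ?g = "\<lambda>k. bas_prod Y as k bs"
  have trX: "truncated ?f" and trY: "truncated ?g"
    using X.trunc[OF a b] Y.trunc[OF as bs] by (simp_all add: truncated_def)
  have b': "X.btransl (basis_vec b) \<in> ppart X (bas_odd X b)" and bs': "Y.btransl (basis_vec bs) \<in> ppart Y (bas_odd Y bs)"
    using X.bprod_ppart[OF basis_ppart(1)[OF b] vac_ppart(1)]
      Y.bprod_ppart[OF basis_ppart(2)[OF bs], of "basis_vec (bas_vac Y)" False] Y.vac_in Y.vac_even
    by (simp_all add: ppart_def)
  note cb = X.ppart_carr[OF b'] Y.ppart_carr[OF bs']
  have tens_fin: "finite {k. tens (?f k) (?g (m - 1 - k)) \<noteq> 0}" by (rule cv_finite[OF trX trY])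
  have T1: "truncated (\<lambda>k. X.btransl (?f k))" "truncated (\<lambda>k. Y.btransl (?g k))"
    using trX trY unfolding truncated_def by (metis bprod_zero1)+
  have 1: "bprod Z (bas_prod Z (a # as) m (b # bs)) (-2) (basis_vec (bas_vac Z)) =
      vscale ?s (cv ?f (\<lambda>k. Y.btransl (?g k)) m + cv (\<lambda>k. X.btransl (?f k)) ?g m)"
  proof -
    have "bprod Z (cv ?f ?g m) (-2) (basis_vec (bas_vac Z)) =
        Sum_any (\<lambda>k. bprod Z (tens (?f k) (?g (m - 1 - k))) (-2) (basis_vec (bas_vac Z)))"
      unfolding cv_def by (rule Sum_any_lin[OF lin_bprod1 tens_fin])
    also have "\<dots> = Sum_any (\<lambda>k. tens (?f k) (Y.btransl (?g (m - 1 - k))) + tens (X.btransl (?f k)) (?g (m - 1 - k)))"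
      using transl_tens[OF X.ppart_carr[OF prod_ppart(1)[OF a b]] prod_ppart(2)[OF as bs]] by (simp only:)
    also have "\<dots> = cv ?f (\<lambda>k. Y.btransl (?g k)) m + cv (\<lambda>k. X.btransl (?f k)) ?g m"
      unfolding cv_def
      by (rule Sum_any.distrib) (rule cv_finite[OF trX T1(2)], rule cv_finite[OF T1(1) trY])
    finally show ?thesis unfolding Zprod[OF a b as bs] bprod_scale1 by simp
  qed
  have 2: "bprod Z (basis_vec (a # as)) m (bas_prod Z (b # bs) (-2) (bas_vac Z)) =
      vscale ?s (cv ?f (\<lambda>k. bprod Y (basis_vec as) k (Y.btransl (basis_vec bs))) m +
        cv (\<lambda>k. bprod X (basis_vec a) k (X.btransl (basis_vec b))) ?g m)"
  proof -
    have h: "bas_prod Z (b # bs) (-2) (bas_vac Z) = tens (basis_vec b) (Y.btransl (basis_vec bs)) + tens (X.btransl (basis_vec b)) (basis_vec bs)"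
      using transl_tens[OF basis_carr(1)[OF b] basis_ppart(2)[OF bs]] by (simp add: tens_basis)
    show ?thesis
      unfolding h tens_basis[symmetric] bprod_add2 bprod_tens[OF basis_carr(1)[OF a] basis_ppart(2)[OF as] basis_ppart(1)[OF b] cb(2)]
        bprod_tens[OF basis_carr(1)[OF a] basis_ppart(2)[OF as] b' basis_carr(2)[OF bs]]
      by (simp add: free.scale_right_distrib)
  qed
  have tX: "truncated (\<lambda>k. bprod X (basis_vec a) k (X.btransl (basis_vec b)))" by (rule Xtr[OF basis_carr(1)[OF a] cb(1)])
  have tY: "truncated (\<lambda>k. bprod Y (basis_vec as) k (Y.btransl (basis_vec bs)))" by (rule Ytr[OF basis_carr(2)[OF as] cb(2)])
  have c1: "cv (\<lambda>k. X.btransl (?f k)) ?g m - cv (\<lambda>k. bprod X (basis_vec a) k (X.btransl (basis_vec b))) ?g m =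
      cv (\<lambda>k. vscale (- of_int k) (?f (k - 1))) ?g m"
  proof -
    have "vscale (- of_int k) (?f (k - 1)) = vscale (-1) (bprod X (basis_vec a) k (X.btransl (basis_vec b))) + X.btransl (?f k)" for k
      using X.transl[OF a b, of k] by (simp add: algebra_simps)
    then show ?thesis using cv_comb1[OF tX T1(1) trY, of "-1" m] by (simp only:) simp
  qed
  have c2: "cv ?f (\<lambda>k. Y.btransl (?g k)) m - cv ?f (\<lambda>k. bprod Y (basis_vec as) k (Y.btransl (basis_vec bs))) m =
      cv ?f (\<lambda>k. vscale (- of_int k) (?g (k - 1))) m"
  proof -
    have "vscale (- of_int k) (?g (k - 1)) = vscale (-1) (bprod Y (basis_vec as) k (Y.btransl (basis_vec bs))) + Y.btransl (?g k)" for k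
      using Y.transl[OF as bs, of k] by (simp add: algebra_simps)
    then show ?thesis using cv_comb2[OF trX tY T1(2), of "-1" m] by (simp only:) simp
  qed
  have re: "vscale ?s (p + q) - vscale ?s (p' + q') = vscale ?s ((q - q') + (p - p'))" for p q p' q' :: "'b list vec"
    by (simp add: free.scale_right_distrib free.scale_right_diff_distrib)
  show ?thesis
    unfolding 1 2
    unfolding re c1 c2 add.commute[of "cv ?f _ m"] cv_deriv[OF trX trY] Zprod[OF a b as bs]
    by (rule free.scale_left_commute)
qed

text \<open>Orders \<open>N\<close> and \<open>M\<close> in the factors give order
  \<open>N + M\<close>: with the powers of z - w divided between the factors, each factor can be
  reordered at the cost of its own sign.\<close>

lemma Z_loc:
  assumes a: "a \<in> bas_set X" and b: "b \<in> bas_set X" and as: "as \<in> bas_set Y" and bs: "bs \<in> bas_set Y"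
  shows "\<exists>N. \<forall>c\<in>bas_set Z.
      (dl ^^ N) (\<lambda>m k. bprod Z (basis_vec (a # as)) m (bas_prod Z (b # bs) k c)
        - vscale (super_sign (bas_odd Z (a # as)) (bas_odd Z (b # bs))) (bprod Z (basis_vec (b # bs)) k (bas_prod Z (a # as) m c))) = (\<lambda>m k. 0)"
proof -
  let ?sX = "super_sign (bas_odd X a) (bas_odd X b)" and ?sY = "super_sign (bas_odd Y as) (bas_odd Y bs)"
  obtain N where N: "\<And>c. c \<in> bas_set X \<Longrightarrow> (dl ^^ N) (\<lambda>m k. bprod X (basis_vec a) m (bas_prod X b k c)
        - vscale ?sX (bprod X (basis_vec b) k (bas_prod X a m c))) = (\<lambda>m k. 0)"
    using X.loc[OF a b] by blast
  obtain M where M: "\<And>c. c \<in> bas_set Y \<Longrightarrow> (dl ^^ M) (\<lambda>m k. bprod Y (basis_vec as) m (bas_prod Y bs k c)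
        - vscale ?sY (bprod Y (basis_vec bs) k (bas_prod Y as m c))) = (\<lambda>m k. 0)"
    using Y.loc[OF as bs] by blast
  have "(dl ^^ (N + M)) (\<lambda>m k. bprod Z (basis_vec (a # as)) m (bas_prod Z (b # bs) k (c # cs))
        - vscale (super_sign (bas_odd Z (a # as)) (bas_odd Z (b # bs))) (bprod Z (basis_vec (b # bs)) k (bas_prod Z (a # as) m (c # cs)))) = (\<lambda>m k. 0)"
    if c: "c \<in> bas_set X" and cs: "cs \<in> bas_set Y" for c cs
  proof -
    define F where "F m k = bprod X (basis_vec a) m (bas_prod X b k c)" for m k
    define F' where "F' m k = bprod X (basis_vec b) k (bas_prod X a m c)" for m k
    define G where "G m k = bprod Y (basis_vec as) m (bas_prod Y bs k cs)" for m k
    define G' where "G' m k = bprod Y (basis_vec bs) k (bas_prod Y as m cs)" for m k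
    let ?t = "super_sign (bas_odd Y bs) (bas_odd X c) * super_sign (bas_odd Y as) (bas_odd X b \<noteq> bas_odd X c)"
    have t2F: "trunc2 F" "trunc2 G" "trunc2 (\<lambda>k m. F' m k)" "trunc2 (\<lambda>k m. G' m k)"
    proof -
      have x: "trunc2 (\<lambda>m k. bprod X (basis_vec a) m (bas_prod X b k c))" if "a \<in> bas_set X" "b \<in> bas_set X" for a b
        unfolding trunc2_def
      proof
        show "\<exists>K. \<forall>k\<ge>K. \<forall>m. bprod X (basis_vec a) m (bas_prod X b k c) = 0"
          using X.trunc[OF that(2) c] bprod_zero2 by metis
        show "\<forall>k. truncated (\<lambda>m. bprod X (basis_vec a) m (bas_prod X b k c))"
          using Xtr[OF basis_carr(1)[OF that(1)] X.ppart_carr[OF prod_ppart(1)[OF that(2) c]]] by blast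
      qed
      have y: "trunc2 (\<lambda>m k. bprod Y (basis_vec as) m (bas_prod Y bs k cs))" if "as \<in> bas_set Y" "bs \<in> bas_set Y" for as bs
        unfolding trunc2_def
      proof
        show "\<exists>K. \<forall>k\<ge>K. \<forall>m. bprod Y (basis_vec as) m (bas_prod Y bs k cs) = 0"
          using Y.trunc[OF that(2) cs] bprod_zero2 by metis
        show "\<forall>k. truncated (\<lambda>m. bprod Y (basis_vec as) m (bas_prod Y bs k cs))"
          using Ytr[OF basis_carr(2)[OF that(1)] Y.ppart_carr[OF prod_ppart(2)[OF that(2) cs]]] by blast
      qed
      show "trunc2 F" "trunc2 G" "trunc2 (\<lambda>k m. F' m k)" "trunc2 (\<lambda>k m. G' m k)"
        unfolding F_def[abs_def] G_def[abs_def] F'_def[abs_def] G'_def[abs_def]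
        by (rule x[OF a b] y[OF as bs] x[OF b a] y[OF bs as])+
    qed
    have cFG: "convergent2 F G" and cFG': "convergent2 F' G'"
      using trunc2_convergent[OF t2F(1,2)] convergent2_flip[OF trunc2_convergent[OF t2F(3,4)]] .
    have AB: "bprod Z (basis_vec (a # as)) m (bas_prod Z (b # bs) k (c # cs)) = vscale ?t (conv F G m k)" for m k
    proof -
      have trb: "truncated (\<lambda>k. bas_prod X b k c)" "truncated (\<lambda>k. bas_prod Y bs k cs)"
        using X.trunc[OF b c] Y.trunc[OF bs cs] by (simp_all add: truncated_def)
      have "bprod Z (tens (basis_vec a) (basis_vec as)) m (cv (\<lambda>k. bas_prod X b k c) (\<lambda>k. bas_prod Y bs k cs) k) =
        Sum_any (\<lambda>j. bprod Z (tens (basis_vec a) (basis_vec as)) m (tens (bas_prod X b j c) (bas_prod Y bs (k - 1 - j) cs)))"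
        unfolding cv_def by (rule Sum_any_lin[OF lin_bprod2 cv_finite[OF trb]])
      also have "\<dots> = Sum_any (\<lambda>j. vscale (super_sign (bas_odd Y as) (bas_odd X b \<noteq> bas_odd X c))
          (Sum_any (\<lambda>i. tens (F i j) (G (m - 1 - i) (k - 1 - j)))))"
        unfolding bprod_tens[OF basis_carr(1)[OF a] basis_ppart(2)[OF as] prod_ppart(1)[OF b c] Y.ppart_carr[OF prod_ppart(2)[OF bs cs]]]
        by (simp only: cv_def F_def G_def)
      also have "\<dots> = vscale (super_sign (bas_odd Y as) (bas_odd X b \<noteq> bas_odd X c))
          (Sum_any (\<lambda>j. Sum_any (\<lambda>i. tens (F i j) (G (m - 1 - i) (k - 1 - j)))))"
        by (rule Sum_any_inj_lin[OF lin_vscale_self, symmetric]) (simp add: super_sign_def split: if_splits)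
      also have "\<dots> = vscale (super_sign (bas_odd Y as) (bas_odd X b \<noteq> bas_odd X c)) (conv F G m k)"
        unfolding conv_def Sum_any_nested(2)[OF convergent2_finite[OF cFG]] ..
      finally show ?thesis
        unfolding Zprod[OF b c bs cs] bprod_scale2 tens_basis by simp
    qed
    let ?t' = "super_sign (bas_odd Y as) (bas_odd X c) * super_sign (bas_odd Y bs) (bas_odd X a \<noteq> bas_odd X c)"
    have BA: "bprod Z (basis_vec (b # bs)) k (bas_prod Z (a # as) m (c # cs)) = vscale ?t' (conv F' G' m k)" for m k
    proof -
      have tra: "truncated (\<lambda>m. bas_prod X a m c)" "truncated (\<lambda>m. bas_prod Y as m cs)"
        using X.trunc[OF a c] Y.trunc[OF as cs] by (simp_all add: truncated_def)
      have "bprod Z (tens (basis_vec b) (basis_vec bs)) k (cv (\<lambda>m. bas_prod X a m c) (\<lambda>m. bas_prod Y as m cs) m) =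
        Sum_any (\<lambda>i. bprod Z (tens (basis_vec b) (basis_vec bs)) k (tens (bas_prod X a i c) (bas_prod Y as (m - 1 - i) cs)))"
        unfolding cv_def by (rule Sum_any_lin[OF lin_bprod2 cv_finite[OF tra]])
      also have "\<dots> = Sum_any (\<lambda>i. vscale (super_sign (bas_odd Y bs) (bas_odd X a \<noteq> bas_odd X c))
          (Sum_any (\<lambda>j. tens (F' i j) (G' (m - 1 - i) (k - 1 - j)))))"
        unfolding bprod_tens[OF basis_carr(1)[OF b] basis_ppart(2)[OF bs] prod_ppart(1)[OF a c] Y.ppart_carr[OF prod_ppart(2)[OF as cs]]]
        by (simp only: cv_def F'_def G'_def)
      also have "\<dots> = vscale (super_sign (bas_odd Y bs) (bas_odd X a \<noteq> bas_odd X c))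
          (Sum_any (\<lambda>i. Sum_any (\<lambda>j. tens (F' i j) (G' (m - 1 - i) (k - 1 - j)))))"
        by (rule Sum_any_inj_lin[OF lin_vscale_self, symmetric]) (simp add: super_sign_def split: if_splits)
      also have "\<dots> = vscale (super_sign (bas_odd Y bs) (bas_odd X a \<noteq> bas_odd X c)) (conv F' G' m k)"
        unfolding conv_def Sum_any_nested(1)[OF convergent2_finite[OF cFG']] ..
      finally show ?thesis
        unfolding Zprod[OF a c as cs] bprod_scale2 tens_basis by simp
    qed
    \<comment> \<open>The Koszul signs of the two orderings differ by exactly what separates the
      sign of the product from the signs of the factors; a check over all parities.\<close>
    have sgn: "super_sign (bas_odd Z (a # as)) (bas_odd Z (b # bs)) * ?t' = ?t * (?sX * ?sY)"
      unfolding Zodd[OF a as] Zodd[OF b bs] super_sign_def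
      by (cases "bas_odd X a"; cases "bas_odd X b"; cases "bas_odd X c"; cases "bas_odd Y as"; cases "bas_odd Y bs") simp_all
    have dF: "(dl ^^ N) F = (\<lambda>m k. vscale ?sX ((dl ^^ N) F' m k))"
      using N[OF c] unfolding F_def[symmetric] F'_def[symmetric]
      by (simp add: dl_pow_diff dl_pow_lin[OF lin_vscale_self] fun_eq_iff)
    have dG: "(dl ^^ M) G = (\<lambda>m k. vscale ?sY ((dl ^^ M) G' m k))"
      using M[OF cs] unfolding G_def[symmetric] G'_def[symmetric]
      by (simp add: dl_pow_diff dl_pow_lin[OF lin_vscale_self] fun_eq_iff)
    have "(dl ^^ (N + M)) (conv F G) = (\<lambda>m k. vscale (?sX * ?sY) ((dl ^^ (N + M)) (conv F' G') m k))"
    proof -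
      have "conv (\<lambda>m k. vscale ?sX (H m k)) (\<lambda>m k. vscale ?sY (K m k)) m k = vscale (?sX * ?sY) (conv H K m k)" for H K m k
      proof -
        have "vscale (?sX * ?sY) (conv H K m k) = Sum_any (\<lambda>x. vscale (?sX * ?sY) (case x of (i, j) \<Rightarrow> tens (H i j) (K (m - 1 - i) (k - 1 - j))))"
          unfolding conv_def
          by (rule Sum_any_inj_lin[OF lin_vscale_self]) (simp add: super_sign_def split: if_splits)
        also have "\<dots> = conv (\<lambda>m k. vscale ?sX (H m k)) (\<lambda>m k. vscale ?sY (K m k)) m k"
          unfolding conv_def by (rule arg_cong[where f = Sum_any]) (auto simp: tens_scale1 tens_scale2 fun_eq_iff)
        finally show ?thesis by simp
      qed
      then show ?thesis
        unfolding dl_pow_conv[OF cFG] dl_pow_conv[OF cFG'] dF dG by (intro ext)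
    qed
    then show ?thesis
      unfolding AB BA free.scale_scale sgn
      by (simp add: dl_pow_diff dl_pow_lin[OF lin_vscale_self] fun_eq_iff)
  qed
  then show ?thesis unfolding Zset by blast
qed

lemma based_Z: "based_vsa Z"
proof
  show "bas_vac Z \<in> bas_set Z" using X.vac_in Y.vac_in by (simp add: Zset Zvac)
  show "\<not> bas_odd Z (bas_vac Z)" using X.vac_in Y.vac_in X.vac_even Y.vac_even by (simp add: Zodd Zvac)
  fix x assume "x \<in> bas_set Z"
  then obtain a as where x: "x = a # as" "a \<in> bas_set X" "as \<in> bas_set Y" by (rule Zelem)
  note Xv = X.vac_in and Yv = Y.vac_in
  have s1: "super_sign False p = 1" "super_sign p False = 1" for p by (simp_all add: super_sign_def)
  show "bas_prod Z (bas_vac Z) m x = (if m = -1 then basis_vec x else 0)" for m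
    unfolding Zvac x(1) Zprod[OF Xv x(2) Yv x(3)]
    using Y.vac_even by (simp add: X.vac_prod[OF x(2)] Y.vac_prod[OF x(3)] cv_delta s1 tens_basis)
  have cr: "bas_prod Z x m (bas_vac Z) = cv (\<lambda>k. bas_prod X a k (bas_vac X)) (\<lambda>k. bas_prod Y as k (bas_vac Y)) m" for m
    unfolding Zvac x(1) Zprod[OF x(2) Xv x(3) Yv] using X.vac_even by (simp add: s1)
  show "bas_prod Z x (-1) (bas_vac Z) = basis_vec x"
    unfolding cr by (subst cv_create(1)) (simp_all add: X.create Y.create x tens_basis)
  show "bas_prod Z x m (bas_vac Z) = 0" if "m \<ge> 0" for m
    unfolding cr using that by (intro cv_create(2)) (simp_all add: X.create Y.create x)
  fix y assume "y \<in> bas_set Z"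
  then obtain b bs where y: "y = b # bs" "b \<in> bas_set X" "bs \<in> bas_set Y" by (rule Zelem)
  show "keys (bas_prod Z x m y) \<subseteq> {c \<in> bas_set Z. bas_odd Z c = (bas_odd Z x \<noteq> bas_odd Z y)}" for m
    unfolding x(1) y(1) Zprod[OF x(2) y(2) x(3) y(3)] cv_def
  proof (intro order_trans[OF keys_vscale] keys_Sum_any_subset keys_tens_subset)
    fix k c cs
    assume "c \<in> keys (bas_prod X a k b)" "cs \<in> keys (bas_prod Y as (m - 1 - k) bs)"
    then have "c \<in> bas_set X" "bas_odd X c = (bas_odd X a \<noteq> bas_odd X b)" "cs \<in> bas_set Y" "bas_odd Y cs = (bas_odd Y as \<noteq> bas_odd Y bs)"
      using X.prod_keys[OF x(2) y(2), of k] Y.prod_keys[OF x(3) y(3), of "m - 1 - k"] by blast+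
    then show "c # cs \<in> {c \<in> bas_set Z. bas_odd Z c = (bas_odd Z (a # as) \<noteq> bas_odd Z (b # bs))}"
      using x y by (auto simp: Zset Zodd)
  qed
  show "\<exists>N. \<forall>m\<ge>N. bas_prod Z x m y = 0"
  proof -
    obtain N where N: "\<And>k. k \<ge> N \<Longrightarrow> bas_prod X a k b = 0" using X.trunc[OF x(2) y(2)] by blast
    obtain M where M: "\<And>k. k \<ge> M \<Longrightarrow> bas_prod Y as k bs = 0" using Y.trunc[OF x(3) y(3)] by blast
    have "cv (\<lambda>k. bas_prod X a k b) (\<lambda>k. bas_prod Y as k bs) m = 0" if "m \<ge> N + M" for m
    proof -
      have "tens (bas_prod X a k b) (bas_prod Y as (m - 1 - k) bs) = 0" for k
        using N[of k] M[of "m - 1 - k"] that by (cases "k \<ge> N") simp_all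
      then show ?thesis by (simp add: cv_def)
    qed
    then show ?thesis unfolding x(1) y(1) Zprod[OF x(2) y(2) x(3) y(3)] by (intro exI[of _ "N + M"]) simp
  qed
  show "bprod Z (bas_prod Z x m y) (-2) (basis_vec (bas_vac Z)) - bprod Z (basis_vec x) m (bas_prod Z y (-2) (bas_vac Z))
        = vscale (- of_int m) (bas_prod Z x (m - 1) y)" for m
    unfolding x(1) y(1) by (rule Z_transl[OF x(2) y(2) x(3) y(3)])
  show "\<exists>N. \<forall>c\<in>bas_set Z. (dl ^^ N) (\<lambda>m k. bprod Z (basis_vec x) m (bas_prod Z y k c)
        - vscale (super_sign (bas_odd Z x) (bas_odd Z y)) (bprod Z (basis_vec y) k (bas_prod Z x m c))) = (\<lambda>m k. 0)"
    unfolding x(1) y(1) by (rule Z_loc[OF x(2) y(2) x(3) y(3)])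
qed

end

section \<open>The tensor power as an iterated binary product\<close>

lemma tensor_power_simps:
  "bas_set (tensor_power n X) = {bs. length bs = n \<and> set bs \<subseteq> bas_set X}"
  "bas_odd (tensor_power n X) = (\<lambda>bs. odd (length (filter (bas_odd X) bs)))"
  "bas_vac (tensor_power n X) = replicate n (bas_vac X)"
  "bas_prod (tensor_power n X) as m bs = vscale (koszul_sign (bas_odd X) as bs)
       (Sum_any (\<lambda>ms :: int list.
          pure_tensor (map (\<lambda>i. bas_prod X (as ! i) (ms ! i) (bs ! i)) [0..<n])
            when length ms = n \<and> sum_list ms + int n = m + 1))"
  by (simp_all add: tensor_power_def)

lemma pure_tensor_Cons: "pure_tensor (v # vs) = tens v (pure_tensor vs)"
  by (simp add: tens_def)

lemma pure_tensor_zero: "0 \<in> set vs \<Longrightarrow> pure_tensor vs = 0"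
  by (induction vs) (auto simp: pure_tensor_Cons simp del: pure_tensor.simps(2))

text \<open>The head \<open>a\<close> passes nothing, whereas every later entry of the first list
  passes \<open>b\<close>, so the new sign depends on the parity of the whole tail
  \<open>as\<close>.\<close>

lemma koszul_sign_Cons:
  assumes "length as = length bs"
  shows "koszul_sign par (a # as) (b # bs) = super_sign (odd (length (filter par as))) (par b) * koszul_sign par as bs"
proof -
  have 1: "(\<Prod>j<Suc i. super_sign p (par ((b # bs) ! j))) = super_sign p (par b) * (\<Prod>j<i. super_sign p (par (bs ! j)))" for i p
    unfolding prod.lessThan_Suc_shift by simp
  have 2: "(\<Prod>i<length as. super_sign (par (as ! i)) (par b)) = super_sign (odd (length (filter par as))) (par b)"
    by (induction as) (auto simp: prod.lessThan_Suc_shift super_sign_def simp del: prod.lessThan_Suc)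
  have "koszul_sign par (a # as) (b # bs) = (\<Prod>i<length as. \<Prod>j<Suc i. super_sign (par (as ! i)) (par ((b # bs) ! j)))"
    unfolding koszul_sign_def length_Cons prod.lessThan_Suc_shift[of _ "length as"] by simp
  also have "\<dots> = (\<Prod>i<length as. super_sign (par (as ! i)) (par b)) * koszul_sign par as bs"
    unfolding 1 prod.distrib koszul_sign_def ..
  finally show ?thesis unfolding 2 .
qed

lemma sum_list_upper: "(\<And>x. x \<in> set ms \<Longrightarrow> x \<le> N) \<Longrightarrow> sum_list ms \<le> int (length ms) * (N :: int)"
  by (induction ms) (auto simp: algebra_simps intro: add_mono)

lemma sum_list_lower: "x \<in> set ms \<Longrightarrow> (\<And>x. x \<in> set ms \<Longrightarrow> x \<le> N) \<Longrightarrow> 0 \<le> N \<Longrightarrow> sum_list ms \<le> x + int (length ms) * (N :: int)"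
proof (induction ms)
  case (Cons k ms)
  show ?case
  proof (cases "x = k")
    case True
    have "sum_list ms \<le> int (length ms) * N" using Cons.prems by (intro sum_list_upper) auto
    then show ?thesis using True Cons.prems(3) by (simp add: algebra_simps)
  next
    case False
    then show ?thesis using Cons by (simp add: algebra_simps) (smt (verit, best))
  qed
qed simp

lemma pure_tensor_finite:
  assumes tr: "\<And>i. i < n \<Longrightarrow> truncated (f i)"
  shows "finite {ms :: int list. pure_tensor (map (\<lambda>i. f i (ms ! i)) [0..<n]) \<noteq> 0 \<and> length ms = n \<and> sum_list ms = t}"
proof -
  have "\<exists>N\<ge>0. \<forall>i<n'. \<forall>k\<ge>N. f i k = 0" if "n' \<le> n" for n'
    using that
  proof (induction n')
    case (Suc n')
    then obtain N where N: "N \<ge> 0" "\<forall>i<n'. \<forall>k\<ge>N. f i k = 0" by auto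
    obtain M where "\<forall>k\<ge>M. f n' k = 0" using tr[of n'] Suc.prems by (auto simp: truncated_def)
    then show ?case using N by (intro exI[of _ "max N M"]) (auto simp: less_Suc_eq)
  qed auto
  then obtain N where N: "N \<ge> 0" "\<And>i k. i < n \<Longrightarrow> k \<ge> N \<Longrightarrow> f i k = 0" by blast
  \<comment> \<open>All entries are at most \<open>N\<close>, so a fixed sum bounds each entry from
    below as well.\<close>
  have "{ms :: int list. pure_tensor (map (\<lambda>i. f i (ms ! i)) [0..<n]) \<noteq> 0 \<and> length ms = n \<and> sum_list ms = t} \<subseteq>
      {ms. set ms \<subseteq> {t - int n * N..N} \<and> length ms = n}"
  proof
    fix ms assume "ms \<in> {ms :: int list. pure_tensor (map (\<lambda>i. f i (ms ! i)) [0..<n]) \<noteq> 0 \<and> length ms = n \<and> sum_list ms = t}"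
    then have ms: "pure_tensor (map (\<lambda>i. f i (ms ! i)) [0..<n]) \<noteq> 0" "length ms = n" "sum_list ms = t" by auto
    have le: "x \<le> N" if x: "x \<in> set ms" for x
    proof (rule ccontr)
      assume "\<not> x \<le> N"
      obtain i where i: "i < n" "x = ms ! i" using x ms(2) by (auto simp: in_set_conv_nth)
      then have "f i (ms ! i) = 0" using N \<open>\<not> x \<le> N\<close> by simp
      then have "0 \<in> set (map (\<lambda>i. f i (ms ! i)) [0..<n])" using i by (force simp: image_iff)
      then show False using pure_tensor_zero ms(1) by blast
    qed
    have "t \<le> x + int n * N" if "x \<in> set ms" for x
      using sum_list_lower[OF that le N(1)] ms by simp
    then show "ms \<in> {ms. set ms \<subseteq> {t - int n * N..N} \<and> length ms = n}" using le ms by fastforce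
  qed
  then show ?thesis by (rule finite_subset) (rule finite_lists_length_eq, simp)
qed

lemma pure_tensor_upt_Suc:
  "pure_tensor (map (\<lambda>i. f i ((k # ms) ! i)) [0..<Suc n]) = tens (f 0 k) (pure_tensor (map (\<lambda>i. f (Suc i) (ms ! i)) [0..<n]))"
proof -
  have "[0..<Suc n] = 0 # map Suc [0..<n]" by (simp add: upt_conv_Cons map_Suc_upt del: upt_Suc)
  then show ?thesis by (simp add: pure_tensor_Cons comp_def del: pure_tensor.simps(2) upt_Suc)
qed

lemma Sum_any_pure_tensor:
  assumes tr: "\<And>i. i < Suc n \<Longrightarrow> truncated (f i)"
  shows "Sum_any (\<lambda>ms :: int list. pure_tensor (map (\<lambda>i. f i (ms ! i)) [0..<Suc n]) when length ms = Suc n \<and> sum_list ms = t)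
    = Sum_any (\<lambda>k. tens (f 0 k) (Sum_any (\<lambda>ms. pure_tensor (map (\<lambda>i. f (Suc i) (ms ! i)) [0..<n]) when length ms = n \<and> sum_list ms = t - k)))"
proof -
  let ?F = "\<lambda>ms :: int list. pure_tensor (map (\<lambda>i. f i (ms ! i)) [0..<Suc n]) when length ms = Suc n \<and> sum_list ms = t"
  let ?G = "\<lambda>k ms. pure_tensor (map (\<lambda>i. f (Suc i) (ms ! i)) [0..<n]) when length ms = n \<and> sum_list ms = t - k"
  have FG: "?F (k # ms) = tens (f 0 k) (?G k ms)" for k ms
    unfolding pure_tensor_upt_Suc by (auto simp: when_def)
  have fin: "finite {ms. ?F ms \<noteq> 0}"
    using pure_tensor_finite[where n = "Suc n" and f = f and t = t, OF tr] by (rule rev_finite_subset) (auto simp: when_def split: if_splits simp del: upt_Suc)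
  have finG: "finite {ms. ?G k ms \<noteq> 0}" for k
    using pure_tensor_finite[where n = n and f = "\<lambda>i. f (Suc i)" and t = "t - k"] tr by (auto simp: when_def elim!: rev_finite_subset)
  let ?S = "{x. (case x of (k, ms) \<Rightarrow> ?F (k # ms)) \<noteq> 0}"
  have img: "{ms. ?F ms \<noteq> 0} = (\<lambda>(k, ms). k # ms) ` ?S"
  proof (intro equalityI subsetI)
    fix ms assume ms: "ms \<in> {ms. ?F ms \<noteq> 0}"
    then have "length ms = Suc n" by (simp add: when_def split: if_splits)
    then obtain k ms' where "ms = k # ms'" by (cases ms) auto
    then show "ms \<in> (\<lambda>(k, ms). k # ms) ` ?S" using ms by (intro image_eqI[of _ _ "(k, ms')"]) (simp_all del: upt_Suc)
  qed (auto simp del: upt_Suc)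
  have inj: "inj_on (\<lambda>(k, ms). k # ms) A" for A :: "(int \<times> int list) set" by (auto simp: inj_on_def)
  have finS: "finite ?S" using fin unfolding img by (rule finite_imageD) (rule inj)
  have "Sum_any ?F = sum ?F ((\<lambda>(k, ms). k # ms) ` ?S)"
    unfolding Sum_any.expand_set img ..
  also have "\<dots> = (\<Sum>x\<in>?S. case x of (k, ms) \<Rightarrow> ?F (k # ms))"
    by (subst sum.reindex[OF inj]) (simp add: split_def comp_def del: upt_Suc)
  also have "\<dots> = Sum_any (\<lambda>(k, ms). ?F (k # ms))"
    unfolding Sum_any.expand_set ..
  also have "\<dots> = Sum_any (\<lambda>k. Sum_any (\<lambda>ms. ?F (k # ms)))"
  proof (rule Sum_any.cartesian_product[symmetric])
    show "finite (fst ` ?S \<times> snd ` ?S)" using finS by simp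
    show "{k. \<exists>ms. ?F (k # ms) \<noteq> 0} \<times> {ms. \<exists>k. ?F (k # ms) \<noteq> 0} \<subseteq> fst ` ?S \<times> snd ` ?S"
    proof
      fix x assume "x \<in> {k. \<exists>ms. ?F (k # ms) \<noteq> 0} \<times> {ms. \<exists>k. ?F (k # ms) \<noteq> 0}"
      then obtain i j i' j' where x: "x = (i, j)" "?F (i # j') \<noteq> 0" "?F (i' # j) \<noteq> 0" by blast
      then have "(i, j') \<in> ?S" "(i', j) \<in> ?S" by (simp_all del: upt_Suc)
      then have "fst (i, j') \<in> fst ` ?S" "snd (i', j) \<in> snd ` ?S" by (blast intro: imageI)+
      then show "x \<in> fst ` ?S \<times> snd ` ?S" using x(1) by simp
    qed
  qed
  also have "\<dots> = Sum_any (\<lambda>k. tens (f 0 k) (Sum_any (?G k)))"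
    unfolding FG Sum_any_lin[OF lin_tens2 finG] ..
  finally show ?thesis .
qed

lemma tensor_cons_power:
  assumes X: "based_vsa X" and Y: "based_vsa (tensor_power n X)"
  shows "tensor_cons X (tensor_power n X) (tensor_power (Suc n) X)"
proof -
  interpret X: based_vsa X by (rule X)
  interpret Y: based_vsa "tensor_power n X" by (rule Y)
  show ?thesis
  proof
    show "bas_set (tensor_power (Suc n) X) = {b # bs | b bs. b \<in> bas_set X \<and> bs \<in> bas_set (tensor_power n X)}"
      unfolding tensor_power_simps by (auto simp: length_Suc_conv)
    show "bas_odd (tensor_power (Suc n) X) (b # bs) = (bas_odd X b \<noteq> bas_odd (tensor_power n X) bs)" for b bs
      unfolding tensor_power_simps by simp
    show "bas_vac (tensor_power (Suc n) X) = bas_vac X # bas_vac (tensor_power n X)"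
      unfolding tensor_power_simps by simp
    fix a b as bs m
    assume a: "a \<in> bas_set X" and b: "b \<in> bas_set X" and as: "as \<in> bas_set (tensor_power n X)" and bs: "bs \<in> bas_set (tensor_power n X)"
    have len: "length as = n" "length bs = n" "set as \<subseteq> bas_set X" "set bs \<subseteq> bas_set X"
      using as bs unfolding tensor_power_simps by auto
    let ?f = "\<lambda>i k. bas_prod X ((a # as) ! i) k ((b # bs) ! i)"
    have tr: "truncated (?f i)" if "i < Suc n" for i
    proof -
      have "(a # as) ! i \<in> set (a # as)" "(b # bs) ! i \<in> set (b # bs)" using that len by (intro nth_mem; simp)+
      then have "(a # as) ! i \<in> bas_set X" "(b # bs) ! i \<in> bas_set X" using a b len by auto
      then show ?thesis unfolding truncated_def by (rule X.trunc)
    qed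
    let ?K = "koszul_sign (bas_odd X) as bs"
    let ?G = "\<lambda>t. Sum_any (\<lambda>ms. pure_tensor (map (\<lambda>i. ?f (Suc i) (ms ! i)) [0..<n]) when length ms = n \<and> sum_list ms = t)"
    have K0: "?K \<noteq> 0" by (simp add: koszul_sign_def super_sign_def)
    have c1: "(\<lambda>ms. sum_list ms + int (Suc n) = m + 1) = (\<lambda>ms. sum_list ms = m - int n)" for m by (auto simp: fun_eq_iff)
    have "bas_prod (tensor_power (Suc n) X) (a # as) m (b # bs) = vscale (koszul_sign (bas_odd X) (a # as) (b # bs))
        (Sum_any (\<lambda>k. tens (?f 0 k) (?G (m - int n - k))))"
    proof -
      have e: "(sum_list ms + int (Suc n) = m + 1) = (sum_list ms = m - int n)" for ms :: "int list" by auto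
      show ?thesis
        unfolding tensor_power_simps(4) e
        by (rule arg_cong[where f = "vscale _"]) (rule Sum_any_pure_tensor[where f = ?f, OF tr])
    qed
    \<comment> \<open>The product in the tail carries its own Koszul sign, which is divided out here
      and reabsorbed by \<open>koszul_sign_Cons\<close>.\<close>
    also have "Sum_any (\<lambda>k. tens (?f 0 k) (?G (m - int n - k))) = Sum_any (\<lambda>k. vscale (1 / ?K) (tens (bas_prod X a k b) (bas_prod (tensor_power n X) as (m - 1 - k) bs)))"
    proof (rule arg_cong[where f = Sum_any], rule ext)
      fix k
      have e: "(sum_list ms + int n = m - 1 - k + 1) = (sum_list ms = m - int n - k)" for ms :: "int list" by auto
      show "tens (?f 0 k) (?G (m - int n - k)) = vscale (1 / ?K) (tens (bas_prod X a k b) (bas_prod (tensor_power n X) as (m - 1 - k) bs))"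
        unfolding tensor_power_simps(4) e using K0 by (simp add: tens_scale2)
    qed
    also have "\<dots> = vscale (1 / ?K) (cv (\<lambda>k. bas_prod X a k b) (\<lambda>k. bas_prod (tensor_power n X) as k bs) m)"
      unfolding cv_def by (rule Sum_any_inj_lin[OF lin_vscale_self, symmetric]) (use K0 in simp)
    finally show "bas_prod (tensor_power (Suc n) X) (a # as) m (b # bs) =
        vscale (super_sign (bas_odd (tensor_power n X) as) (bas_odd X b))
          (cv (\<lambda>k. bas_prod X a k b) (\<lambda>k. bas_prod (tensor_power n X) as k bs) m)"
      using K0 len by (simp add: koszul_sign_Cons tensor_power_simps(2))
  qed
qed

theorem based_tensor_power:
  assumes X: "based_vsa X"
  shows "based_vsa (tensor_power n X)"
proof (induction n)
  case 0
  \<comment> \<open>The empty power is spanned by its vacuum \<open>[]\<close>. Only the empty list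
    of modes contributes, and the constraint on its sum then forces \<open>m = -1\<close>.\<close>
  have p: "bas_prod (tensor_power 0 X) [] m [] = (if m = -1 then basis_vec [] else 0)" for m
  proof -
    have "Sum_any (\<lambda>ms :: int list. (basis_vec [] :: 'a list vec) when length ms = 0 \<and> sum_list ms + 0 = m + 1) =
       (\<Sum>ms\<in>{[]}. basis_vec [] when length ms = 0 \<and> sum_list ms + 0 = m + 1)"
      by (rule Sum_any.expand_superset) (auto simp: when_def)
    then show ?thesis unfolding tensor_power_simps(4) by (auto simp: koszul_sign_def when_def)
  qed
  have b: "bprod (tensor_power 0 X) (basis_vec []) m v = (if m = -1 then lin_ext (\<lambda>b. basis_vec []) v else 0)" if "v \<in> {basis_vec [], 0}" for m v
    using that p by (auto simp: bprod_zero2)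
  have S: "x = []" if "x \<in> bas_set (tensor_power 0 X)" for x using that by (simp add: tensor_power_simps)
  have vac: "bas_vac (tensor_power 0 X) = []" by (simp add: tensor_power_simps)
  show ?case
  proof
    show "bas_vac (tensor_power 0 X) \<in> bas_set (tensor_power 0 X)" "\<not> bas_odd (tensor_power 0 X) (bas_vac (tensor_power 0 X))"
      by (simp_all add: tensor_power_simps)
    fix a b assume ab: "a \<in> bas_set (tensor_power 0 X)" "b \<in> bas_set (tensor_power 0 X)"
    then have [simp]: "a = []" "b = []" using S by auto
    show "keys (bas_prod (tensor_power 0 X) a m b) \<subseteq> {c \<in> bas_set (tensor_power 0 X).
        bas_odd (tensor_power 0 X) c = (bas_odd (tensor_power 0 X) a \<noteq> bas_odd (tensor_power 0 X) b)}" for m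
      by (simp add: p) (simp add: tensor_power_simps)
    show "\<exists>N. \<forall>m\<ge>N. bas_prod (tensor_power 0 X) a m b = 0" by (intro exI[of _ 0]) (simp add: p)
    show "bprod (tensor_power 0 X) (bas_prod (tensor_power 0 X) a m b) (-2) (basis_vec (bas_vac (tensor_power 0 X))) -
        bprod (tensor_power 0 X) (basis_vec a) m (bas_prod (tensor_power 0 X) b (-2) (bas_vac (tensor_power 0 X)))
        = vscale (- of_int m) (bas_prod (tensor_power 0 X) a (m - 1) b)" for m
      by (simp add: vac p bprod_zero1 bprod_zero2)
    show "\<exists>N. \<forall>c\<in>bas_set (tensor_power 0 X). (dl ^^ N) (\<lambda>m k. bprod (tensor_power 0 X) (basis_vec a) m (bas_prod (tensor_power 0 X) b k c)
        - vscale (super_sign (bas_odd (tensor_power 0 X) a) (bas_odd (tensor_power 0 X) b))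
            (bprod (tensor_power 0 X) (basis_vec b) k (bas_prod (tensor_power 0 X) a m c))) = (\<lambda>m k. 0)"
    proof (intro exI[of _ 0] ballI)
      fix c assume "c \<in> bas_set (tensor_power 0 X)"
      then have [simp]: "c = []" using S by auto
      show "(dl ^^ 0) (\<lambda>m k. bprod (tensor_power 0 X) (basis_vec a) m (bas_prod (tensor_power 0 X) b k c)
        - vscale (super_sign (bas_odd (tensor_power 0 X) a) (bas_odd (tensor_power 0 X) b))
            (bprod (tensor_power 0 X) (basis_vec b) k (bas_prod (tensor_power 0 X) a m c))) = (\<lambda>m k. 0)"
        by (auto simp: fun_eq_iff p bprod_zero2 super_sign_def tensor_power_simps(2))
    qed
  next
    have [simp]: "bas_set (tensor_power 0 X) = {[]}" by (auto simp: tensor_power_simps)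
    show "bas_prod (tensor_power 0 X) (bas_vac (tensor_power 0 X)) m a = (if m = -1 then basis_vec a else 0)"
      if "a \<in> bas_set (tensor_power 0 X)" for a m
      using that by (simp add: vac p)
    show "bas_prod (tensor_power 0 X) a (-1) (bas_vac (tensor_power 0 X)) = basis_vec a"
      if "a \<in> bas_set (tensor_power 0 X)" for a
      using that by (simp add: vac p)
    show "bas_prod (tensor_power 0 X) a m (bas_vac (tensor_power 0 X)) = 0"
      if "a \<in> bas_set (tensor_power 0 X)" "m \<ge> 0" for a m
      using that by (simp add: vac p)
  qed
next
  case (Suc n)
  interpret tensor_cons X "tensor_power n X" "tensor_power (Suc n) X" by (rule tensor_cons_power[OF X Suc])
  show ?case by (rule based_Z)
qed

section \<open>Tensor powers of symplectic fermions\<close>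

lemma SF1_simps [simp]: "bas_set SF1 = UNIV" "bas_vac SF1 = ({||}, {||})"
  "bas_prod SF1 a m b = sf_field a m (basis_vec b)"
  by (simp_all add: SF1_def)

lemma SF1_odd: "bas_odd SF1 (A, B) = odd (fcard A + fcard B)"
  by (simp add: SF1_def)

lemma emb_basis_parity: "keys (emb (basis_vec a)) \<subseteq> {b. odd (snd b) = bas_odd SF1 a}"
  using emb_parity[of "fst a" "snd a"] by (cases a) (simp add: SF1_odd)

lemma emb_bprod: "emb (bprod SF1 u m v) = bprod VZ (emb u) m (emb v)"
proof (rule lin_eqI[where v = u and f = "\<lambda>u. emb (bprod SF1 u m v)" and g = "\<lambda>u. bprod VZ (emb u) m (emb v)"])
  show "lin (\<lambda>u. emb (bprod SF1 u m v))" by (rule lin_comp[OF lin_emb lin_bprod1])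
  show "lin (\<lambda>u. bprod VZ (emb u) m (emb v))" by (rule lin_comp[OF lin_bprod1 lin_emb])
  fix a
  show "emb (bprod SF1 (basis_vec a) m v) = bprod VZ (emb (basis_vec a)) m (emb v)"
  proof (rule lin_eqI[where v = v and f = "\<lambda>v. emb (bprod SF1 (basis_vec a) m v)" and g = "\<lambda>v. bprod VZ (emb (basis_vec a)) m (emb v)"])
    show "lin (\<lambda>v. emb (bprod SF1 (basis_vec a) m v))" by (rule lin_comp[OF lin_emb lin_bprod2])
    show "lin (\<lambda>v. bprod VZ (emb (basis_vec a)) m (emb v))" by (rule lin_comp[OF lin_bprod2 lin_emb])
    show "emb (bprod SF1 (basis_vec a) m (basis_vec b)) = bprod VZ (emb (basis_vec a)) m (emb (basis_vec b))" for b
      by (simp add: emb_prod bprod_VZ)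
  qed
qed

text \<open>Split \<open>x\<close> by parity. The image of the component of the wrong parity has
  keys of both parities, hence is 0, and injectivity removes the component.\<close>

lemma parity_reflect:
  assumes f: "lin f" and inj: "\<And>x. keys x \<subseteq> S \<Longrightarrow> f x = 0 \<Longrightarrow> x = 0"
    and par: "\<And>b. b \<in> S \<Longrightarrow> keys (f (basis_vec b)) \<subseteq> {c. par' c = par b}"
    and x: "keys x \<subseteq> S" and fx: "keys (f x) \<subseteq> {c. par' c = (p :: bool)}"
  shows "keys x \<subseteq> {b. par b = p}"
proof -
  let ?e = "\<lambda>q. lin_ext (\<lambda>b. if par b = q then basis_vec b else 0) x"
  have "?e p + ?e (\<not> p) = lin_ext basis_vec x"
    unfolding lin_ext_plus by (rule lin_ext_cong) auto
  moreover have "lin_ext basis_vec x = x" using lin_ext_id[of 1 x] by simp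
  ultimately have xe: "x = ?e p + ?e (\<not> p)" by metis
  have k: "keys (?e q) \<subseteq> {b \<in> S. par b = q}" for q
    using x by (intro keys_lin_ext_subset) auto
  have fk: "keys (f (?e q)) \<subseteq> {c. par' c = q}" for q
    unfolding lin_eq_lin_ext[OF f, of "?e q"]
  proof (rule keys_lin_ext_subset)
    fix b assume "b \<in> keys (?e q)"
    then have "b \<in> S" "par b = q" using k[of q] by blast+
    then show "keys (f (basis_vec b)) \<subseteq> {c. par' c = q}" using par by blast
  qed
  have "f (?e (\<not> p)) = f x + vscale (-1) (f (?e p))"
    using lin_add[OF f, of "?e p" "?e (\<not> p)"] xe by (simp add: algebra_simps)
  then have "keys (f (?e (\<not> p))) \<subseteq> {c. par' c = p}"
    using order_trans[OF Poly_Mapping.keys_add Un_least[OF fx order_trans[OF keys_vscale fk[of p]]], of "-1"] by simp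
  then have "keys (f (?e (\<not> p))) = {}" using fk[of "\<not> p"] by blast
  then have "?e (\<not> p) = 0" using k[of "\<not> p"] by (intro inj) (auto simp: keys_eq_empty)
  then show ?thesis using k[of p] xe by auto
qed

lemma emb_parity_reflect:
  "keys (emb x) \<subseteq> {b. odd (snd b) = p} \<Longrightarrow> keys x \<subseteq> {a. bas_odd SF1 a = p}"
  by (rule parity_reflect[where S = UNIV and f = emb and par' = "\<lambda>b. odd (snd b)"])
    (simp_all add: emb_eq_zero emb_basis_parity)

interpretation VZ_based: based_vsa VZ by (rule based_VZ)

lemma carr_VZ: "v \<in> carr VZ"
  by (simp add: carr_def)

lemma emb_ppart: "emb (basis_vec a) \<in> ppart VZ (bas_odd SF1 a)"
  using emb_basis_parity[of a] by (simp add: ppart_def)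

text \<open>The axioms hold after applying \<open>emb\<close>, inside \<open>VZ\<close>; injectivity
  reflects the equations, and \<open>emb_parity_reflect\<close> the parity condition.\<close>

lemma based_SF1: "based_vsa SF1"
proof
  show "\<not> bas_odd SF1 (bas_vac SF1)" by (simp add: SF1_odd fcard_fempty)
  fix a b :: sf_label
  note ep = emb_prod[of a _ "basis_vec b"]
  show "keys (bas_prod SF1 a m b) \<subseteq> {c \<in> bas_set SF1. bas_odd SF1 c = (bas_odd SF1 a \<noteq> bas_odd SF1 b)}" for m
    using VZ.Yv_parity[OF emb_basis_parity emb_basis_parity, of a m b]
    by (simp add: emb_parity_reflect emb_prod)
  show "\<exists>N. \<forall>m\<ge>N. bas_prod SF1 a m b = 0"
    using is_fieldE[OF VZ.Yv_field, of "emb (basis_vec a)" "emb (basis_vec b)"] emb_eq_zero ep by (metis SF1_simps(3))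
  have v: "emb (basis_vec (bas_vac SF1)) = exp_basis 0" by (simp add: emb_vac)
  show "bas_prod SF1 (bas_vac SF1) m a = (if m = -1 then basis_vec a else 0)" for m
    by (rule emb_inj) (simp add: emb_prod emb_vac VZ.vac_field id_field_def when_def lin_zero)
  show "bas_prod SF1 a (-1) (bas_vac SF1) = basis_vec a"
    by (rule emb_inj) (use VZ.Yv_creates[of "emb (basis_vec a)"] in \<open>simp add: emb_prod emb_vac creates_def\<close>)
  show "bas_prod SF1 a m (bas_vac SF1) = 0" if "m \<ge> 0" for m
    by (rule emb_inj) (use that VZ.Yv_creates[of "emb (basis_vec a)"] in \<open>simp add: emb_prod emb_vac creates_def lin_zero\<close>)
  show "bprod SF1 (bas_prod SF1 a m b) (-2) (basis_vec (bas_vac SF1)) - bprod SF1 (basis_vec a) m (bas_prod SF1 b (-2) (bas_vac SF1))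
        = vscale (- of_int m) (bas_prod SF1 a (m - 1) b)" for m
    unfolding bprod_basis[symmetric]
    by (rule emb_inj)
      (use VZ_based.bprod_transl[OF carr_VZ carr_VZ, of "emb (basis_vec a)" m "emb (basis_vec b)"] in
        \<open>simp only: lin_diff[OF lin_emb] lin_scale[OF lin_emb] emb_bprod v VZ_simps\<close>)
  obtain N where N: "mlocal N (super_sign (bas_odd SF1 a) (bas_odd SF1 b)) (VZ.Yv (emb (basis_vec a))) (VZ.Yv (emb (basis_vec b)))"
    using VZ.Yv_local[OF emb_basis_parity emb_basis_parity] by blast
  show "\<exists>N. \<forall>c\<in>bas_set SF1. (dl ^^ N) (\<lambda>m k. bprod SF1 (basis_vec a) m (bas_prod SF1 b k c)
        - vscale (super_sign (bas_odd SF1 a) (bas_odd SF1 b)) (bprod SF1 (basis_vec b) k (bas_prod SF1 a m c))) = (\<lambda>m k. 0)"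
  proof (intro exI[of _ N] ballI ext)
    fix c m k
    let ?F = "\<lambda>m k. bprod SF1 (basis_vec a) m (bas_prod SF1 b k c)
        - vscale (super_sign (bas_odd SF1 a) (bas_odd SF1 b)) (bprod SF1 (basis_vec b) k (bas_prod SF1 a m c))"
    have "(\<lambda>m k. emb (?F m k)) = (\<lambda>m k. VZ.Yv (emb (basis_vec a)) m (VZ.Yv (emb (basis_vec b)) k (emb (basis_vec c)))
        - vscale (super_sign (bas_odd SF1 a) (bas_odd SF1 b)) (VZ.Yv (emb (basis_vec b)) k (VZ.Yv (emb (basis_vec a)) m (emb (basis_vec c)))))"
      by (simp add: lin_diff[OF lin_emb] lin_scale[OF lin_emb] emb_bprod bprod_VZ emb_prod)
    then have "(\<lambda>m k. emb ((dl ^^ N) ?F m k)) = (\<lambda>m k. 0)"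
      using N unfolding mlocal_def dl_pow_lin[OF lin_emb, symmetric] by simp
    then show "(dl ^^ N) ?F m k = 0" using emb_eq_zero by (metis (no_types, lifting))
  qed
qed simp_all

section \<open>Embedding of tensor powers and its left inverse\<close>

primrec embl :: "sf_label list \<Rightarrow> boson_label list vec" where
  "embl [] = basis_vec []"
| "embl (a # as) = tens (emb (basis_vec a)) (embl as)"

primrec retl :: "boson_label list \<Rightarrow> sf_label list vec" where
  "retl [] = basis_vec []"
| "retl (b # bs) = tens (ret (basis_vec b)) (retl bs)"

definition embn :: "sf_label list vec \<Rightarrow> boson_label list vec" where
  "embn = lin_ext embl"

definition retn :: "boson_label list vec \<Rightarrow> sf_label list vec" where
  "retn = lin_ext retl"

lemma lin_embn [simp]: "lin embn" and lin_retn [simp]: "lin retn"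
  by (simp_all add: embn_def retn_def)

lemma embn_basis [simp]: "embn (basis_vec as) = embl as" and retn_basis [simp]: "retn (basis_vec bs) = retl bs"
  by (simp_all add: embn_def retn_def)

lemma tens_map:
  assumes "lin F" "lin f" "lin G" "\<And>a as. F (basis_vec (a # as)) = tens (f (basis_vec a)) (G (basis_vec as))"
  shows "F (tens u v) = tens (f u) (G v)"
proof (rule lin_eqI[where v = u and f = "\<lambda>u. F (tens u v)" and g = "\<lambda>u. tens (f u) (G v)"])
  show "lin (\<lambda>u. F (tens u v))" by (rule lin_comp[OF assms(1) lin_tens1])
  show "lin (\<lambda>u. tens (f u) (G v))" by (rule lin_comp[OF lin_tens1 assms(2)])
  fix a
  show "F (tens (basis_vec a) v) = tens (f (basis_vec a)) (G v)"
  proof (rule lin_eqI[where v = v and f = "\<lambda>v. F (tens (basis_vec a) v)" and g = "\<lambda>v. tens (f (basis_vec a)) (G v)"])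
    show "lin (\<lambda>v. F (tens (basis_vec a) v))" by (rule lin_comp[OF assms(1) lin_tens2])
    show "lin (\<lambda>v. tens (f (basis_vec a)) (G v))" by (rule lin_comp[OF lin_tens2 assms(3)])
  qed (simp add: tens_basis assms(4))
qed

lemma embn_tens: "embn (tens u v) = tens (emb u) (embn v)"
  by (rule tens_map) simp_all

lemma retn_tens: "retn (tens u v) = tens (ret u) (retn v)"
  by (rule tens_map) (simp_all add: lin_ret)

lemma retn_embn: "retn (embn v) = v"
proof (rule lin_eqI[where f = "\<lambda>v. retn (embn v)" and g = "\<lambda>v. v"])
  show "lin (\<lambda>v. retn (embn v))" by (rule lin_comp[OF lin_retn lin_embn])
  have "retn (embl as) = basis_vec as" for as
    by (induction as) (simp_all add: retn_tens ret_emb tens_basis)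
  then show "retn (embn (basis_vec as)) = basis_vec as" for as by simp
qed (rule lin_id)

lemma embn_eq_zero: "embn v = 0 \<Longrightarrow> v = 0"
  using retn_embn[of v] by (simp add: lin_zero)

abbreviation "SFt n \<equiv> tensor_power n SF1"
abbreviation "VZt n \<equiv> tensor_power n VZ"

interpretation SFt: based_vsa "tensor_power n SF1" for n by (rule based_tensor_power[OF based_SF1])
interpretation VZt: based_vsa "tensor_power n VZ" for n by (rule based_tensor_power[OF based_VZ])
interpretation SFc: tensor_cons SF1 "tensor_power n SF1" "tensor_power (Suc n) SF1" for n
  by (rule tensor_cons_power[OF based_SF1 SFt.based_vsa_axioms])
interpretation VZc: tensor_cons VZ "tensor_power n VZ" "tensor_power (Suc n) VZ" for n
  by (rule tensor_cons_power[OF based_VZ VZt.based_vsa_axioms])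

lemma tens_ppart:
  assumes "u \<in> ppart X p" "v \<in> ppart (tensor_power n X) q"
  shows "tens u v \<in> ppart (tensor_power (Suc n) X) (p \<noteq> q)"
  unfolding ppart_def mem_Collect_eq
  by (rule keys_tens_subset) (use assms in \<open>force simp: ppart_def tensor_power_simps\<close>)

lemma set_tensor_power_UNIV: "bas_set X = UNIV \<Longrightarrow> bas_set (tensor_power n X) = {bs. length bs = n}"
  by (simp add: tensor_power_simps)

lemmas tset = set_tensor_power_UNIV[OF SF1_simps(1)] set_tensor_power_UNIV[OF VZ_simps(1)]

lemma embl_ppart: "length as = n \<Longrightarrow> embl as \<in> ppart (VZt n) (bas_odd (SFt n) as)"
proof (induction as arbitrary: n)
  case Nil
  then show ?case by (simp add: ppart_def tensor_power_simps)
next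
  case (Cons a as)
  then obtain k where n: "n = Suc k" "length as = k" by auto
  have "bas_odd (SFt (Suc k)) (a # as) = (bas_odd SF1 a \<noteq> bas_odd (SFt k) as)"
    using n by (intro SFc.Zodd) (simp_all add: tset)
  then show ?case using tens_ppart[OF emb_ppart Cons.IH[OF n(2)]] by (simp add: n)
qed

text \<open>\<open>emb\<close> preserves parity, so the signs of the two recursions agree and the
  first factor can be split off.\<close>

lemma embn_prod_basis:
  "length as = n \<Longrightarrow> length bs = n \<Longrightarrow> embn (bas_prod (SFt n) as m bs) = bprod (VZt n) (embl as) m (embl bs)"
proof (induction n arbitrary: as bs m)
  case 0
  have 1: "basis_vec [] \<in> carr (SFt 0)" "basis_vec [] \<in> carr (VZt 0)" by (simp_all add: carr_def tset)
  have vac: "bas_vac (SFt 0) = []" "bas_vac (VZt 0) = []" by (simp_all add: tensor_power_simps)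
  from 0 show ?case
    using SFt.vac_prod[of "[]" 0 m] VZt.bprod_vac[OF 1(2), of m] by (simp add: tset vac lin_zero split: if_splits)
next
  case (Suc n)
  obtain a as' where a: "as = a # as'" "length as' = n" using Suc.prems by (auto simp: length_Suc_conv)
  obtain b bs' where b: "bs = b # bs'" "length bs' = n" using Suc.prems by (auto simp: length_Suc_conv)
  have "embn (cv (\<lambda>k. bas_prod SF1 a k b) (\<lambda>k. bas_prod (SFt n) as' k bs') m) =
      cv (\<lambda>k. bprod VZ (emb (basis_vec a)) k (emb (basis_vec b))) (\<lambda>k. bprod (VZt n) (embl as') k (embl bs')) m"
    unfolding cv_def
    by (subst Sum_any_inj_lin[OF lin_embn embn_eq_zero])
      (simp_all add: embn_tens Suc.IH[OF a(2) b(2)] emb_prod bprod_VZ)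
  moreover have "embl bs' \<in> carr (VZt n)" using embl_ppart[OF b(2)] by (rule VZt.ppart_carr)
  ultimately show ?case
    unfolding a(1) b(1) embl.simps
    using VZc.bprod_tens[OF carr_VZ embl_ppart[OF a(2)] emb_ppart, of "embl bs'" "emb (basis_vec a)" m b] 
      SFc.Zprod[of a b as' n bs' m] a b
    by (simp add: tset lin_scale)
qed

lemma embn_bprod:
  assumes "u \<in> carr (SFt n)" "v \<in> carr (SFt n)"
  shows "embn (bprod (SFt n) u m v) = bprod (VZt n) (embn u) m (embn v)"
proof (rule lin_eqI[where v = u and f = "\<lambda>u. embn (bprod (SFt n) u m v)" and g = "\<lambda>u. bprod (VZt n) (embn u) m (embn v)"])
  show "lin (\<lambda>u. embn (bprod (SFt n) u m v))" by (rule lin_comp[OF lin_embn lin_bprod1])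
  show "lin (\<lambda>u. bprod (VZt n) (embn u) m (embn v))" by (rule lin_comp[OF lin_bprod1 lin_embn])
  fix a assume a: "a \<in> keys u"
  show "embn (bprod (SFt n) (basis_vec a) m v) = bprod (VZt n) (embn (basis_vec a)) m (embn v)"
  proof (rule lin_eqI[where v = v and f = "\<lambda>v. embn (bprod (SFt n) (basis_vec a) m v)" and g = "\<lambda>v. bprod (VZt n) (embn (basis_vec a)) m (embn v)"])
    show "lin (\<lambda>v. embn (bprod (SFt n) (basis_vec a) m v))" by (rule lin_comp[OF lin_embn lin_bprod2])
    show "lin (\<lambda>v. bprod (VZt n) (embn (basis_vec a)) m (embn v))" by (rule lin_comp[OF lin_bprod2 lin_embn])
    fix b assume "b \<in> keys v"
    then have "length a = n" "length b = n" using a assms by (auto simp: carr_def tset)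
    then show "embn (bprod (SFt n) (basis_vec a) m (basis_vec b)) = bprod (VZt n) (embn (basis_vec a)) m (embn (basis_vec b))"
      by (simp add: embn_prod_basis)
  qed
qed

lemma embl_vac: "embl (bas_vac (SFt n)) = basis_vec (bas_vac (VZt n))"
proof -
  have "embl (replicate n ({||}, {||})) = basis_vec (replicate n ({#}, 0))"
    by (induction n) (simp_all add: emb_vac tens_basis)
  then show ?thesis by (simp add: tensor_power_simps)
qed

lemma embn_ppart:
  assumes "v \<in> ppart (SFt n) p"
  shows "embn v \<in> ppart (VZt n) p"
proof -
  have "keys (embl as) \<subseteq> {b \<in> bas_set (VZt n). bas_odd (VZt n) b = p}" if "as \<in> keys v" for as
  proof -
    have "length as = n" "bas_odd (SFt n) as = p" using that assms by (auto simp: ppart_def tset)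
    then show ?thesis using embl_ppart[of as n] by (simp add: ppart_def)
  qed
  then show ?thesis unfolding ppart_def mem_Collect_eq embn_def by (rule keys_lin_ext_subset)
qed

lemma embn_ppart_reflect:
  assumes v: "v \<in> carr (SFt n)" and p: "embn v \<in> ppart (VZt n) p"
  shows "v \<in> ppart (SFt n) p"
proof -
  have "keys v \<subseteq> {as. bas_odd (SFt n) as = p}"
  proof (rule parity_reflect[OF lin_embn, where par' = "bas_odd (VZt n)"])
    show "keys v \<subseteq> bas_set (SFt n)" using v by (simp add: carr_def)
    show "keys (embn v) \<subseteq> {c. bas_odd (VZt n) c = p}" using p by (auto simp: ppart_def)
    show "keys (embn (basis_vec as)) \<subseteq> {c. bas_odd (VZt n) c = bas_odd (SFt n) as}" if "as \<in> bas_set (SFt n)" for as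
      using embl_ppart[of as n] that by (auto simp: ppart_def tset)
  qed (rule embn_eq_zero)
  then show ?thesis using v by (auto simp: ppart_def carr_def)
qed

lemma retn_carr: "v \<in> carr (VZt n) \<Longrightarrow> retn v \<in> carr (SFt n)"
proof -
  assume v: "v \<in> carr (VZt n)"
  have "keys (retl bs) \<subseteq> {as. length as = length bs}" for bs
  proof (induction bs)
    case (Cons b bs)
    show ?case unfolding retl.simps by (rule keys_tens_subset) (use Cons in auto)
  qed simp
  then show ?thesis using v unfolding carr_def mem_Collect_eq retn_def tset
    by (intro keys_lin_ext_subset) blast
qed

section \<open>The joint kernel of the screening operators\<close>

text \<open>Positions count from 0 here, whereas the short roots are numbered from 1.\<close>

definition scr_label :: "nat \<Rightarrow> nat \<Rightarrow> boson_label list" where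
  "scr_label n j = (replicate n ({#}, 0))[j := ({#}, -1)]"

definition scr :: "nat \<Rightarrow> nat \<Rightarrow> boson_label list vec \<Rightarrow> boson_label list vec" where
  "scr n j v = bprod (VZt n) (basis_vec (scr_label n j)) 0 v"

lemma lin_scr: "lin (scr n j)"
  unfolding scr_def[abs_def] by (rule lin_bprod2)

lemma cv_delta': "cv f (\<lambda>k. if k = -1 then v else 0) m = tens (f m) v"
proof -
  have "cv f (\<lambda>k. if k = -1 then v else 0) m = (\<Sum>k\<in>{m}. tens (f k) (if m - 1 - k = -1 then v else 0))"
    unfolding cv_def by (rule Sum_any.expand_superset) (auto split: if_splits)
  then show ?thesis by simp
qed

lemma vac_VZt: "bas_vac (VZt n) = replicate n ({#}, 0)"
  by (simp add: tensor_power_simps)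

lemma scr_tens_0:
  assumes u: "u \<in> ppart VZ q" and v: "v \<in> carr (VZt n)"
  shows "scr (Suc n) 0 (tens u v) = tens (fc 0 u) v"
proof -
  have "basis_vec (scr_label (Suc n) 0) = tens (exp_basis (-1)) (basis_vec (bas_vac (VZt n)))"
    by (simp add: scr_label_def tens_basis vac_VZt)
  moreover have "basis_vec (bas_vac (VZt n)) \<in> ppart (VZt n) False"
    using VZt.vac_in[of n] VZt.vac_even[of n] by (simp add: ppart_def)
  ultimately show ?thesis
    unfolding scr_def
    by (simp add: VZc.bprod_tens[OF carr_VZ _ u v] VZt.bprod_vac[OF v] cv_delta' super_sign_def bprod_VZ_basis boson_field_exp)
qed

text \<open>The odd screening operator passes the first factor; since \<open>u\<close> is
  homogeneous this costs only a scalar sign.\<close>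

lemma scr_tens_Suc:
  assumes u: "u \<in> ppart VZ q" and v: "v \<in> carr (VZt n)" and j: "j < n"
  shows "scr (Suc n) (Suc j) (tens u v) = vscale (super_sign True q) (tens u (scr n j v))"
proof -
  have e: "basis_vec (scr_label (Suc n) (Suc j)) = tens (basis_vec (bas_vac VZ)) (basis_vec (scr_label n j))"
    by (simp add: scr_label_def tens_basis)
  have "odd (length (filter (bas_odd VZ) (scr_label n j)))"
    using j
  proof (induction n arbitrary: j)
    case (Suc n)
    show ?case
    proof (cases j)
      case 0
      have "filter (bas_odd VZ) (replicate n ({#}, 0)) = []" by (simp add: filter_empty_conv)
      then show ?thesis by (simp add: 0 scr_label_def)
    next
      case (Suc i)
      then show ?thesis using Suc.IH[of i] Suc.prems by (simp add: scr_label_def)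
    qed
  qed simp
  then have p: "basis_vec (scr_label n j) \<in> ppart (VZt n) True"
    by (simp add: ppart_def tset tensor_power_simps(2) scr_label_def)
  have uc: "u \<in> carr VZ" by (rule carr_VZ)
  show ?thesis
    unfolding scr_def e VZc.bprod_tens[OF carr_VZ p u v] VZ_based.bprod_vac[OF uc] cv_delta ..
qed

lemma scr_embn: "v \<in> carr (SFt n) \<Longrightarrow> j < n \<Longrightarrow> scr n j (embn v) = 0"
proof -
  assume v: "v \<in> carr (SFt n)" and j: "j < n"
  have "scr n j (embl as) = 0" if "length as = n" "j < n" for as n j
    using that
  proof (induction as arbitrary: n j)
    case (Cons a as)
    then obtain k where n: "n = Suc k" "length as = k" by auto
    have c: "embl as \<in> carr (VZt k)" using embl_ppart[OF n(2)] by (rule VZt.ppart_carr)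
    show ?case
    proof (cases j)
      case 0
      then show ?thesis by (simp add: n scr_tens_0[OF emb_ppart c] screening_emb)
    next
      case (Suc i)
      then show ?thesis using Cons n by (simp add: scr_tens_Suc[OF emb_ppart c])
    qed
  qed simp
  note * = this
  show ?thesis
  proof (rule lin_eqI[where f = "\<lambda>v. scr n j (embn v)" and g = "\<lambda>v. 0"])
    show "lin (\<lambda>v. scr n j (embn v))" by (rule lin_comp[OF lin_scr lin_embn])
    fix as assume "as \<in> keys v"
    then show "scr n j (embn (basis_vec as)) = 0" using v j * by (auto simp: carr_def tset)
  qed (rule lin_const_zero)
qed

text \<open>Contraction of the first tensor factor with the dual basis vector of
  \<open>b\<close>.\<close>

definition head_part :: "'b \<Rightarrow> 'b list vec \<Rightarrow> 'b list vec" where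
  "head_part b = lin_ext (\<lambda>bs. if bs \<noteq> [] \<and> hd bs = b then basis_vec (tl bs) else 0)"

lemma lin_head_part: "lin (head_part b)"
  by (simp add: head_part_def)

lemma head_part_tens: "head_part b (tens (basis_vec c) v) = (if c = b then v else 0)"
proof (rule lin_eqI[where f = "\<lambda>v. head_part b (tens (basis_vec c) v)" and g = "\<lambda>v. if c = b then v else 0"])
  show "lin (\<lambda>v. head_part b (tens (basis_vec c) v))" by (rule lin_comp[OF lin_head_part lin_tens2])
  show "lin (\<lambda>v. if c = b then v else 0)" by (cases "c = b") (simp_all add: lin_id lin_const_zero)
qed (simp add: tens_basis head_part_def)

lemma decompose_tens:
  assumes x: "keys x \<subseteq> {bs. length bs = Suc n}"
  shows "x = (\<Sum>b\<in>hd ` keys x. tens (basis_vec b) (head_part b x))"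
    and "keys (head_part b x) \<subseteq> {bs. length bs = n}"
proof -
  let ?B = "hd ` keys x"
  show "x = (\<Sum>b\<in>?B. tens (basis_vec b) (head_part b x))"
  proof (rule lin_eqI[where f = "\<lambda>x. x" and g = "\<lambda>x. \<Sum>b\<in>?B. tens (basis_vec b) (head_part b x)"])
    show "lin (\<lambda>x. \<Sum>b\<in>?B. tens (basis_vec b) (head_part b x))"
      by (rule lin_sum_op, rule lin_comp[OF lin_tens2 lin_head_part])
    fix bs assume bs: "bs \<in> keys x"
    then obtain c cs where c: "bs = c # cs" using x by (auto simp: length_Suc_conv)
    have "(\<Sum>b\<in>?B. tens (basis_vec b) (head_part b (basis_vec bs))) = (\<Sum>b\<in>?B. if b = c then basis_vec bs else 0)"
      by (intro sum.cong) (auto simp: c head_part_def tens_basis)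
    also have "\<dots> = basis_vec bs" using bs by (force simp: c image_iff)
    finally show "basis_vec bs = (\<Sum>b\<in>?B. tens (basis_vec b) (head_part b (basis_vec bs)))" by simp
  qed (rule lin_id)
  show "keys (head_part b x) \<subseteq> {bs. length bs = n}"
    unfolding head_part_def by (rule keys_lin_ext_subset) (use x in auto)
qed

definition op1 :: "('b vec \<Rightarrow> 'b vec) \<Rightarrow> 'b list vec \<Rightarrow> 'b list vec" where
  "op1 f = lin_ext (\<lambda>bs. tens (f (basis_vec (hd bs))) (basis_vec (tl bs)))"

lemma op1_tens: "lin f \<Longrightarrow> op1 f (tens u v) = tens (f u) v"
  by (rule tens_map[where G = "\<lambda>v. v"]) (simp_all add: op1_def lin_id)

lemma basis_ppart_VZ: "basis_vec b \<in> ppart VZ (odd (snd b))"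
  by (simp add: ppart_def)

text \<open>Write \<open>x\<close> as a sum of \<open>b \<otimes> x_b\<close> over first labels. The
  later screenings act on the \<open>x_b\<close>, which by independence of the labels lie in the
  smaller joint kernel and are fixed by induction. On the first factor
  \<open>emb (ret b) = b - fb (-1) (fc 0 b)\<close>, and the total correction is
  \<open>fb (-1)\<close> applied to the first screening of \<open>x\<close>, which is 0.\<close>

theorem kernel_embn:
  "x \<in> carr (VZt n) \<Longrightarrow> (\<And>j. j < n \<Longrightarrow> scr n j x = 0) \<Longrightarrow> embn (retn x) = x"
proof (induction n arbitrary: x)
  case 0
  show ?case
  proof (rule lin_eqI[where f = "\<lambda>x. embn (retn x)" and g = "\<lambda>x. x"])
    show "lin (\<lambda>x. embn (retn x))" by (rule lin_comp[OF lin_embn lin_retn])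
    fix b assume "b \<in> keys x"
    then have "b = []" using 0 by (auto simp: carr_def tset)
    then show "embn (retn (basis_vec b)) = basis_vec b" by simp
  qed (rule lin_id)
next
  case (Suc n)
  have x: "keys x \<subseteq> {bs. length bs = Suc n}" using Suc.prems by (simp add: carr_def tset)
  define B where "B = hd ` keys x"
  have fB: "finite B" by (simp add: B_def)
  note dec = decompose_tens(1)[OF x, folded B_def]
  have c: "head_part b x \<in> carr (VZt n)" for b using decompose_tens(2)[OF x] by (simp add: carr_def tset)
  have FR: "embn (retn (head_part b x)) = head_part b x" if b: "b \<in> B" for b
  proof (rule Suc.IH[OF c])
    fix j assume j: "j < n"
    have "0 = scr (Suc n) (Suc j) (\<Sum>b\<in>B. tens (basis_vec b) (head_part b x))"
      using Suc.prems(2)[of "Suc j"] j dec by simp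
    also have "\<dots> = (\<Sum>b\<in>B. vscale (super_sign True (odd (snd b))) (tens (basis_vec b) (scr n j (head_part b x))))"
      unfolding lin_sum[OF lin_scr] scr_tens_Suc[OF basis_ppart_VZ c j] ..
    \<comment> \<open>Contracting with \<open>b\<close> isolates its summand, since the labels in
      \<open>B\<close> are distinct.\<close>
    finally have "head_part b 0 = head_part b (\<Sum>b\<in>B. vscale (super_sign True (odd (snd b))) (tens (basis_vec b) (scr n j (head_part b x))))"
      by simp
    also have "\<dots> = (\<Sum>b'\<in>B. if b' = b then vscale (super_sign True (odd (snd b))) (scr n j (head_part b x)) else 0)"
      unfolding lin_sum[OF lin_head_part] lin_scale[OF lin_head_part] head_part_tens by (intro sum.cong) auto
    finally have "vscale (super_sign True (odd (snd b))) (scr n j (head_part b x)) = 0"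
      using b fB by (simp add: lin_zero[OF lin_head_part])
    then show "scr n j (head_part b x) = 0" by (simp add: super_sign_def split: if_splits)
  qed
  have z0: "(\<Sum>b\<in>B. tens (fc 0 (basis_vec b)) (head_part b x)) = 0"
  proof -
    have "(\<Sum>b\<in>B. tens (fc 0 (basis_vec b)) (head_part b x)) = scr (Suc n) 0 (\<Sum>b\<in>B. tens (basis_vec b) (head_part b x))"
      unfolding lin_sum[OF lin_scr] scr_tens_0[OF basis_ppart_VZ c] ..
    also have "\<dots> = 0" using Suc.prems(2)[of 0] dec by simp
    finally show ?thesis .
  qed
  have "embn (retn x) = (\<Sum>b\<in>B. tens (emb (ret (basis_vec b))) (embn (retn (head_part b x))))"
    by (subst dec) (simp add: lin_sum retn_tens embn_tens)
  also have "\<dots> = (\<Sum>b\<in>B. tens (basis_vec b) (head_part b x) - tens (fb (-1) (fc 0 (basis_vec b))) (head_part b x))"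
    by (intro sum.cong refl) (simp add: FR emb_ret' tens_diff1)
  \<comment> \<open>\<open>op1\<close> extends \<open>fb (-1)\<close> linearly to the whole tensor,
    so the corrections are collected into the image of one vanishing sum.\<close>
  also have "\<dots> = x - op1 (fb (-1)) (\<Sum>b\<in>B. tens (fc 0 (basis_vec b)) (head_part b x))"
  proof -
    have "lin (op1 (fb (-1)))" by (simp add: op1_def)
    then have "op1 (fb (-1)) (\<Sum>b\<in>B. tens (fc 0 (basis_vec b)) (head_part b x)) = (\<Sum>b\<in>B. tens (fb (-1) (fc 0 (basis_vec b))) (head_part b x))"
      by (simp add: lin_sum op1_tens)
    then show ?thesis by (simp only: sum_subtractf dec[symmetric])
  qed
  also have "\<dots> = x" unfolding z0 by (simp add: op1_def)
  finally show ?case .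
qed

section \<open>The coroot lattice and the isomorphism\<close>

lemma odd_filter_sum: "odd (length (filter (bas_odd VZ) bs)) = odd (sum_list (map snd bs))"
  by (induction bs) auto

text \<open>In simple-root coordinates \<open>\<beta>\<close> has entries
  \<open>P k / sqrt 2\<close> with partial sums \<open>P k\<close>, whereas \<open>sqrt 2\<close>
  times a coroot vector has entries \<open>c k / sqrt 2\<close> for \<open>k < n\<close> and
  \<open>sqrt 2 * c n\<close> at \<open>k = n\<close>, because the short simple root is its own
  coroot. The sole condition is that the full sum \<open>P n\<close> is even.\<close>

lemma sqrt2_coroot_lattice_even:
  assumes n: "n \<ge> 1" and len: "length \<beta> = n"
  shows "\<beta> \<in> sqrt2_coroot_lattice n \<longleftrightarrow> even (sum_list \<beta>)"
proof -
  have norm: "formB n (simple_root i) (simple_root i) = gramB n i i" if "1 \<le> i" "i \<le> n" for i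
  proof -
    have "(\<Sum>l=1..n. simple_root i k * simple_root i l * gramB n k l) = (if k = i then gramB n i i else 0)" for k
    proof -
      have "(\<Sum>l=1..n. simple_root i k * simple_root i l * gramB n k l)
          = (\<Sum>l=1..n. if l = i then (if k = i then gramB n i i else 0) else 0)"
        by (intro sum.cong refl) (auto simp: simple_root_def)
      then show ?thesis using that by simp
    qed
    then show ?thesis using that by (simp add: formB_def)
  qed
  have cor: "simple_coroot n i k = (if k = i then 2 / gramB n i i else 0)" if "1 \<le> i" "i \<le> n" for i k
    unfolding simple_coroot_def norm[OF that] by (simp add: simple_root_def)
  define P where "P k = (\<Sum>i=1..k. \<beta> ! (i - 1))" for k
  have Pn: "P n = sum_list \<beta>"
    unfolding P_def sum_list_sum_nth len
    by (rule sum.reindex_bij_witness[of _ Suc "\<lambda>i. i - 1"]) auto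
  have coroot: "(\<lambda>k. \<Sum>i=1..n. of_int (c i) * simple_coroot n i k) =
      (\<lambda>k. if 1 \<le> k \<and> k \<le> n then (if k = n then of_int (c k) else of_int (c k) / 2) else 0)" for c :: "nat \<Rightarrow> int"
  proof
    fix k
    have "(\<Sum>i=1..n. of_int (c i) * simple_coroot n i k) = (\<Sum>i=1..n. if i = k then (if k = n then of_int (c k) else of_int (c k) / 2) else 0)"
      by (intro sum.cong refl) (auto simp: cor gramB_def)
    then show "(\<Sum>i=1..n. of_int (c i) * simple_coroot n i k) = (if 1 \<le> k \<and> k \<le> n then (if k = n then of_int (c k) else of_int (c k) / 2) else 0)"
      by simp
  qed
  have emb: "zn_embed n \<beta> k = (if 1 \<le> k \<and> k \<le> n then of_int (P k) / sqrt 2 else 0)" for k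
  proof -
    have "zn_embed n \<beta> k = (\<Sum>i=1..n. if k \<in> {i..n} then of_int (\<beta> ! (i - 1)) / sqrt 2 else 0)"
      unfolding zn_embed_def by (intro sum.cong refl) (auto simp: eps_def short_root_eq)
    also have "\<dots> = (if k \<le> n then (\<Sum>i=1..k. of_int (\<beta> ! (i - 1))) / sqrt 2 else 0)"
    proof (cases "k \<le> n")
      case True
      have "{1..k} = {1..n} \<inter> {i. k \<in> {i..n}}" using True by auto
      with True show ?thesis by (auto simp: sum.inter_restrict sum_divide_distrib intro!: sum.cong)
    qed auto
    finally show ?thesis by (auto simp: P_def)
  qed
  show ?thesis
  proof
    assume "\<beta> \<in> sqrt2_coroot_lattice n"
    then obtain c :: "nat \<Rightarrow> int" where "zn_embed n \<beta> = (\<lambda>k. sqrt 2 * (\<Sum>i=1..n. of_int (c i) * simple_coroot n i k))"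
      unfolding sqrt2_coroot_lattice_def coroot_latticeB_def by auto
    then have "zn_embed n \<beta> n = sqrt 2 * (\<Sum>i=1..n. of_int (c i) * simple_coroot n i n)" by simp
    also have "(\<Sum>i=1..n. of_int (c i) * simple_coroot n i n) = of_int (c n)"
      using fun_cong[OF coroot[of c], of n] n by simp
    finally have "of_int (P n) / sqrt 2 = sqrt 2 * of_int (c n)" using n by (simp add: emb)
    then have "of_int (P n) = sqrt 2 * sqrt 2 * (of_int (c n) :: real)" by (simp add: field_simps)
    then have "of_int (P n) = (of_int (2 * c n) :: real)" by simp
    then have "P n = 2 * c n" by (simp only: of_int_eq_iff)
    then show "even (sum_list \<beta>)" unfolding Pn by simp
  next
    assume "even (sum_list \<beta>)"
    \<comment> \<open>Solves the comparison of coordinates; only the last one requires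
      halving.\<close>
    define c where "c k = (if k = n then P n div 2 else P k)" for k
    let ?x = "\<lambda>k. \<Sum>i=1..n. of_int (c i) * simple_coroot n i k"
    have "2 * (P n div 2) = P n" using \<open>even (sum_list \<beta>)\<close> unfolding Pn by simp
    then have half: "(of_int (P n div 2) :: real) = of_int (P n) / 2"
      by (metis of_int_mult of_int_numeral nonzero_mult_div_cancel_left zero_neq_numeral)
    have "zn_embed n \<beta> k = sqrt 2 * ?x k" for k
    proof -
      have "?x k = (if 1 \<le> k \<and> k \<le> n then of_int (P k) / 2 else 0)"
        using fun_cong[OF coroot[of c], of k] half by (auto simp: c_def)
      then show ?thesis unfolding emb by (auto simp: field_simps)
    qed
    then have "zn_embed n \<beta> = (\<lambda>k. sqrt 2 * ?x k)" by (rule ext)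
    moreover have "?x \<in> coroot_latticeB n" unfolding coroot_latticeB_def by blast
    ultimately show "\<beta> \<in> sqrt2_coroot_lattice n"
      unfolding sqrt2_coroot_lattice_def mem_Collect_eq using len by (intro conjI bexI[of _ ?x])
  qed
qed

text \<open>A label is odd exactly when its total charge is, so the lattice condition and the parity
  condition coincide.\<close>

lemma V_sqrt2_carrier:
  assumes "n \<ge> 1"
  shows "va_carrier (V_sqrt2_coroot n) = ppart (VZt n) False"
proof -
  have "lattice_deg bs \<in> sqrt2_coroot_lattice n \<longleftrightarrow> \<not> bas_odd (VZt n) bs" if "length bs = n" for bs
    using sqrt2_coroot_lattice_even[OF assms, of "lattice_deg bs"] that odd_filter_sum[of bs]
    by (simp add: lattice_deg_def tensor_power_simps)
  then show ?thesis
    unfolding V_sqrt2_coroot_def va_restrict_def VZn_def by (auto simp: carr_def ppart_def tset)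
qed

lemma short_screening_scr:
  assumes "1 \<le> i" "i \<le> n"
  shows "short_screening n i = scr n (i - 1)"
proof
  fix v
  have "map (\<lambda>l. ({#}, l)) ((replicate n 0)[i - 1 := -1]) = scr_label n (i - 1)"
    by (simp add: scr_label_def map_update)
  then show "short_screening n i v = scr n (i - 1) v"
    unfolding short_screening_def zn_coords_short_root[OF assms] screening_def exp_vec_def VZn_def scr_def by simp
qed

lemma W_carrier:
  assumes "n \<ge> 1"
  shows "va_carrier (W_B_4 n) = {v \<in> ppart (VZt n) False. \<forall>j<n. scr n j v = 0}"
proof -
  have "(\<forall>i\<in>{1..n}. short_screening n i v = 0) \<longleftrightarrow> (\<forall>j<n. scr n j v = 0)" for v
  proof -
    have "(\<forall>i\<in>{1..n}. scr n (i - 1) v = 0) \<longleftrightarrow> (\<forall>j<n. scr n j v = 0)"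
    proof
      assume a: "\<forall>i\<in>{1..n}. scr n (i - 1) v = 0"
      show "\<forall>j<n. scr n j v = 0"
      proof (intro allI impI)
        fix j assume "j < n"
        then show "scr n j v = 0" using bspec[OF a, of "Suc j"] by simp
      qed
    qed auto
    then show ?thesis by (simp add: short_screening_scr)
  qed
  then show ?thesis
    using assms unfolding W_B_4_def va_restrict_def V_sqrt2_carrier[OF assms] by auto
qed

text \<open>Both algebras of the theorem sit in the even part of an ambient superalgebra; listing
  the components of \<open>U\<close> lets one argument cover \<open>va_even\<close> and
  \<open>W_B_4\<close>.\<close>

lemma vertex_algebra_sub:
  assumes V: "vertex_superalgebra V" and C: "free.subspace C" "C \<subseteq> va_part V False" "va_vac V \<in> C"
    and closed: "\<And>u v m. u \<in> C \<Longrightarrow> v \<in> C \<Longrightarrow> va_prod V u m v \<in> C"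
    and U: "va_carrier U = C" "va_part U False = C" "va_part U True = {0}" "va_vac U = va_vac V" "va_prod U = va_prod V"
  shows "vertex_algebra U"
proof -
  interpret V: vertex_superalgebra V by (rule V)
  have CV: "u \<in> va_carrier V" if "u \<in> C" for u
  proof -
    have "u = u + 0" "0 \<in> va_part V True" using free.subspace_0[OF V.subspaces(2)] by simp_all
    then show ?thesis using that C(2) unfolding V.grading(1) by blast
  qed
  have part: "u \<in> va_part V p" "u \<in> C" if "u \<in> va_part U p" for u p
    using that C free.subspace_0[OF V.subspaces(2)] free.subspace_0[OF C(1)] U by (cases p; auto)+
  have zero: "va_prod V 0 m v = 0" "va_prod V v m 0 = 0" if "v \<in> C" for v m
    using V.prod_scale(1)[OF CV[OF that] CV[OF that], of 0 m] V.prod_scale(2)[OF CV[OF that] CV[OF that], of m 0] by simp_all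
  have "vertex_superalgebra U"
  proof (unfold_locales, unfold U va_transl_def)
    show "free.subspace C" by (rule C)
    show "free.subspace (va_part U p)" for p using C(1) U(2,3) by (cases p) simp_all
    show "C = {u + v |u v. u \<in> C \<and> v \<in> {0}}" by auto
    show "C \<inter> {0} = {0}" using free.subspace_0[OF C(1)] by auto
    show "va_vac V \<in> C" by (rule C)
    show "va_prod V a m b \<in> va_part U (p \<noteq> q)" if "a \<in> va_part U p" "b \<in> va_part U q" for a p b q m
      using that closed[of a b m] zero[OF part(2)[OF that(1)], of m] zero[OF part(2)[OF that(2)], of m] free.subspace_0[OF C(1)] U(2,3)
      by (cases p; cases q) auto
    show "\<exists>N::nat. \<forall>m k. \<forall>v\<in>C. (\<Sum>j\<le>N. vscale ((-1) ^ j * of_nat (N choose j))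
            (va_prod V a (m + int (N - j)) (va_prod V b (k + int j) v)
             - vscale (super_sign p q) (va_prod V b (k + int j) (va_prod V a (m + int (N - j)) v)))) = 0"
      if "a \<in> va_part U p" "b \<in> va_part U q" for a p b q
      using V.locality[OF part(1)[OF that(1)] part(1)[OF that(2)]] CV by meson
    show "va_prod V (va_prod V a m b) (-2) (va_vac V) - va_prod V a m (va_prod V b (-2) (va_vac V)) = vscale (- of_int m) (va_prod V a (m - 1) b)"
      if "a \<in> C" "b \<in> C" for a b m
      using V.translation[OF CV[OF that(1)] CV[OF that(2)], of m] unfolding va_transl_def .
  qed (simp_all add: CV V.prod_add V.prod_scale V.truncation V.vacuum V.creation)
  then show ?thesis unfolding vertex_algebra_def using U by simp
qed

lemma ppart_subspace: "free.subspace (ppart X p)"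
  unfolding ppart_def by (rule subspace_keys)

theorem corollary7p8:
  fixes n :: nat
  assumes "n \<ge> 1"
  shows "vertex_algebra (va_even (SF n))
    \<and> vertex_algebra (W_B_4 n)
    \<and> va_iso (va_even (SF n)) (W_B_4 n) \<noteq> {}"
proof -
  let ?E = "ppart (SFt n) False"
  define W where "W = {v \<in> ppart (VZt n) False. \<forall>j<n. scr n j v = 0}"
  have zero: "0 \<in> ppart X p" for X :: "'x based_vertex_data" and p by (simp add: ppart_def)
  have disj: "ppart X True \<inter> ppart X False = {0}" for X :: "'x based_vertex_data"
  proof -
    have "v = 0" if "v \<in> ppart X True" "v \<in> ppart X False" for v
    proof -
      have "keys v = {}" using that unfolding ppart_def by blast
      then show ?thesis by (simp only: keys_eq_empty)
    qed
    then show ?thesis using zero by blast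
  qed
  have SFev: "va_carrier (va_even (SF n)) = ?E" "va_part (va_even (SF n)) False = ?E" "va_part (va_even (SF n)) True = {0}"
    "va_vac (va_even (SF n)) = basis_vec (bas_vac (SFt n))" "va_prod (va_even (SF n)) = bprod (SFt n)"
    using disj[of "SFt n"] SFt.ppart_carr by (auto simp: va_even_def va_restrict_def SF_def)
  have Wc: "va_carrier (W_B_4 n) = W" unfolding W_def by (rule W_carrier[OF assms])
  have sub: "va_carrier (W_B_4 n) \<subseteq> {v. \<forall>bs\<in>keys v. lattice_deg bs \<in> sqrt2_coroot_lattice n}"
    unfolding W_B_4_def V_sqrt2_coroot_def va_restrict_def by auto
  have Wp: "va_part (W_B_4 n) p = ppart (VZt n) p \<inter> W" for p
  proof -
    have "va_part (W_B_4 n) p = ppart (VZt n) p \<inter> {v. \<forall>bs\<in>keys v. lattice_deg bs \<in> sqrt2_coroot_lattice n}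
        \<inter> (\<Inter>i\<in>{1..n}. {v \<in> va_carrier (V_sqrt2_coroot n). short_screening n i v = 0})"
      unfolding W_B_4_def V_sqrt2_coroot_def va_restrict_def VZn_def by simp
    also have "\<dots> = ppart (VZt n) p \<inter> va_carrier (W_B_4 n)"
    proof -
      have "va_carrier (W_B_4 n) = va_carrier (V_sqrt2_coroot n) \<inter> (\<Inter>i\<in>{1..n}. {v \<in> va_carrier (V_sqrt2_coroot n). short_screening n i v = 0})"
        unfolding W_B_4_def va_restrict_def by simp
      \<comment> \<open>An intersection over an empty range would be everything;
        \<open>n \<ge> 1\<close> makes it a subset of the carrier.\<close>
      moreover have "(\<Inter>i\<in>{1..n}. {v \<in> va_carrier (V_sqrt2_coroot n). short_screening n i v = 0}) \<subseteq> va_carrier (V_sqrt2_coroot n)"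
        using assms by fastforce
      ultimately show ?thesis using sub by blast
    qed
    finally show ?thesis unfolding Wc .
  qed
  have Wd: "va_part (W_B_4 n) False = W" "va_part (W_B_4 n) True = {0}"
    "va_vac (W_B_4 n) = basis_vec (bas_vac (VZt n))" "va_prod (W_B_4 n) = bprod (VZt n)"
  proof -
    show "va_part (W_B_4 n) False = W" unfolding Wp by (auto simp: W_def)
    show "va_part (W_B_4 n) True = {0}" unfolding Wp using disj[of "VZt n"] zero[of "VZt n"] by (auto simp: W_def lin_zero[OF lin_scr])
    show "va_vac (W_B_4 n) = basis_vec (bas_vac (VZt n))" "va_prod (W_B_4 n) = bprod (VZt n)"
      by (simp_all add: W_B_4_def V_sqrt2_coroot_def va_restrict_def VZn_def)
  qed
  have img: "embn ` ?E = W"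
  proof (intro equalityI subsetI)
    fix x assume "x \<in> embn ` ?E"
    then show "x \<in> W" unfolding W_def using embn_ppart scr_embn SFt.ppart_carr by blast
  next
    fix x assume x: "x \<in> W"
    then have xc: "x \<in> carr (VZt n)" using VZt.ppart_carr unfolding W_def by blast
    have e: "embn (retn x) = x" using x by (intro kernel_embn[OF xc]) (simp add: W_def)
    \<comment> \<open>Evenness of the preimage is reflected from that of \<open>x\<close>, its image
      under the injective map \<open>embn\<close>.\<close>
    have "retn x \<in> ?E" using x by (intro embn_ppart_reflect retn_carr[OF xc]) (simp add: e W_def)
    then show "x \<in> embn ` ?E" using e by (metis imageI)
  qed
  have Eprod: "bprod (SFt n) u m v \<in> ?E" if "u \<in> ?E" "v \<in> ?E" for u v m
    using SFt.bprod_ppart[OF that, of m] by simp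
  have hom: "embn (bprod (SFt n) u m v) = bprod (VZt n) (embn u) m (embn v)" if "u \<in> ?E" "v \<in> ?E" for u v m
    by (rule embn_bprod[OF SFt.ppart_carr[OF that(1)] SFt.ppart_carr[OF that(2)]])
  have vacE: "basis_vec (bas_vac (SFt n)) \<in> ?E"
    using SFt.vac_in[of n] SFt.vac_even[of n] by (simp add: ppart_def)
  have "vertex_algebra (va_even (SF n))"
    by (rule vertex_algebra_sub[where C = ?E, OF SFt.vertex_superalgebra_span[of n] ppart_subspace])
      (simp_all add: SFev vacE Eprod)
  moreover have "vertex_algebra (W_B_4 n)"
  proof (rule vertex_algebra_sub[where C = W, OF VZt.vertex_superalgebra_span[of n]])
    show "free.subspace W"
      unfolding free.subspace_def W_def
      using free.subspace_add[OF ppart_subspace] free.subspace_scale[OF ppart_subspace]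
      by (auto simp: zero lin_zero[OF lin_scr] lin_add[OF lin_scr] lin_scale[OF lin_scr])
    \<comment> \<open>\<open>W\<close> is the image of the even part under the homomorphism
      \<open>embn\<close> and so inherits closure under products.\<close>
    show "va_prod (span_va (VZt n)) u m v \<in> W" if u: "u \<in> W" and v: "v \<in> W" for u v m
    proof -
      obtain u' v' where "u' \<in> ?E" "u = embn u'" "v' \<in> ?E" "v = embn v'" using u v unfolding img[symmetric] by blast
      then show ?thesis using hom Eprod unfolding img[symmetric] by (metis imageI span_va_simps(4))
    qed
    show "va_vac (span_va (VZt n)) \<in> W"
      using imageI[OF vacE, of embn] unfolding img by (simp add: embl_vac)
  qed (use Wc Wd in \<open>auto simp: W_def\<close>)
  moreover have "embn \<in> va_iso (va_even (SF n)) (W_B_4 n)"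
  proof -
    have "inj_on embn ?E" by (metis inj_onI retn_embn)
    then have "bij_betw embn ?E W" using img by (simp add: bij_betw_def)
    then show ?thesis
      unfolding va_iso_def SFev Wc Wd by (simp add: lin_add lin_scale embl_vac hom)
  qed
  ultimately show ?thesis by blast
qed

end
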